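(* Let $n,d\ge 1$ be integers, let $p\in(1,n)$, $p^*=np/(n-p)$, and let $\Omega\subset\mathbb R^n$ be a bounded open set. Let $A:\overline\Omega\to M(n;\mathbb R)$ be continuous, with $A(x)=A(x)^\top$ for all $x\in\overline\Omega$, and such that for some $\tau>0$, $\tau|\xi|^2\le\langle A(x)\xi,\xi\rangle$ for all $(x,\xi)\in\overline\Omega\times\mathbb R^n$. Let $G\in C^1(\mathbb R^d)$ be homogeneous of degree $p^*$ with $G(s)>0$ for all $s\ne0$. Suppose there exists $x_0\in\Omega$ that minimizes $\det A$ over $\overline\Omega$ and that there are constants $C_0>0$ and $\gamma\in(0,p]$ such that $$\langle A(x)\xi,\xi\rangle^{p/2}\ge\langle A(x_0)\xi,\xi\rangle^{p/2}+C_0|x-x_0|^\gamma|\xi|^p\qquad\text{for all }(x,\xi)\in\Omega\times\mathbb R^n.$$ Then there is $\lambda^*\in(0,\lambda_1(A,p))$ such that for every $F\in C^1(\mathbb R^d)$ that is homogeneous of degree $p$ and satisfies $M_F\in(0,\lambda_1(A,p))$ and $\mu_F>\lambda^*$, the problem $$\begin{cases}-L_{A,p}\mathbf u=\frac1p\nabla F(\mathbf u)+\frac1{p^*}\nabla G(\mathbf u)&\text{in }\Omega\\ \mathbf u=0&\text{on }\partial\Omega\end{cases}$$ has a nontrivial weak solution $\mathbf u\in W_0^{1,p}(\Omega;\mathbb R^d)$.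
   Context: $M(n;\mathbb R)$ is the space of real $n\times n$ matrices; $\langle\cdot,\cdot\rangle$ is the Euclidean inner product. A function $H:\mathbb R^d\to\mathbb R$ is homogeneous of degree $q$ if $H(\varrho s)=\varrho^qH(s)$ for all $\varrho>0$, $s\in\mathbb R^d$. For scalar $u$, $L_{A,p}u=\mathrm{div}\big(\langle A(x)\nabla u,\nabla u\rangle^{\frac{p-2}2}A(x)\nabla u\big)$ (the vector field being $0$ where $\nabla u=0$), and for $\mathbf u=(u_1,\dots,u_d)$, $L_{A,p}\mathbf u=(L_{A,p}u_1,\dots,L_{A,p}u_d)$. A weak solution of the problem is $\mathbf u\in W_0^{1,p}(\Omega;\mathbb R^d)$ such that for each $j\in\{1,\dots,d\}$ and all $\varphi\in W_0^{1,p}(\Omega)$, $$\int_\Omega\langle A\nabla u_j,\nabla u_j\rangle^{\frac{p-2}2}\langle A\nabla u_j,\nabla\varphi\rangle\,dx=\int_\Omega\Big(\tfrac1p\partial_jF(\mathbf u)+\tfrac1{p^*}\partial_jG(\mathbf u)\Big)\varphi\,dx.$$ $\lambda_1(A,p)=\inf\{\int_\Omega\langle A(x)\nabla u,\nabla u\rangle^{p/2}dx:\ u\in W_0^{1,p}(\Omega),\ \|u\|_{L^p(\Omega)}=1\}$ is the first Dirichlet eigenvalue of $-L_{A,p}$. $\mathbb S_p^{d-1}=\{s\in\mathbb R^d:|s_1|^p+\dots+|s_d|^p=1\}$, $M_F=\max_{\mathbb S_p^{d-1}}F$, $\mu_F=\min_{\mathbb S_p^{d-1}}F$. *)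

theory Defs
  imports "HOL-Analysis.Analysis"
begin

definition partial_deriv :: "'m::finite \<Rightarrow> (real^'m \<Rightarrow> real) \<Rightarrow> real^'m \<Rightarrow> real" where
  "partial_deriv i f x = frechet_derivative f (at x) (axis i 1)"

primrec Ck :: "nat \<Rightarrow> (real^'m::finite \<Rightarrow> real) \<Rightarrow> bool" where
  "Ck 0 f \<longleftrightarrow> continuous_on UNIV f"
| "Ck (Suc k) f \<longleftrightarrow> f differentiable_on UNIV \<and> (\<forall>i. Ck k (partial_deriv i f))"

definition homogeneous :: "real \<Rightarrow> (real^'d::finite \<Rightarrow> real) \<Rightarrow> bool" where
  "homogeneous q H \<longleftrightarrow> (\<forall>\<rho>>0. \<forall>s. H (\<rho> *\<^sub>R s) = \<rho> powr q * H s)"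

definition p_sphere :: "real \<Rightarrow> (real^'d::finite) set" where
  "p_sphere p = {s. (\<Sum>i\<in>UNIV. \<bar>s $ i\<bar> powr p) = 1}"

text \<open>Both extrema are attained when \<open>F\<close> is continuous, as \<open>p_sphere p\<close> is compact and
  nonempty for \<open>p > 0\<close>; for discontinuous \<open>F\<close> they may be unspecified.\<close>

definition max_sphere :: "real \<Rightarrow> (real^'d::finite \<Rightarrow> real) \<Rightarrow> real" where
  "max_sphere p F = (GREATEST m. m \<in> F ` p_sphere p)"

definition min_sphere :: "real \<Rightarrow> (real^'d::finite \<Rightarrow> real) \<Rightarrow> real" where
  "min_sphere p F = (LEAST m. m \<in> F ` p_sphere p)"

text \<open>Functions on an open set \<open>\<Omega>\<close> are represented by total functions of which only the values
  on \<open>\<Omega>\<close> matter; elements of the function spaces below are representatives, not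
  almost-everywhere classes.\<close>

definition Lp :: "(real^'n::finite) set \<Rightarrow> real \<Rightarrow> (real^'n \<Rightarrow> 'b::real_normed_vector) set" where
  "Lp \<Omega> p = {u. u \<in> borel_measurable (lebesgue_on \<Omega>) \<and>
                 integrable (lebesgue_on \<Omega>) (\<lambda>x. norm (u x) powr p)}"

definition Lp_norm :: "(real^'n::finite) set \<Rightarrow> real \<Rightarrow> (real^'n \<Rightarrow> 'b::real_normed_vector) \<Rightarrow> real" where
  "Lp_norm \<Omega> p u = (LINT x|lebesgue_on \<Omega>. norm (u x) powr p) powr (1 / p)"

definition locally_integrable ::
    "(real^'n::finite) set \<Rightarrow> (real^'n \<Rightarrow> 'b::{banach, second_countable_topology}) \<Rightarrow> bool" where
  "locally_integrable \<Omega> u \<longleftrightarrow> (\<forall>K. compact K \<and> K \<subseteq> \<Omega> \<longrightarrow> integrable (lebesgue_on K) u)"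

definition test_functions :: "(real^'n::finite) set \<Rightarrow> (real^'n \<Rightarrow> real) set" where
  "test_functions \<Omega> = {\<phi>. (\<forall>k. Ck k \<phi>) \<and> compact (closure {x. \<phi> x \<noteq> 0}) \<and>
                          closure {x. \<phi> x \<noteq> 0} \<subseteq> \<Omega>}"

definition has_weak_gradient ::
    "(real^'n::finite) set \<Rightarrow> (real^'n \<Rightarrow> real) \<Rightarrow> (real^'n \<Rightarrow> real^'n) \<Rightarrow> bool" where
  "has_weak_gradient \<Omega> u g \<longleftrightarrow> locally_integrable \<Omega> u \<and> locally_integrable \<Omega> g \<and>
     (\<forall>\<phi>\<in>test_functions \<Omega>. \<forall>i.
        (LINT x|lebesgue_on \<Omega>. u x * partial_deriv i \<phi> x) =
        - (LINT x|lebesgue_on \<Omega>. g x $ i * \<phi> x))"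

text \<open>Weak gradients are unique up to null sets, so the choice made here does not affect any
  of the integrals below.\<close>

definition weak_grad :: "(real^'n::finite) set \<Rightarrow> (real^'n \<Rightarrow> real) \<Rightarrow> real^'n \<Rightarrow> real^'n" where
  "weak_grad \<Omega> u = (SOME g. has_weak_gradient \<Omega> u g)"

definition W1p :: "(real^'n::finite) set \<Rightarrow> real \<Rightarrow> (real^'n \<Rightarrow> real) set" where
  "W1p \<Omega> p = {u \<in> Lp \<Omega> p. \<exists>g \<in> Lp \<Omega> p. has_weak_gradient \<Omega> u g}"

definition W1p_norm :: "(real^'n::finite) set \<Rightarrow> real \<Rightarrow> (real^'n \<Rightarrow> real) \<Rightarrow> real" where
  "W1p_norm \<Omega> p u = Lp_norm \<Omega> p u + Lp_norm \<Omega> p (weak_grad \<Omega> u)"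

definition W01p :: "(real^'n::finite) set \<Rightarrow> real \<Rightarrow> (real^'n \<Rightarrow> real) set" where
  "W01p \<Omega> p = {u \<in> W1p \<Omega> p. \<forall>\<epsilon>>0. \<exists>\<phi>\<in>test_functions \<Omega>. W1p_norm \<Omega> p (\<lambda>x. u x - \<phi> x) < \<epsilon>}"

definition W01p_vec :: "(real^'n::finite) set \<Rightarrow> real \<Rightarrow> (real^'n \<Rightarrow> real^'d::finite) set" where
  "W01p_vec \<Omega> p = {u. \<forall>j. (\<lambda>x. u x $ j) \<in> W01p \<Omega> p}"

definition lambda1 :: "(real^'n::finite) set \<Rightarrow> (real^'n \<Rightarrow> real^'n^'n) \<Rightarrow> real \<Rightarrow> real" where
  "lambda1 \<Omega> A p =
     Inf {LINT x|lebesgue_on \<Omega>. ((A x *v weak_grad \<Omega> u x) \<bullet> weak_grad \<Omega> u x) powr (p / 2)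
          | u. u \<in> W01p \<Omega> p \<and> Lp_norm \<Omega> p u = 1}"

definition crit_exp :: "real \<Rightarrow> real \<Rightarrow> real" where
  "crit_exp n p = n * p / (n - p)"

text \<open>At points where \<open>\<nabla>u\<^sub>j = 0\<close> the flux integrand below is \<open>0\<close> for every \<open>p\<close>, as the second
  factor vanishes.  The two integrability conditions make explicit that both integrals of the
  weak formulation exist, since the Bochner integral of a non-integrable function is \<open>0\<close>.\<close>

definition weak_solution ::
    "(real^'n::finite) set \<Rightarrow> (real^'n \<Rightarrow> real^'n^'n) \<Rightarrow> real \<Rightarrow> (real^'d::finite \<Rightarrow> real) \<Rightarrow>
     (real^'d \<Rightarrow> real) \<Rightarrow> (real^'n \<Rightarrow> real^'d) \<Rightarrow> bool" where
  "weak_solution \<Omega> A p F G u \<longleftrightarrow> u \<in> W01p_vec \<Omega> p \<and>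
     (\<forall>j. \<forall>\<phi>\<in>W01p \<Omega> p.
        let Du = weak_grad \<Omega> (\<lambda>x. u x $ j);
            lhs = (\<lambda>x. ((A x *v Du x) \<bullet> Du x) powr ((p - 2) / 2) *
                        ((A x *v Du x) \<bullet> weak_grad \<Omega> \<phi> x));
            rhs = (\<lambda>x. (1 / p * partial_deriv j F (u x) +
                        1 / crit_exp (real CARD('n)) p * partial_deriv j G (u x)) * \<phi> x)
        in integrable (lebesgue_on \<Omega>) lhs \<and> integrable (lebesgue_on \<Omega>) rhs \<and>
           (LINT x|lebesgue_on \<Omega>. lhs x) = (LINT x|lebesgue_on \<Omega>. rhs x))"

end

theory Submission
  imports Defs "HOL-Complex_Analysis.Great_Picard"
begin

text \<open>
  Weak solutions are multiples of minimisers of \<open>Q(u) = \<integral> \<Sum>\<^sub>j \<langle>A \<nabla>u\<^sub>j, \<nabla>u\<^sub>j\<rangle>\<^bsup>p/2\<^esup> - \<integral> F(u)\<close> under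
  the constraint \<open>\<integral> G(u) = 1\<close>. Since \<open>F \<le> M\<^sub>F \<Sum>\<^sub>j |s\<^sub>j|\<^sup>p\<close> with \<open>M\<^sub>F < \<lambda>\<^sub>1\<close>, \<open>Q\<close> is coercive; the only
  obstruction to the existence of a minimiser is the lack of compactness of the critical Sobolev
  embedding. Mass can concentrate only at a fixed positive energy cost \<open>\<kappa>\<close>, which depends on the
  Sobolev constant, \<open>A\<close> and \<open>G\<close> but not on \<open>F\<close>, so a minimiser exists as soon as the infimum is
  below \<open>\<kappa>\<close>. Testing with an almost optimal function for \<open>\<lambda>\<^sub>1\<close>, placed in one component, bounds the
  infimum by a constant multiple of \<open>\<lambda>\<^sub>1 - \<mu>\<^sub>F\<close>, which is small when \<open>\<lambda>\<^sup>*\<close> is close to \<open>\<lambda>\<^sub>1\<close>. As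
  \<open>\<lambda>\<^sup>*\<close> may be chosen that close, no sharp constants are needed.
\<close>

section \<open>Functions with integrable \<open>p\<close>-th power\<close>

text \<open>The energy and the mass lost in the limit are tied by two inequalities of different
  degree. Let S be the level, \<Gamma> half the energy that may be lost, and \<theta> the constraint
  value of the limit v. Comparing v with S by homogeneity gives 2\<Gamma> <= S (1 - \<theta>),
  linear in the lost mass, whereas the Sobolev inequality gives 1 - \<theta> <= C \<Gamma>^(q/p)
  with q/p > 1. Since \<Gamma> <= S, a positive \<Gamma> would force C S^(q/p) >= 2, so a small S
  excludes any loss; this is the origin of \<kappa>. The obstacle is to control \<Gamma> without
  weak or pointwise convergence of gradients. Strict convexity, homogeneity and compactness of the
  unit sphere give a quantitative uniform convexity of the integrand. It makes near-minimisers over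
  small L^p balls have Cauchy gradients, which yields lower semicontinuity, and it bounds the
  gradient of u_k - v by the midpoint gap of the energies, hence by \<Gamma> where the gradient of v
  is negligible.\<close>

definition LP :: "'a measure \<Rightarrow> real \<Rightarrow> ('a \<Rightarrow> 'b::{banach, second_countable_topology}) set" where
  "LP M p = {u \<in> borel_measurable M. integrable M (\<lambda>x. norm (u x) powr p)}"

text \<open>The p-th power of the norm without the root: it adds up over components and passes
  directly through Fatou's lemma. The triangle inequality then holds up to the factor
  \<open>2 powr p\<close>, which is enough for smallness and boundedness.\<close>

definition pint :: "'a measure \<Rightarrow> real \<Rightarrow> ('a \<Rightarrow> 'b::{banach, second_countable_topology}) \<Rightarrow> real" where
  "pint M p u = (LINT x|M. norm (u x) powr p)"

lemma LP_D: "u \<in> LP M p \<Longrightarrow> u \<in> borel_measurable M"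
  "u \<in> LP M p \<Longrightarrow> integrable M (\<lambda>x. norm (u x) powr p)"
  by (auto simp: LP_def)

lemma pint_nonneg: "0 \<le> pint M p u"
  unfolding pint_def by (rule integral_nonneg_AE) auto

lemma powr_add_le:
  fixes a b p :: real
  assumes "0 \<le> a" "0 \<le> b" "0 \<le> p"
  shows "(a + b) powr p \<le> 2 powr p * (a powr p + b powr p)"
proof -
  have "(a + b) powr p \<le> (2 * max a b) powr p"
    using assms by (intro powr_mono2) auto
  also have "\<dots> = 2 powr p * (max a b) powr p"
    using assms by (simp add: powr_mult)
  also have "(max a b) powr p \<le> a powr p + b powr p"
    by (simp add: max_def)
  finally show ?thesis by simp
qed

lemma norm_add_powr_le:
  assumes "0 \<le> p"
  shows "norm (a + b) powr p \<le> 2 powr p * (norm a powr p + norm b powr p)"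
proof -
  have "norm (a + b) powr p \<le> (norm a + norm b) powr p"
    using assms by (intro powr_mono2 norm_triangle_ineq) auto
  also have "\<dots> \<le> 2 powr p * (norm a powr p + norm b powr p)"
    using assms by (intro powr_add_le) auto
  finally show ?thesis .
qed

lemma LP_add:
  assumes "u \<in> LP M p" "v \<in> LP M p" "0 \<le> p"
  shows "(\<lambda>x. u x + v x) \<in> LP M p"
proof -
  have [measurable]: "u \<in> borel_measurable M" "v \<in> borel_measurable M" using assms
    by (auto simp: LP_def)
  have "integrable M (\<lambda>x. norm (u x + v x) powr p)"
  proof (rule Bochner_Integration.integrable_bound)
    show "integrable M (\<lambda>x. 2 powr p * (norm (u x) powr p + norm (v x) powr p))"
      using assms by (auto simp: LP_def)
  qed (use assms in \<open>auto intro!: AE_I2 norm_add_powr_le\<close>)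
  then show ?thesis by (simp add: LP_def)
qed

lemma LP_scaleR:
  assumes "u \<in> LP M p"
  shows "(\<lambda>x. c *\<^sub>R u x) \<in> LP M p"
  using assms by (auto simp: LP_def powr_mult)

lemma LP_diff:
  assumes "u \<in> LP M p" "v \<in> LP M p" "0 \<le> p"
  shows "(\<lambda>x. u x - v x) \<in> LP M p"
  using LP_add[OF assms(1) LP_scaleR[OF assms(2), of "-1"] assms(3)] by simp

lemma LP_cong_AE:
  assumes "u \<in> LP M p" "v \<in> borel_measurable M" "AE x in M. u x = v x"
  shows "v \<in> LP M p"
  using assms by (auto simp: LP_def elim: integrable_cong_AE_imp)

lemma pint_cong_AE:
  assumes "AE x in M. u x = v x" "u \<in> borel_measurable M" "v \<in> borel_measurable M"
  shows "pint M p u = pint M p v"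
  unfolding pint_def using assms by (intro integral_cong_AE) auto

lemma pint_minus: "pint M p (\<lambda>x. u x - v x) = pint M p (\<lambda>x. v x - u x)"
  by (simp add: pint_def norm_minus_commute)

lemma pint_scaleR: "pint M p (\<lambda>x. c *\<^sub>R u x) = \<bar>c\<bar> powr p * pint M p u"
  by (simp add: pint_def powr_mult)

lemma pint_add_le:
  assumes "u \<in> LP M p" "v \<in> LP M p" "0 \<le> p"
  shows "pint M p (\<lambda>x. u x + v x) \<le> 2 powr p * (pint M p u + pint M p v)"
proof -
  have "pint M p (\<lambda>x. u x + v x) \<le> (LINT x|M. 2 powr p * (norm (u x) powr p + norm (v x) powr p))"
    unfolding pint_def
    using assms LP_D(2)[OF LP_add[OF assms]]
    by (intro integral_mono norm_add_powr_le) (auto simp: LP_def)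
  also have "\<dots> = 2 powr p * (pint M p u + pint M p v)"
    using assms by (simp add: LP_def pint_def)
  finally show ?thesis .
qed

lemma pint_diff_le:
  assumes "u \<in> LP M p" "v \<in> LP M p" "0 \<le> p"
  shows "pint M p (\<lambda>x. u x - v x) \<le> 2 powr p * (pint M p u + pint M p v)"
  using pint_add_le[OF assms(1) LP_scaleR[OF assms(2), of "-1"] assms(3)] pint_scaleR[of M p "-1" v] by simp

lemma LP_dominated:
  assumes "v \<in> LP M p" "u \<in> borel_measurable M" "\<And>x. x \<in> space M \<Longrightarrow> norm (u x) \<le> norm (v x)" "0 \<le> p"
  shows "u \<in> LP M p" "pint M p u \<le> pint M p v"
proof -
  have m[measurable]: "u \<in> borel_measurable M" by fact
  have i: "integrable M (\<lambda>x. norm (v x) powr p)" using assms by (simp add: LP_def)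
  have le: "norm (u x) powr p \<le> norm (v x) powr p" if "x \<in> space M" for x
    using assms that by (intro powr_mono2) auto
  have "integrable M (\<lambda>x. norm (u x) powr p)"
    by (rule Bochner_Integration.integrable_bound[OF i]) (use le in \<open>auto intro!: AE_I2\<close>)
  then show "u \<in> LP M p" by (simp add: LP_def)
  then show "pint M p u \<le> pint M p v"
    unfolding pint_def using i le by (intro integral_mono) (auto simp: LP_def)
qed

lemma LP_component:
  fixes u :: "'a \<Rightarrow> ('b::{euclidean_space})^'d"
  assumes "u \<in> LP M p" "0 \<le> p"
  shows "(\<lambda>x. u x $ j) \<in> LP M p" "pint M p (\<lambda>x. u x $ j) \<le> pint M p u"
proof -
  have m: "(\<lambda>x. u x $ j) \<in> borel_measurable M"
    by (rule measurable_compose[OF LP_D(1)[OF assms(1)]])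
      (intro borel_measurable_continuous_onI continuous_on_component continuous_on_id)
  show "(\<lambda>x. u x $ j) \<in> LP M p" "pint M p (\<lambda>x. u x $ j) \<le> pint M p u"
    using LP_dominated[OF assms(1) m _ assms(2)] by (auto simp: Finite_Cartesian_Product.norm_nth_le)
qed

text \<open>The norm is at most CARD('d) times the largest component, and the p-th power of that
  component is one of the summands.\<close>

lemma norm_vec_powr_le:
  fixes v :: "('b::real_normed_vector)^'d"
  assumes "0 \<le> p"
  shows "norm v powr p \<le> real CARD('d) powr p * (\<Sum>j\<in>UNIV. norm (v $ j) powr p)"
proof -
  obtain k where k: "\<And>j. norm (v $ j) \<le> norm (v $ k)"
  proof -
    have "finite (range (\<lambda>j. norm (v $ j)))" by simp
    then have "Max (range (\<lambda>j. norm (v $ j))) \<in> range (\<lambda>j. norm (v $ j))"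
      by (intro Max_in) auto
    then obtain k where "Max (range (\<lambda>j. norm (v $ j))) = norm (v $ k)"
      by (metis (no_types, lifting) imageE)
    then show ?thesis by (intro that[of k]) (metis Max_ge finite finite_imageI rangeI)
  qed
  have "norm v \<le> (\<Sum>j\<in>UNIV. norm (v $ j))"
    unfolding norm_vec_def by (rule L2_set_le_sum) auto
  also have "\<dots> \<le> (\<Sum>j\<in>(UNIV::'d set). norm (v $ k))" by (intro sum_mono k)
  finally have "norm v powr p \<le> (real CARD('d) * norm (v $ k)) powr p"
    using assms by (intro powr_mono2) auto
  also have "\<dots> = real CARD('d) powr p * norm (v $ k) powr p" by (simp add: powr_mult)
  also have "\<dots> \<le> real CARD('d) powr p * (\<Sum>j\<in>UNIV. norm (v $ j) powr p)"
    by (intro mult_left_mono member_le_sum) auto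
  finally show ?thesis .
qed

lemma LP_vecI:
  fixes u :: "'a \<Rightarrow> ('b::{euclidean_space})^'d"
  assumes "\<And>j. (\<lambda>x. u x $ j) \<in> LP M p" "0 \<le> p"
  shows "u \<in> LP M p"
    "pint M p u \<le> real CARD('d) powr p * (\<Sum>j\<in>UNIV. pint M p (\<lambda>x. u x $ j))"
proof -
  have m[measurable]: "u \<in> borel_measurable M"
  proof -
    \<comment> \<open>Measurability is known only componentwise, so \<open>u\<close> is rebuilt as a
      finite sum of continuous images of its components.\<close>
    have "(\<lambda>x. \<Sum>j\<in>UNIV. axis j (u x $ j)) \<in> borel_measurable M"
    proof (intro borel_measurable_sum)
      fix j :: 'd
      have "continuous_on UNIV (axis j :: 'b \<Rightarrow> 'b^'d)"
        unfolding axis_def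
      proof (intro continuous_on_vec_lambda)
        fix i show "continuous_on UNIV (\<lambda>x::'b. if i = j then x else 0)"
          by (cases "i = j") auto
      qed
      then show "(\<lambda>x. axis j (u x $ j)) \<in> borel_measurable M"
        using LP_D(1)[OF assms(1)[of j]] borel_measurable_continuous_onI measurable_compose by blast
    qed
    also have "(\<lambda>x. \<Sum>j\<in>UNIV. axis j (u x $ j)) = u"
      by (auto simp: fun_eq_iff vec_eq_iff axis_def sum.delta)
    finally show ?thesis .
  qed
  have i: "integrable M (\<lambda>x. real CARD('d) powr p * (\<Sum>j\<in>UNIV. norm (u x $ j) powr p))"
    using assms by (auto simp: LP_def)
  have "integrable M (\<lambda>x. norm (u x) powr p)"
    by (rule Bochner_Integration.integrable_bound[OF i])
      (use norm_vec_powr_le[OF assms(2)] in \<open>auto intro!: AE_I2 simp: sum_nonneg abs_mult\<close>)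
  then show *: "u \<in> LP M p" by (simp add: LP_def)
  have "pint M p u \<le> (LINT x|M. real CARD('d) powr p * (\<Sum>j\<in>UNIV. norm (u x $ j) powr p))"
    unfolding pint_def using i * norm_vec_powr_le[OF assms(2)] by (intro integral_mono) (auto simp: LP_def)
  also have "\<dots> = real CARD('d) powr p * (\<Sum>j\<in>UNIV. pint M p (\<lambda>x. u x $ j))"
    using assms by (simp add: LP_def pint_def)
  finally show "pint M p u \<le> real CARD('d) powr p * (\<Sum>j\<in>UNIV. pint M p (\<lambda>x. u x $ j))" .
qed

lemma pint_tendsto_triangle:
  assumes "\<And>k. u k \<in> LP M p" "\<And>k. v k \<in> LP M p" "0 \<le> p"
    "(\<lambda>k. pint M p (u k)) \<longlonglongrightarrow> 0" "(\<lambda>k. pint M p (v k)) \<longlonglongrightarrow> 0"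
  shows "(\<lambda>k. pint M p (\<lambda>x. u k x + v k x)) \<longlonglongrightarrow> 0"
proof (rule tendsto_sandwich[OF _ _ tendsto_const])
  show "(\<lambda>k. 2 powr p * (pint M p (u k) + pint M p (v k))) \<longlonglongrightarrow> 0"
    using tendsto_mult[OF tendsto_const[of "2 powr p"] tendsto_add[OF assms(4,5)]] by simp
  show "\<forall>\<^sub>F k in sequentially. pint M p (\<lambda>x. u k x + v k x) \<le> 2 powr p * (pint M p (u k) + pint M p (v k))"
    using pint_add_le[OF assms(1,2,3)] by (auto intro!: always_eventually)
qed (use pint_nonneg in \<open>auto intro!: always_eventually\<close>)

lemma pint_AE_subseq:
  fixes u :: "nat \<Rightarrow> 'a \<Rightarrow> 'b::{banach, second_countable_topology}"
  assumes "\<And>k. (\<lambda>x. u k x - v x) \<in> LP M p" "0 < p" "(\<lambda>k. pint M p (\<lambda>x. u k x - v x)) \<longlonglongrightarrow> 0"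
  obtains r where "strict_mono (r::nat\<Rightarrow>nat)" "AE x in M. (\<lambda>k. u (r k) x) \<longlonglongrightarrow> v x"
proof -
  have "\<exists>r::nat\<Rightarrow>nat. strict_mono r \<and> (AE x in M. (\<lambda>k. norm (u (r k) x - v x) powr p) \<longlonglongrightarrow> 0)"
    by (rule tendsto_L1_AE_subseq) (use assms in \<open>auto simp: LP_def pint_def\<close>)
  then obtain r :: "nat \<Rightarrow> nat" where r: "strict_mono r" "AE x in M. (\<lambda>k. norm (u (r k) x - v x) powr p) \<longlonglongrightarrow> 0"
    by auto
  have "(\<lambda>k. u (r k) x) \<longlonglongrightarrow> v x"
    if "(\<lambda>k. norm (u (r k) x - v x) powr p) \<longlonglongrightarrow> 0" for x
  proof -
    have "(\<lambda>k. (norm (u (r k) x - v x) powr p) powr (1/p)) \<longlonglongrightarrow> 0 powr (1/p)"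
      by (rule tendsto_powr'[OF that tendsto_const]) (use assms in auto)
    then have "(\<lambda>k. norm (u (r k) x - v x)) \<longlonglongrightarrow> 0"
      using assms by (simp add: powr_powr)
    then show ?thesis
      using LIM_zero_iff tendsto_norm_zero_iff by blast
  qed
  with r show ?thesis by (intro that[of r]) (auto elim: eventually_mono)
qed

text \<open>Fatou's lemma in the form in which almost everywhere limits inherit bounds: in the
  completeness proof, for truncated functions in the critical space, and for the mass of a
  limit.\<close>

lemma LP_Fatou:
  fixes u :: "nat \<Rightarrow> 'a \<Rightarrow> 'b::{banach, second_countable_topology}"
  assumes u: "\<And>k. u k \<in> LP M p" and v: "v \<in> borel_measurable M" and p: "0 < p"
    and ae: "AE x in M. (\<lambda>k. u k x) \<longlonglongrightarrow> v x"
    and b: "\<forall>\<^sub>F k in sequentially. pint M p (u k) \<le> B"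
  shows "v \<in> LP M p" "pint M p v \<le> B"
proof -
  have [measurable]: "v \<in> borel_measurable M" "\<And>k. u k \<in> borel_measurable M"
    using v u by (auto simp: LP_def)
  obtain N where N: "\<And>k. k \<ge> N \<Longrightarrow> pint M p (u k) \<le> B"
    using b by (auto simp: eventually_sequentially)
  have B: "0 \<le> B" using N[of N] pint_nonneg[of M p "u N"] by simp
  have "(\<integral>\<^sup>+x. ennreal (norm (v x) powr p) \<partial>M) = (\<integral>\<^sup>+x. liminf (\<lambda>k. ennreal (norm (u k x) powr p)) \<partial>M)"
  proof (rule nn_integral_cong_AE)
    show "AE x in M. ennreal (norm (v x) powr p) = liminf (\<lambda>k. ennreal (norm (u k x) powr p))"
      using ae
    proof eventually_elim
      case (elim x)
      have "(\<lambda>k. ennreal (norm (u k x) powr p)) \<longlonglongrightarrow> ennreal (norm (v x) powr p)"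
        using p by (intro tendsto_ennrealI tendsto_powr' tendsto_norm elim tendsto_const) auto
      then show ?case by (rule lim_imp_Liminf[symmetric, rotated]) simp
    qed
  qed
  also have "\<dots> \<le> liminf (\<lambda>k. \<integral>\<^sup>+x. ennreal (norm (u k x) powr p) \<partial>M)"
    by (rule nn_integral_liminf) auto
  also have "\<dots> \<le> ennreal B"
  proof (rule Liminf_le)
    have "(\<integral>\<^sup>+x. ennreal (norm (u k x) powr p) \<partial>M) \<le> ennreal B" if "k \<ge> N"
      for k
      using N[OF that] u[of k] by (subst nn_integral_eq_integral) (auto simp: LP_def pint_def ennreal_leI)
    then show "\<forall>\<^sub>F k in sequentially. (\<integral>\<^sup>+x. ennreal (norm (u k x) powr p) \<partial>M) \<le> ennreal B"
      by (auto simp: eventually_sequentially)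
  qed simp
  finally have le: "(\<integral>\<^sup>+x. ennreal (norm (v x) powr p) \<partial>M) \<le> ennreal B" .
  then have "integrable M (\<lambda>x. norm (v x) powr p)"
    by (intro integrableI_bounded) (auto simp: order.strict_trans1)
  then show "v \<in> LP M p" by (simp add: LP_def)
  show "pint M p v \<le> B"
    unfolding pint_def by (rule integral_real_bounded[OF B]) (use le in simp)
qed

text \<open>Riesz-Fischer without Minkowski's inequality: along a fast subsequence the increments
  are dominated pointwise by a geometric series, and Fatou's lemma carries the Cauchy estimate to
  the limit.\<close>

lemma LP_complete:
  fixes u :: "nat \<Rightarrow> 'a \<Rightarrow> 'b::{banach, second_countable_topology}"
  assumes u: "\<And>k. u k \<in> LP M p" and p: "0 < p"
    and cau: "\<And>\<epsilon>. \<epsilon> > 0 \<Longrightarrow> \<exists>N. \<forall>m\<ge>N. \<forall>n\<ge>N. pint M p (\<lambda>x. u m x - u n x) < \<epsilon>"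
  obtains v where "v \<in> LP M p" "(\<lambda>k. pint M p (\<lambda>x. u k x - v x)) \<longlonglongrightarrow> 0"
proof -
  have [measurable]: "\<And>k. u k \<in> borel_measurable M" using u by (auto simp: LP_def)
  \<comment> \<open>The factor \<open>((1/2) ^ k) powr p\<close> pays for the weight
    \<open>2 ^ k\<close> inside the p-th power in \<open>D\<close>; the other factor
    \<open>(1/2) ^ k\<close> makes the integrals of \<open>D k\<close> summable.\<close>
  define \<delta> where "\<delta> k = (1/2) ^ k * ((1/2) ^ k) powr p" for k :: nat
  have \<delta>: "\<delta> k > 0" for k by (simp add: \<delta>_def)
  have "\<exists>N. \<forall>k. \<forall>m\<ge>N k. \<forall>n\<ge>N k. pint M p (\<lambda>x. u m x - u n x) < \<delta> k"
    using cau[OF \<delta>] by metis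
  then obtain N where N: "\<And>k m n. m \<ge> N k \<Longrightarrow> n \<ge> N k \<Longrightarrow> pint M p (\<lambda>x. u m x - u n x) < \<delta> k" by metis
  \<comment> \<open>Summing the \<open>Suc (N i)\<close> makes the indices strictly increasing and
    still at least \<open>N k\<close>.\<close>
  define r where "r k = (\<Sum>i\<le>k. Suc (N i))" for k
  have rmono: "strict_mono r" by (auto simp: r_def strict_mono_Suc_iff)
  have rN: "r k \<ge> N k" for k
  proof -
    have "N k \<le> Suc (N k)" by simp
    also have "\<dots> \<le> r k" unfolding r_def by (rule member_le_sum) auto
    finally show ?thesis .
  qed
  define d where "d k x = u (r (Suc k)) x - u (r k) x" for k x
  have [measurable]: "d k \<in> borel_measurable M" for k unfolding d_def[abs_def] by measurable
  have dLP: "d k \<in> LP M p" for k unfolding d_def using u p by (intro LP_diff) auto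
  have dle: "pint M p (d k) \<le> \<delta> k" for k
    unfolding d_def
      using N[of k "r (Suc k)" "r k"] rN[of k] rN[of "Suc k"] strict_monoD[OF rmono, of k "Suc k"] by simp
  define D where "D k x = (2 ^ k) powr p * norm (d k x) powr p" for k :: nat and x
  have Dint: "(\<integral>\<^sup>+x. ennreal (D k x) \<partial>M) \<le> ennreal ((1/2) ^ k)" for k
  proof -
    have "(\<integral>\<^sup>+x. ennreal (D k x) \<partial>M) = ennreal ((2 ^ k) powr p * pint M p (d k))"
      unfolding D_def using dLP[of k] by (subst nn_integral_eq_integral) (auto simp: LP_def pint_def)
    also have "\<dots> \<le> ennreal ((2 ^ k) powr p * \<delta> k)"
      by (intro ennreal_leI mult_left_mono dle) auto
    also have "(2 ^ k) powr p * \<delta> k = (1/2) ^ k * (2 ^ k * (1/2) ^ k) powr p"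
      by (simp add: \<delta>_def powr_mult power_one_over divide_simps powr_divide)
    also have "2 ^ k * (1/2::real) ^ k = 1" by (simp add: power_one_over)
    finally show ?thesis by simp
  qed
  have "(\<integral>\<^sup>+x. (\<Sum>k. ennreal (D k x)) \<partial>M) = (\<Sum>k. \<integral>\<^sup>+x. ennreal (D k x) \<partial>M)"
    by (rule nn_integral_suminf) (auto simp: D_def)
  also have "\<dots> \<le> (\<Sum>k. ennreal ((1/2) ^ k))" by (intro suminf_le Dint) auto
  also have "\<dots> = ennreal (\<Sum>k. (1/2) ^ k)"
    by (intro suminf_ennreal2) (auto intro!: summable_geometric)
  also have "\<dots> < \<infinity>" by simp
  finally have "AE x in M. (\<Sum>k. ennreal (D k x)) \<noteq> \<infinity>"
    by (intro nn_integral_PInf_AE) (auto simp: D_def)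
  then have conv: "AE x in M. convergent (\<lambda>k. u (r k) x)"
  proof eventually_elim
    case (elim x)
    have D0: "0 \<le> D k x" for k by (simp add: D_def)
    have sD: "summable (\<lambda>k. D k x)"
      using elim D0 by (intro summable_suminf_not_top) auto
    then have "bounded (range (\<lambda>k. D k x))"
      using convergent_imp_bounded summable_LIMSEQ_zero by blast
    then obtain B where B: "\<And>k. D k x \<le> B"
      unfolding bounded_iff by (auto dest!: abs_le_D1)
    have B0: "0 \<le> B" using B[of 0] D0[of 0] by simp
    \<comment> \<open>Only boundedness of \<open>D k x\<close> in k is used: the weight
      \<open>2 ^ k\<close> turns it into geometric decay of the increments.\<close>
    have "norm (d k x) \<le> B powr (1/p) * (1/2) ^ k" for k
    proof -
      have "(2 ^ k * norm (d k x)) powr p \<le> B" using B[of k] by (simp add: D_def powr_mult)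
      then have "((2 ^ k * norm (d k x)) powr p) powr (1/p) \<le> B powr (1/p)"
        using p by (intro powr_mono2) auto
      then show ?thesis using p by (simp add: powr_powr power_one_over field_simps)
    qed
    moreover have "summable (\<lambda>k. B powr (1/p) * (1/2) ^ k)"
      by (intro summable_mult summable_geometric) auto
    ultimately have "summable (\<lambda>k. d k x)"
      by (intro summable_comparison_test'[of "\<lambda>k. B powr (1/p) * (1/2) ^ k" 0 "\<lambda>k. d k x"]) auto
    then have "convergent (\<lambda>n. \<Sum>k<n. d k x)" by (simp add: summable_iff_convergent)
    moreover have "(\<Sum>k<n. d k x) = u (r n) x - u (r 0) x" for n
      unfolding d_def by (rule sum_lessThan_telescope)
    ultimately have "convergent (\<lambda>n. u (r n) x - u (r 0) x)" by simp
    then have "convergent (\<lambda>n. (u (r n) x - u (r 0) x) + u (r 0) x)"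
      by (intro convergent_add convergent_const)
    then show ?case by simp
  qed
  define v where "v x = lim (\<lambda>k. u (r k) x)" for x
  have vm[measurable]: "v \<in> borel_measurable M"
    unfolding v_def[abs_def] by (rule borel_measurable_lim_metric) measurable
  have ae: "AE x in M. (\<lambda>k. u (r k) x) \<longlonglongrightarrow> v x"
    using conv by eventually_elim (simp add: v_def convergent_LIMSEQ_iff)
  have close: "(\<lambda>x. u n x - v x) \<in> LP M p" "pint M p (\<lambda>x. u n x - v x) \<le> \<epsilon>"
    if n: "\<And>m. m \<ge> n \<Longrightarrow> pint M p (\<lambda>x. u n x - u m x) \<le> \<epsilon>"
      for n \<epsilon>
  proof -
    have ae': "AE x in M. (\<lambda>k. u n x - u (r k) x) \<longlonglongrightarrow> u n x - v x"
      using ae by eventually_elim (intro tendsto_intros)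
    have "\<forall>\<^sub>F k in sequentially. pint M p (\<lambda>x. u n x - u (r k) x) \<le> \<epsilon>"
      unfolding eventually_sequentially using n seq_suble[OF rmono] by (intro exI[of _ n]) (meson order_trans)
    then show "(\<lambda>x. u n x - v x) \<in> LP M p" "pint M p (\<lambda>x. u n x - v x) \<le> \<epsilon>"
      using u p by (intro LP_Fatou[OF _ _ p ae'] LP_diff; auto)+
  qed
  obtain N1 where N1: "\<forall>m\<ge>N1. \<forall>n\<ge>N1. pint M p (\<lambda>x. u m x - u n x) < 1"
    using cau[of 1] by auto
  have "(\<lambda>x. u N1 x - v x) \<in> LP M p" using N1
    by (intro close(1)[of N1 1]) (auto intro: less_imp_le)
  then have "(\<lambda>x. u N1 x - (u N1 x - v x)) \<in> LP M p"
    using LP_diff[OF u[of N1], of "\<lambda>x. u N1 x - v x"] p by simp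
  then have "v \<in> LP M p" by simp
  moreover have "(\<lambda>k. pint M p (\<lambda>x. u k x - v x)) \<longlonglongrightarrow> 0"
  proof (rule LIMSEQ_I)
    fix \<epsilon> :: real assume "\<epsilon> > 0"
    then obtain N where N: "\<forall>m\<ge>N. \<forall>n\<ge>N. pint M p (\<lambda>x. u m x - u n x) < \<epsilon>/2" using cau[of "\<epsilon>/2"] by auto
    have *: "pint M p (\<lambda>x. u n x - v x) \<le> \<epsilon>/2" if "n \<ge> N" for n
      using N that by (intro close(2)) (auto intro!: less_imp_le)
    have "norm (pint M p (\<lambda>x. u n x - v x) - 0) < \<epsilon>" if "n \<ge> N" for n
      using *[OF that] \<open>\<epsilon> > 0\<close> pint_nonneg[of M p "\<lambda>x. u n x - v x"] by simp
    then show "\<exists>N. \<forall>n\<ge>N. norm (pint M p (\<lambda>x. u n x - v x) - 0) < \<epsilon>"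
      by blast
  qed
  ultimately show ?thesis by (rule that)
qed

text \<open>Scaling reduces the claim to unit vectors. If no constant worked there, points with
  \<Psi> > \<epsilon> + n N would accumulate at a point with \<Psi> >= \<epsilon> and N = 0, against
  the hypothesis on the zeros of N. Growth bounds, moduli of continuity and uniform convexity all
  follow from this by a choice of \<Psi> and N.\<close>

lemma homogeneous_compact_bound:
  fixes \<Psi> N :: "'a::metric_space \<Rightarrow> 'b::euclidean_space \<Rightarrow> real"
  assumes K: "compact K"
    and c\<Psi>: "continuous_on (K \<times> UNIV) (\<lambda>(x, v). \<Psi> x v)" and cN: "continuous_on (K \<times> UNIV) (\<lambda>(x, v). N x v)"
    and h\<Psi>: "\<And>x v \<rho>. x \<in> K \<Longrightarrow> \<rho> > 0 \<Longrightarrow> \<Psi> x (\<rho> *\<^sub>R v) = \<rho> powr p * \<Psi> x v"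
    and hN: "\<And>x v \<rho>. x \<in> K \<Longrightarrow> \<rho> > 0 \<Longrightarrow> N x (\<rho> *\<^sub>R v) = \<rho> powr p * N x v"
    and N0: "\<And>x v. x \<in> K \<Longrightarrow> N x v \<ge> 0"
    and Z: "\<And>x v. x \<in> K \<Longrightarrow> v \<noteq> 0 \<Longrightarrow> N x v = 0 \<Longrightarrow> \<Psi> x v \<le> 0"
    and \<epsilon>: "\<epsilon> > 0" and p: "p > 0"
  obtains C where "C \<ge> 0" "\<And>x v. x \<in> K \<Longrightarrow> \<Psi> x v \<le> \<epsilon> * norm v powr p + C * N x v"
proof -
  let ?S = "K \<times> sphere (0::'b) 1"
  have S: "compact ?S" using K by (intro compact_Times) auto
  have "\<exists>C\<ge>0. \<forall>x\<in>K. \<forall>v\<in>sphere 0 1. \<Psi> x v \<le> \<epsilon> + C * N x v"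
  proof (rule ccontr)
    assume "\<not> ?thesis"
    then have "\<forall>n::nat. \<exists>z\<in>?S. \<Psi> (fst z) (snd z) > \<epsilon> + real n * N (fst z) (snd z)"
    proof (intro allI)
      fix n :: nat
      have "\<not> (\<forall>x\<in>K. \<forall>v\<in>sphere 0 1. \<Psi> x v \<le> \<epsilon> + real n * N x v)"
        using \<open>\<not> (\<exists>C\<ge>0. _ C)\<close> by auto
      then obtain x v where "x \<in> K" "v \<in> sphere 0 1" "\<not> \<Psi> x v \<le> \<epsilon> + real n * N x v" by auto
      then show "\<exists>z\<in>?S. \<Psi> (fst z) (snd z) > \<epsilon> + real n * N (fst z) (snd z)"
        by (intro bexI[of _ "(x, v)"]) (auto simp: not_le)
    qed
    then obtain z where z: "\<And>n. z n \<in> ?S" "\<And>n::nat. \<Psi> (fst (z n)) (snd (z n)) > \<epsilon> + real n * N (fst (z n)) (snd (z n))"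
      by metis
    obtain l r where l: "l \<in> ?S" "strict_mono (r::nat\<Rightarrow>nat)" "(z \<circ> r) \<longlonglongrightarrow> l"
      using S z(1) unfolding compact_def by metis
    have cS: "continuous_on ?S (\<lambda>z. \<Psi> (fst z) (snd z))" "continuous_on ?S (\<lambda>z. N (fst z) (snd z))"
      using c\<Psi> cN by (auto simp: case_prod_beta elim: continuous_on_subset)
    have lim\<Psi>: "(\<lambda>k. \<Psi> (fst (z (r k))) (snd (z (r k)))) \<longlonglongrightarrow> \<Psi> (fst l) (snd l)"
      using continuous_on_tendsto_compose[OF cS(1) l(3) l(1)] z(1) by (simp add: o_def)
    have limN: "(\<lambda>k. N (fst (z (r k))) (snd (z (r k)))) \<longlonglongrightarrow> N (fst l) (snd l)"
      using continuous_on_tendsto_compose[OF cS(2) l(3) l(1)] z(1) by (simp add: o_def)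
    have "\<epsilon> \<le> \<Psi> (fst l) (snd l)"
    proof (rule LIMSEQ_le_const[OF lim\<Psi>], intro exI allI impI)
      fix k
      have "N (fst (z (r k))) (snd (z (r k))) \<ge> 0" using z(1)[of "r k"] N0 by auto
      then show "\<epsilon> \<le> \<Psi> (fst (z (r k))) (snd (z (r k)))" using z(2)[of "r k"]
        by (smt (verit) mult_nonneg_nonneg of_nat_0_le_iff)
    qed
    moreover have "N (fst l) (snd l) = 0"
    proof (rule ccontr)
      assume "N (fst l) (snd l) \<noteq> 0"
      then have "N (fst l) (snd l) > 0" using N0[of "fst l" "snd l"] l(1) by (auto simp: less_le)
      \<comment> \<open>A positive limit of N, multiplied by the indices \<open>r k\<close>, would
        drive \<Psi> to infinity although it converges.\<close>
      then have "filterlim (\<lambda>k. N (fst (z (r k))) (snd (z (r k))) * real (r k)) at_top sequentially"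
        using l(2)
          by (intro filterlim_tendsto_pos_mult_at_top[OF limN] filterlim_compose[OF filterlim_real_sequentially] filterlim_subseq) auto
      then have "filterlim (\<lambda>k. \<Psi> (fst (z (r k))) (snd (z (r k)))) at_top sequentially"
        by (rule filterlim_at_top_mono) (use z(2) \<epsilon> in \<open>auto intro!: always_eventually less_imp_le simp: mult.commute\<close>, smt (verit))
      then show False using lim\<Psi> not_tendsto_and_filterlim_at_infinity[of sequentially]
        by (metis filterlim_at_top_imp_at_infinity trivial_limit_sequentially)
    qed
    moreover have "snd l \<noteq> 0" using l(1) by (auto simp: mem_Times_iff)
    ultimately show False using Z[of "fst l" "snd l"] l(1) \<epsilon> by (auto simp: mem_Times_iff)
  qed
  then obtain C where C: "C \<ge> 0" "\<And>x v. x \<in> K \<Longrightarrow> norm v = 1 \<Longrightarrow> \<Psi> x v \<le> \<epsilon> + C * N x v" by auto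
  show ?thesis
  proof (rule that[OF C(1)])
    fix x v assume x: "x \<in> K"
    show "\<Psi> x v \<le> \<epsilon> * norm v powr p + C * N x v"
    proof (cases "v = 0")
      case True
      \<comment> \<open>Scaling by 2 fixes the origin, so homogeneity of nonzero degree forces the
        value 0.\<close>
      have "\<Psi> x 0 = 2 powr p * \<Psi> x 0" using h\<Psi>[OF x, of 2 0] by simp
      moreover have "2 powr p \<noteq> (1::real)" using p by (simp add: powr_eq_one_iff_gen)
      ultimately have "\<Psi> x 0 = 0" by simp
      then show ?thesis using C(1) N0[OF x, of 0] True by simp
    next
      case False
      let ?v = "v /\<^sub>R norm v"
      have "\<Psi> x ?v \<le> \<epsilon> + C * N x ?v" using False by (intro C x) auto
      then have "norm v powr p * \<Psi> x ?v \<le> norm v powr p * (\<epsilon> + C * N x ?v)"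
        by (intro mult_left_mono) auto
      moreover have "norm v powr p * \<Psi> x ?v = \<Psi> x v" "norm v powr p * N x ?v = N x v"
        using h\<Psi>[OF x, of "norm v" ?v] hN[OF x, of "norm v" ?v] False by auto
      ultimately show ?thesis by (simp add: algebra_simps)
    qed
  qed
qed

section \<open>Smooth functions with compact support\<close>

definition grad :: "(real^'n \<Rightarrow> real) \<Rightarrow> real^'n \<Rightarrow> real^'n" where
  "grad f x = (\<chi> i. partial_deriv i f x)"

lemma has_derivative_grad:
  assumes "f differentiable (at x)"
  shows "(f has_derivative (\<lambda>h. grad f x \<bullet> h)) (at x)"
proof -
  have d: "(f has_derivative frechet_derivative f (at x)) (at x)"
    using assms frechet_derivative_works by blast
  have lin: "linear (frechet_derivative f (at x))"
    using d has_derivative_linear by blast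
  have "frechet_derivative f (at x) h = grad f x \<bullet> h" for h
  proof -
    have "frechet_derivative f (at x) (\<Sum>i\<in>UNIV. (h $ i) *\<^sub>R axis i 1) = (\<Sum>i\<in>UNIV. h $ i * frechet_derivative f (at x) (axis i 1))"
      by (simp add: linear_sum[OF lin] linear_scale[OF lin])
    moreover have "(\<Sum>i\<in>UNIV. (h $ i) *\<^sub>R axis i 1) = h"
      using basis_expansion[of h] by (simp add: scalar_mult_eq_scaleR)
    ultimately show ?thesis
      by (simp add: grad_def partial_deriv_def inner_vec_def mult.commute)
  qed
  then have "frechet_derivative f (at x) = (\<lambda>h. grad f x \<bullet> h)" by (rule ext)
  then show ?thesis using d by simp
qed

lemma has_derivative_imp_grad:
  assumes "(f has_derivative (\<lambda>h. g \<bullet> h)) (at x)"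
  shows "grad f x = g" "partial_deriv i f x = g $ i"
proof -
  have "frechet_derivative f (at x) = (\<lambda>h. g \<bullet> h)" using frechet_derivative_at[OF assms]
    by simp
  then show "partial_deriv i f x = g $ i" "grad f x = g"
    by (simp_all add: grad_def partial_deriv_def vec_eq_iff inner_axis)
qed

lemma partial_deriv_eqI:
  assumes "(f has_derivative f') (at x)"
  shows "partial_deriv i f x = f' (axis i 1)"
  using frechet_derivative_at[OF assms] by (simp add: partial_deriv_def)

section \<open>Closure of \<open>Ck\<close> under sums and products\<close>

lemma Ck_Suc_D: "Ck (Suc k) f \<Longrightarrow> Ck k f"
proof (induction k arbitrary: f)
  case 0
  then show ?case by (auto intro: differentiable_imp_continuous_on)
next
  case (Suc k)
  then have "f differentiable_on UNIV" "\<And>i. Ck (Suc k) (partial_deriv i f)" by auto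
  with Suc.IH show ?case by simp
qed

lemma Ck_const: "Ck k (\<lambda>x. c)"
proof (induction k arbitrary: c)
  case (Suc k)
  have "partial_deriv i (\<lambda>x::real^'a. c) = (\<lambda>x. 0)" for i
    by (rule ext) (rule partial_deriv_eqI, rule has_derivative_const)
  then show ?case using Suc by auto
qed auto

lemma Ck_add: "Ck k f \<Longrightarrow> Ck k g \<Longrightarrow> Ck k (\<lambda>x. f x + g x)"
proof (induction k arbitrary: f g)
  case 0
  then show ?case by (auto intro: continuous_intros)
next
  case (Suc k)
  have d: "f differentiable (at x)" "g differentiable (at x)" for x
    using Suc.prems by (auto simp: differentiable_on_def)
  have "partial_deriv i (\<lambda>x. f x + g x) = (\<lambda>x. partial_deriv i f x + partial_deriv i g x)"
    for i
    using has_derivative_imp_grad(2)[of "\<lambda>x. f x + g x" "grad f _ + grad g _"]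
      has_derivative_add[OF has_derivative_grad[OF d(1)] has_derivative_grad[OF d(2)]]
    by (auto simp: fun_eq_iff grad_def inner_add_left)
  then show ?case using Suc d by (auto intro!: differentiable_on_add)
qed

lemma Ck_mult: "Ck k f \<Longrightarrow> Ck k g \<Longrightarrow> Ck k (\<lambda>x. f x * g x)"
proof (induction k arbitrary: f g)
  case 0
  then show ?case by (auto intro: continuous_intros)
next
  case (Suc k)
  have d: "f differentiable (at x)" "g differentiable (at x)" for x
    using Suc.prems by (auto simp: differentiable_on_def)
  have "partial_deriv i (\<lambda>x. f x * g x) = (\<lambda>x. f x * partial_deriv i g x + partial_deriv i f x * g x)" for i
  proof
    fix x
    have "((\<lambda>x. f x * g x) has_derivative (\<lambda>h. f x * (grad g x \<bullet> h) + (grad f x \<bullet> h) * g x)) (at x)"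
      by (intro has_derivative_mult has_derivative_grad d)
    from partial_deriv_eqI[OF this] show "partial_deriv i (\<lambda>x. f x * g x) x = f x * partial_deriv i g x + partial_deriv i f x * g x"
      by (simp add: inner_axis grad_def)
  qed
  moreover have "Ck k f" "Ck k g" using Suc.prems Ck_Suc_D by blast+
  ultimately show ?case using Suc by (auto intro!: differentiable_on_mult Ck_add)
qed

lemma Ck_prod: "finite I \<Longrightarrow> (\<And>i. i \<in> I \<Longrightarrow> Ck k (f i)) \<Longrightarrow> Ck k (\<lambda>x. \<Prod>i\<in>I. f i x)"
  by (induction I rule: finite_induct) (auto intro: Ck_const Ck_mult)

text \<open>Carrying the polynomial \<open>P\<close> makes the family closed under differentiation,
  so that \<open>Ck k\<close> follows by induction on k; \<open>P = 1\<close> is the classical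
  smooth function that is flat at 0.\<close>

definition flat_exp :: "real poly \<Rightarrow> real \<Rightarrow> real" where
  "flat_exp P t = (if t > 0 then poly P (1/t) * exp (- (1/t)) else 0)"

text \<open>The extra power \<open>s ^ k\<close> absorbs the factor s that each coefficient step of
  the induction on P produces.\<close>

lemma poly_exp_tendsto_0: "((\<lambda>s. s ^ k * poly P s * exp (- s)) \<longlongrightarrow> 0) at_top"
  for P :: "real poly"
proof (induction P arbitrary: k)
  case 0
  then show ?case by simp
next
  case (pCons a P)
  have "((\<lambda>s::real. a * (s ^ k / exp s) + s ^ Suc k * poly P s * exp (- s)) \<longlongrightarrow> a * 0 + 0) at_top"
    by (intro tendsto_intros pCons.IH tendsto_power_div_exp_0)
  then show ?case by (simp add: algebra_simps exp_minus divide_inverse)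
qed

text \<open>With s = 1/t the derivative of P(s) exp(-s) in t is s^2 (P(s) - P'(s)) exp(-s), and
  \<open>[:0,0,1:]\<close> is the factor s^2. At 0 the difference quotient from the right is s P(s)
  exp(-s), which tends to 0.\<close>

lemma flat_exp_deriv:
  "(flat_exp P has_real_derivative flat_exp ([:0,0,1:] * (P - pderiv P)) t) (at t)"
proof -
  consider "t > 0" | "t < 0" | "t = 0" by linarith
  then show ?thesis
  proof cases
    case 1
    have "((\<lambda>t. poly P (1/t) * exp (- (1/t))) has_real_derivative flat_exp ([:0,0,1:] * (P - pderiv P)) t) (at t)"
      using 1 by (auto intro!: derivative_eq_intros DERIV_chain2[OF poly_DERIV]
          simp: flat_exp_def field_simps power2_eq_square)
    moreover have "\<forall>\<^sub>F s in nhds t. poly P (1/s) * exp (- (1/s)) = flat_exp P s"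
      using eventually_nhds_in_open[of "{0<..}" t] 1 by (auto elim!: eventually_mono simp: flat_exp_def)
    ultimately show ?thesis by (subst DERIV_cong_ev[OF refl _ refl, symmetric]) auto
  next
    case 2
    have ev: "\<forall>\<^sub>F s in nhds t. flat_exp P s = 0"
      using eventually_nhds_in_open[of "{..<0}" t] 2 by (auto elim!: eventually_mono simp: flat_exp_def)
    have "(flat_exp P has_real_derivative 0) (at t)"
      by (subst DERIV_cong_ev[OF refl ev refl]) (rule DERIV_const)
    then show ?thesis using 2 by (simp add: flat_exp_def)
  next
    case 3
    have r: "((\<lambda>h. flat_exp P h / h) \<longlongrightarrow> 0) (at_right 0)"
    proof -
      have "((\<lambda>h::real. (1/h) ^ 1 * poly P (1/h) * exp (- (1/h))) \<longlongrightarrow> 0) (at_right 0)"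
        using filterlim_compose[OF poly_exp_tendsto_0[of 1 P] filterlim_inverse_at_top_right]
        by (simp add: inverse_eq_divide)
      moreover have "\<forall>\<^sub>F h::real in at_right 0. (1/h) ^ 1 * poly P (1/h) * exp (- (1/h)) = flat_exp P h / h"
        unfolding eventually_at_right_field by (intro exI[of _ 1]) (auto simp: flat_exp_def)
      ultimately show ?thesis by (rule Lim_transform_eventually)
    qed
    have l: "((\<lambda>h. flat_exp P h / h) \<longlongrightarrow> 0) (at_left 0)"
    proof (rule Lim_transform_eventually[OF tendsto_const])
      show "\<forall>\<^sub>F h::real in at_left 0. 0 = flat_exp P h / h"
        unfolding eventually_at_left_field by (intro exI[of _ "-1"]) (auto simp: flat_exp_def)
    qed
    have "(flat_exp P has_real_derivative 0) (at 0)"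
      using filterlim_split_at[OF l r] unfolding DERIV_def by (simp add: flat_exp_def)
    then show ?thesis using 3 by (simp add: flat_exp_def)
  qed
qed

lemma Ck_flat_exp: "Ck k (\<lambda>x::real^'n. flat_exp P (c * x $ i + a))"
proof (induction k arbitrary: P)
  case 0
  have "continuous_on UNIV (flat_exp P)"
    using flat_exp_deriv DERIV_isCont continuous_at_imp_continuous_on by blast
  then show ?case
    by (auto intro!: continuous_on_compose2[where f="\<lambda>x. c * x $ i + a" and g="flat_exp P"] continuous_intros)
next
  case (Suc k)
  let ?Q = "[:0,0,1:] * (P - pderiv P)"
  have d: "((\<lambda>x::real^'n. flat_exp P (c * x $ i + a)) has_derivative
      (\<lambda>h. (c * h $ i) * flat_exp ?Q (c * x $ i + a))) (at x)" for x
  proof (rule DERIV_compose_FDERIV[OF flat_exp_deriv])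
    show "((\<lambda>x. c * x $ i + a) has_derivative (\<lambda>h. c * h $ i)) (at x)"
      by (auto intro!: derivative_eq_intros bounded_linear.has_derivative[OF bounded_linear_vec_nth])
  qed
  have "partial_deriv j (\<lambda>x::real^'n. flat_exp P (c * x $ i + a))
      = (\<lambda>x. (c * axis j 1 $ i) * flat_exp ?Q (c * x $ i + a))" for j
    using partial_deriv_eqI[OF d] by (intro ext) simp
  moreover have "(\<lambda>x::real^'n. flat_exp P (c * x $ i + a)) differentiable_on UNIV"
    unfolding differentiable_on_def differentiable_def using d by auto
  ultimately show ?case using Suc by (auto intro!: Ck_mult Ck_const)
qed

text \<open>A product of flat functions of the distances to the faces of a box. Large steepness
  \<open>c\<close> brings it close to the indicator of the box while it stays between 0 and 1, so it
  takes the place of mollified indicators.\<close>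

definition bump :: "real^'n \<Rightarrow> real^'n \<Rightarrow> real \<Rightarrow> real^'n \<Rightarrow> real" where
  "bump a b c x = (\<Prod>i\<in>UNIV. flat_exp 1 (c * x $ i + - c * a $ i) * flat_exp 1 (- c * x $ i + c * b $ i))"

lemma Ck_bump: "Ck k (bump a b c)"
  unfolding bump_def[abs_def] by (intro Ck_prod Ck_mult Ck_flat_exp) auto

lemma flat_exp_1: "flat_exp 1 t = (if t > 0 then exp (- (1/t)) else 0)"
  by (simp add: flat_exp_def)

lemma flat_exp_1_le: "0 \<le> flat_exp 1 t" "flat_exp 1 t \<le> 1"
  by (auto simp: flat_exp_1)

lemma bump_bounds: "0 \<le> bump a b c x" "bump a b c x \<le> 1"
  unfolding bump_def by (auto intro!: prod_nonneg mult_nonneg_nonneg prod_le_1 mult_le_one flat_exp_1_le)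

lemma bump_eq_0:
  assumes "c > 0" "x \<notin> box a b"
  shows "bump a b c x = 0"
proof -
  obtain i where "\<not> (a $ i < x $ i \<and> x $ i < b $ i)" using assms(2) by (auto simp: mem_box_cart)
  then have "c * x $ i + - c * a $ i \<le> 0 \<or> - c * x $ i + c * b $ i \<le> 0" using assms(1)
    by (auto simp: not_less)
  then have "flat_exp 1 (c * x $ i + - c * a $ i) * flat_exp 1 (- c * x $ i + c * b $ i) = 0"
    unfolding flat_exp_1 by auto
  then show ?thesis unfolding bump_def by (intro prod_zero) auto
qed

lemma bump_tendsto: "(\<lambda>k. bump a b (real (Suc k)) x) \<longlonglongrightarrow> indicator (box a b) x"
proof (cases "x \<in> box a b")
  case True
  have *: "(\<lambda>k. flat_exp 1 (real (Suc k) * s)) \<longlonglongrightarrow> 1" if "s > 0" for s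
  proof -
    have "(\<lambda>k. exp (- (1 / s * inverse (real (Suc k))))) \<longlonglongrightarrow> exp (- (1 / s * 0))"
      by (intro tendsto_intros LIMSEQ_inverse_real_of_nat)
    moreover have "exp (- (1 / s * inverse (real (Suc k)))) = flat_exp 1 (real (Suc k) * s)" for k
      using that by (simp add: flat_exp_1 field_simps zero_less_mult_iff del: of_nat_Suc)
    ultimately show ?thesis by simp
  qed
  have "(\<lambda>k. \<Prod>i\<in>UNIV. flat_exp 1 (real (Suc k) * (x $ i - a $ i)) * flat_exp 1 (real (Suc k) * (b $ i - x $ i))) \<longlonglongrightarrow> (\<Prod>i\<in>(UNIV::'a set). 1 * 1)"
    using True by (intro tendsto_prod tendsto_mult *) (auto simp: mem_box_cart)
  then show ?thesis using True by (simp add: bump_def algebra_simps del: of_nat_Suc)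
qed (simp add: bump_eq_0)

lemma bump_test:
  assumes "c > 0" "cbox a b \<subseteq> \<Omega>"
  shows "bump a b c \<in> test_functions \<Omega>"
proof -
  have "{x. bump a b c x \<noteq> 0} \<subseteq> cbox a b"
    using bump_eq_0[OF assms(1)] box_subset_cbox by blast
  then have s: "closure {x. bump a b c x \<noteq> 0} \<subseteq> cbox a b"
    using closure_minimal closed_cbox by blast
  then have "compact (closure {x. bump a b c x \<noteq> 0})"
    using compact_cbox closed_closure by (metis compact_Int_closed inf.absorb_iff2)
  then show ?thesis using s assms Ck_bump by (auto simp: test_functions_def)
qed

text \<open>The gradient is part of the data, and only one continuous derivative is required: the
  class must be closed under composition with functions such as |s|^\<gamma>, which need not be
  smooth at 0.\<close>

definition C1c :: "(real^'n \<Rightarrow> real) \<Rightarrow> (real^'n \<Rightarrow> real^'n) \<Rightarrow> bool" where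
  "C1c f g \<longleftrightarrow> (\<forall>x. (f has_derivative (\<lambda>h. g x \<bullet> h)) (at x)) \<and> continuous_on UNIV g \<and>
     (\<exists>R. \<forall>x. norm x > R \<longrightarrow> f x = 0 \<and> g x = 0)"

lemma C1c_cont: "C1c f g \<Longrightarrow> continuous_on UNIV f" "C1c f g \<Longrightarrow> continuous_on UNIV g"
  by (auto simp: C1c_def intro!: continuous_at_imp_continuous_on has_derivative_continuous)

section \<open>Bounds and integration by parts for compactly supported functions\<close>

lemma continuous_compact_support_bound:
  fixes f :: "'a::euclidean_space \<Rightarrow> 'b::real_normed_vector"
  assumes "continuous_on UNIV f" "\<And>x. norm x > R \<Longrightarrow> f x = 0"
  obtains B where "B \<ge> 0" "\<And>x. norm (f x) \<le> B"
proof -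
  have "compact (f ` cball 0 R)" using assms(1)
    by (intro compact_continuous_image) (auto elim: continuous_on_subset)
  then have "bounded (f ` cball 0 R)" by (rule compact_imp_bounded)
  then obtain B where B: "\<forall>y \<in> f ` cball 0 R. norm y \<le> B" unfolding bounded_iff by blast
  have "norm (f x) \<le> max B 0" for x
    using B assms(2)[of x] by (cases "norm x \<le> R") (auto simp: le_max_iff_disj)
  then show ?thesis by (intro that[of "max B 0"]) auto
qed

lemma continuous_compact_support_integrable:
  fixes f :: "'a::euclidean_space \<Rightarrow> 'b::{banach, second_countable_topology}"
  assumes "continuous_on UNIV f" "\<And>x. norm x > R \<Longrightarrow> f x = 0"
  shows "integrable lborel f"
proof -
  obtain B where B: "B \<ge> 0" "\<And>x. norm (f x) \<le> B" using continuous_compact_support_bound[OF assms]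
    by blast
  have m[measurable]: "f \<in> borel_measurable lborel" using borel_measurable_continuous_onI[OF assms(1)]
    by simp
  have i: "integrable lborel (\<lambda>x. B * indicator (cball 0 R) x)"
    by (intro integrable_mult_right integrable_real_indicator) (use emeasure_bounded_finite[OF bounded_cball] in auto)
  show ?thesis
  proof (rule Bochner_Integration.integrable_bound[OF i m], rule AE_I2)
    show "norm (f x) \<le> norm (B * indicator (cball 0 R) x)" for x
      using B assms(2)[of x] by (cases "norm x > R") (auto simp: indicator_def)
  qed
qed

lemma lborel_integrable_translate:
  fixes f :: "'a::euclidean_space \<Rightarrow> 'b::{banach, second_countable_topology}"
  assumes "f \<in> borel_measurable borel"
  shows "integrable lborel (\<lambda>x. f (c + x)) \<longleftrightarrow> integrable lborel f"
  using integrable_distr_eq[of "(+) c" lborel borel f] assms by (simp add: lborel_distr_plus)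

lemma lborel_integral_translate:
  fixes f :: "'a::euclidean_space \<Rightarrow> 'b::{banach, second_countable_topology}"
  assumes "f \<in> borel_measurable borel"
  shows "(LINT x|lborel. f (c + x)) = (LINT x|lborel. f x)"
  using integral_distr[of "(+) c" lborel borel f] assms by (simp add: lborel_distr_plus)

lemma C1c_lipschitz:
  assumes "C1c f g" "\<And>x. norm (g x) \<le> B"
  shows "\<bar>f (x + h) - f x\<bar> \<le> B * norm h"
proof -
  have "norm (f (x + h) - f x) \<le> B * norm (x + h - x)"
  proof (rule differentiable_bound[where S=UNIV and f'="\<lambda>x h. g x \<bullet> h"])
    show "(f has_derivative (\<bullet>) (g x)) (at x within UNIV)" for x using assms(1) by (simp add: C1c_def)
    show "onorm ((\<bullet>) (g x)) \<le> B" for x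
    proof (rule onorm_bound)
      show "0 \<le> B" using assms(2)[of x] norm_ge_zero order_trans by blast
      show "norm (g x \<bullet> h) \<le> B * norm h" for h
        using Cauchy_Schwarz_ineq2[of "g x" h] mult_right_mono[OF assms(2)[of x] norm_ge_zero[of h]] by simp
    qed
  qed auto
  then show ?thesis by simp
qed

text \<open>Difference quotients have integral 0 by translation invariance and converge boundedly to
  the partial derivative. Together with the product rule this is integration by parts.\<close>

lemma C1c_integral_partial:
  assumes "C1c f g"
  shows "(LINT x|lborel. g x $ i) = 0"
proof -
  obtain R where R: "\<And>x. norm x > R \<Longrightarrow> f x = 0 \<and> g x = 0" using assms
    by (auto simp: C1c_def)
  have cf: "continuous_on UNIV f" and cg: "continuous_on UNIV g" using assms C1c_cont by auto
  have [measurable]: "f \<in> borel_measurable borel" "g \<in> borel_measurable borel"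
    using cf cg borel_measurable_continuous_onI by auto
  obtain B where B: "B \<ge> 0" "\<And>x. norm (g x) \<le> B" using continuous_compact_support_bound[OF cg] R
    by blast
  have fi: "integrable lborel f" using continuous_compact_support_integrable[OF cf] R by blast
  define t where "t k = inverse (real (Suc k))" for k
  have t: "0 < t k" "t k \<le> 1" for k by (auto simp: t_def divide_simps inverse_eq_divide)
  have t0: "t \<longlonglongrightarrow> 0" unfolding t_def by (rule LIMSEQ_inverse_real_of_nat)
  define q where "q k x = (f (t k *\<^sub>R axis i 1 + x) - f x) / t k" for k x
  have qz: "(LINT x|lborel. q k x) = 0" for k
    unfolding q_def using fi lborel_integrable_translate[of f] lborel_integral_translate[of f]
    by (simp add: Bochner_Integration.integral_diff)
  have "(\<lambda>k. LINT x|lborel. q k x) \<longlonglongrightarrow> (LINT x|lborel. g x $ i)"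
  \<comment> \<open>All shifts \<open>t k\<close> are at most 1, so the difference quotients vanish
    outside the ball of radius R + 1; \<open>B\<close> is a Lipschitz constant of f.\<close>
  proof (rule integral_dominated_convergence[where w="\<lambda>x. B * indicator (cball 0 (R + 1)) x"])
    show "integrable lborel (\<lambda>x::real^'a. B * indicator (cball 0 (R + 1)) x)"
      by (intro integrable_mult_right integrable_real_indicator) (use emeasure_bounded_finite[OF bounded_cball] in auto)
    show "AE x in lborel. (\<lambda>k. q k x) \<longlonglongrightarrow> g x $ i"
    proof (rule AE_I2)
      fix x
      have "(f has_derivative (\<bullet>) (g x)) (at (x + 0 *\<^sub>R axis i 1))" using assms
        by (simp add: C1c_def)
      moreover have "((\<lambda>t. x + t *\<^sub>R axis i 1) has_derivative (\<lambda>t. t *\<^sub>R axis i 1)) (at (0::real))"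
        by (rule has_derivative_eq_rhs) (rule derivative_intros | simp)+
      ultimately have "((\<lambda>t. f (x + t *\<^sub>R axis i 1)) has_derivative (\<lambda>h. g x \<bullet> (h *\<^sub>R axis i 1))) (at 0)"
        using has_derivative_compose by blast
      then have "((\<lambda>t. f (x + t *\<^sub>R axis i 1)) has_real_derivative g x $ i) (at 0)"
        unfolding has_field_derivative_def by (rule has_derivative_eq_rhs) (auto simp: inner_axis)
      then have "((\<lambda>h. (f (x + h *\<^sub>R axis i 1) - f x) / h) \<longlongrightarrow> g x $ i) (at 0)"
        unfolding DERIV_def by simp
      moreover have "filterlim t (at 0) sequentially"
        using t0 t(1) by (auto simp: filterlim_at less_imp_neq[THEN not_sym])
      ultimately have "((\<lambda>k. (f (x + t k *\<^sub>R axis i 1) - f x) / t k) \<longlonglongrightarrow> g x $ i)"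
        by (rule filterlim_compose)
      then show "(\<lambda>k. q k x) \<longlonglongrightarrow> g x $ i" by (simp add: q_def add.commute)
    qed
    show "AE x in lborel. norm (q k x) \<le> B * indicator (cball 0 (R + 1)) x" for k
    proof (rule AE_I2)
      fix x
      have "\<bar>f (x + t k *\<^sub>R axis i 1) - f x\<bar> \<le> B * t k"
        using C1c_lipschitz[OF assms B(2), of x "t k *\<^sub>R axis i 1"] t[of k] by simp
      then have le: "norm (q k x) \<le> B" using t[of k] by (simp add: q_def add.commute divide_simps)
      show "norm (q k x) \<le> B * indicator (cball 0 (R + 1)) x"
      proof (cases "norm x \<le> R + 1")
        case False
        have "norm x \<le> norm (t k *\<^sub>R axis i 1 + x) + norm (t k *\<^sub>R axis i (1::real))"
          by (metis add_diff_cancel_left' norm_triangle_ineq4)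
        then have "norm (t k *\<^sub>R axis i 1 + x) > R" using False t[of k] by simp
        then show ?thesis using R[of x] R[of "t k *\<^sub>R axis i 1 + x"] False
          by (simp add: q_def indicator_def)
      qed (use le in simp)
    qed
  next
    show "(\<lambda>x. g x $ i) \<in> borel_measurable lborel"
      using borel_measurable_continuous_onI[OF continuous_on_component[OF cg]] by simp
  qed (auto simp: q_def)
  then show ?thesis by (simp add: qz LIMSEQ_const_iff)
qed

lemma C1c_mult:
  assumes "C1c f g" "C1c f' g'"
  shows "C1c (\<lambda>x. f x * f' x) (\<lambda>x. f x *\<^sub>R g' x + f' x *\<^sub>R g x)"
proof -
  obtain R where R: "\<And>x. norm x > R \<Longrightarrow> f x = 0 \<and> g x = 0" using assms
    by (auto simp: C1c_def)
  have "((\<lambda>x. f x * f' x) has_derivative (\<lambda>h. (f x *\<^sub>R g' x + f' x *\<^sub>R g x) \<bullet> h)) (at x)" for x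
  proof -
    have "((\<lambda>x. f x * f' x) has_derivative (\<lambda>h. f x * (g' x \<bullet> h) + (g x \<bullet> h) * f' x)) (at x)"
      using assms by (intro has_derivative_mult) (auto simp: C1c_def)
    then show ?thesis by (rule has_derivative_eq_rhs) (auto simp: inner_add_left algebra_simps)
  qed
  then show ?thesis using C1c_cont[OF assms(1)] C1c_cont[OF assms(2)] R unfolding C1c_def
    by (auto intro!: continuous_intros exI[of _ R])
qed

text \<open>The condition \<open>T 0 = 0\<close> keeps the support compact.\<close>

lemma C1c_compose:
  assumes "C1c f g" "\<And>s. (T has_real_derivative T' s) (at s)" "continuous_on UNIV T'" "T 0 = 0"
  shows "C1c (\<lambda>x. T (f x)) (\<lambda>x. T' (f x) *\<^sub>R g x)"
proof -
  obtain R where R: "\<And>x. norm x > R \<Longrightarrow> f x = 0 \<and> g x = 0" using assms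
    by (auto simp: C1c_def)
  have "((\<lambda>x. T (f x)) has_derivative (\<lambda>h. (T' (f x) *\<^sub>R g x) \<bullet> h)) (at x)"
    for x
  proof -
    have "(f has_derivative (\<lambda>h. g x \<bullet> h)) (at x)" using assms(1) by (auto simp: C1c_def)
    from DERIV_compose_FDERIV[OF assms(2) this] show ?thesis by (simp add: mult.commute)
  qed
  moreover have "continuous_on UNIV (\<lambda>x. T' (f x) *\<^sub>R g x)"
    using C1c_cont[OF assms(1)] by (intro continuous_intros continuous_on_compose2[OF assms(3)]) auto
  moreover have "\<exists>R. \<forall>x. norm x > R \<longrightarrow> T (f x) = 0 \<and> T' (f x) *\<^sub>R g x = 0"
    using R assms(4) by (intro exI[of _ R]) auto
  ultimately show ?thesis unfolding C1c_def by blast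
qed

section \<open>Weak gradients\<close>

text \<open>The positive and negative parts of h are densities of two measures that agree and are
  finite on boxes, an intersection-stable generator; equal measures have equal densities.\<close>

lemma AE_zero_if_box_integrals_zero:
  fixes h :: "'a::euclidean_space \<Rightarrow> real"
  assumes h: "integrable lebesgue h"
    and z: "\<And>l u. (LINT x|lebesgue. indicator (box l u) x * h x) = 0"
  shows "AE x in lebesgue. h x = 0"
proof -
  have hm: "h \<in> borel_measurable lebesgue" using h by auto
  \<comment> \<open>A Borel representative is used because the two measures are compared on Borel
    sets.\<close>
  then obtain h' where h'[measurable]: "h' \<in> borel_measurable lborel" and eq: "AE x in lborel. h x = h' x"
    using completion_ex_borel_measurable_real by blast
  have eq': "AE x in lebesgue. h x = h' x" using eq by (rule AE_completion)
  have ih': "integrable lebesgue h'"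
    using integrable_cong_AE_imp[OF h measurable_completion[OF h']] eq' by (auto simp: eq_commute)
  then have ih: "integrable lborel h'" by (simp add: integrable_completion)
  have z': "(LINT x|lborel. indicator (box l u) x * h' x) = 0" for l u
  proof -
    have [measurable]: "h \<in> borel_measurable lebesgue" "h' \<in> borel_measurable lebesgue"
      using hm measurable_completion[OF h'] by auto
    have [measurable]: "box l u \<in> sets lebesgue" by auto
    have "(LINT x|lborel. indicator (box l u) x * h' x) = (LINT x|lebesgue. indicator (box l u) x * h' x)"
      by (subst integral_completion) auto
    also have "\<dots> = (LINT x|lebesgue. indicator (box l u) x * h x)"
      using eq' by (intro integral_cong_AE) (measurable, auto elim: eventually_mono)
    finally show ?thesis using z by simp
  qed
  let ?P = "\<lambda>x. ennreal (h' x)" and ?N = "\<lambda>x. ennreal (- h' x)"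
  have em: "emeasure (density lborel ?P) (box l u) = emeasure (density lborel ?N) (box l u)"
    and fin: "emeasure (density lborel ?P) (box l u) \<noteq> \<infinity>" for l u
  proof -
    let ?k = "\<lambda>x. indicator (box l u) x * h' x"
    have ik: "integrable lborel ?k" using integrable_mult_indicator[OF _ ih, of "box l u"] by auto
    have P: "emeasure (density lborel ?P) (box l u) = (\<integral>\<^sup>+x. ennreal (?k x) \<partial>lborel)"
      by (subst emeasure_density) (auto intro!: nn_integral_cong simp: indicator_def)
    have N: "emeasure (density lborel ?N) (box l u) = (\<integral>\<^sup>+x. ennreal (- ?k x) \<partial>lborel)"
      by (subst emeasure_density) (auto intro!: nn_integral_cong simp: indicator_def)
    have f: "(\<integral>\<^sup>+x. ennreal (?k x) \<partial>lborel) \<noteq> \<infinity>" "(\<integral>\<^sup>+x. ennreal (- ?k x) \<partial>lborel) \<noteq> \<infinity>"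
      using ik by (auto simp: real_integrable_def)
    have "enn2real (\<integral>\<^sup>+x. ennreal (?k x) \<partial>lborel) = enn2real (\<integral>\<^sup>+x. ennreal (- ?k x) \<partial>lborel)"
      using real_lebesgue_integral_def[OF ik] z'[of l u] by simp
    then show "emeasure (density lborel ?P) (box l u) = emeasure (density lborel ?N) (box l u)"
      using ennreal_enn2real[of "\<integral>\<^sup>+x. ennreal (?k x) \<partial>lborel"] ennreal_enn2real[of "\<integral>\<^sup>+x. ennreal (- ?k x) \<partial>lborel"] f
      unfolding P N by (simp add: less_top)
    show "emeasure (density lborel ?P) (box l u) \<noteq> \<infinity>" using f unfolding P by simp
  qed
  have "density lborel ?P = density lborel ?N"
  proof (rule measure_eqI_generator_eq)
    let ?E = "range (\<lambda>(a, b). box a b::'a set)"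
    show "Int_stable ?E" by (auto simp: Int_stable_def box_Int_box)
    show "?E \<subseteq> Pow UNIV" "sets (density lborel ?P) = sigma_sets UNIV ?E" "sets (density lborel ?N) = sigma_sets UNIV ?E"
      by (simp_all add: borel_eq_box)
    let ?A = "\<lambda>n::nat. box (- (real n *\<^sub>R One)) (real n *\<^sub>R One) :: 'a set"
    show "range ?A \<subseteq> ?E" "(\<Union>i. ?A i) = UNIV"
      unfolding UN_box_eq_UNIV by auto
  qed (use em fin in auto)
  then have "AE x in lborel. ?P x = ?N x"
    using ih by (subst (asm) finite_density_unique) (auto simp: real_integrable_def)
  \<comment> \<open>\<open>ennreal\<close> cuts off negative values, so the truncations of
    \<open>h' x\<close> and of its negative agree only at the value 0.\<close>
  then have "AE x in lborel. h' x = 0"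
  proof eventually_elim
    case (elim x)
    then show ?case by (cases "h' x \<ge> 0") (auto simp: ennreal_neg not_le)
  qed
  then have "AE x in lborel. h x = 0" using eq by eventually_elim simp
  then show ?thesis by (rule AE_completion)
qed

section \<open>Integrals over subsets and extension by zero\<close>

lemma open_sets_lebesgue: "open S \<Longrightarrow> S \<in> sets lebesgue"
  by auto

lemma integrable_lebesgue_on_subset:
  fixes f :: "'a::euclidean_space \<Rightarrow> 'b::{banach, second_countable_topology}"
  assumes "integrable (lebesgue_on T) f" "S \<subseteq> T" "S \<in> sets lebesgue" "T \<in> sets lebesgue"
  shows "integrable (lebesgue_on S) f"
proof -
  have "integrable lebesgue (\<lambda>x. if x \<in> T then f x else 0)"
    using assms by (simp add: Lebesgue_Measure.integrable_restrict_UNIV)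
  from integrable_mult_indicator[OF assms(3) this]
  have "integrable lebesgue (\<lambda>x. if x \<in> S then f x else 0)"
    by (rule Bochner_Integration.integrable_cong[THEN iffD1, rotated -1]) (use assms(2) in \<open>auto simp: indicator_def\<close>)
  then show ?thesis using assms by (simp add: Lebesgue_Measure.integrable_restrict_UNIV)
qed

lemma lebesgue_on_zero_outside:
  fixes f :: "'a::euclidean_space \<Rightarrow> 'b::euclidean_space"
  assumes "f \<in> borel_measurable borel" "\<And>x. x \<notin> S \<Longrightarrow> f x = 0" "S \<in> sets lebesgue"
  shows "(LINT x|lebesgue_on S. f x) = (LINT x|lborel. f x)"
    "integrable (lebesgue_on S) f \<longleftrightarrow> integrable lborel f"
proof -
  have e: "(\<lambda>x. if x \<in> S then f x else 0) = f" using assms(2) by auto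
  show "(LINT x|lebesgue_on S. f x) = (LINT x|lborel. f x)"
    using Lebesgue_Measure.integral_restrict_UNIV[OF assms(3), of f] assms(1) e
      by (simp add: integral_completion)
  show "integrable (lebesgue_on S) f \<longleftrightarrow> integrable lborel f"
    using Lebesgue_Measure.integrable_restrict_UNIV[OF assms(3), of f] assms(1) e
      by (simp add: integrable_completion)
qed

section \<open>Test functions: supports, gradients and linear operations\<close>

lemma test_grad_zero:
  assumes "x \<notin> closure {x. \<phi> x \<noteq> 0}"
  shows "grad \<phi> x = 0"
proof -
  let ?U = "- closure {x. \<phi> x \<noteq> 0}"
  have z: "\<phi> y = 0" if "y \<in> ?U" for y using that closure_subset[of "{x. \<phi> x \<noteq> 0}"]
    by auto
  have "((\<lambda>y. 0) has_derivative (\<lambda>h. 0)) (at x)" by simp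
  then have "(\<phi> has_derivative (\<lambda>h. 0)) (at x)"
  proof (rule has_derivative_transform_within_open[of _ _ _ UNIV ?U])
    show "open ?U" by (rule open_Compl[OF closed_closure])
    show "x \<in> ?U" using assms by blast
    show "0 = \<phi> y" if "y \<in> ?U" for y by (rule z[OF that, symmetric])
  qed
  then show ?thesis using has_derivative_imp_grad(1)[of \<phi> 0 x] by simp
qed

lemma test_C1c:
  assumes "\<phi> \<in> test_functions \<Omega>"
  shows "C1c \<phi> (grad \<phi>)"
proof -
  have ck: "Ck 1 \<phi>" and c: "compact (closure {x. \<phi> x \<noteq> 0})" using assms
    by (auto simp: test_functions_def)
  have d: "(\<phi> has_derivative (\<lambda>h. grad \<phi> x \<bullet> h)) (at x)" for x
    using ck by (intro has_derivative_grad) (auto simp: differentiable_on_def)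
  moreover have "continuous_on UNIV (grad \<phi>)"
    unfolding grad_def[abs_def] using ck by (intro continuous_on_vec_lambda) auto
  moreover obtain R where R: "\<forall>x \<in> closure {x. \<phi> x \<noteq> 0}. norm x \<le> R"
    using compact_imp_bounded[OF c] unfolding bounded_iff by blast
  have "\<phi> x = 0 \<and> grad \<phi> x = 0" if "norm x > R" for x
  proof -
    have n: "x \<notin> closure {x. \<phi> x \<noteq> 0}" using R that by auto
    then have "\<phi> x = 0" using closure_subset[of "{x. \<phi> x \<noteq> 0}"] by auto
    then show ?thesis using test_grad_zero[OF n] by simp
  qed
  ultimately show ?thesis unfolding C1c_def by blast
qed

lemma test_zero_outside: "\<phi> \<in> test_functions \<Omega> \<Longrightarrow> x \<notin> \<Omega> \<Longrightarrow> \<phi> x = 0"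
  "\<phi> \<in> test_functions \<Omega> \<Longrightarrow> x \<notin> \<Omega> \<Longrightarrow> grad \<phi> x = 0"
proof -
  assume a: "\<phi> \<in> test_functions \<Omega>" "x \<notin> \<Omega>"
  then have "x \<notin> closure {x. \<phi> x \<noteq> 0}" by (auto simp: test_functions_def)
  then show "\<phi> x = 0" "grad \<phi> x = 0"
    using test_grad_zero[of x \<phi>] closure_subset[of "{x. \<phi> x \<noteq> 0}"] by auto
qed

lemma compact_closure_in:
  fixes K :: "'a::heine_borel set"
  shows "compact K \<Longrightarrow> closure S \<subseteq> K \<Longrightarrow> compact (closure S)"
proof -
  assume K: "compact K" "closure S \<subseteq> K"
  have "S \<subseteq> K" using closure_subset[of S] K(2) by (rule order_trans)
  from bounded_subset[OF compact_imp_bounded[OF K(1)] this] show ?thesis by simp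
qed

lemma test_add:
  assumes "\<phi> \<in> test_functions \<Omega>" "\<psi> \<in> test_functions \<Omega>"
  shows "(\<lambda>x. \<phi> x + \<psi> x) \<in> test_functions \<Omega>"
proof -
  have "{x. \<phi> x + \<psi> x \<noteq> 0} \<subseteq> {x. \<phi> x \<noteq> 0} \<union> {x. \<psi> x \<noteq> 0}" by auto
  then have s: "closure {x. \<phi> x + \<psi> x \<noteq> 0} \<subseteq> closure {x. \<phi> x \<noteq> 0} \<union> closure {x. \<psi> x \<noteq> 0}"
    using closure_mono[of "{x. \<phi> x + \<psi> x \<noteq> 0}" "{x. \<phi> x \<noteq> 0} \<union> {x. \<psi> x \<noteq> 0}"] by (simp add: closure_Un)
  moreover have "compact (closure {x. \<phi> x \<noteq> 0} \<union> closure {x. \<psi> x \<noteq> 0})"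
    using assms by (auto simp: test_functions_def)
  ultimately have "compact (closure {x. \<phi> x + \<psi> x \<noteq> 0})"
    using compact_closure_in[OF _ s] by blast
  then show ?thesis using s assms unfolding test_functions_def by (auto intro: Ck_add)
qed

lemma test_scale:
  assumes "\<phi> \<in> test_functions \<Omega>"
  shows "(\<lambda>x. c * \<phi> x) \<in> test_functions \<Omega>"
proof -
  have "{x. c * \<phi> x \<noteq> 0} \<subseteq> {x. \<phi> x \<noteq> 0}" by auto
  then have s: "closure {x. c * \<phi> x \<noteq> 0} \<subseteq> closure {x. \<phi> x \<noteq> 0}"
    by (rule closure_mono)
  moreover have "compact (closure {x. \<phi> x \<noteq> 0})" using assms by (auto simp: test_functions_def)
  ultimately have "compact (closure {x. c * \<phi> x \<noteq> 0})"
    using compact_closure_in[OF _ s] by blast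
  then show ?thesis using s assms unfolding test_functions_def by (auto intro: Ck_mult Ck_const)
qed

lemma grad_add:
  assumes "\<phi> \<in> test_functions \<Omega>" "\<psi> \<in> test_functions \<Omega>"
  shows "grad (\<lambda>x. \<phi> x + \<psi> x) x = grad \<phi> x + grad \<psi> x"
proof (rule has_derivative_imp_grad(1))
  have "((\<lambda>x. \<phi> x + \<psi> x) has_derivative (\<lambda>h. grad \<phi> x \<bullet> h + grad \<psi> x \<bullet> h)) (at x)"
    using test_C1c[OF assms(1)] test_C1c[OF assms(2)] by (intro has_derivative_add) (auto simp: C1c_def)
  then show "((\<lambda>x. \<phi> x + \<psi> x) has_derivative (\<lambda>h. (grad \<phi> x + grad \<psi> x) \<bullet> h)) (at x)"
    by (simp only: inner_add_left)
qed

lemma grad_scale: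
  assumes "\<phi> \<in> test_functions \<Omega>"
  shows "grad (\<lambda>x. c * \<phi> x) x = c *\<^sub>R grad \<phi> x"
proof (rule has_derivative_imp_grad(1))
  have "((\<lambda>x. c * \<phi> x) has_derivative (\<lambda>h. c * (grad \<phi> x \<bullet> h))) (at x)"
    using test_C1c[OF assms(1)] by (intro has_derivative_mult_right) (auto simp: C1c_def)
  then show "((\<lambda>x. c * \<phi> x) has_derivative (\<lambda>h. (c *\<^sub>R grad \<phi> x) \<bullet> h)) (at x)"
    by (simp only: inner_scaleR_left)
qed

lemma locally_integrable_mult_test:
  fixes h :: "real^'n \<Rightarrow> real"
  assumes h: "locally_integrable \<Omega> h" and \<Omega>: "open \<Omega>" and K: "compact K" "K \<subseteq> \<Omega>"
    and f: "continuous_on UNIV f" "\<And>x. x \<notin> K \<Longrightarrow> f x = 0"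
  shows "integrable (lebesgue_on \<Omega>) (\<lambda>x. h x * f x)"
proof -
  have hK: "integrable (lebesgue_on K) h" using h K by (auto simp: locally_integrable_def)
  obtain R where R: "\<And>x. x \<in> K \<Longrightarrow> norm x \<le> R" using compact_imp_bounded[OF K(1)]
    by (auto simp: bounded_iff)
  have "f x = 0" if "norm x > R" for x using R[of x] f(2)[of x] that by force
  then obtain B where B: "B \<ge> 0" "\<And>x. norm (f x) \<le> B"
    using continuous_compact_support_bound[OF f(1)] by blast
  have Kl: "K \<in> sets lebesgue" using borel_closed[OF compact_imp_closed[OF K(1)]] by auto
  have fm: "f \<in> borel_measurable (lebesgue_on K)"
    using borel_measurable_continuous_onI[OF f(1)]
      by (auto intro!: measurable_restrict_space1 measurable_completion)
  have "integrable (lebesgue_on K) (\<lambda>x. h x * f x)"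
    by (rule Bochner_Integration.integrable_bound[OF integrable_mult_left[OF integrable_norm[OF hK], of B]])
      (use hK fm B in \<open>auto intro!: AE_I2 mult_left_mono simp: abs_mult\<close>)
  then have "integrable lebesgue (\<lambda>x. if x \<in> K then h x * f x else 0)" using Kl
    by (simp add: Lebesgue_Measure.integrable_restrict_UNIV)
  also have "(\<lambda>x. if x \<in> K then h x * f x else 0) = (\<lambda>x. if x \<in> \<Omega> then h x * f x else 0)"
    using f(2) K(2) by fastforce
  finally show ?thesis using \<Omega> by (simp add: Lebesgue_Measure.integrable_restrict_UNIV)
qed

lemma locally_integrable_mult_test_functions:
  fixes h :: "real^'n \<Rightarrow> real"
  assumes "locally_integrable \<Omega> h" "open \<Omega>" "\<phi> \<in> test_functions \<Omega>"
  shows "integrable (lebesgue_on \<Omega>) (\<lambda>x. h x * \<phi> x)" "integrable (lebesgue_on \<Omega>) (\<lambda>x. h x * partial_deriv i \<phi> x)"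
proof -
  have K: "compact (closure {x. \<phi> x \<noteq> 0})" "closure {x. \<phi> x \<noteq> 0} \<subseteq> \<Omega>"
    using assms(3) by (auto simp: test_functions_def)
  have c: "continuous_on UNIV \<phi>" "continuous_on UNIV (partial_deriv i \<phi>)"
    using C1c_cont[OF test_C1c[OF assms(3)]] continuous_on_component[of UNIV "grad \<phi>" i]
      by (auto simp: grad_def)
  have "\<phi> x = 0" if "x \<notin> closure {x. \<phi> x \<noteq> 0}" for x
    using that closure_subset[of "{x. \<phi> x \<noteq> 0}"] by auto
  then show "integrable (lebesgue_on \<Omega>) (\<lambda>x. h x * \<phi> x)"
    by (rule locally_integrable_mult_test[OF assms(1,2) K c(1)])
  have "partial_deriv i \<phi> x = 0" if "x \<notin> closure {x. \<phi> x \<noteq> 0}" for x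
    using test_grad_zero[OF that] by (simp add: grad_def vec_eq_iff)
  then show "integrable (lebesgue_on \<Omega>) (\<lambda>x. h x * partial_deriv i \<phi> x)"
    by (rule locally_integrable_mult_test[OF assms(1,2) K c(2)])
qed

text \<open>Bumps converge boundedly to indicators of boxes, so d has integral 0 over every box
  inside \<Omega>. Varying the box gives d = 0 almost everywhere on each of them, and \<Omega> is a
  countable union of boxes.\<close>

lemma fundamental_lemma:
  fixes d :: "real^'n \<Rightarrow> real"
  assumes \<Omega>: "open \<Omega>" and d: "locally_integrable \<Omega> d"
    and z: "\<And>\<phi>. \<phi> \<in> test_functions \<Omega> \<Longrightarrow> (LINT x|lebesgue_on \<Omega>. d x * \<phi> x) = 0"
  shows "AE x in lebesgue_on \<Omega>. d x = 0"
proof -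
  have box0: "(LINT x|lebesgue. indicator (box a b) x * d x) = 0" if ab: "cbox a b \<subseteq> \<Omega>"
    for a b
  proof -
    have dK: "integrable (lebesgue_on (cbox a b)) d" using d ab by (auto simp: locally_integrable_def)
    then have iK: "integrable lebesgue (\<lambda>x. if x \<in> cbox a b then d x else 0)"
      by (simp add: Lebesgue_Measure.integrable_restrict_UNIV)
    have [measurable]: "box a b \<in> sets lebesgue" by auto
    define D where "D x = (if x \<in> cbox a b then d x else 0)" for x
    have Dm[measurable]: "D \<in> borel_measurable lebesgue" using iK unfolding D_def[abs_def] by auto
    have bm[measurable]: "bump a b c \<in> borel_measurable lebesgue" for c
    proof -
      have "continuous_on UNIV (bump a b c)" using Ck_bump[of 0 a b c] by simp
      then show ?thesis by (intro measurable_completion) (simp add: borel_measurable_continuous_onI)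
    qed
    have "(\<lambda>k. LINT x|lebesgue. bump a b (real (Suc k)) x * D x) \<longlonglongrightarrow> (LINT x|lebesgue. indicator (box a b) x * D x)"
    proof (rule integral_dominated_convergence[where w="\<lambda>x. norm (D x)"])
      show "integrable lebesgue (\<lambda>x. norm (D x))" using iK by (simp add: D_def[abs_def])
      show "AE x in lebesgue. (\<lambda>k. bump a b (real (Suc k)) x * D x) \<longlonglongrightarrow> indicator (box a b) x * D x"
        by (intro AE_I2 tendsto_mult bump_tendsto tendsto_const)
      show "AE x in lebesgue. norm (bump a b (real (Suc k)) x * D x) \<le> norm (D x)" for k
        using bump_bounds[of a b "real (Suc k)"]
          by (intro AE_I2) (auto simp: abs_mult mult_left_le_one_le simp del: of_nat_Suc)
    qed auto
    moreover have "(LINT x|lebesgue. bump a b (real (Suc k)) x * D x) = 0" for k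
    proof -
      have "bump a b (real (Suc k)) x * D x = (if x \<in> \<Omega> then d x * bump a b (real (Suc k)) x else 0)" for x
        using ab bump_eq_0[of "real (Suc k)" x a b] box_subset_cbox[of a b] by (auto simp: D_def)
      then show ?thesis using z[OF bump_test[OF _ ab, of "real (Suc k)"]] \<Omega>
        by (simp add: Lebesgue_Measure.integral_restrict_UNIV)
    qed
    ultimately have "(LINT x|lebesgue. indicator (box a b) x * D x) = 0" by (simp add: LIMSEQ_const_iff)
    moreover have "indicator (box a b) x * D x = indicator (box a b) x * d x" for x
      using box_subset_cbox[of a b] by (auto simp: D_def indicator_def)
    ultimately show ?thesis by simp
  qed
  have cb: "AE x in lebesgue. x \<in> cbox a b \<longrightarrow> d x = 0"
    if ab: "cbox a b \<subseteq> \<Omega>" for a b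
  proof -
    have "integrable (lebesgue_on (cbox a b)) d" using d ab by (auto simp: locally_integrable_def)
    then have "integrable (lebesgue_on (box a b)) d"
      by (rule integrable_lebesgue_on_subset) (auto simp: box_subset_cbox)
    then have i: "integrable lebesgue (\<lambda>x. if x \<in> box a b then d x else 0)"
      by (simp add: Lebesgue_Measure.integrable_restrict_UNIV)
    have "AE x in lebesgue. (if x \<in> box a b then d x else 0) = 0"
    proof (rule AE_zero_if_box_integrals_zero[OF i])
      fix l u :: "real^'n"
      \<comment> \<open>The test box may leave \<open>box a b\<close>; intersections of boxes are
        boxes, and the closure of a nonempty one stays inside \<open>cbox a b\<close>.\<close>
      obtain l' u' where lu: "box l u \<inter> box a b = box l' u'" using box_Int_box[of l u a b] by blast
      have e: "indicator (box l u) x * (if x \<in> box a b then d x else 0) = indicator (box l' u') x * d x"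
        for x
        unfolding lu[symmetric] by (auto simp: indicator_def)
      show "(LINT x|lebesgue. indicator (box l u) x * (if x \<in> box a b then d x else 0)) = 0"
      proof (cases "box l' u' = {}")
        case False
        then have "cbox l' u' = closure (box l' u')" by simp
        also have "\<dots> \<subseteq> closure (cbox a b)" using lu box_subset_cbox[of a b]
          by (intro closure_mono) auto
        finally have "cbox l' u' \<subseteq> cbox a b" by simp
        then show ?thesis unfolding e using box0 ab by auto
      qed (simp add: e)
    qed
    \<comment> \<open>The argument covers only the open box; its boundary is a null set.\<close>
    moreover have "AE x in lebesgue. x \<notin> cbox a b - box a b"
      using negligible_frontier_interval[of a b] by (intro AE_not_in) (simp add: negligible_iff_null_sets)
    ultimately show ?thesis by eventually_elim auto
  qed
  obtain \<D> where D: "countable \<D>" "\<D> \<subseteq> Pow \<Omega>" "\<And>X. X \<in> \<D> \<Longrightarrow> \<exists>a b. X = cbox a b" "\<Union>\<D> = \<Omega>"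
    by (rule open_countable_Union_open_cbox[OF \<Omega>]) (rule that)
  have "AE x in lebesgue. \<forall>X\<in>\<D>. x \<in> X \<longrightarrow> d x = 0"
  proof (subst AE_ball_countable[OF D(1)], rule ballI)
    fix X assume X: "X \<in> \<D>"
    then obtain a b where ab: "X = cbox a b" using D(3) by blast
    have "cbox a b \<subseteq> \<Omega>" using X D(2) ab by blast
    then show "AE x in lebesgue. x \<in> X \<longrightarrow> d x = 0" unfolding ab by (rule cb)
  qed
  then have "AE x in lebesgue. x \<in> \<Omega> \<longrightarrow> d x = 0"
    by eventually_elim (use D(4) in auto)
  then show ?thesis using \<Omega> by (subst AE_restrict_space_iff) auto
qed

lemma integrable_lborel_imp_locally_integrable:
  assumes "integrable lborel f" "\<Omega> \<in> sets lebesgue"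
  shows "locally_integrable \<Omega> f"
  unfolding locally_integrable_def
proof (intro allI impI)
  fix K assume "compact K \<and> K \<subseteq> \<Omega>"
  then have K: "K \<in> sets lebesgue" using borel_closed[OF compact_imp_closed[of K]] by auto
  have "integrable (lebesgue_on UNIV) f" using assms(1)
    by (simp add: lebesgue_on_UNIV_eq integrable_completion borel_measurable_integrable)
  then show "integrable (lebesgue_on K) f" by (rule integrable_lebesgue_on_subset) (use K in auto)
qed

lemma C1c_integrable: "C1c f g \<Longrightarrow> integrable lborel f" "C1c f g \<Longrightarrow> integrable lborel g"
proof -
  assume c: "C1c f g"
  then obtain R where R: "\<And>x. norm x > R \<Longrightarrow> f x = 0" "\<And>x. norm x > R \<Longrightarrow> g x = 0" by (auto simp: C1c_def)
  show "integrable lborel f" "integrable lborel g"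
    using continuous_compact_support_integrable[OF C1c_cont(1)[OF c] R(1)] continuous_compact_support_integrable[OF C1c_cont(2)[OF c] R(2)] by auto
qed

text \<open>The gradient of the product of two test functions has integral 0, and its two terms are
  the two sides of the definition.\<close>

lemma test_has_weak_gradient:
  assumes "open \<Omega>" "\<phi> \<in> test_functions \<Omega>"
  shows "has_weak_gradient \<Omega> \<phi> (grad \<phi>)"
  unfolding has_weak_gradient_def
proof (intro conjI ballI allI)
  have c: "C1c \<phi> (grad \<phi>)" using test_C1c[OF assms(2)] .
  show l\<phi>: "locally_integrable \<Omega> \<phi>" and "locally_integrable \<Omega> (grad \<phi>)"
    using C1c_integrable[OF c] assms(1) by (auto intro!: integrable_lborel_imp_locally_integrable)
  fix \<psi> i assume \<psi>: "\<psi> \<in> test_functions \<Omega>"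
  have c': "C1c \<psi> (grad \<psi>)" using test_C1c[OF \<psi>] .
  let ?f = "\<lambda>x. \<phi> x * partial_deriv i \<psi> x" and ?g = "\<lambda>x. grad \<phi> x $ i * \<psi> x"
  have cont: "continuous_on UNIV \<phi>" "continuous_on UNIV \<psi>" "continuous_on UNIV (partial_deriv i \<psi>)" "continuous_on UNIV (\<lambda>x. grad \<phi> x $ i)"
    using C1c_cont[OF c] C1c_cont[OF c'] continuous_on_component[of UNIV "grad \<psi>" i] continuous_on_component[of UNIV "grad \<phi>" i]
    by (auto simp: grad_def)
  obtain R where R: "\<And>x. norm x > R \<Longrightarrow> \<phi> x = 0" using c by (auto simp: C1c_def)
  obtain R' where R': "\<And>x. norm x > R' \<Longrightarrow> \<psi> x = 0" using c' by (auto simp: C1c_def)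
  have i: "integrable lborel ?f" "integrable lborel ?g"
    using R R'
      by (auto intro!: continuous_compact_support_integrable[of ?f R] continuous_compact_support_integrable[of ?g R'] continuous_on_mult cont)
  have "(LINT x|lborel. ?f x + ?g x) = 0"
    using C1c_integral_partial[OF C1c_mult[OF c c'], of i] by (simp add: grad_def mult.commute)
  then have "(LINT x|lborel. ?f x) = - (LINT x|lborel. ?g x)" using i by simp
  moreover have "(LINT x|lebesgue_on \<Omega>. ?f x) = (LINT x|lborel. ?f x)" "(LINT x|lebesgue_on \<Omega>. ?g x) = (LINT x|lborel. ?g x)"
    using i test_zero_outside[OF assms(2)] test_zero_outside[OF \<psi>] assms(1)
    using borel_measurable_integrable[OF i(1)] borel_measurable_integrable[OF i(2)]
    by (auto intro!: lebesgue_on_zero_outside(1))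
  ultimately show "(LINT x|lebesgue_on \<Omega>. ?f x) = - (LINT x|lebesgue_on \<Omega>. ?g x)" by simp
qed

lemma locally_integrable_component: "locally_integrable \<Omega> g \<Longrightarrow> locally_integrable \<Omega> (\<lambda>x. g x $ i)"
  for g :: "real^'n \<Rightarrow> real^'m"
  unfolding locally_integrable_def by (auto intro: integrable_bounded_linear[OF bounded_linear_vec_nth])

lemma has_weak_gradient_add:
  assumes "open \<Omega>" "has_weak_gradient \<Omega> u g" "has_weak_gradient \<Omega> v h"
  shows "has_weak_gradient \<Omega> (\<lambda>x. u x + v x) (\<lambda>x. g x + h x)"
  unfolding has_weak_gradient_def
proof (intro conjI ballI allI)
  have l: "locally_integrable \<Omega> u" "locally_integrable \<Omega> v" "locally_integrable \<Omega> g" "locally_integrable \<Omega> h"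
    using assms by (auto simp: has_weak_gradient_def)
  then show "locally_integrable \<Omega> (\<lambda>x. u x + v x)" "locally_integrable \<Omega> (\<lambda>x. g x + h x)"
    by (auto simp: locally_integrable_def)
  fix \<psi> i assume \<psi>: "\<psi> \<in> test_functions \<Omega>"
  note li = locally_integrable_component[of \<Omega> _ i, OF l(3)] locally_integrable_component[of \<Omega> _ i, OF l(4)]
  have "(LINT x|lebesgue_on \<Omega>. u x * partial_deriv i \<psi> x) = - (LINT x|lebesgue_on \<Omega>. g x $ i * \<psi> x)"
    "(LINT x|lebesgue_on \<Omega>. v x * partial_deriv i \<psi> x) = - (LINT x|lebesgue_on \<Omega>. h x $ i * \<psi> x)"
    using assms(2,3) \<psi> by (auto simp: has_weak_gradient_def)
  then show "(LINT x|lebesgue_on \<Omega>. (u x + v x) * partial_deriv i \<psi> x) = - (LINT x|lebesgue_on \<Omega>. (g x + h x) $ i * \<psi> x)"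
    using locally_integrable_mult_test_functions(2)[OF l(1) assms(1) \<psi>, of i] locally_integrable_mult_test_functions(2)[OF l(2) assms(1) \<psi>, of i]
      locally_integrable_mult_test_functions(1)[OF li(1) assms(1) \<psi>] locally_integrable_mult_test_functions(1)[OF li(2) assms(1) \<psi>]
    by (simp add: distrib_right)
qed

lemma has_weak_gradient_scale:
  assumes "open \<Omega>" "has_weak_gradient \<Omega> u g"
  shows "has_weak_gradient \<Omega> (\<lambda>x. c * u x) (\<lambda>x. c *\<^sub>R g x)"
  using assms by (auto simp: has_weak_gradient_def locally_integrable_def mult.assoc)

lemma has_weak_gradient_diff:
  assumes "open \<Omega>" "has_weak_gradient \<Omega> u g" "has_weak_gradient \<Omega> v h"
  shows "has_weak_gradient \<Omega> (\<lambda>x. u x - v x) (\<lambda>x. g x - h x)"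
  using has_weak_gradient_add[OF assms(1,2) has_weak_gradient_scale[OF assms(1,3), of "-1"]] by simp

lemma weak_gradient_unique:
  fixes g h :: "real^'n \<Rightarrow> real^'n"
  assumes "open \<Omega>" "has_weak_gradient \<Omega> u g" "has_weak_gradient \<Omega> u h"
  shows "AE x in lebesgue_on \<Omega>. g x = h x"
proof -
  have w: "has_weak_gradient \<Omega> (\<lambda>x. 0) (\<lambda>x. g x - h x)"
    using has_weak_gradient_diff[OF assms] by simp
  have "AE x in lebesgue_on \<Omega>. (g x - h x) $ i = 0" for i
  proof (rule fundamental_lemma[OF assms(1)])
    show "locally_integrable \<Omega> (\<lambda>x. (g x - h x) $ i)"
      using w locally_integrable_component[of \<Omega> "\<lambda>x. g x - h x" i]
        by (simp add: has_weak_gradient_def)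
    show "(LINT x|lebesgue_on \<Omega>. (g x - h x) $ i * \<phi> x) = 0"
      if "\<phi> \<in> test_functions \<Omega>" for \<phi>
      using w that by (simp add: has_weak_gradient_def)
  qed
  then have "AE x in lebesgue_on \<Omega>. \<forall>i\<in>UNIV. (g x - h x) $ i = 0"
    by (intro AE_finite_allI) auto
  then show ?thesis by eventually_elim (simp add: vec_eq_iff)
qed

section \<open>From p-th powers to L^1 on spaces of finite measure\<close>

lemma finite_measure_lebesgue_on_bounded: "open \<Omega> \<Longrightarrow> bounded \<Omega> \<Longrightarrow> finite_measure (lebesgue_on \<Omega>)"
  by (intro finite_measure_lebesgue_on bounded_set_imp_lmeasurable) auto

text \<open>Either t <= \<epsilon>, or (t/\<epsilon>)^(p-1) >= 1 and t is absorbed by its power. On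
  a finite measure space the free \<epsilon> makes convergence in L^p imply convergence in L^1
  without Hoelder's inequality.\<close>

lemma abs_le_powr_split:
  fixes t p \<epsilon> :: real
  assumes "0 \<le> t" "1 \<le> p" "0 < \<epsilon>"
  shows "t \<le> \<epsilon> + \<epsilon> powr (1 - p) * t powr p"
proof (cases "t \<le> \<epsilon>")
  case False
  then have "t > 0" using assms by simp
  have "1 \<le> (t / \<epsilon>) powr (p - 1)" using False assms by (intro ge_one_powr_ge_zero) auto
  then have "t * 1 \<le> t * (t / \<epsilon>) powr (p - 1)" using assms by (intro mult_left_mono) auto
  also have "\<dots> = \<epsilon> powr (1 - p) * t powr p"
    using \<open>t > 0\<close> assms by (simp add: powr_divide powr_diff field_simps)
  finally show ?thesis using assms by simp
qed (use assms in \<open>simp add: add_increasing2\<close>)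

lemma (in finite_measure) LP_integrable:
  assumes "u \<in> LP M p" "1 \<le> p"
  shows "integrable M u"
  using assms abs_le_powr_split[of "norm (u _)" p 1]
  by (intro Bochner_Integration.integrable_bound[where f="\<lambda>x. 1 + norm (u x) powr p" and g=u])
    (auto simp: LP_def intro!: AE_I2 integrable_add)

lemma (in finite_measure) LP_L1_bound:
  assumes "u \<in> LP M p" "1 \<le> p" "0 < \<epsilon>"
  shows "(LINT x|M. norm (u x)) \<le> \<epsilon> * measure M (space M) + \<epsilon> powr (1 - p) * pint M p u"
proof -
  have "(LINT x|M. norm (u x)) \<le> (LINT x|M. \<epsilon> + \<epsilon> powr (1 - p) * norm (u x) powr p)"
    using LP_integrable[OF assms(1,2)] assms abs_le_powr_split[of "norm (u _)" p \<epsilon>]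
    by (intro integral_mono) (auto simp: LP_def)
  then show ?thesis using assms by (simp add: LP_def pint_def mult.commute)
qed

lemma (in finite_measure) pint_tendsto_L1:
  assumes "\<And>k. u k \<in> LP M p" "1 \<le> p" "(\<lambda>k. pint M p (u k)) \<longlonglongrightarrow> 0"
  shows "(\<lambda>k. LINT x|M. norm (u k x)) \<longlonglongrightarrow> 0"
proof (rule LIMSEQ_I)
  fix r :: real assume r: "r > 0"
  define \<epsilon> where "\<epsilon> = r / (2 * (measure M (space M) + 1))"
  have \<epsilon>: "\<epsilon> > 0" "\<epsilon> * measure M (space M) < r / 2 + 0"
    using r measure_nonneg[of M "space M"] by (auto simp: \<epsilon>_def field_simps add_pos_nonneg)
  have "(\<lambda>k. \<epsilon> powr (1 - p) * pint M p (u k)) \<longlonglongrightarrow> \<epsilon> powr (1 - p) * 0" by (intro tendsto_intros assms)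
  then have "\<forall>\<^sub>F k in sequentially. \<epsilon> powr (1 - p) * pint M p (u k) < r / 2"
    using r by (intro order_tendstoD(2)[where y="\<epsilon> powr (1 - p) * 0"]) auto
  then obtain N where N: "\<And>k. k \<ge> N \<Longrightarrow> \<epsilon> powr (1 - p) * pint M p (u k) < r / 2"
    by (auto simp: eventually_sequentially)
  have "norm ((LINT x|M. norm (u k x)) - 0) < r" if "k \<ge> N" for k
    using LP_L1_bound[OF assms(1)[of k] assms(2) \<epsilon>(1)] N[OF that] \<epsilon>(2) integral_nonneg_AE[of "\<lambda>x. norm (u k x)" M] by simp
  then show "\<exists>N. \<forall>k\<ge>N. norm ((LINT x|M. norm (u k x)) - 0) < r" by blast
qed

lemma LP_locally_integrable:
  assumes "u \<in> LP (lebesgue_on \<Omega>) p" "1 \<le> p" "open \<Omega>" "bounded \<Omega>"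
  shows "locally_integrable \<Omega> u"
proof -
  have "integrable (lebesgue_on \<Omega>) u"
    using finite_measure.LP_integrable[OF finite_measure_lebesgue_on_bounded[OF assms(3,4)] assms(1,2)] .
  then show ?thesis unfolding locally_integrable_def
  proof (intro allI impI)
    fix K assume K: "compact K \<and> K \<subseteq> \<Omega>"
    then have "K \<in> sets lebesgue" using borel_closed[OF compact_imp_closed[of K]] by auto
    with \<open>integrable (lebesgue_on \<Omega>) u\<close> show "integrable (lebesgue_on K) u"
      by (rule integrable_lebesgue_on_subset[OF _ conjunct2[OF K]]) (rule open_sets_lebesgue[OF assms(3)])
  qed
qed

lemma integral_mult_tendsto:
  fixes w :: "nat \<Rightarrow> 'a \<Rightarrow> real"
  assumes w: "\<And>k. integrable M (w k)" "(\<lambda>k. LINT x|M. \<bar>w k x\<bar>) \<longlonglongrightarrow> 0"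
    and f: "f \<in> borel_measurable M" "\<And>x. \<bar>f x\<bar> \<le> B"
  shows "(\<lambda>k. LINT x|M. w k x * f x) \<longlonglongrightarrow> 0"
proof (rule Lim_null_comparison)
  have i: "integrable M (\<lambda>x. B * \<bar>w k x\<bar>)" for k using w by auto
  have le: "norm (w k x * f x) \<le> B * \<bar>w k x\<bar>" for k x
    using mult_left_mono[OF f(2)[of x] abs_ge_zero[of "w k x"]] by (simp add: abs_mult mult.commute)
  have B: "0 \<le> B" using f(2) order_trans abs_ge_zero by blast
  have i2: "integrable M (\<lambda>x. w k x * f x)" for k
    by (rule Bochner_Integration.integrable_bound[OF i[of k]]) (use w f le B in \<open>auto intro!: AE_I2 simp: abs_mult\<close>)
  have "norm (LINT x|M. w k x * f x) \<le> B * (LINT x|M. \<bar>w k x\<bar>)" for k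
  proof -
    have "norm (LINT x|M. w k x * f x) \<le> (LINT x|M. norm (w k x * f x))" by (rule integral_norm_bound)
    also have "\<dots> \<le> (LINT x|M. B * \<bar>w k x\<bar>)" using i2 i le by (intro integral_mono) auto
    finally show ?thesis by simp
  qed
  then show "\<forall>\<^sub>F k in sequentially. norm (LINT x|M. w k x * f x) \<le> B * (LINT x|M. \<bar>w k x\<bar>)" by simp
  show "(\<lambda>k. B * (LINT x|M. \<bar>w k x\<bar>)) \<longlonglongrightarrow> 0"
    using tendsto_mult[OF tendsto_const w(2), of B] by simp
qed

text \<open>Test functions and their derivatives are bounded, so both sides of the defining identity
  pass to the limit under L^1 convergence, which L^p convergence implies on the bounded set
  \<Omega>.\<close>

lemma has_weak_gradient_limit:
  fixes u :: "nat \<Rightarrow> real^'n \<Rightarrow> real" and g :: "nat \<Rightarrow> real^'n \<Rightarrow> real^'n"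
  assumes \<Omega>: "open \<Omega>" "bounded \<Omega>" and p: "1 \<le> p"
    and w: "\<And>k. has_weak_gradient \<Omega> (u k) (g k)"
    and L: "\<And>k. u k \<in> LP (lebesgue_on \<Omega>) p" "\<And>k. g k \<in> LP (lebesgue_on \<Omega>) p"
      "v \<in> LP (lebesgue_on \<Omega>) p" "h \<in> LP (lebesgue_on \<Omega>) p"
    and lim: "(\<lambda>k. pint (lebesgue_on \<Omega>) p (\<lambda>x. u k x - v x)) \<longlonglongrightarrow> 0" "(\<lambda>k. pint (lebesgue_on \<Omega>) p (\<lambda>x. g k x - h x)) \<longlonglongrightarrow> 0"
  shows "has_weak_gradient \<Omega> v h"
  unfolding has_weak_gradient_def
proof (intro conjI ballI allI)
  interpret finite_measure "lebesgue_on \<Omega>" using finite_measure_lebesgue_on_bounded[OF \<Omega>] .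
  have p0: "0 \<le> p" using p by simp
  show lv: "locally_integrable \<Omega> v" and lh: "locally_integrable \<Omega> h" using L p \<Omega>
    by (auto intro: LP_locally_integrable)
  fix \<psi> i assume \<psi>: "\<psi> \<in> test_functions \<Omega>"
  have c: "C1c \<psi> (grad \<psi>)" using test_C1c[OF \<psi>] .
  obtain R where R: "\<And>x. norm x > R \<Longrightarrow> \<psi> x = 0 \<and> grad \<psi> x = 0" using c
    by (auto simp: C1c_def)
  obtain B1 where B1: "\<And>x. norm (\<psi> x) \<le> B1"
    using continuous_compact_support_bound[OF C1c_cont(1)[OF c]] R by metis
  obtain B2 where B2: "\<And>x. norm (grad \<psi> x) \<le> B2"
    using continuous_compact_support_bound[OF C1c_cont(2)[OF c]] R by metis
  have b2: "\<bar>partial_deriv i \<psi> x\<bar> \<le> B2" for x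
    using order_trans[OF component_le_norm_cart[of "grad \<psi> x" i] B2] by (simp add: grad_def)
  have cont: "continuous_on UNIV (partial_deriv i \<psi>)"
    using C1c_cont[OF c] continuous_on_component[of UNIV "grad \<psi>" i] by (simp add: grad_def)
  have m: "\<psi> \<in> borel_measurable (lebesgue_on \<Omega>)" "partial_deriv i \<psi> \<in> borel_measurable (lebesgue_on \<Omega>)"
    using borel_measurable_continuous_onI[OF C1c_cont(1)[OF c]] borel_measurable_continuous_onI[OF cont]
    by (auto intro!: measurable_restrict_space1 measurable_completion)
  have L1: "(\<lambda>x. u k x - v x) \<in> LP (lebesgue_on \<Omega>) p" "(\<lambda>x. g k x - h x) \<in> LP (lebesgue_on \<Omega>) p" for k
    using L p0 by (auto intro: LP_diff)
  have "(\<lambda>k. LINT x|lebesgue_on \<Omega>. (u k x - v x) * partial_deriv i \<psi> x) \<longlonglongrightarrow> 0"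
    using pint_tendsto_L1[OF L1(1) p lim(1)] LP_integrable[OF L1(1) p] b2 m
      by (intro integral_mult_tendsto) auto
  moreover have "(\<lambda>k. LINT x|lebesgue_on \<Omega>. (g k x - h x) $ i * \<psi> x) \<longlonglongrightarrow> 0"
  proof (rule integral_mult_tendsto[OF _ _ m(1)])
    show i: "integrable (lebesgue_on \<Omega>) (\<lambda>x. (g k x - h x) $ i)" for k
      using integrable_bounded_linear[OF bounded_linear_vec_nth LP_integrable[OF L1(2) p]] .
    show "(\<lambda>k. LINT x|lebesgue_on \<Omega>. \<bar>(g k x - h x) $ i\<bar>) \<longlonglongrightarrow> 0"
    proof (rule tendsto_sandwich[OF _ _ tendsto_const pint_tendsto_L1[OF L1(2) p lim(2)]])
      show "\<forall>\<^sub>F k in sequentially. (LINT x|lebesgue_on \<Omega>. \<bar>(g k x - h x) $ i\<bar>) \<le> (LINT x|lebesgue_on \<Omega>. norm (g k x - h x))"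
      proof (intro always_eventually allI integral_mono)
        show "\<bar>(g k x - h x) $ i\<bar> \<le> norm (g k x - h x)" for k x by (rule component_le_norm_cart)
        show "integrable (lebesgue_on \<Omega>) (\<lambda>x. \<bar>(g k x - h x) $ i\<bar>)" for k
          using integrable_norm[OF i[of k]] by simp
        show "integrable (lebesgue_on \<Omega>) (\<lambda>x. norm (g k x - h x))" for k
          using LP_integrable[OF L1(2) p] by (rule integrable_norm)
      qed
    qed (auto intro!: always_eventually integral_nonneg_AE)
  qed (use B1 in simp)
  ultimately have "(\<lambda>k. (LINT x|lebesgue_on \<Omega>. (u k x - v x) * partial_deriv i \<psi> x) + (LINT x|lebesgue_on \<Omega>. (g k x - h x) $ i * \<psi> x)) \<longlonglongrightarrow> 0 + 0"
    by (rule tendsto_add)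
  moreover have "(LINT x|lebesgue_on \<Omega>. (u k x - v x) * partial_deriv i \<psi> x) + (LINT x|lebesgue_on \<Omega>. (g k x - h x) $ i * \<psi> x)
      = - (LINT x|lebesgue_on \<Omega>. v x * partial_deriv i \<psi> x) - (LINT x|lebesgue_on \<Omega>. h x $ i * \<psi> x)" for k
  proof -
    have lk: "locally_integrable \<Omega> (u k)" "locally_integrable \<Omega> (g k)" using w[of k]
      by (auto simp: has_weak_gradient_def)
    have "(LINT x|lebesgue_on \<Omega>. u k x * partial_deriv i \<psi> x) = - (LINT x|lebesgue_on \<Omega>. g k x $ i * \<psi> x)"
      using w[of k] \<psi> by (auto simp: has_weak_gradient_def)
    then show ?thesis
      using locally_integrable_mult_test_functions(2)[OF lk(1) \<Omega>(1) \<psi>, of i] locally_integrable_mult_test_functions(2)[OF lv \<Omega>(1) \<psi>, of i]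
      locally_integrable_mult_test_functions(1)[OF locally_integrable_component[OF lk(2)] \<Omega>(1) \<psi>, of i]
      locally_integrable_mult_test_functions(1)[OF locally_integrable_component[OF lh] \<Omega>(1) \<psi>, of i]
      by (simp add: left_diff_distrib)
  qed
  ultimately show "(LINT x|lebesgue_on \<Omega>. v x * partial_deriv i \<psi> x) = - (LINT x|lebesgue_on \<Omega>. h x $ i * \<psi> x)"
    by (simp add: LIMSEQ_const_iff)
qed

section \<open>The Sobolev inequality\<close>

text \<open>Exponent 0 gives 1 everywhere, also at \<open>top\<close>. Factors of weight 0 then
  disappear from products, both in Hoelder's inequality and at the limiting exponent of the Sobolev
  argument.\<close>

definition epow :: "ennreal \<Rightarrow> real \<Rightarrow> ennreal" where
  "epow x r = (if r = 0 then 1 else if x = top then top else ennreal (enn2real x powr r))"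

lemma epow_0 [simp]: "epow x 0 = 1"
  by (simp add: epow_def)

lemma epow_top [simp]: "r \<noteq> 0 \<Longrightarrow> epow top r = top"
  by (simp add: epow_def)

lemma epow_ennreal: "0 \<le> a \<Longrightarrow> r \<noteq> 0 \<Longrightarrow> epow (ennreal a) r = ennreal (a powr r)"
  by (simp add: epow_def)

lemma epow_eq_0_iff: "r > 0 \<Longrightarrow> epow x r = 0 \<longleftrightarrow> x = 0"
  by (cases x) (auto simp: epow_ennreal)

lemma epow_measurable [measurable]:
  assumes [measurable]: "f \<in> borel_measurable M"
  shows "(\<lambda>x. epow (f x) r) \<in> borel_measurable M"
  unfolding epow_def by measurable

lemma epow_mono: "x \<le> y \<Longrightarrow> 0 \<le> r \<Longrightarrow> epow x r \<le> epow y r"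
proof (cases "y = top \<or> r = 0")
  case False
  assume "x \<le> y" "0 \<le> r"
  then show ?thesis using False
    by (cases x; cases y) (auto simp: epow_ennreal top_unique intro!: ennreal_leI powr_mono2)
qed (auto simp: epow_def)

lemma epow_add: "0 \<le> r \<Longrightarrow> 0 \<le> s \<Longrightarrow> epow x (r + s) = epow x r * epow x s"
proof (cases "r = 0 \<or> s = 0")
  case False
  assume "0 \<le> r" "0 \<le> s"
  then show ?thesis using False
    by (cases x) (auto simp: epow_ennreal powr_add ennreal_mult ennreal_top_mult)
qed auto

text \<open>Concavity of \<open>ln\<close>, exponentiated.\<close>

lemma weighted_amgm:
  fixes x w :: "'a \<Rightarrow> real"
  assumes J: "finite J" "J \<noteq> {}" and w: "\<And>i. i \<in> J \<Longrightarrow> 0 \<le> w i" "sum w J = 1" and x: "\<And>i. i \<in> J \<Longrightarrow> 0 < x i"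
  shows "(\<Prod>i\<in>J. x i powr w i) \<le> (\<Sum>i\<in>J. w i * x i)"
proof -
  have c: "ln (\<Sum>i\<in>J. w i *\<^sub>R x i) \<ge> (\<Sum>i\<in>J. w i * ln (x i))"
    by (rule concave_on_sum[OF J ln_concave]) (use w x in auto)
  have "(\<Sum>i\<in>J. w i * x i) > 0"
  proof -
    obtain i where "i \<in> J" "w i \<noteq> 0" using w(2) by (metis sum.neutral zero_neq_one)
    then show ?thesis using J w x by (intro sum_pos2[of _ i]) (auto simp: less_le intro!: mult_nonneg_nonneg)
  qed
  then have "exp (\<Sum>i\<in>J. w i * ln (x i)) \<le> (\<Sum>i\<in>J. w i * x i)"
    using c by (simp add: ln_ge_iff)
  moreover have "exp (\<Sum>i\<in>J. w i * ln (x i)) = (\<Prod>i\<in>J. x i powr w i)"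
    using x by (subst exp_sum[OF J(1)]) (force intro!: prod.cong simp: powr_def)
  ultimately show ?thesis by simp
qed

text \<open>The arithmetic-geometric mean inequality for the ratios x_i / c_i, with the powers of
  the c_i multiplied back. The scales \<open>c i\<close> stay free so that Hoelder's inequality can
  insert the integrals of the factors.\<close>

lemma epow_amgm:
  assumes J: "finite J" "J \<noteq> {}" and w: "\<And>i. i \<in> J \<Longrightarrow> 0 < w i" "sum w J = 1" and c: "\<And>i. i \<in> J \<Longrightarrow> 0 < c i"
  shows "(\<Prod>i\<in>J. epow (x i) (w i)) \<le> ennreal (\<Prod>i\<in>J. c i powr w i) * (\<Sum>i\<in>J. ennreal (w i / c i) * x i)"
proof -
  have pc: "(\<Prod>i\<in>J. c i powr w i) > 0" using c by (intro prod_pos) force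
  consider (top) "\<exists>i\<in>J. x i = top" | (zero) "\<exists>i\<in>J. x i = 0" | (pos) "\<forall>i\<in>J. x i \<noteq> top \<and> x i \<noteq> 0" by blast
  then show ?thesis
  proof cases
    case top
    then obtain i where i: "i \<in> J" "x i = top" by auto
    have "w i / c i > 0" using i w c by simp
    then have "ennreal (w i / c i) \<noteq> 0" by (simp only: ennreal_eq_0_iff not_le)
    then have "ennreal (w i / c i) * x i = top" using i(2) by (simp add: ennreal_mult_top)
    then have "(\<Sum>i\<in>J. ennreal (w i / c i) * x i) = top"
      using member_le_sum[of i J "\<lambda>i. ennreal (w i / c i) * x i"] i(1) J(1) by (simp add: top_unique)
    then show ?thesis using pc by (simp add: ennreal_mult_top)
  next
    case zero
    then have z: "(\<Prod>i\<in>J. epow (x i) (w i)) = 0" using J w by (auto simp: epow_eq_0_iff)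
    show ?thesis by (subst z) simp
  next
    case pos
    define y where "y i = enn2real (x i)" for i
    have y: "0 < y i" "x i = ennreal (y i)" if "i \<in> J" for i
      using pos that by (auto simp: y_def enn2real_positive_iff less_top zero_less_iff_neq_zero)
    have "(\<Prod>i\<in>J. epow (x i) (w i)) = (\<Prod>i\<in>J. ennreal (y i powr w i))"
      using y w by (force intro!: prod.cong simp: epow_ennreal)
    also have "\<dots> = ennreal (\<Prod>i\<in>J. y i powr w i)" by (rule prod_ennreal) auto
    also have "\<dots> \<le> ennreal ((\<Prod>i\<in>J. c i powr w i) * (\<Sum>i\<in>J. w i * (y i / c i)))"
    proof (rule ennreal_leI)
      have "(\<Prod>i\<in>J. (y i / c i) powr w i) \<le> (\<Sum>i\<in>J. w i * (y i / c i))"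
        using J w c y by (intro weighted_amgm) (auto intro: less_imp_le)
      then have "(\<Prod>i\<in>J. c i powr w i) * (\<Prod>i\<in>J. (y i / c i) powr w i) \<le> (\<Prod>i\<in>J. c i powr w i) * (\<Sum>i\<in>J. w i * (y i / c i))"
        using pc by (intro mult_left_mono) auto
      moreover have "(\<Prod>i\<in>J. c i powr w i) * (\<Prod>i\<in>J. (y i / c i) powr w i) = (\<Prod>i\<in>J. y i powr w i)"
        unfolding prod.distrib[symmetric]
      proof (rule prod.cong[OF refl])
        fix i assume "i \<in> J"
        then show "c i powr w i * (y i / c i) powr w i = y i powr w i"
          using c[of i] y(1)[of i] by (simp add: powr_mult[symmetric])
      qed
      ultimately show "(\<Prod>i\<in>J. y i powr w i) \<le> (\<Prod>i\<in>J. c i powr w i) * (\<Sum>i\<in>J. w i * (y i / c i))" by simp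
    qed
    also have "\<dots> = ennreal (\<Prod>i\<in>J. c i powr w i) * ennreal (\<Sum>i\<in>J. w i * (y i / c i))"
      using pc
        by (intro ennreal_mult) (auto intro!: sum_nonneg mult_nonneg_nonneg divide_nonneg_nonneg less_imp_le[OF w(1)] less_imp_le[OF y(1)] less_imp_le[OF c])
    also have "ennreal (\<Sum>i\<in>J. w i * (y i / c i)) = (\<Sum>i\<in>J. ennreal (w i / c i) * x i)"
    proof -
      have "ennreal (\<Sum>i\<in>J. w i * (y i / c i)) = (\<Sum>i\<in>J. ennreal (w i * (y i / c i)))"
        by (subst sum_ennreal) (auto intro!: mult_nonneg_nonneg divide_nonneg_nonneg less_imp_le[OF w(1)] less_imp_le[OF y(1)] less_imp_le[OF c])
      also have "\<dots> = (\<Sum>i\<in>J. ennreal (w i / c i) * x i)"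
        using w y c by (force intro!: sum.cong simp: ennreal_mult[symmetric])
      finally show ?thesis .
    qed
    finally show ?thesis .
  qed
qed

text \<open>After division by their integrals the factors satisfy the arithmetic-geometric mean
  inequality, and the weighted sum integrates to the sum of the weights, 1. A factor with integral 0
  vanishes almost everywhere and kills the product; failing that, an infinite integral makes the
  bound trivial.\<close>

lemma nn_integral_Holder_prod:
  assumes J: "finite J" and w: "\<And>i. i \<in> J \<Longrightarrow> 0 \<le> w i" "sum w J = 1"
    and f: "\<And>i. i \<in> J \<Longrightarrow> f i \<in> borel_measurable M"
  shows "(\<integral>\<^sup>+x. (\<Prod>i\<in>J. epow (f i x) (w i)) \<partial>M) \<le> (\<Prod>i\<in>J. epow (\<integral>\<^sup>+x. f i x \<partial>M) (w i))"
proof -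
  \<comment> \<open>Factors of weight 0 equal 1 on both sides and are dropped; the treatment of zero
    and infinite factors relies on positive weights.\<close>
  define K where "K = {i\<in>J. w i > 0}"
  have K: "finite K" "K \<subseteq> J" using J by (auto simp: K_def)
  have wK: "0 < w i" if "i \<in> K" for i using that by (auto simp: K_def)
  have w0: "w i = 0" if "i \<in> J - K" for i using that w(1)[of i] by (auto simp: K_def)
  have sK: "sum w K = 1" using w(2) K w0 J by (metis sum.mono_neutral_left)
  have Kne: "K \<noteq> {}" using sK by auto
  have fK: "f i \<in> borel_measurable M" if "i \<in> K" for i using that K f by auto
  have eq: "(\<Prod>i\<in>J. epow (g i) (w i)) = (\<Prod>i\<in>K. epow (g i) (w i))"
    for g :: "_ \<Rightarrow> ennreal"
    using J K w0 by (intro prod.mono_neutral_right) auto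
  let ?I = "\<lambda>i. \<integral>\<^sup>+x. f i x \<partial>M"
  have "(\<integral>\<^sup>+x. (\<Prod>i\<in>K. epow (f i x) (w i)) \<partial>M) \<le> (\<Prod>i\<in>K. epow (?I i) (w i))"
  proof -
    consider (zero) "\<exists>i\<in>K. ?I i = 0" | (top) "\<forall>i\<in>K. ?I i \<noteq> 0" "\<exists>i\<in>K. ?I i = top" | (pos) "\<forall>i\<in>K. ?I i \<noteq> top \<and> ?I i \<noteq> 0" by blast
    then show ?thesis
    proof cases
      case zero
      then obtain i where i: "i \<in> K" "?I i = 0" by auto
      then have "AE x in M. f i x = 0" using fK by (simp add: nn_integral_0_iff_AE)
      then have "AE x in M. (\<Prod>i\<in>K. epow (f i x) (w i)) = 0"
        by eventually_elim (use i K wK in \<open>auto simp: epow_eq_0_iff\<close>)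
      then have "(\<integral>\<^sup>+x. (\<Prod>i\<in>K. epow (f i x) (w i)) \<partial>M) = (\<integral>\<^sup>+x. 0 \<partial>M)" by (rule nn_integral_cong_AE)
      then show ?thesis by simp
    next
      case top
      then have "(\<Prod>i\<in>K. epow (?I i) (w i)) = top"
        using K(1) wK
          by (auto simp: ennreal_prod_eq_top epow_eq_0_iff intro!: bexI) (metis epow_top less_irrefl)
      then show ?thesis by simp
    next
      case pos
      define c where "c i = enn2real (?I i)" for i
      have c: "0 < c i" "?I i = ennreal (c i)" if "i \<in> K" for i
        using pos that by (auto simp: c_def enn2real_positive_iff less_top zero_less_iff_neq_zero)
      have "(\<integral>\<^sup>+x. (\<Prod>i\<in>K. epow (f i x) (w i)) \<partial>M)
          \<le> (\<integral>\<^sup>+x. ennreal (\<Prod>i\<in>K. c i powr w i) * (\<Sum>i\<in>K. ennreal (w i / c i) * f i x) \<partial>M)"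
        using K Kne wK sK c by (intro nn_integral_mono epow_amgm) auto
      also have "\<dots> = ennreal (\<Prod>i\<in>K. c i powr w i) * (\<Sum>i\<in>K. ennreal (w i / c i) * ?I i)"
        using fK by (simp add: nn_integral_cmult nn_integral_sum)
      also have "(\<Sum>i\<in>K. ennreal (w i / c i) * ?I i) = (\<Sum>i\<in>K. ennreal (w i))"
      proof (rule sum.cong[OF refl])
        fix i assume i: "i \<in> K"
        show "ennreal (w i / c i) * ?I i = ennreal (w i)"
          using c(1)[OF i] wK[OF i] unfolding c(2)[OF i] by (simp add: ennreal_mult[symmetric])
      qed
      also have "\<dots> = 1" using wK sK by (subst sum_ennreal) (auto intro: less_imp_le)
      also have "ennreal (\<Prod>i\<in>K. c i powr w i) = (\<Prod>i\<in>K. epow (?I i) (w i))"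
      proof -
        have "(\<Prod>i\<in>K. epow (?I i) (w i)) = (\<Prod>i\<in>K. ennreal (c i powr w i))"
        proof (rule prod.cong[OF refl])
          fix i assume i: "i \<in> K"
          show "epow (?I i) (w i) = ennreal (c i powr w i)"
            using c(1)[OF i] wK[OF i] unfolding c(2)[OF i] by (simp add: epow_ennreal)
        qed
        also have "\<dots> = ennreal (\<Prod>i\<in>K. c i powr w i)" by (rule prod_ennreal) auto
        finally show ?thesis by simp
      qed
      finally show ?thesis by simp
    qed
  qed
  then show ?thesis unfolding eq .
qed

section \<open>Integration along coordinate lines\<close>

interpretation lborel_product: product_sigma_finite "\<lambda>_. lborel :: real measure" ..

lemma line_integral_measurable:
  assumes i: "i \<in> I" and f[measurable]: "f \<in> borel_measurable (Pi\<^sub>M I (\<lambda>_. lborel :: real measure))"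
  shows "(\<lambda>x. \<integral>\<^sup>+t. f (x(i := t)) \<partial>lborel) \<in> borel_measurable (Pi\<^sub>M I (\<lambda>_. lborel :: real measure))"
proof -
  have I: "insert i I = I" using i by auto
  have "(\<lambda>(x, t). f (x(i := t))) \<in> borel_measurable (Pi\<^sub>M I (\<lambda>_. lborel) \<Otimes>\<^sub>M (lborel :: real measure))"
    using measurable_compose[OF measurable_add_dim[of i I "\<lambda>_. lborel :: real measure", unfolded I] f]
      by (simp add: case_prod_beta)
  then show ?thesis by (rule lborel.borel_measurable_nn_integral)
qed

text \<open>The inductive form of the Gagliardo--Nirenberg inequality: each factor is \<open>f\<close> integrated
  along a line parallel to a coordinate axis, and one coordinate is integrated out at a time by
  Hoelder's inequality.\<close>

lemma grid_lines:
  fixes f :: "('i \<Rightarrow> real) \<Rightarrow> ennreal"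
  assumes "finite I" "f \<in> borel_measurable (Pi\<^sub>M I (\<lambda>_. lborel))" "0 \<le> r" "(real (card I) - 1) * r \<le> 1"
  shows "(\<integral>\<^sup>+x. epow (f x) (1 - (real (card I) - 1) * r) * (\<Prod>i\<in>I. epow (\<integral>\<^sup>+t. f (x(i := t)) \<partial>lborel) r) \<partial>Pi\<^sub>M I (\<lambda>_. lborel))
    \<le> epow (\<integral>\<^sup>+x. f x \<partial>Pi\<^sub>M I (\<lambda>_. lborel)) (1 + r)"
  using assms
proof (induction I arbitrary: f rule: finite_induct)
  case empty
  then show ?case by (simp add: PiM_empty nn_integral_count_space_finite add.commute)
next
  case (insert k J)
  let ?P = "\<lambda>I. Pi\<^sub>M I (\<lambda>_. lborel :: real measure)"
  let ?m = "real (card J)"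
  have f[measurable]: "f \<in> borel_measurable (?P (insert k J))" by fact
  have cI: "real (card (insert k J)) - 1 = ?m" using insert by simp
  have r: "0 \<le> r" "?m * r \<le> 1" using insert.prems cI by auto
  define F where "F y = (\<integral>\<^sup>+s. f (y(k := s)) \<partial>lborel)" for y
  have upd: "(\<lambda>(y, s). f (y(k := s))) \<in> borel_measurable (?P J \<Otimes>\<^sub>M lborel)"
    using measurable_compose[OF measurable_add_dim[of k J "\<lambda>_. lborel :: real measure"] f]
      by (simp add: case_prod_beta)
  have Fm: "F \<in> borel_measurable (?P J)"
    unfolding F_def[abs_def] using upd by (rule lborel.borel_measurable_nn_integral)
  have lm[measurable]: "(\<lambda>x. \<integral>\<^sup>+t. f (x(i := t)) \<partial>lborel) \<in> borel_measurable (?P (insert k J))" if "i \<in> insert k J" for i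
    using line_integral_measurable[OF that f] .
  let ?g = "\<lambda>x. epow (f x) (1 - ?m * r) * (\<Prod>i\<in>insert k J. epow (\<integral>\<^sup>+t. f (x(i := t)) \<partial>lborel) r)"
  have gm: "?g \<in> borel_measurable (?P (insert k J))"
    by (intro borel_measurable_times_ennreal borel_measurable_prod_ennreal epow_measurable lm f)
  have secm: "(\<lambda>s. h (y(k := s))) \<in> borel_measurable lborel"
    if "y \<in> space (?P J)" "h \<in> borel_measurable (?P (insert k J))"
      for y and h :: "_ \<Rightarrow> ennreal"
  proof -
    have "(\<lambda>(y, s). h (y(k := s))) \<in> borel_measurable (?P J \<Otimes>\<^sub>M lborel)"
      using measurable_compose[OF measurable_add_dim[of k J "\<lambda>_. lborel :: real measure"] that(2)]
        by (simp add: case_prod_beta)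
    from measurable_Pair2[OF this that(1)] show ?thesis by simp
  qed
  have inner: "(\<integral>\<^sup>+s. ?g (y(k := s)) \<partial>lborel) \<le> epow (F y) (1 - (?m - 1) * r) * (\<Prod>i\<in>J. epow (\<integral>\<^sup>+t. F (y(i := t)) \<partial>lborel) r)"
    if y: "y \<in> space (?P J)" for y
  proof -
    let ?fi = "\<lambda>i s. \<integral>\<^sup>+t. f ((y(k := s))(i := t)) \<partial>lborel"
    have fim: "?fi i \<in> borel_measurable lborel" if "i \<in> J" for i
      using secm[OF y lm[of i]] that by simp
    have f0m: "(\<lambda>s. f (y(k := s))) \<in> borel_measurable lborel" using secm[OF y f] .
    \<comment> \<open>The integral along the k-th direction does not depend on s and leaves the
      inner integral as \<open>epow (F y) r\<close>.\<close>
    have split: "?g (y(k := s)) = epow (F y) r * (epow (f (y(k := s))) (1 - ?m * r) * (\<Prod>i\<in>J. epow (?fi i s) r))" for s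
      using insert.hyps by (simp add: F_def ac_simps)
    \<comment> \<open>The factors of Hoelder's inequality in s: \<open>None\<close> stands for f
      itself with weight 1 - |J| r, \<open>Some i\<close> for the line integral in direction i with
      weight r.\<close>
    define h where "h j s = (case j of None \<Rightarrow> f (y(k := s)) | Some i \<Rightarrow> ?fi i s)"
      for j s
    define w where "w j = (case j of None \<Rightarrow> 1 - ?m * r | Some i \<Rightarrow> r)"
      for j :: "'i option"
    let ?J = "insert None (Some ` J)"
    have sw: "sum w ?J = 1"
      using insert.hyps by (simp add: w_def sum.reindex)
    have prod_h: "(\<Prod>j\<in>?J. epow (G j) (w j)) = epow (G None) (1 - ?m * r) * (\<Prod>i\<in>J. epow (G (Some i)) r)" for G
      using insert.hyps by (simp add: w_def prod.reindex)
    have "(\<integral>\<^sup>+s. (\<Prod>j\<in>?J. epow (h j s) (w j)) \<partial>lborel) \<le> (\<Prod>j\<in>?J. epow (\<integral>\<^sup>+s. h j s \<partial>lborel) (w j))"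
    proof (rule nn_integral_Holder_prod[OF _ _ sw])
      show "h j \<in> borel_measurable lborel" if "j \<in> ?J" for j
        using that fim f0m by (auto simp: h_def[abs_def])
    qed (use insert.hyps r in \<open>auto simp: w_def\<close>)
    then have "(\<integral>\<^sup>+s. epow (f (y(k := s))) (1 - ?m * r) * (\<Prod>i\<in>J. epow (?fi i s) r) \<partial>lborel)
        \<le> epow (F y) (1 - ?m * r) * (\<Prod>i\<in>J. epow (\<integral>\<^sup>+s. ?fi i s \<partial>lborel) r)"
      unfolding prod_h by (simp add: h_def[abs_def] F_def)
    also have "(\<Prod>i\<in>J. epow (\<integral>\<^sup>+s. ?fi i s \<partial>lborel) r) = (\<Prod>i\<in>J. epow (\<integral>\<^sup>+t. F (y(i := t)) \<partial>lborel) r)"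
    proof (rule prod.cong[OF refl])
      fix i assume i: "i \<in> J"
      then have ik: "i \<noteq> k" using insert.hyps by auto
      have "(\<lambda>(s, t). f ((y(k := s))(i := t))) \<in> borel_measurable (lborel \<Otimes>\<^sub>M lborel)"
      proof -
        have e: "insert i (insert k J) = insert k J" using i by auto
        have s: "(\<lambda>s. y(k := s)) \<in> lborel \<rightarrow>\<^sub>M ?P (insert k J)"
          using measurable_Pair2[OF measurable_add_dim[of k J "\<lambda>_. lborel :: real measure"] y] by simp
        have "(\<lambda>z. (y(k := fst z), snd z)) \<in> (lborel \<Otimes>\<^sub>M lborel) \<rightarrow>\<^sub>M (?P (insert k J) \<Otimes>\<^sub>M lborel)"
          by (intro measurable_Pair measurable_compose[OF measurable_fst s] measurable_snd)
        from measurable_compose[OF this measurable_compose[OF measurable_add_dim[of i "insert k J" "\<lambda>_. lborel :: real measure", unfolded e] f]]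
        show ?thesis by (simp add: case_prod_beta)
      qed
      \<comment> \<open>For i different from k the two one-dimensional integrations commute, so
        integrating out k turns line integrals of f into line integrals of F.\<close>
      then have "(\<integral>\<^sup>+s. ?fi i s \<partial>lborel) = (\<integral>\<^sup>+t. (\<integral>\<^sup>+s. f ((y(k := s))(i := t)) \<partial>lborel) \<partial>lborel)"
        by (rule lborel_pair.Fubini'[symmetric])
      also have "\<dots> = (\<integral>\<^sup>+t. F (y(i := t)) \<partial>lborel)"
        unfolding F_def using ik by (simp add: fun_upd_twist)
      finally show "epow (\<integral>\<^sup>+s. ?fi i s \<partial>lborel) r = epow (\<integral>\<^sup>+t. F (y(i := t)) \<partial>lborel) r" by simp
    qed
    finally have *: "(\<integral>\<^sup>+s. epow (f (y(k := s))) (1 - ?m * r) * (\<Prod>i\<in>J. epow (?fi i s) r) \<partial>lborel)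
        \<le> epow (F y) (1 - ?m * r) * (\<Prod>i\<in>J. epow (\<integral>\<^sup>+t. F (y(i := t)) \<partial>lborel) r)" .
    have "(\<integral>\<^sup>+s. ?g (y(k := s)) \<partial>lborel) = epow (F y) r * (\<integral>\<^sup>+s. epow (f (y(k := s))) (1 - ?m * r) * (\<Prod>i\<in>J. epow (?fi i s) r) \<partial>lborel)"
      unfolding split using fim f0m
        by (intro nn_integral_cmult borel_measurable_times_ennreal borel_measurable_prod_ennreal epow_measurable) auto
    also have "\<dots> \<le> epow (F y) r * (epow (F y) (1 - ?m * r) * (\<Prod>i\<in>J. epow (\<integral>\<^sup>+t. F (y(i := t)) \<partial>lborel) r))"
      by (intro mult_left_mono *) simp
    also have "\<dots> = epow (F y) (r + (1 - ?m * r)) * (\<Prod>i\<in>J. epow (\<integral>\<^sup>+t. F (y(i := t)) \<partial>lborel) r)"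
      using r by (subst epow_add) (auto simp: mult.assoc)
    \<comment> \<open>The factor pulled out restores the exponent that the induction hypothesis
      requires for the smaller index set.\<close>
    also have "r + (1 - ?m * r) = 1 - (?m - 1) * r" by (simp add: algebra_simps)
    finally show ?thesis .
  qed
  have "(\<integral>\<^sup>+x. ?g x \<partial>?P (insert k J)) = (\<integral>\<^sup>+y. (\<integral>\<^sup>+s. ?g (y(k := s)) \<partial>lborel) \<partial>?P J)"
    by (rule lborel_product.product_nn_integral_insert[OF insert.hyps gm])
  also have "\<dots> \<le> (\<integral>\<^sup>+y. epow (F y) (1 - (?m - 1) * r) * (\<Prod>i\<in>J. epow (\<integral>\<^sup>+t. F (y(i := t)) \<partial>lborel) r) \<partial>?P J)"
    by (rule nn_integral_mono) (rule inner)
  also have "\<dots> \<le> epow (\<integral>\<^sup>+y. F y \<partial>?P J) (1 + r)"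
  proof (rule insert.IH[OF Fm])
    show "(?m - 1) * r \<le> 1" using r by (simp add: algebra_simps)
  qed (rule r)
  also have "(\<integral>\<^sup>+y. F y \<partial>?P J) = (\<integral>\<^sup>+x. f x \<partial>?P (insert k J))"
    unfolding F_def by (rule lborel_product.product_nn_integral_insert[OF insert.hyps f, symmetric])
  finally show ?case unfolding cI .
qed

lemma vec_lambda_measurable:
  "(\<lambda>x. \<chi> i. x i) \<in> Pi\<^sub>M UNIV (\<lambda>_::'n::finite. lborel :: real measure) \<rightarrow>\<^sub>M (borel :: (real^'n) measure)"
proof -
    have "(\<lambda>x. \<Sum>i\<in>UNIV. x i *\<^sub>R axis i 1) \<in> Pi\<^sub>M UNIV (\<lambda>_::'n. lborel :: real measure) \<rightarrow>\<^sub>M (borel :: (real^'n) measure)"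
      by (intro borel_measurable_sum borel_measurable_scaleR borel_measurable_const)
        (use measurable_component_singleton[of _ "UNIV :: 'n set" "\<lambda>_. lborel :: real measure"] in simp)
    also have "(\<lambda>x. \<Sum>i\<in>UNIV. x i *\<^sub>R axis i 1) = (\<lambda>x. (\<chi> i. x i) :: real^'n)"
      by (auto simp: fun_eq_iff vec_eq_iff axis_def if_distrib[of "(*) _"] cong: if_cong)
    finally show ?thesis .
qed

text \<open>Both measures agree on boxes. The identification makes coordinatewise integration on the
  product space available for \<open>real^'n\<close>.\<close>

lemma lborel_eq_distr_PiM:
  "lborel = distr (Pi\<^sub>M UNIV (\<lambda>_::'n::finite. lborel :: real measure)) borel (\<lambda>x. \<chi> i. x i)"
proof (rule lborel_eqI)
  fix l u :: "real^'n" assume lu: "\<And>b. b \<in> Basis \<Longrightarrow> l \<bullet> b \<le> u \<bullet> b"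
  have lu': "l $ i \<le> u $ i" for i using lu[of "axis i 1"] by (simp add: inner_axis)
  have "(\<lambda>x. \<chi> i. x i) -` box l u \<inter> space (Pi\<^sub>M UNIV (\<lambda>_::'n. lborel :: real measure)) = (\<Pi>\<^sub>E i\<in>UNIV. {l $ i <..< u $ i})"
    by (auto simp: mem_box_cart space_PiM PiE_iff)
  then have "emeasure (distr (Pi\<^sub>M UNIV (\<lambda>_::'n. lborel)) borel (\<lambda>x. \<chi> i. x i)) (box l u)
      = emeasure (Pi\<^sub>M UNIV (\<lambda>_::'n. lborel :: real measure)) (\<Pi>\<^sub>E i\<in>UNIV. {l $ i <..< u $ i})"
    by (subst emeasure_distr[OF vec_lambda_measurable]) auto
  also have "\<dots> = (\<Prod>i\<in>UNIV. emeasure lborel {l $ i <..< u $ i})"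
    by (rule lborel_product.emeasure_PiM) auto
  also have "\<dots> = (\<Prod>i\<in>UNIV. ennreal (u $ i - l $ i))" using lu' by simp
  also have "\<dots> = ennreal (\<Prod>i\<in>UNIV. u $ i - l $ i)" using lu' by (intro prod_ennreal) simp
  also have "(\<Prod>i\<in>UNIV. u $ i - l $ i) = (\<Prod>b\<in>Basis. (u - l) \<bullet> b)"
  proof -
    have B: "(Basis :: (real^'n) set) = range (\<lambda>i. axis i 1)" by (auto simp: Basis_vec_def)
    have "inj (\<lambda>i::'n. axis i (1::real))" by (auto simp: inj_on_def axis_eq_axis)
    then show ?thesis unfolding B by (subst prod.reindex) (auto simp: inner_axis)
  qed
  finally show "emeasure (distr (Pi\<^sub>M UNIV (\<lambda>_::'n. lborel)) borel (\<lambda>x. \<chi> i. x i)) (box l u) = ennreal (\<Prod>b\<in>Basis. (u - l) \<bullet> b)" .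
qed simp

text \<open>The fundamental theorem of calculus along the line in direction j, started at a point
  outside the support.\<close>

lemma line_bound:
  fixes f :: "real^'n \<Rightarrow> real"
  assumes "C1c f g"
  shows "ennreal \<bar>f (\<chi> i. y i)\<bar> \<le> (\<integral>\<^sup>+t. ennreal (norm (g (\<chi> i. (y(j := t)) i))) \<partial>lborel)"
proof -
  obtain R where R: "\<And>x. norm x > R \<Longrightarrow> f x = 0 \<and> g x = 0" using assms
    by (auto simp: C1c_def)
  define X where "X t = (\<chi> i. (y(j := t)) i)" for t
  \<comment> \<open>The starting coordinate is at most -|R| - 1, so the starting point has norm
    larger than R; the minimum with \<open>y j\<close> keeps the interval in the right
    order.\<close>
  define a where "a = min (y j) (- \<bar>R\<bar> - 1)"
  have "\<bar>X a $ j\<bar> \<le> norm (X a)" by (rule component_le_norm_cart)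
  moreover have "X a $ j = a" by (simp add: X_def)
  moreover have "a \<le> - \<bar>R\<bar> - 1" by (simp add: a_def)
  ultimately have "norm (X a) > R" by linarith
  then have fa: "f (X a) = 0" using R by blast
  define c where "c = X 0"
  have xa: "X t = c + t *\<^sub>R axis j 1" for t by (auto simp: vec_eq_iff axis_def c_def X_def)
  have xd: "((\<lambda>t. X t) has_derivative (\<lambda>h. h *\<^sub>R axis j 1)) (at t)" for t
    unfolding xa by (rule has_derivative_eq_rhs) (rule derivative_intros | simp)+
  have d: "((\<lambda>t. f (X t)) has_real_derivative g (X t) $ j) (at t)" for t
  proof -
    have "(f has_derivative (\<lambda>h. g (X t) \<bullet> h)) (at (X t))" using assms by (simp add: C1c_def)
    from has_derivative_compose[OF xd this] show ?thesis
      unfolding has_field_derivative_def by (rule has_derivative_eq_rhs) (auto simp: inner_axis mult.commute)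
  qed
  have cx: "continuous_on UNIV X"
    using xd by (intro continuous_at_imp_continuous_on ballI has_derivative_continuous) auto
  have cg: "continuous_on UNIV (\<lambda>t. g (X t) $ j)"
    by (intro continuous_on_component continuous_on_compose2[OF C1c_cont(2)[OF assms] cx]) auto
  let ?h = "\<lambda>t. g (X t) $ j * indicator {a..y j} t"
  have "(LINT t|lborel. ?h t) = f (X (y j)) - f (X a)"
    by (rule integral_FTC_Icc_real) (use d cg in \<open>auto simp: a_def continuous_on_eq_continuous_within\<close>)
  then have "ennreal \<bar>f (\<chi> i. y i)\<bar> = ennreal (norm (LINT t|lborel. ?h t))" using fa
    by (simp add: X_def)
  also have "\<dots> \<le> (\<integral>\<^sup>+t. ennreal (norm (?h t)) \<partial>lborel)"
  proof (rule integral_norm_bound_ennreal)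
    have "set_integrable lborel {a..y j} (\<lambda>t. g (X t) $ j)"
      by (intro borel_integrable_atLeastAtMost') (auto intro: continuous_on_subset[OF cg])
    then show "integrable lborel ?h" by (simp add: set_integrable_def mult.commute)
  qed
  also have "\<dots> \<le> (\<integral>\<^sup>+t. ennreal (norm (g (X t))) \<partial>lborel)"
  proof (intro nn_integral_mono ennreal_leI)
    show "norm (?h t) \<le> norm (g (X t))" for t
      using component_le_norm_cart[of "g (X t)" j] by (auto simp: indicator_def)
  qed
  finally show ?thesis by (simp only: X_def)
qed

text \<open>With r = 1/(n-1) one has |f|^e = (|f|^r)^n, and each of the n factors is bounded by the
  line integral in its own direction. This is the case of \<open>grid_lines\<close> where the power
  of f itself has exponent 0.\<close>

lemma sobolev_L1:
  fixes f :: "real^'n \<Rightarrow> real"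
  assumes c: "C1c f g" and n: "2 \<le> CARD('n)"
  defines "e \<equiv> real CARD('n) / (real CARD('n) - 1)"
  shows "(\<integral>\<^sup>+x. ennreal (\<bar>f x\<bar> powr e) \<partial>lborel) \<le> epow (\<integral>\<^sup>+x. ennreal (norm (g x)) \<partial>lborel) e"
proof -
  let ?P = "Pi\<^sub>M UNIV (\<lambda>_::'n. lborel :: real measure)"
  let ?T = "\<lambda>y::'n \<Rightarrow> real. (\<chi> i. y i) :: real^'n"
  define r where "r = 1 / (real CARD('n) - 1)"
  have r: "r > 0" "(real CARD('n) - 1) * r = 1" "1 + r = e" "e = real CARD('n) * r"
    using n by (auto simp: r_def e_def field_simps)
  have [measurable]: "f \<in> borel_measurable borel" "g \<in> borel_measurable borel"
    using C1c_cont[OF c] borel_measurable_continuous_onI by auto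
  define H where "H y = ennreal (norm (g (?T y)))" for y
  have Hm: "H \<in> borel_measurable ?P"
    unfolding H_def[abs_def] using vec_lambda_measurable by measurable
  have "(\<integral>\<^sup>+x. ennreal (\<bar>f x\<bar> powr e) \<partial>lborel) = (\<integral>\<^sup>+y. ennreal (\<bar>f (?T y)\<bar> powr e) \<partial>?P)"
    by (subst lborel_eq_distr_PiM, subst nn_integral_distr[OF vec_lambda_measurable]) auto
  also have "\<dots> \<le> (\<integral>\<^sup>+y. epow (H y) (1 - (real (card (UNIV::'n set)) - 1) * r) * (\<Prod>i\<in>UNIV. epow (\<integral>\<^sup>+t. H (y(i := t)) \<partial>lborel) r) \<partial>?P)"
  proof (rule nn_integral_mono)
    fix y
    have "ennreal (\<bar>f (?T y)\<bar> powr e) = (\<Prod>i\<in>(UNIV::'n set). ennreal (\<bar>f (?T y)\<bar> powr r))"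
      unfolding r(4)
        by (simp add: ennreal_power powr_powr[symmetric] powr_realpow' mult.commute[of "real CARD('n)"])
    also have "\<dots> = (\<Prod>i\<in>(UNIV::'n set). epow (ennreal \<bar>f (?T y)\<bar>) r)"
      using r(1) by (simp add: epow_ennreal)
    also have "\<dots> \<le> (\<Prod>i\<in>UNIV. epow (\<integral>\<^sup>+t. H (y(i := t)) \<partial>lborel) r)"
      unfolding H_def using r(1) by (intro prod_mono_ennreal epow_mono line_bound[OF c]) auto
    finally show "ennreal (\<bar>f (?T y)\<bar> powr e) \<le> epow (H y) (1 - (real (card (UNIV::'n set)) - 1) * r) * (\<Prod>i\<in>UNIV. epow (\<integral>\<^sup>+t. H (y(i := t)) \<partial>lborel) r)"
      using r(2) by simp
  qed
  also have "\<dots> \<le> epow (\<integral>\<^sup>+y. H y \<partial>?P) (1 + r)"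
    using grid_lines[OF _ Hm, of r] r by simp
  also have "(\<integral>\<^sup>+y. H y \<partial>?P) = (\<integral>\<^sup>+x. ennreal (norm (g x)) \<partial>lborel)"
    unfolding H_def by (subst lborel_eq_distr_PiM, subst nn_integral_distr[OF vec_lambda_measurable]) auto
  finally show ?thesis unfolding r(3) .
qed

section \<open>From exponent 1 to exponent p in the Sobolev inequality\<close>

lemma abs_powr_has_derivative:
  assumes "\<gamma> > 1"
  shows "((\<lambda>s. \<bar>s\<bar> powr \<gamma>) has_real_derivative \<gamma> * (\<bar>s\<bar> powr (\<gamma> - 1) * sgn s)) (at s)"
proof -
  consider "s > 0" | "s < 0" | "s = 0" by linarith
  then show ?thesis
  proof cases
    case 1
    have ev: "\<forall>\<^sub>F t in nhds s. \<bar>t\<bar> powr \<gamma> = t powr \<gamma>"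
      using eventually_nhds_in_open[of "{0<..}" s] 1 by (auto elim!: eventually_mono)
    show ?thesis using 1 by (subst DERIV_cong_ev[OF refl ev refl]) (auto intro!: derivative_eq_intros)
  next
    case 2
    have ev: "\<forall>\<^sub>F t in nhds s. \<bar>t\<bar> powr \<gamma> = (- t) powr \<gamma>"
      using eventually_nhds_in_open[of "{..<0}" s] 2 by (auto elim!: eventually_mono)
    show ?thesis using 2 by (subst DERIV_cong_ev[OF refl ev refl]) (auto intro!: derivative_eq_intros)
  next
    case 3
    have "((\<lambda>h::real. \<bar>h\<bar> powr \<gamma> / h) \<longlongrightarrow> 0) (at 0)"
    proof (rule Lim_null_comparison)
      show "\<forall>\<^sub>F h::real in at 0. norm (\<bar>h\<bar> powr \<gamma> / h) \<le> \<bar>h\<bar> powr (\<gamma> - 1)"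
        unfolding eventually_at_filter by (intro always_eventually) (auto simp: powr_diff)
      show "((\<lambda>h::real. \<bar>h\<bar> powr (\<gamma> - 1)) \<longlongrightarrow> 0) (at 0)"
        by (rule tendsto_eq_rhs[OF tendsto_powr'[OF tendsto_rabs[OF tendsto_ident_at] tendsto_const]]) (use assms in auto)
    qed
    then show ?thesis using 3 by (simp add: DERIV_def)
  qed
qed

lemma abs_powr_derivative_continuous:
  assumes "\<gamma> > 1"
  shows "continuous_on UNIV (\<lambda>s::real. \<gamma> * (\<bar>s\<bar> powr (\<gamma> - 1) * sgn s))"
proof (rule continuous_on_mult_left, rule continuous_at_imp_continuous_on, rule ballI)
  fix s :: real
  show "isCont (\<lambda>s. \<bar>s\<bar> powr (\<gamma> - 1) * sgn s) s"
  proof (cases "s = 0")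
    case True
    have "((\<lambda>h::real. \<bar>h\<bar> powr (\<gamma> - 1) * sgn h) \<longlongrightarrow> 0) (at 0)"
    proof (rule Lim_null_comparison)
      show "\<forall>\<^sub>F h::real in at 0. norm (\<bar>h\<bar> powr (\<gamma> - 1) * sgn h) \<le> \<bar>h\<bar> powr (\<gamma> - 1)"
        by (intro always_eventually) (auto simp: abs_mult abs_sgn_eq)
      show "((\<lambda>h::real. \<bar>h\<bar> powr (\<gamma> - 1)) \<longlongrightarrow> 0) (at 0)"
        by (rule tendsto_eq_rhs[OF tendsto_powr'[OF tendsto_rabs[OF tendsto_ident_at] tendsto_const]]) (use assms in auto)
    qed
    then show ?thesis using True by (simp add: isCont_def)
  next
    case False
    then show ?thesis unfolding isCont_def by (intro tendsto_intros) auto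
  qed
qed

text \<open>The L^1 inequality is applied to |f|^\<gamma>, and Hoelder's inequality separates
  |f|^(\<gamma>-1) from the gradient.\<close>

lemma sobolev_C1c:
  fixes p :: real
  assumes p: "1 < p" "p < real CARD('n::finite)"
  defines "q \<equiv> crit_exp (real CARD('n)) p"
  obtains C where "C > 0"
    "\<And>f :: real^'n \<Rightarrow> real. \<And>g. C1c f g \<Longrightarrow> (LINT x|lborel. \<bar>f x\<bar> powr q) powr (p / q) \<le> C * (LINT x|lborel. norm (g x) powr p)"
proof -
  define n where "n = real CARD('n)"
  \<comment> \<open>Chosen so that \<gamma> e = q and (\<gamma> - 1) p/(p-1) = q: the same power of
    f then appears on both sides.\<close>
  define \<gamma> where "\<gamma> = p * (n - 1) / (n - p)"
  define e where "e = n / (n - 1)"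
  have np: "1 < n" "p < n" using p by (auto simp: n_def)
  have \<gamma>: "\<gamma> > 1" using np p by (simp add: \<gamma>_def less_divide_eq algebra_simps)
  have q: "q > 0" "\<gamma> * e = q" "q * (1 - 1/p) = \<gamma> - 1" "p / q = 1 - p / n" "e > 0"
    using np p
      by (auto simp: q_def crit_exp_def n_def[symmetric] \<gamma>_def e_def divide_simps) (simp_all add: algebra_simps)
  have n2: "2 \<le> CARD('n)" using np by (simp add: n_def)
  have "(LINT x|lborel. \<bar>f x\<bar> powr q) powr (p / q) \<le> \<gamma> powr p * (LINT x|lborel. norm (g x) powr p)"
    if c: "C1c f g" for f :: "real^'n \<Rightarrow> real" and g
  proof -
    obtain R where R: "\<And>x. norm x > R \<Longrightarrow> f x = 0 \<and> g x = 0" using c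
      by (auto simp: C1c_def)
    define x where "x = (LINT x|lborel. \<bar>f x\<bar> powr q)"
    define y where "y = (LINT x|lborel. norm (g x) powr p)"
    have x0: "0 \<le> x" "0 \<le> y" unfolding x_def y_def by (auto intro!: integral_nonneg_AE)
    have cf: "continuous_on UNIV f" "continuous_on UNIV g" using C1c_cont[OF c] by auto
    have [measurable]: "f \<in> borel_measurable borel" "g \<in> borel_measurable borel"
      using cf borel_measurable_continuous_onI by auto
    have ix: "integrable lborel (\<lambda>x. \<bar>f x\<bar> powr q)"
      using R q
        by (intro continuous_compact_support_integrable[of _ R] continuous_on_powr' continuous_intros cf) auto
    have iy: "integrable lborel (\<lambda>x. norm (g x) powr p)"
      using R p
        by (intro continuous_compact_support_integrable[of _ R] continuous_on_powr' continuous_intros cf) auto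
    have X: "(\<integral>\<^sup>+x. ennreal (\<bar>f x\<bar> powr q) \<partial>lborel) = ennreal x"
      unfolding x_def by (rule nn_integral_eq_integral[OF ix]) auto
    have Y: "(\<integral>\<^sup>+x. ennreal (norm (g x) powr p) \<partial>lborel) = ennreal y" unfolding y_def
      by (rule nn_integral_eq_integral[OF iy]) auto
    have cS: "C1c (\<lambda>x. \<bar>f x\<bar> powr \<gamma>) (\<lambda>x. (\<gamma> * (\<bar>f x\<bar> powr (\<gamma> - 1) * sgn (f x))) *\<^sub>R g x)"
      by (rule C1c_compose[OF c abs_powr_has_derivative[OF \<gamma>] abs_powr_derivative_continuous[OF \<gamma>]]) simp
    have "ennreal x = (\<integral>\<^sup>+x. ennreal (\<bar>\<bar>f x\<bar> powr \<gamma>\<bar> powr e) \<partial>lborel)"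
      using X q by (simp add: powr_powr)
    also have "\<dots> \<le> epow (\<integral>\<^sup>+x. ennreal (norm ((\<gamma> * (\<bar>f x\<bar> powr (\<gamma> - 1) * sgn (f x))) *\<^sub>R g x)) \<partial>lborel) e"
      using sobolev_L1[OF cS n2] by (simp add: e_def n_def)
    also have "\<dots> \<le> epow (ennreal (\<gamma> * (x powr (1 - 1/p) * y powr (1/p)))) e"
    proof (intro epow_mono)
      have "(\<integral>\<^sup>+x. ennreal (norm ((\<gamma> * (\<bar>f x\<bar> powr (\<gamma> - 1) * sgn (f x))) *\<^sub>R g x)) \<partial>lborel)
          \<le> (\<integral>\<^sup>+x. ennreal \<gamma> * (epow (ennreal (\<bar>f x\<bar> powr q)) (1 - 1/p) * epow (ennreal (norm (g x) powr p)) (1/p)) \<partial>lborel)"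
      proof (rule nn_integral_mono)
        fix x
        have "norm ((\<gamma> * (\<bar>f x\<bar> powr (\<gamma> - 1) * sgn (f x))) *\<^sub>R g x) \<le> \<gamma> * (\<bar>f x\<bar> powr (\<gamma> - 1) * norm (g x))"
          using \<gamma> by (auto simp: abs_mult abs_sgn_eq)
        then have "ennreal (norm ((\<gamma> * (\<bar>f x\<bar> powr (\<gamma> - 1) * sgn (f x))) *\<^sub>R g x)) \<le> ennreal (\<gamma> * (\<bar>f x\<bar> powr (\<gamma> - 1) * norm (g x)))"
          by (rule ennreal_leI)
        also have "\<dots> = ennreal \<gamma> * (epow (ennreal (\<bar>f x\<bar> powr q)) (1 - 1/p) * epow (ennreal (norm (g x) powr p)) (1/p))"
          using \<gamma> p q(3) by (simp add: epow_ennreal powr_powr ennreal_mult)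
        finally show "ennreal (norm ((\<gamma> * (\<bar>f x\<bar> powr (\<gamma> - 1) * sgn (f x))) *\<^sub>R g x))
          \<le> ennreal \<gamma> * (epow (ennreal (\<bar>f x\<bar> powr q)) (1 - 1/p) * epow (ennreal (norm (g x) powr p)) (1/p))" .
      qed
      also have "\<dots> = ennreal \<gamma> * (\<integral>\<^sup>+x. epow (ennreal (\<bar>f x\<bar> powr q)) (1 - 1/p) * epow (ennreal (norm (g x) powr p)) (1/p) \<partial>lborel)"
        by (rule nn_integral_cmult) measurable
      also have "(\<integral>\<^sup>+x. epow (ennreal (\<bar>f x\<bar> powr q)) (1 - 1/p) * epow (ennreal (norm (g x) powr p)) (1/p) \<partial>lborel)
          \<le> epow (ennreal x) (1 - 1/p) * epow (ennreal y) (1/p)"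
        using nn_integral_Holder_prod[of "{True, False}" "\<lambda>b. if b then 1 - 1/p else 1/p"
            "\<lambda>b x. if b then ennreal (\<bar>f x\<bar> powr q) else ennreal (norm (g x) powr p)" lborel] p X Y by simp
      also have "epow (ennreal x) (1 - 1/p) * epow (ennreal y) (1/p) = ennreal (x powr (1 - 1/p) * y powr (1/p))"
        using x0 p by (simp add: epow_ennreal ennreal_mult)
      also have "ennreal \<gamma> * \<dots> = ennreal (\<gamma> * (x powr (1 - 1/p) * y powr (1/p)))"
        using \<gamma> by (simp add: ennreal_mult)
      finally show "(\<integral>\<^sup>+x. ennreal (norm ((\<gamma> * (\<bar>f x\<bar> powr (\<gamma> - 1) * sgn (f x))) *\<^sub>R g x)) \<partial>lborel)
        \<le> ennreal (\<gamma> * (x powr (1 - 1/p) * y powr (1/p)))"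
        by (meson mult_left_mono order_trans zero_le)
    qed (use q in simp)
    also have "\<dots> = ennreal ((\<gamma> * (x powr (1 - 1/p) * y powr (1/p))) powr e)"
      using \<gamma> q by (intro epow_ennreal) auto
    finally have le: "x \<le> (\<gamma> * (x powr (1 - 1/p) * y powr (1/p))) powr e"
      by (simp add: ennreal_le_iff)
    show "x powr (p / q) \<le> \<gamma> powr p * y"
    proof (cases "x = 0")
      case False
      then have xp: "x > 0" using x0 by simp
      have "y \<noteq> 0" using le xp p q by (auto simp: not_le[symmetric])
      then have yp: "y > 0" using x0 by simp
      have "x powr (p / e) \<le> ((\<gamma> * (x powr (1 - 1/p) * y powr (1/p))) powr e) powr (p / e)"
        using le x0 p q by (intro powr_mono2) auto
      also have "\<dots> = (\<gamma> * (x powr (1 - 1/p) * y powr (1/p))) powr p" using q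
        by (simp add: powr_powr)
      also have "\<dots> = \<gamma> powr p * (x powr (p - 1) * y)"
        using \<gamma> xp yp p by (simp add: powr_mult powr_powr left_diff_distrib)
      \<comment> \<open>The power of the unknown integral on the right is divided out; the exponent
        p/e - (p-1) that remains is p/q.\<close>
      finally have "x powr (p / e) \<le> (\<gamma> powr p * y) * x powr (p - 1)" by (simp add: ac_simps)
      then have "x powr (p / e) / x powr (p - 1) \<le> \<gamma> powr p * y" using xp
        by (simp add: pos_divide_le_eq)
      also have "x powr (p / e) / x powr (p - 1) = x powr (p / q)"
      proof -
        have "p / e - (p - 1) = p / q" unfolding q(4) using np by (simp add: e_def field_simps)
        then show ?thesis by (simp add: powr_diff[symmetric])
      qed
      finally show ?thesis .
    qed (use x0 \<gamma> in auto)
  qed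
  then show ?thesis using that[of "\<gamma> powr p"] \<gamma> by auto
qed

section \<open>The Rellich compactness theorem\<close>

text \<open>The increment is the integral of the derivative along the segment from x to x + z; by
  Fubini and translation invariance every point of the segment contributes the same amount.\<close>

lemma C1c_translation_L1:
  fixes f :: "real^'n \<Rightarrow> real"
  assumes c: "C1c f g"
  shows "(\<integral>\<^sup>+x. ennreal \<bar>f (x + z) - f x\<bar> \<partial>lborel) \<le> ennreal (norm z * (LINT x|lborel. norm (g x)))"
proof -
  have cg: "continuous_on UNIV g" using C1c_cont[OF c] by simp
  have [measurable]: "f \<in> borel_measurable borel" "g \<in> borel_measurable borel"
    using C1c_cont[OF c] borel_measurable_continuous_onI by auto
  let ?h = "\<lambda>x t. ennreal (indicator {0..1} t * (norm (g (x + t *\<^sub>R z)) * norm z))"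
  have pt: "ennreal \<bar>f (x + z) - f x\<bar> \<le> (\<integral>\<^sup>+t. ?h x t \<partial>lborel)" for x
  proof -
    have xd: "((\<lambda>t. x + t *\<^sub>R z) has_derivative (\<lambda>h. h *\<^sub>R z)) (at t)" for t
      by (rule has_derivative_eq_rhs) (rule derivative_intros | simp)+
    have d: "((\<lambda>t. f (x + t *\<^sub>R z)) has_real_derivative g (x + t *\<^sub>R z) \<bullet> z) (at t)" for t
    proof -
      have "(f has_derivative (\<lambda>h. g (x + t *\<^sub>R z) \<bullet> h)) (at (x + t *\<^sub>R z))"
        using c by (simp add: C1c_def)
      from has_derivative_compose[OF xd this] show ?thesis
        unfolding has_field_derivative_def by (rule has_derivative_eq_rhs) (auto simp: mult.commute)
    qed
    have cg': "continuous_on UNIV (\<lambda>t. g (x + t *\<^sub>R z) \<bullet> z)"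
      by (intro continuous_intros continuous_on_compose2[OF cg]) auto
    let ?k = "\<lambda>t. (g (x + t *\<^sub>R z) \<bullet> z) * indicator {0..1} t"
    have "(LINT t|lborel. ?k t) = f (x + 1 *\<^sub>R z) - f (x + 0 *\<^sub>R z)"
      by (rule integral_FTC_Icc_real) (use d cg' in \<open>auto simp: continuous_on_eq_continuous_within\<close>)
    then have "ennreal \<bar>f (x + z) - f x\<bar> = ennreal (norm (LINT t|lborel. ?k t))" by simp
    also have "\<dots> \<le> (\<integral>\<^sup>+t. ennreal (norm (?k t)) \<partial>lborel)"
    proof (rule integral_norm_bound_ennreal)
      have "set_integrable lborel {0..1} (\<lambda>t. g (x + t *\<^sub>R z) \<bullet> z)"
        by (intro borel_integrable_atLeastAtMost') (auto intro: continuous_on_subset[OF cg'])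
      then show "integrable lborel ?k" by (simp add: set_integrable_def mult.commute)
    qed
    also have "\<dots> \<le> (\<integral>\<^sup>+t. ?h x t \<partial>lborel)"
      by (intro nn_integral_mono ennreal_leI) (auto simp: indicator_def Cauchy_Schwarz_ineq2)
    finally show ?thesis .
  qed
  have G: "(\<integral>\<^sup>+x. ennreal (norm (g x)) \<partial>lborel) = ennreal (LINT x|lborel. norm (g x))"
    using C1c_integrable[OF c] by (intro nn_integral_eq_integral) auto
  have sh: "(\<integral>\<^sup>+x. ennreal (norm (g (x + v))) \<partial>lborel) = ennreal (LINT x|lborel. norm (g x))" for v
  proof -
    have "(\<integral>\<^sup>+x. ennreal (norm (g (v + x))) \<partial>lborel) = (\<integral>\<^sup>+x. ennreal (norm (g x)) \<partial>distr lborel borel ((+) v))"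
      by (subst nn_integral_distr) auto
    then show ?thesis by (simp add: lborel_distr_plus G add.commute)
  qed
  have "(\<integral>\<^sup>+x. ennreal \<bar>f (x + z) - f x\<bar> \<partial>lborel) \<le> (\<integral>\<^sup>+x. (\<integral>\<^sup>+t. ?h x t \<partial>lborel) \<partial>lborel)"
    by (rule nn_integral_mono) (rule pt)
  also have "\<dots> = (\<integral>\<^sup>+t. (\<integral>\<^sup>+x. ?h x t \<partial>lborel) \<partial>lborel)"
    by (rule lborel_pair.Fubini'[symmetric]) measurable
  also have "\<dots> = (\<integral>\<^sup>+t. ennreal (norm z * (LINT x|lborel. norm (g x))) * indicator {0..1::real} t \<partial>lborel)"
  proof (rule nn_integral_cong)
    fix t :: real
    have "(\<integral>\<^sup>+x. ?h x t \<partial>lborel) = (\<integral>\<^sup>+x. ennreal (indicator {0..1} t * norm z) * ennreal (norm (g (x + t *\<^sub>R z))) \<partial>lborel)"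
      by (intro nn_integral_cong) (auto simp: ennreal_mult[symmetric] mult_ac)
    also have "\<dots> = ennreal (indicator {0..1} t * norm z) * ennreal (LINT x|lborel. norm (g x))"
      by (subst nn_integral_cmult) (auto simp: sh)
    also have "\<dots> = ennreal (norm z * (LINT x|lborel. norm (g x))) * indicator {0..1} t"
      by (auto simp: indicator_def ennreal_mult)
    finally show "(\<integral>\<^sup>+x. ?h x t \<partial>lborel) = ennreal (norm z * (LINT x|lborel. norm (g x))) * indicator {0..1} t" .
  qed
  also have "\<dots> = ennreal (norm z * (LINT x|lborel. norm (g x)))"
    by (subst nn_integral_cmult_indicator) auto
  finally show ?thesis .
qed

text \<open>The mean over a ball without division by its volume, which therefore appears as the
  factor \<open>V\<close> in the approximation estimate.\<close>

definition ball_int :: "real \<Rightarrow> (real^'n \<Rightarrow> real) \<Rightarrow> real^'n \<Rightarrow> real" where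
  "ball_int h f x = (LINT z|lborel. indicator (ball 0 h) z * f (x + z))"

lemma ball_int_integrable:
  fixes f :: "real^'n \<Rightarrow> real"
  assumes "integrable lborel f"
  shows "integrable lborel (\<lambda>z. indicator (ball 0 h) z * f (x + z))" "integrable lborel (\<lambda>z. f (x + z))"
proof -
  show i: "integrable lborel (\<lambda>z. f (x + z))"
    using assms lborel_integrable_translate[of f x] borel_measurable_integrable[OF assms] by simp
  show "integrable lborel (\<lambda>z. indicator (ball 0 h) z * f (x + z))"
    using integrable_mult_indicator[OF _ i, of "ball 0 h"] by simp
qed

lemma ball_int_bound:
  assumes "integrable lborel f"
  shows "\<bar>ball_int h f x\<bar> \<le> (LINT x|lborel. \<bar>f x\<bar>)"
proof -
  have m: "f \<in> borel_measurable borel" using borel_measurable_integrable[OF assms] by simp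
  have "\<bar>ball_int h f x\<bar> \<le> (LINT z|lborel. norm (indicator (ball 0 h) z * f (x + z)))"
    unfolding ball_int_def real_norm_def[symmetric] by (rule integral_norm_bound)
  also have "\<dots> \<le> (LINT z|lborel. \<bar>f (x + z)\<bar>)"
    using integrable_norm[OF ball_int_integrable(1)[OF assms]] integrable_norm[OF ball_int_integrable(2)[OF assms]]
    by (intro integral_mono) (auto simp: indicator_def)
  also have "\<dots> = (LINT x|lborel. \<bar>f x\<bar>)"
    using lborel_integral_translate[of "\<lambda>x. \<bar>f x\<bar>" x] m by simp
  finally show ?thesis .
qed

text \<open>The Lipschitz constant involves only the L^1 norm of the gradient, so gradients bounded
  in L^1 give equicontinuous ball integrals.\<close>

lemma ball_int_lipschitz:
  assumes c: "C1c f g"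
  shows "\<bar>ball_int h f x - ball_int h f y\<bar> \<le> norm (x - y) * (LINT x|lborel. norm (g x))"
proof -
  have fi: "integrable lborel f" using C1c_integrable[OF c] by simp
  have m[measurable]: "f \<in> borel_measurable borel" using borel_measurable_integrable[OF fi] by simp
  have "ball_int h f x - ball_int h f y = (LINT z|lborel. indicator (ball 0 h) z * f (x + z) - indicator (ball 0 h) z * f (y + z))"
    unfolding ball_int_def using ball_int_integrable(1)[OF fi] by simp
  then have "ennreal \<bar>ball_int h f x - ball_int h f y\<bar> \<le> (\<integral>\<^sup>+z. ennreal (norm (indicator (ball 0 h) z * f (x + z) - indicator (ball 0 h) z * f (y + z))) \<partial>lborel)"
    using integral_norm_bound_ennreal[of lborel "\<lambda>z. indicator (ball 0 h) z * f (x + z) - indicator (ball 0 h) z * f (y + z)"] ball_int_integrable(1)[OF fi] by simp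
  also have "\<dots> \<le> (\<integral>\<^sup>+z. ennreal \<bar>f ((y + z) + (x - y)) - f (y + z)\<bar> \<partial>lborel)"
    by (intro nn_integral_mono ennreal_leI) (auto simp: indicator_def algebra_simps)
  also have "\<dots> = (\<integral>\<^sup>+w. ennreal \<bar>f (w + (x - y)) - f w\<bar> \<partial>distr lborel borel ((+) y))"
    by (subst nn_integral_distr) auto
  also have "\<dots> \<le> ennreal (norm (x - y) * (LINT x|lborel. norm (g x)))"
    unfolding lborel_distr_plus by (rule C1c_translation_L1[OF c])
  finally show ?thesis
    by (subst (asm) ennreal_le_iff) (auto intro!: mult_nonneg_nonneg integral_nonneg_AE)
qed

lemma ball_int_continuous:
  assumes c: "C1c f g"
  shows "continuous_on UNIV (ball_int h f)"
proof -
  let ?L = "LINT x|lborel. norm (g x)"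
  have "?L-lipschitz_on UNIV (ball_int h f)"
    using ball_int_lipschitz[OF c, of h]
    by (intro lipschitz_onI) (auto simp: dist_norm mult.commute intro!: integral_nonneg_AE)
  then show ?thesis by (rule lipschitz_on_continuous_on)
qed

text \<open>Every translation by a vector shorter than h moves f in L^1 by at most h times the L^1
  norm of its gradient.\<close>

lemma ball_int_approx:
  fixes f :: "real^'n \<Rightarrow> real"
  assumes c: "C1c f g" and h: "h > 0"
  defines "V \<equiv> measure lborel (ball (0::real^'n) h)"
  shows "(\<integral>\<^sup>+x. ennreal \<bar>ball_int h f x - V * f x\<bar> \<partial>lborel) \<le> ennreal (V * h * (LINT x|lborel. norm (g x)))"
proof -
  have fi: "integrable lborel f" using C1c_integrable[OF c] by simp
  have m[measurable]: "f \<in> borel_measurable borel" using borel_measurable_integrable[OF fi] by simp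
  have Vf: "emeasure lborel (ball (0::real^'n) h) = ennreal V"
    unfolding V_def using emeasure_bounded_finite[OF bounded_ball]
      by (intro emeasure_eq_ennreal_measure) (auto simp: less_top)
  let ?G = "LINT x|lborel. norm (g x)"
  have G0: "0 \<le> ?G" by (auto intro!: integral_nonneg_AE)
  have [measurable]: "ball (0::real^'n) h \<in> sets borel" by simp
  let ?k = "\<lambda>x z. ennreal (indicator (ball 0 h) z * \<bar>f (x + z) - f x\<bar>)"
  have ib: "integrable lborel (\<lambda>z. indicator (ball (0::real^'n) h) z * a)" for a :: real
    by (intro integrable_mult_left integrable_real_indicator) (use Vf in auto)
  have pt: "ennreal \<bar>ball_int h f x - V * f x\<bar> \<le> (\<integral>\<^sup>+z. ?k x z \<partial>lborel)" for x
  proof -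
    have e: "ball_int h f x - V * f x = (LINT z|lborel. indicator (ball 0 h) z * f (x + z) - indicator (ball 0 h) z * f x)"
      unfolding ball_int_def V_def using ball_int_integrable(1)[OF fi] ib by simp
    have "ennreal (norm (LINT z|lborel. indicator (ball 0 h) z * f (x + z) - indicator (ball 0 h) z * f x)) \<le> (\<integral>\<^sup>+z. ennreal (norm (indicator (ball 0 h) z * f (x + z) - indicator (ball 0 h) z * f x)) \<partial>lborel)"
      using ball_int_integrable(1)[OF fi] ib by (intro integral_norm_bound_ennreal) auto
    also have "\<dots> = (\<integral>\<^sup>+z. ?k x z \<partial>lborel)"
      by (intro nn_integral_cong) (auto simp: indicator_def)
    finally show ?thesis unfolding e by simp
  qed
  have "(\<integral>\<^sup>+x. ennreal \<bar>ball_int h f x - V * f x\<bar> \<partial>lborel) \<le> (\<integral>\<^sup>+x. (\<integral>\<^sup>+z. ?k x z \<partial>lborel) \<partial>lborel)"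
    by (rule nn_integral_mono) (rule pt)
  also have "\<dots> = (\<integral>\<^sup>+z. (\<integral>\<^sup>+x. ?k x z \<partial>lborel) \<partial>lborel)"
    by (rule lborel_pair.Fubini'[symmetric]) measurable
  also have "\<dots> \<le> (\<integral>\<^sup>+z. ennreal (h * ?G) * indicator (ball (0::real^'n) h) z \<partial>lborel)"
  proof (rule nn_integral_mono)
    fix z :: "real^'n"
    show "(\<integral>\<^sup>+x. ?k x z \<partial>lborel) \<le> ennreal (h * ?G) * indicator (ball (0::real^'n) h) z"
    proof (cases "z \<in> ball 0 h")
      case True
      have "(\<integral>\<^sup>+x. ?k x z \<partial>lborel) \<le> ennreal (norm z * ?G)"
        using C1c_translation_L1[OF c, of z] True by simp
      also have "\<dots> \<le> ennreal (h * ?G)" using True G0 by (intro ennreal_leI mult_right_mono) auto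
      finally show ?thesis using True by simp
    qed simp
  qed
  also have "\<dots> = ennreal (V * h * ?G)"
    using G0 h by (subst nn_integral_cmult_indicator) (auto simp: Vf ennreal_mult[symmetric] V_def mult_ac)
  finally show ?thesis .
qed

text \<open>A diagonal argument over a countable dense set, all radii 1/(m+1) and all indices j at
  once; the common Lipschitz bound extends convergence to every point.\<close>

lemma ball_int_subsequence:
  fixes f :: "nat \<Rightarrow> 'd::finite \<Rightarrow> real^'n \<Rightarrow> real"
  assumes c: "\<And>k j. C1c (f k j) (g k j)"
    and B1: "\<And>k j. (LINT x|lborel. \<bar>f k j x\<bar>) \<le> B" and B2: "\<And>k j. (LINT x|lborel. norm (g k j x)) \<le> B"
  obtains r where "strict_mono (r::nat\<Rightarrow>nat)" "\<And>j m x. convergent (\<lambda>k. ball_int (inverse (real (Suc m))) (f (r k) j) x)"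
proof -
  obtain D :: "(real^'n) set" where D: "countable D" "\<And>X. open X \<Longrightarrow> X \<noteq> {} \<Longrightarrow> \<exists>d\<in>D. d \<in> X"
    using countable_dense_setE by blast
  let ?S = "(UNIV :: nat set) \<times> D \<times> (UNIV :: 'd set)"
  let ?F = "\<lambda>k (m, q, j). ball_int (inverse (real (Suc m))) (f k j) q"
  have cS: "countable ?S" using D(1) by (intro countable_SIGMA) auto
  have bS: "norm (?F k s) \<le> B" for k s
    using order_trans[OF ball_int_bound[OF C1c_integrable(1)[OF c]] B1] by (cases s) simp
  obtain r where r: "strict_mono (r::nat\<Rightarrow>nat)" "\<And>s. s \<in> ?S \<Longrightarrow> \<exists>l. (\<lambda>k. ?F (r k) s) \<longlonglongrightarrow> l"
    using function_convergent_subsequence[OF cS, of ?F B] bS by metis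
  have "convergent (\<lambda>k. ball_int (inverse (real (Suc m))) (f (r k) j) x)" for j m x
  proof -
    let ?a = "\<lambda>k x. ball_int (inverse (real (Suc m))) (f (r k) j) x"
    have "Cauchy (\<lambda>k. ?a k x)"
    proof (rule metric_CauchyI)
      fix e :: real assume e: "e > 0"
      have "0 \<le> (LINT x|lborel. \<bar>f 0 j x\<bar>)" by (rule integral_nonneg_AE) auto
      then have B0: "B \<ge> 0" using B1[of 0 j] by linarith
      define \<delta> where "\<delta> = e / (3 * (B + 1))"
      have \<delta>: "\<delta> > 0" "\<delta> * B \<le> e / 3" using e B0
        by (auto simp: \<delta>_def field_simps)
      have "\<exists>q\<in>D. q \<in> ball x \<delta>" by (rule D(2)) (use \<delta> in auto)
      then obtain q where q: "q \<in> D" "q \<in> ball x \<delta>" by blast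
      have lip: "\<bar>?a k x - ?a k q\<bar> \<le> e / 3" for k
      proof -
        have "\<bar>?a k x - ?a k q\<bar> \<le> norm (x - q) * (LINT x|lborel. norm (g (r k) j x))"
          by (rule ball_int_lipschitz[OF c])
        also have "\<dots> \<le> \<delta> * B" using q \<delta> B2
          by (intro mult_mono) (auto simp: dist_norm intro!: integral_nonneg_AE)
        finally show ?thesis using \<delta> by simp
      qed
      have "convergent (\<lambda>k. ?a k q)" using r(2)[of "(m, q, j)"] q by (auto simp: convergent_def)
      then have "Cauchy (\<lambda>k. ?a k q)" by (simp add: Cauchy_convergent_iff)
      then obtain N where N: "\<And>k l. k \<ge> N \<Longrightarrow> l \<ge> N \<Longrightarrow> dist (?a k q) (?a l q) < e / 3"
        using e unfolding Cauchy_def by (metis divide_pos_pos zero_less_numeral)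
      have "dist (?a k x) (?a l x) < e" if "k \<ge> N" "l \<ge> N" for k l
        using N[OF that] lip[of k] lip[of l] unfolding dist_real_def by linarith
      then show "\<exists>N. \<forall>k\<ge>N. \<forall>l\<ge>N. dist (?a k x) (?a l x) < e" by blast
    qed
    then show ?thesis by (simp add: Cauchy_convergent_iff)
  qed
  with r(1) show ?thesis by (rule that)
qed

text \<open>In L^1 each function is close to its ball mean, uniformly along the sequence, and on the
  bounded set \<Omega> the ball integrals converge boundedly, hence in L^1.\<close>

lemma C1c_L1_compact:
  fixes f :: "nat \<Rightarrow> 'd::finite \<Rightarrow> real^'n \<Rightarrow> real"
  assumes \<Omega>: "open \<Omega>" "bounded \<Omega>" and c: "\<And>k j. C1c (f k j) (g k j)" and z: "\<And>k j x. x \<notin> \<Omega> \<Longrightarrow> f k j x = 0"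
    and B1: "\<And>k j. (LINT x|lborel. \<bar>f k j x\<bar>) \<le> B" and B2: "\<And>k j. (LINT x|lborel. norm (g k j x)) \<le> B"
  obtains r where "strict_mono (r::nat\<Rightarrow>nat)"
    "\<And>j \<epsilon>. \<epsilon> > 0 \<Longrightarrow> \<exists>N. \<forall>k\<ge>N. \<forall>l\<ge>N. (LINT x|lborel. \<bar>f (r k) j x - f (r l) j x\<bar>) < \<epsilon>"
proof -
  have "0 \<le> (LINT x|lborel. \<bar>f 0 undefined x\<bar>)" by (rule integral_nonneg_AE) auto
  then have B0: "B \<ge> 0" using B1[of 0 undefined] by linarith
  obtain r where r: "strict_mono (r::nat\<Rightarrow>nat)" "\<And>j m x. convergent (\<lambda>k. ball_int (inverse (real (Suc m))) (f (r k) j) x)"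
    by (rule ball_int_subsequence[OF c B1 B2]) (rule that)
  have "\<exists>N. \<forall>k\<ge>N. \<forall>l\<ge>N. (LINT x|lborel. \<bar>f (r k) j x - f (r l) j x\<bar>) < \<epsilon>" if e: "\<epsilon> > 0" for j \<epsilon>
  proof -
    \<comment> \<open>The radius is fixed first, so that replacing either of the two functions by
      its ball mean costs at most \<epsilon>/4.\<close>
    obtain m where m: "inverse (real (Suc m)) < \<epsilon> / (4 * (B + 1))"
      using reals_Archimedean[of "\<epsilon> / (4 * (B + 1))"] e B0 by auto
    define h where "h = inverse (real (Suc m))"
    have h: "h > 0" "h * B \<le> \<epsilon> / 4"
    proof -
      have "h * (B + 1) < \<epsilon> / 4" using m B0 by (simp add: h_def pos_less_divide_eq field_simps)
      moreover have "h * B \<le> h * (B + 1)" by (intro mult_left_mono) (auto simp: h_def)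
      ultimately show "h * B \<le> \<epsilon> / 4" by linarith
    qed (simp add: h_def)
    define V where "V = measure lborel (ball (0::real^'n) h)"
    have V: "V > 0" unfolding V_def using h(1) by (simp add: content_ball_pos)
    let ?a = "\<lambda>k. ball_int h (f (r k) j)"
    have ca: "continuous_on UNIV (?a k)" for k by (rule ball_int_continuous[OF c])
    have am[measurable]: "?a k \<in> borel_measurable borel" for k using ca borel_measurable_continuous_onI
      by auto
    have [measurable]: "\<Omega> \<in> sets borel" using \<Omega> by auto
    have fi: "integrable lborel (f k j)" for k using C1c_integrable[OF c] by simp
    have fm[measurable]: "f k j \<in> borel_measurable borel" for k
      using borel_measurable_integrable[OF fi[of k]] by simp
    define L where "L x = lim (\<lambda>k. ?a k x)" for x
    have aL: "(\<lambda>k. ?a k x) \<longlonglongrightarrow> L x" for x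
      using r(2)[of m j x] by (simp add: L_def h_def convergent_LIMSEQ_iff)
    have Lm[measurable]: "L \<in> borel_measurable borel" by (rule borel_measurable_LIMSEQ_metric[OF am aL])
    have ab: "\<bar>?a k x\<bar> \<le> B" for k x using order_trans[OF ball_int_bound[OF fi] B1] .
    have Lb: "\<bar>L x\<bar> \<le> B" for x
      by (rule LIMSEQ_le_const2[OF tendsto_rabs[OF aL]]) (use ab in auto)
    have i\<Omega>: "integrable lborel (\<lambda>x. indicator \<Omega> x * a)" for a :: real
      using emeasure_bounded_finite[OF \<Omega>(2)]
        by (intro integrable_mult_left integrable_real_indicator) auto
    let ?d = "\<lambda>k x. indicator \<Omega> x * \<bar>?a k x - L x\<bar>"
    have db: "norm (?d k x) \<le> indicator \<Omega> x * (2 * B)" for k x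
      using ab[of k x] Lb[of x] by (auto simp: indicator_def)
    have di: "integrable lborel (?d k)" for k
      by (rule Bochner_Integration.integrable_bound[OF i\<Omega>[of "2 * B"]]) (use db B0 in \<open>auto intro!: AE_I2 simp: abs_mult\<close>)
    have "(\<lambda>k. LINT x|lborel. ?d k x) \<longlonglongrightarrow> (LINT x|lborel. indicator \<Omega> x * \<bar>L x - L x\<bar>)"
    proof (rule integral_dominated_convergence[OF _ _ i\<Omega>[of "2 * B"]])
      show "AE x in lborel. (\<lambda>k. ?d k x) \<longlonglongrightarrow> indicator \<Omega> x * \<bar>L x - L x\<bar>"
        by (intro AE_I2 tendsto_intros aL)
      show "AE x in lborel. norm (?d k x) \<le> indicator \<Omega> x * (2 * B)" for k using db
        by (intro AE_I2)
    qed auto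
    then have "(\<lambda>k. LINT x|lborel. ?d k x) \<longlonglongrightarrow> 0" by simp
    then have "\<forall>\<^sub>F k in sequentially. (LINT x|lborel. ?d k x) < V * \<epsilon> / 4"
      using V e by (intro order_tendstoD(2)[where y=0]) auto
    then obtain N where N: "\<And>k. k \<ge> N \<Longrightarrow> (LINT x|lborel. ?d k x) < V * \<epsilon> / 4"
      by (auto simp: eventually_sequentially)
    let ?w = "\<lambda>k x. \<bar>?a k x - V * f (r k) j x\<bar>"
    have wn: "(\<integral>\<^sup>+x. ennreal (?w k x) \<partial>lborel) \<le> ennreal (V * (\<epsilon> / 4))"
      for k
    proof -
      have "(\<integral>\<^sup>+x. ennreal (?w k x) \<partial>lborel) \<le> ennreal (V * h * (LINT x|lborel. norm (g (r k) j x)))"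
        unfolding V_def by (rule ball_int_approx[OF c h(1)])
      also have "\<dots> \<le> ennreal (V * (\<epsilon> / 4))"
      proof (rule ennreal_leI)
        have "h * (LINT x|lborel. norm (g (r k) j x)) \<le> h * B" using h(1) B2
          by (intro mult_left_mono) auto
        then have "h * (LINT x|lborel. norm (g (r k) j x)) \<le> \<epsilon> / 4" using h by linarith
        then show "V * h * (LINT x|lborel. norm (g (r k) j x)) \<le> V * (\<epsilon> / 4)"
          unfolding mult.assoc using V by (intro mult_left_mono) auto
      qed
      finally show ?thesis .
    qed
    have wi: "integrable lborel (?w k)" for k
      using wn[of k] by (intro integrableI_bounded) (auto simp: le_less_trans)
    have wl: "(LINT x|lborel. ?w k x) \<le> V * (\<epsilon> / 4)" for k
      by (rule integral_real_bounded) (use V e wn in auto)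
    have "(LINT x|lborel. \<bar>f (r k) j x - f (r l) j x\<bar>) < \<epsilon>" if kl: "k \<ge> N" "l \<ge> N"
      for k l
    proof -
      have fkl: "integrable lborel (\<lambda>x. V * \<bar>f (r k) j x - f (r l) j x\<bar>)"
        using fi by (intro integrable_mult_right integrable_abs Bochner_Integration.integrable_diff) auto
      have "V * (LINT x|lborel. \<bar>f (r k) j x - f (r l) j x\<bar>) = (LINT x|lborel. V * \<bar>f (r k) j x - f (r l) j x\<bar>)" by simp
      also have "\<dots> \<le> (LINT x|lborel. ?w k x + ?w l x + ?d k x + ?d l x)"
      proof (rule integral_mono[OF fkl])
        show "integrable lborel (\<lambda>x. ?w k x + ?w l x + ?d k x + ?d l x)"
          using wi di by (intro Bochner_Integration.integrable_add) auto
        fix x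
        have "V * \<bar>f (r k) j x - f (r l) j x\<bar> = \<bar>V * f (r k) j x - V * f (r l) j x\<bar>"
          using V by (simp add: abs_mult right_diff_distrib[symmetric])
        then show "V * \<bar>f (r k) j x - f (r l) j x\<bar> \<le> ?w k x + ?w l x + ?d k x + ?d l x"
          using z[of x] by (cases "x \<in> \<Omega>") auto
      qed
      also have "\<dots> = (LINT x|lborel. ?w k x) + (LINT x|lborel. ?w l x) + (LINT x|lborel. ?d k x) + (LINT x|lborel. ?d l x)"
        using wi di by (simp add: Bochner_Integration.integral_add)
      also have "\<dots> < V * \<epsilon>" using wl[of k] wl[of l] N[OF kl(1)] N[OF kl(2)] by simp
      finally show ?thesis using V by simp
    qed
    then show ?thesis by blast
  qed
  with r(1) show ?thesis by (rule that)
qed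

text \<open>Two cases, according to whether t^(q-p) reaches 1/\<epsilon>. Given a bound in L^q, the
  inequality upgrades L^1 convergence to L^p convergence.\<close>

lemma powr_interpolation:
  fixes t p q \<epsilon> :: real
  assumes "0 \<le> t" "1 \<le> p" "p < q" "0 < \<epsilon>"
  shows "t powr p \<le> \<epsilon> * t powr q + (1 / \<epsilon>) powr ((p - 1) / (q - p)) * t"
proof (cases "t = 0")
  case False
  then have t: "t > 0" using assms by simp
  show ?thesis
  proof (cases "1 / \<epsilon> \<le> t powr (q - p)")
    case True
    then have "1 \<le> \<epsilon> * t powr (q - p)" using assms by (simp add: field_simps)
    then have "t powr p * 1 \<le> t powr p * (\<epsilon> * t powr (q - p))" by (intro mult_left_mono) auto
    also have "\<dots> = \<epsilon> * t powr q" using t by (simp add: powr_diff)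
    finally show ?thesis using t by (simp add: add_increasing2)
  next
    case False
    then have "(t powr (q - p)) powr ((p - 1) / (q - p)) \<le> (1 / \<epsilon>) powr ((p - 1) / (q - p))"
      using assms by (intro powr_mono2) auto
    then have "t powr (p - 1) \<le> (1 / \<epsilon>) powr ((p - 1) / (q - p))" using assms
      by (simp add: powr_powr)
    then have "t powr (p - 1) * t \<le> (1 / \<epsilon>) powr ((p - 1) / (q - p)) * t" using t
      by (intro mult_right_mono) auto
    moreover have "t powr (p - 1) * t = t powr p" using t by (simp add: powr_diff)
    ultimately show ?thesis using assms by (simp add: add_increasing)
  qed
qed (use assms in simp)

section \<open>Integrals over \<Omega> as integrals over the whole space\<close>

lemma C1c_LP:
  assumes "open \<Omega>" "C1c f g" "\<And>x. x \<notin> \<Omega> \<Longrightarrow> f x = 0" "\<And>x. x \<notin> \<Omega> \<Longrightarrow> g x = 0" "0 < p"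
  shows "f \<in> LP (lebesgue_on \<Omega>) p" "g \<in> LP (lebesgue_on \<Omega>) p"
    "pint (lebesgue_on \<Omega>) p f = (LINT x|lborel. \<bar>f x\<bar> powr p)"
    "pint (lebesgue_on \<Omega>) p g = (LINT x|lborel. norm (g x) powr p)"
proof -
  note c = assms(2)
  obtain R where R: "\<And>x. norm x > R \<Longrightarrow> f x = 0 \<and> g x = 0" using c
    by (auto simp: C1c_def)
  have cont: "continuous_on UNIV (\<lambda>x. \<bar>f x\<bar> powr p)" "continuous_on UNIV (\<lambda>x. norm (g x) powr p)"
    using assms(5) by (intro continuous_on_powr' continuous_intros C1c_cont[OF c]; auto)+
  have i: "integrable lborel (\<lambda>x. \<bar>f x\<bar> powr p)" "integrable lborel (\<lambda>x. norm (g x) powr p)"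
    using R assms(5) by (auto intro!: continuous_compact_support_integrable[of _ R] cont)
  have m: "f \<in> borel_measurable borel" "g \<in> borel_measurable borel"
    using borel_measurable_continuous_onI[OF C1c_cont(1)[OF c]] borel_measurable_continuous_onI[OF C1c_cont(2)[OF c]] by auto
  have m\<Omega>: "f \<in> borel_measurable (lebesgue_on \<Omega>)" "g \<in> borel_measurable (lebesgue_on \<Omega>)"
    using m by (auto intro!: measurable_restrict_space1 measurable_completion)
  have e: "(LINT x|lebesgue_on \<Omega>. \<bar>f x\<bar> powr p) = (LINT x|lborel. \<bar>f x\<bar> powr p)"
    "integrable (lebesgue_on \<Omega>) (\<lambda>x. \<bar>f x\<bar> powr p)"
    using lebesgue_on_zero_outside[of "\<lambda>x. \<bar>f x\<bar> powr p" \<Omega>] assms(1,3) i(1) borel_measurable_continuous_onI[OF cont(1)] by auto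
  have e': "(LINT x|lebesgue_on \<Omega>. norm (g x) powr p) = (LINT x|lborel. norm (g x) powr p)"
    "integrable (lebesgue_on \<Omega>) (\<lambda>x. norm (g x) powr p)"
    using lebesgue_on_zero_outside[of "\<lambda>x. norm (g x) powr p" \<Omega>] assms(1,4) i(2) borel_measurable_continuous_onI[OF cont(2)] by auto
  show "f \<in> LP (lebesgue_on \<Omega>) p" "g \<in> LP (lebesgue_on \<Omega>) p"
    "pint (lebesgue_on \<Omega>) p f = (LINT x|lborel. \<bar>f x\<bar> powr p)"
    "pint (lebesgue_on \<Omega>) p g = (LINT x|lborel. norm (g x) powr p)"
    using e e' m\<Omega> by (auto simp: LP_def pint_def)
qed

lemma test_LP:
  assumes "open \<Omega>" "\<phi> \<in> test_functions \<Omega>" "0 < p"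
  shows "\<phi> \<in> LP (lebesgue_on \<Omega>) p" "grad \<phi> \<in> LP (lebesgue_on \<Omega>) p"
    "pint (lebesgue_on \<Omega>) p \<phi> = (LINT x|lborel. \<bar>\<phi> x\<bar> powr p)"
    "pint (lebesgue_on \<Omega>) p (grad \<phi>) = (LINT x|lborel. norm (grad \<phi> x) powr p)"
  using C1c_LP[OF assms(1) test_C1c[OF assms(2)] _ _ assms(3)] test_zero_outside[OF assms(2)] by blast+

lemma crit_exp_gt: "1 < p \<Longrightarrow> p < n \<Longrightarrow> p < crit_exp n p"
  by (simp add: crit_exp_def less_divide_eq algebra_simps mult_strict_left_mono)

text \<open>The Sobolev inequality bounds the sequence in L^q, L^1 compactness gives a Cauchy
  subsequence, and interpolation between the two gives L^p. One subsequence serves all components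
  j.\<close>

lemma rellich_test:
  fixes \<phi> :: "nat \<Rightarrow> 'd::finite \<Rightarrow> real^'n \<Rightarrow> real"
  assumes \<Omega>: "open \<Omega>" "bounded \<Omega>" and p: "1 < p" "p < real CARD('n)"
    and \<phi>: "\<And>k j. \<phi> k j \<in> test_functions \<Omega>"
    and B: "\<And>k j. pint (lebesgue_on \<Omega>) p (grad (\<phi> k j)) \<le> B"
  obtains r where "strict_mono (r::nat\<Rightarrow>nat)"
    "\<And>j \<epsilon>. \<epsilon> > 0 \<Longrightarrow> \<exists>N. \<forall>k\<ge>N. \<forall>l\<ge>N. pint (lebesgue_on \<Omega>) p (\<lambda>x. \<phi> (r k) j x - \<phi> (r l) j x) < \<epsilon>"
proof -
  let ?M = "lebesgue_on \<Omega>"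
  interpret finite_measure ?M using finite_measure_lebesgue_on_bounded[OF \<Omega>] .
  define q where "q = crit_exp (real CARD('n)) p"
  have q: "p < q" "1 < q" "0 < q" using crit_exp_gt[OF p] p by (auto simp: q_def)
  obtain C where C: "C > 0"
    "\<And>f :: real^'n \<Rightarrow> real. \<And>g. C1c f g \<Longrightarrow> (LINT x|lborel. \<bar>f x\<bar> powr q) powr (p / q) \<le> C * (LINT x|lborel. norm (g x) powr p)"
    using sobolev_C1c[OF p] unfolding q_def by metis
  note L = test_LP[OF \<Omega>(1) \<phi>]
  define K where "K = (C * B) powr (q / p)"
  have K: "pint ?M q (\<phi> k j) \<le> K" for k j
  proof -
    have "(pint ?M q (\<phi> k j)) powr (p / q) \<le> C * pint ?M p (grad (\<phi> k j))"
      using C(2)[OF test_C1c[OF \<phi>[of k j]]] L(3)[of q k j] L(4)[of p k j] q p by simp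
    also have "\<dots> \<le> C * B" using C(1) B by (intro mult_left_mono) auto
    finally have "((pint ?M q (\<phi> k j)) powr (p / q)) powr (q / p) \<le> K"
      unfolding K_def using p q by (intro powr_mono2) auto
    then show ?thesis using p q pint_nonneg[of ?M q "\<phi> k j"] by (simp add: powr_powr)
  qed
  have K0: "K \<ge> 0" by (simp add: K_def)
  define B' where "B' = measure ?M (space ?M) + \<bar>B\<bar> + K"
  have c: "C1c (\<phi> k j) (grad (\<phi> k j))" for k j using test_C1c[OF \<phi>] .
  have g1: "(LINT x|lborel. norm (grad (\<phi> k j) x)) \<le> B'" for k j
    using LP_L1_bound[OF L(2)[of p k j], of 1] B[of k j] p K0 L(4)[of 1 k j] by (simp add: B'_def pint_def)
  have f1: "(LINT x|lborel. \<bar>\<phi> k j x\<bar>) \<le> B'" for k j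
    using LP_L1_bound[OF L(1)[of q k j], of 1] K[of k j] q K0 L(3)[of 1 k j] by (simp add: B'_def pint_def)
  have z: "\<phi> k j x = 0" if "x \<notin> \<Omega>" for k j x by (rule test_zero_outside(1)[OF \<phi> that])
  obtain r where r: "strict_mono (r::nat\<Rightarrow>nat)"
    "\<And>j \<epsilon>. \<epsilon> > 0 \<Longrightarrow> \<exists>N. \<forall>k\<ge>N. \<forall>l\<ge>N. (LINT x|lborel. \<bar>\<phi> (r k) j x - \<phi> (r l) j x\<bar>) < \<epsilon>"
    by (rule C1c_L1_compact[OF \<Omega> c z f1 g1]) (assumption, rule that)
  have "\<exists>N. \<forall>k\<ge>N. \<forall>l\<ge>N. pint ?M p (\<lambda>x. \<phi> (r k) j x - \<phi> (r l) j x) < \<epsilon>" if e: "\<epsilon> > 0" for j \<epsilon>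
  proof -
    \<comment> \<open>Makes the interpolation term with the q-th power at most \<epsilon>/2; the
      added 1 keeps the denominator positive.\<close>
    define \<eta> where "\<eta> = \<epsilon> / (2 * (2 powr q * (K + K) + 1))"
    have den: "2 powr q * (K + K) + 1 > 0" using K0 by (intro add_nonneg_pos) auto
    have \<eta>: "\<eta> > 0" "\<eta> * (2 powr q * (K + K)) \<le> \<epsilon> / 2"
    proof -
      show "\<eta> > 0" using e den by (simp add: \<eta>_def)
      then have "\<eta> * (2 powr q * (K + K)) \<le> \<eta> * (2 powr q * (K + K) + 1)"
        by (intro mult_left_mono) auto
      also have "\<dots> = \<epsilon> / 2"
      proof -
        have "\<epsilon> / (2 * D) * D = \<epsilon> / 2" if "D > 0" for D :: real using that by simp
        from this[OF den] show ?thesis unfolding \<eta>_def .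
      qed
      finally show "\<eta> * (2 powr q * (K + K)) \<le> \<epsilon> / 2" .
    qed
    define c' where "c' = (1 / \<eta>) powr ((p - 1) / (q - p))"
    have c': "c' > 0" using \<eta> by (simp add: c'_def)
    obtain N where N: "\<forall>k\<ge>N. \<forall>l\<ge>N. (LINT x|lborel. \<bar>\<phi> (r k) j x - \<phi> (r l) j x\<bar>) < \<epsilon> / (2 * c')"
      using r(2)[of "\<epsilon> / (2 * c')" j] e c' by auto
    have "pint ?M p (\<lambda>x. \<phi> (r k) j x - \<phi> (r l) j x) < \<epsilon>"
      if kl: "k \<ge> N" "l \<ge> N" for k l
    proof -
      let ?w = "\<lambda>x. \<phi> (r k) j x - \<phi> (r l) j x"
      have wt: "?w \<in> test_functions \<Omega>"
        using test_add[OF \<phi>[of "r k" j] test_scale[OF \<phi>[of "r l" j], of "-1"]] by simp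
      have i1: "integrable ?M ?w" using LP_integrable[OF test_LP(1)[OF \<Omega>(1) wt, of p]] p by simp
      have iq: "integrable ?M (\<lambda>x. norm (?w x) powr q)" and ip: "integrable ?M (\<lambda>x. norm (?w x) powr p)"
        using LP_D(2)[OF test_LP(1)[OF \<Omega>(1) wt]] p q by auto
      have "pint ?M p ?w \<le> (LINT x|?M. \<eta> * norm (?w x) powr q + c' * norm (?w x))"
        unfolding pint_def
      proof (rule integral_mono[OF ip])
        show "integrable ?M (\<lambda>x. \<eta> * norm (?w x) powr q + c' * norm (?w x))" using i1 iq by auto
        show "norm (?w x) powr p \<le> \<eta> * norm (?w x) powr q + c' * norm (?w x)" for x
          unfolding c'_def by (rule powr_interpolation) (use p q \<eta> in auto)
      qed
      also have "\<dots> = \<eta> * pint ?M q ?w + c' * (LINT x|?M. norm (?w x))"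
        using iq i1 by (simp add: pint_def)
      also have "pint ?M q ?w \<le> 2 powr q * (pint ?M q (\<phi> (r k) j) + pint ?M q (\<phi> (r l) j))"
        using L(1) q by (intro pint_diff_le) auto
      also have "\<dots> \<le> 2 powr q * (K + K)" using K by (intro mult_left_mono add_mono) auto
      also have "\<eta> * (2 powr q * (K + K)) \<le> \<epsilon> / 2" by (rule \<eta>(2))
      also have "(LINT x|?M. norm (?w x)) = (LINT x|lborel. \<bar>?w x\<bar>)"
        using test_LP(3)[OF \<Omega>(1) wt, of 1] by (simp add: pint_def)
      also have "\<epsilon> / 2 + c' * (LINT x|lborel. \<bar>?w x\<bar>) < \<epsilon> / 2 + \<epsilon> / 2"
      proof -
        have "(LINT x|lborel. \<bar>?w x\<bar>) < \<epsilon> / (2 * c')" using N kl by blast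
        then have "c' * (LINT x|lborel. \<bar>?w x\<bar>) < c' * (\<epsilon> / (2 * c'))" using c'
          by (intro mult_strict_left_mono) auto
        then show ?thesis using c' by simp
      qed
      finally show ?thesis using \<eta>(1) c' by (simp add: mult_left_mono)
    qed
    then show ?thesis by blast
  qed
  with r(1) show ?thesis by (rule that)
qed

section \<open>Functions vanishing on the boundary\<close>

text \<open>Completeness of Lebesgue measure. A gradient picked by \<open>weak_grad\<close> is
  compared with a given one only almost everywhere, and this is how it becomes measurable on all of
  \<Omega>.\<close>

lemma borel_measurable_AE_lebesgue_on:
  fixes f :: "'a::euclidean_space \<Rightarrow> 'b::euclidean_space"
  assumes "f \<in> borel_measurable (lebesgue_on S)" "AE x in lebesgue_on S. f x = g x" "S \<in> sets lebesgue"
  shows "g \<in> borel_measurable (lebesgue_on S)"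
proof -
  have "(\<lambda>x. indicator S x *\<^sub>R f x) \<in> borel_measurable lebesgue"
    using assms by (simp add: borel_measurable_restrict_space_iff)
  moreover have "AE x in lebesgue. indicator S x *\<^sub>R f x = indicator S x *\<^sub>R g x"
    using assms(2,3) by (subst (asm) AE_restrict_space_iff) (auto simp: indicator_def elim: eventually_mono)
  ultimately have "(\<lambda>x. indicator S x *\<^sub>R g x) \<in> borel_measurable lebesgue"
    by (rule borel_measurable_AE)
  then show ?thesis using assms(3) by (simp add: borel_measurable_restrict_space_iff)
qed

lemma (in finite_measure) LP_exponent:
  fixes u :: "'a \<Rightarrow> 'b::{banach, second_countable_topology}"
  assumes "0 < p" "p < q" "u \<in> LP M q"
  shows "u \<in> LP M p" "pint M p u \<le> (measure M (space M)) powr (1 - p / q) * (pint M q u) powr (p / q)"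
proof -
  have [measurable]: "u \<in> borel_measurable M" using assms by (simp add: LP_def)
  have pq: "0 < p / q" "p / q < 1" using assms by auto
  have "(\<integral>\<^sup>+x. ennreal (norm (u x) powr p) \<partial>M) = (\<integral>\<^sup>+x. (\<Prod>b\<in>{True, False}. epow (if b then ennreal (norm (u x) powr q) else 1) (if b then p / q else 1 - p / q)) \<partial>M)"
    using assms pq epow_ennreal[of 1 "1 - p / q"]
      by (intro nn_integral_cong) (simp add: epow_ennreal powr_powr)
  also have "\<dots> \<le> (\<Prod>b\<in>{True, False}. epow (\<integral>\<^sup>+x. (if b then ennreal (norm (u x) powr q) else 1) \<partial>M) (if b then p / q else 1 - p / q))"
    using pq by (intro nn_integral_Holder_prod) auto
  also have "\<dots> = ennreal ((pint M q u) powr (p / q)) * ennreal ((measure M (space M)) powr (1 - p / q))"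
  proof -
    have "(\<integral>\<^sup>+x. ennreal (norm (u x) powr q) \<partial>M) = ennreal (pint M q u)"
      unfolding pint_def using LP_D(2)[OF assms(3)] by (intro nn_integral_eq_integral) auto
    moreover have "(\<integral>\<^sup>+x. 1 \<partial>M) = ennreal (measure M (space M))"
      by (simp add: emeasure_eq_measure)
    moreover have "p / q \<noteq> 0" "1 - p / q \<noteq> 0" using pq by auto
    ultimately show ?thesis using pint_nonneg[of M q u] by (simp add: epow_ennreal del: divide_eq_0_iff)
  qed
  also have "\<dots> = ennreal ((measure M (space M)) powr (1 - p / q) * (pint M q u) powr (p / q))"
    by (simp add: ennreal_mult mult.commute)
  finally have *: "(\<integral>\<^sup>+x. ennreal (norm (u x) powr p) \<partial>M) \<le> ennreal ((measure M (space M)) powr (1 - p / q) * (pint M q u) powr (p / q))" .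
  then show "u \<in> LP M p"
    unfolding LP_def by (auto intro!: integrableI_bounded simp: le_less_trans)
  show "pint M p u \<le> (measure M (space M)) powr (1 - p / q) * (pint M q u) powr (p / q)"
    using integral_real_bounded[OF _ *] by (simp add: pint_def[of M p u])
qed

lemma pint_tendsto_minus:
  assumes "(\<lambda>k. pint M p (\<lambda>x. u k x - v k x)) \<longlonglongrightarrow> 0"
  shows "(\<lambda>k. pint M p (\<lambda>x. v k x - u k x)) \<longlonglongrightarrow> 0"
proof -
  have "(\<lambda>k. pint M p (\<lambda>x. v k x - u k x)) = (\<lambda>k. pint M p (\<lambda>x. u k x - v k x))"
    by (rule ext) (rule pint_minus)
  with assms show ?thesis by simp
qed

lemma LIMSEQ_null_inverse_Suc:
  fixes a :: "nat \<Rightarrow> real"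
  assumes "\<And>k. 0 \<le> a k" "\<And>k. a k \<le> inverse (real (Suc k))"
  shows "a \<longlonglongrightarrow> 0"
  by (rule tendsto_sandwich[OF _ _ tendsto_const LIMSEQ_inverse_real_of_nat])
    (use assms in \<open>auto intro!: always_eventually simp del: of_nat_Suc\<close>)

text \<open>\<open>sob \<Omega> p u g\<close>: \<open>u\<close> belongs to the closure of the test functions in the Sobolev norm and
  \<open>g\<close>
    is its weak gradient. Carrying the gradient along avoids the choice in \<open>weak_grad\<close>.\<close>

definition sob :: "(real^'n) set \<Rightarrow> real \<Rightarrow> (real^'n \<Rightarrow> real) \<Rightarrow> (real^'n \<Rightarrow> real^'n) \<Rightarrow> bool" where
  "sob \<Omega> p u g \<longleftrightarrow> u \<in> LP (lebesgue_on \<Omega>) p \<and> g \<in> LP (lebesgue_on \<Omega>) p \<and>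
     (\<exists>\<phi>. (\<forall>k. \<phi> k \<in> test_functions \<Omega>) \<and>
       (\<lambda>k. pint (lebesgue_on \<Omega>) p (\<lambda>x. u x - \<phi> k x)) \<longlonglongrightarrow> 0 \<and>
       (\<lambda>k. pint (lebesgue_on \<Omega>) p (\<lambda>x. g x - grad (\<phi> k) x)) \<longlonglongrightarrow> 0)"

locale dirichlet_domain =
  fixes \<Omega> :: "(real^'n) set" and p q :: real
  assumes open_\<Omega>: "open \<Omega>" and bounded_\<Omega>: "bounded \<Omega>" and p_gt: "1 < p" and p_lt: "p < real CARD('n)"
    and q_def: "q = crit_exp (real CARD('n)) p"
begin

abbreviation "M \<equiv> lebesgue_on \<Omega>"

lemma p_pos: "0 < p" "0 \<le> p" "1 \<le> p"
  using p_gt by auto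

lemma pq: "p < q" "0 < q" "1 < q" "0 \<le> q"
  using crit_exp_gt[OF p_gt p_lt] p_gt by (auto simp: q_def)

sublocale finite_measure "lebesgue_on \<Omega>"
  by (rule finite_measure_lebesgue_on_bounded[OF open_\<Omega> bounded_\<Omega>])

lemma \<Omega>_sets: "\<Omega> \<in> sets lebesgue"
  using open_\<Omega> by auto

lemma sob_LP: "sob \<Omega> p u g \<Longrightarrow> u \<in> LP M p" "sob \<Omega> p u g \<Longrightarrow> g \<in> LP M p"
  by (auto simp: sob_def)

lemma sob_approx:
  assumes "sob \<Omega> p u g"
  obtains \<phi> where "\<And>k. \<phi> k \<in> test_functions \<Omega>" "(\<lambda>k. pint M p (\<lambda>x. u x - \<phi> k x)) \<longlonglongrightarrow> 0"
    "(\<lambda>k. pint M p (\<lambda>x. g x - grad (\<phi> k) x)) \<longlonglongrightarrow> 0"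
  using assms by (auto simp: sob_def)

lemma sob_test: "\<phi> \<in> test_functions \<Omega> \<Longrightarrow> sob \<Omega> p \<phi> (grad \<phi>)"
  using test_LP[OF open_\<Omega>, of \<phi> p] p_pos unfolding sob_def
  by (auto intro!: exI[of _ "\<lambda>k. \<phi>"] simp: pint_def)

lemma sob_add:
  assumes "sob \<Omega> p u g" "sob \<Omega> p v h"
  shows "sob \<Omega> p (\<lambda>x. u x + v x) (\<lambda>x. g x + h x)"
proof -
  obtain \<phi> where \<phi>: "\<And>k. \<phi> k \<in> test_functions \<Omega>" "(\<lambda>k. pint M p (\<lambda>x. u x - \<phi> k x)) \<longlonglongrightarrow> 0"
    "(\<lambda>k. pint M p (\<lambda>x. g x - grad (\<phi> k) x)) \<longlonglongrightarrow> 0"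
      by (rule sob_approx[OF assms(1)]) (rule that)
  obtain \<psi> where \<psi>: "\<And>k. \<psi> k \<in> test_functions \<Omega>" "(\<lambda>k. pint M p (\<lambda>x. v x - \<psi> k x)) \<longlonglongrightarrow> 0"
    "(\<lambda>k. pint M p (\<lambda>x. h x - grad (\<psi> k) x)) \<longlonglongrightarrow> 0"
      by (rule sob_approx[OF assms(2)]) (rule that)
  note L = sob_LP[OF assms(1)] sob_LP[OF assms(2)]
  note T = test_LP(1,2)[OF open_\<Omega> \<phi>(1) p_pos(1)] test_LP(1,2)[OF open_\<Omega> \<psi>(1) p_pos(1)]
  have "(\<lambda>k. pint M p (\<lambda>x. (u x - \<phi> k x) + (v x - \<psi> k x))) \<longlonglongrightarrow> 0"
    using L T p_pos by (intro pint_tendsto_triangle \<phi>(2) \<psi>(2) LP_diff)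
  moreover have "(\<lambda>k. pint M p (\<lambda>x. (g x - grad (\<phi> k) x) + (h x - grad (\<psi> k) x))) \<longlonglongrightarrow> 0"
    using L T p_pos by (intro pint_tendsto_triangle \<phi>(3) \<psi>(3) LP_diff)
  ultimately show ?thesis unfolding sob_def
    using LP_add[OF L(1) L(3)] LP_add[OF L(2) L(4)] p_pos test_add[OF \<phi>(1) \<psi>(1)]
    by (intro conjI exI[of _ "\<lambda>k x. \<phi> k x + \<psi> k x"]) (auto simp: grad_add[OF \<phi>(1) \<psi>(1)] algebra_simps)
qed

lemma sob_scale:
  assumes "sob \<Omega> p u g"
  shows "sob \<Omega> p (\<lambda>x. c * u x) (\<lambda>x. c *\<^sub>R g x)"
proof -
  obtain \<phi> where \<phi>: "\<And>k. \<phi> k \<in> test_functions \<Omega>" "(\<lambda>k. pint M p (\<lambda>x. u x - \<phi> k x)) \<longlonglongrightarrow> 0"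
    "(\<lambda>k. pint M p (\<lambda>x. g x - grad (\<phi> k) x)) \<longlonglongrightarrow> 0"
      by (rule sob_approx[OF assms(1)]) (rule that)
  have "(\<lambda>k. pint M p (\<lambda>x. c *\<^sub>R (u x - \<phi> k x))) \<longlonglongrightarrow> 0" "(\<lambda>k. pint M p (\<lambda>x. c *\<^sub>R (g x - grad (\<phi> k) x))) \<longlonglongrightarrow> 0"
    unfolding pint_scaleR
      using tendsto_mult[OF tendsto_const \<phi>(2), of "\<bar>c\<bar> powr p"] tendsto_mult[OF tendsto_const \<phi>(3), of "\<bar>c\<bar> powr p"] by auto
  then show ?thesis unfolding sob_def
    using LP_scaleR[OF sob_LP(1)[OF assms], of c] LP_scaleR[OF sob_LP(2)[OF assms], of c] test_scale[OF \<phi>(1)]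
    by (intro conjI exI[of _ "\<lambda>k x. c * \<phi> k x"]) (auto simp: grad_scale[OF \<phi>(1)] algebra_simps)
qed

lemma sob_diff:
  assumes "sob \<Omega> p u g" "sob \<Omega> p v h"
  shows "sob \<Omega> p (\<lambda>x. u x - v x) (\<lambda>x. g x - h x)"
  using sob_add[OF assms(1) sob_scale[OF assms(2), of "-1"]] by simp

lemma sob_close:
  assumes "sob \<Omega> p u g" "0 < \<epsilon>"
  shows "\<exists>\<phi>. \<phi> \<in> test_functions \<Omega> \<and> pint M p (\<lambda>x. u x - \<phi> x) < \<epsilon> \<and> pint M p (\<lambda>x. g x - grad \<phi> x) < \<epsilon>"
proof -
  obtain \<phi> where \<phi>: "\<And>i. \<phi> i \<in> test_functions \<Omega>" "(\<lambda>i. pint M p (\<lambda>x. u x - \<phi> i x)) \<longlonglongrightarrow> 0"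
    "(\<lambda>i. pint M p (\<lambda>x. g x - grad (\<phi> i) x)) \<longlonglongrightarrow> 0"
      by (rule sob_approx[OF assms(1)]) (rule that)
  have "\<forall>\<^sub>F i in sequentially. pint M p (\<lambda>x. u x - \<phi> i x) < \<epsilon> \<and> pint M p (\<lambda>x. g x - grad (\<phi> i) x) < \<epsilon>"
    using assms(2)
      by (intro eventually_conj order_tendstoD(2)[OF \<phi>(2)] order_tendstoD(2)[OF \<phi>(3)]) auto
  then show ?thesis using \<phi>(1) unfolding eventually_sequentially by blast
qed

text \<open>For each k a test function is chosen that is within 1/(k+1) of \<open>u k\<close>, and
  likewise for the gradients; these approximate the limit.\<close>

lemma sob_limit:
  assumes s: "\<And>k. sob \<Omega> p (u k) (g k)" and L: "v \<in> LP M p" "h \<in> LP M p"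
    and l: "(\<lambda>k. pint M p (\<lambda>x. u k x - v x)) \<longlonglongrightarrow> 0" "(\<lambda>k. pint M p (\<lambda>x. g k x - h x)) \<longlonglongrightarrow> 0"
  shows "sob \<Omega> p v h"
proof -
  have "\<forall>k. \<exists>\<phi>. \<phi> \<in> test_functions \<Omega> \<and> pint M p (\<lambda>x. u k x - \<phi> x) < inverse (real (Suc k)) \<and> pint M p (\<lambda>x. g k x - grad \<phi> x) < inverse (real (Suc k))"
    using sob_close[OF s] by (intro allI) simp
  from choice[OF this] obtain \<phi> where "\<forall>k. \<phi> k \<in> test_functions \<Omega> \<and> pint M p (\<lambda>x. u k x - \<phi> k x) < inverse (real (Suc k)) \<and> pint M p (\<lambda>x. g k x - grad (\<phi> k) x) < inverse (real (Suc k))"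
    by blast
  then have \<phi>: "\<And>k. \<phi> k \<in> test_functions \<Omega>" "\<And>k. pint M p (\<lambda>x. u k x - \<phi> k x) < inverse (real (Suc k))"
    "\<And>k. pint M p (\<lambda>x. g k x - grad (\<phi> k) x) < inverse (real (Suc k))" by blast+
  note T = test_LP(1,2)[OF open_\<Omega> \<phi>(1) p_pos(1)]
  have l1: "(\<lambda>k. pint M p (\<lambda>x. u k x - \<phi> k x)) \<longlonglongrightarrow> 0" "(\<lambda>k. pint M p (\<lambda>x. g k x - grad (\<phi> k) x)) \<longlonglongrightarrow> 0"
    using LIMSEQ_null_inverse_Suc[OF pint_nonneg less_imp_le[OF \<phi>(2)]] LIMSEQ_null_inverse_Suc[OF pint_nonneg less_imp_le[OF \<phi>(3)]] by auto
  have "(\<lambda>k. pint M p (\<lambda>x. (v x - u k x) + (u k x - \<phi> k x))) \<longlonglongrightarrow> 0"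
    by (rule pint_tendsto_triangle[OF LP_diff[OF L(1) sob_LP(1)[OF s] p_pos(2)] LP_diff[OF sob_LP(1)[OF s] T(1) p_pos(2)] p_pos(2) pint_tendsto_minus[OF l(1)] l1(1)])
  moreover have "(\<lambda>k. pint M p (\<lambda>x. (h x - g k x) + (g k x - grad (\<phi> k) x))) \<longlonglongrightarrow> 0"
    by (rule pint_tendsto_triangle[OF LP_diff[OF L(2) sob_LP(2)[OF s] p_pos(2)] LP_diff[OF sob_LP(2)[OF s] T(2) p_pos(2)] p_pos(2) pint_tendsto_minus[OF l(2)] l1(2)])
  ultimately show ?thesis unfolding sob_def using L \<phi>(1) by auto
qed

lemma sob_has_weak_gradient:
  assumes "sob \<Omega> p u g"
  shows "has_weak_gradient \<Omega> u g"
proof -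
  obtain \<phi> where \<phi>: "\<And>k. \<phi> k \<in> test_functions \<Omega>" "(\<lambda>k. pint M p (\<lambda>x. u x - \<phi> k x)) \<longlonglongrightarrow> 0"
    "(\<lambda>k. pint M p (\<lambda>x. g x - grad (\<phi> k) x)) \<longlonglongrightarrow> 0"
      by (rule sob_approx[OF assms(1)]) (rule that)
  note T = test_LP(1,2)[OF open_\<Omega> \<phi>(1) p_pos(1)]
  show ?thesis
    by (rule has_weak_gradient_limit[OF open_\<Omega> bounded_\<Omega> p_pos(3) test_has_weak_gradient[OF open_\<Omega> \<phi>(1)] T sob_LP[OF assms]
      pint_tendsto_minus[OF \<phi>(2)] pint_tendsto_minus[OF \<phi>(3)]])
qed

section \<open>Comparison of \<open>sob\<close> with \<open>W01p\<close> and the chosen weak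
  gradient\<close>

lemma Lp_eq_LP: "(Lp \<Omega> p :: (real^'n \<Rightarrow> 'b::{banach,second_countable_topology}) set) = LP M p"
  by (auto simp: Lp_def LP_def)

lemma Lp_norm_eq: "Lp_norm \<Omega> p u = pint M p u powr (1/p)"
  by (simp add: Lp_norm_def pint_def)

lemma weak_grad_AE:
  assumes "has_weak_gradient \<Omega> u g"
  shows "AE x in M. weak_grad \<Omega> u x = g x"
proof -
  have "has_weak_gradient \<Omega> u (weak_grad \<Omega> u)"
    using someI[of "has_weak_gradient \<Omega> u" g] assms by (simp add: weak_grad_def)
  then show ?thesis using weak_gradient_unique[OF open_\<Omega> _ assms] by blast
qed

lemma weak_grad_LP:
  assumes "has_weak_gradient \<Omega> u g" "g \<in> LP M p"
  shows "weak_grad \<Omega> u \<in> LP M p" "pint M p (weak_grad \<Omega> u) = pint M p g"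
proof -
  have ae: "AE x in M. g x = weak_grad \<Omega> u x" using weak_grad_AE[OF assms(1)]
    by (auto elim: eventually_mono)
  have m: "weak_grad \<Omega> u \<in> borel_measurable M"
    using borel_measurable_AE_lebesgue_on[OF LP_D(1)[OF assms(2)] ae \<Omega>_sets] .
  show "weak_grad \<Omega> u \<in> LP M p" using LP_cong_AE[OF assms(2) m ae] .
  show "pint M p (weak_grad \<Omega> u) = pint M p g" using pint_cong_AE[OF ae LP_D(1)[OF assms(2)] m] by simp
qed

lemma sob_W01p:
  assumes "sob \<Omega> p u g"
  shows "u \<in> W01p \<Omega> p"
proof -
  note w = sob_has_weak_gradient[OF assms]
  obtain \<phi> where \<phi>: "\<And>k. \<phi> k \<in> test_functions \<Omega>" "(\<lambda>k. pint M p (\<lambda>x. u x - \<phi> k x)) \<longlonglongrightarrow> 0"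
    "(\<lambda>k. pint M p (\<lambda>x. g x - grad (\<phi> k) x)) \<longlonglongrightarrow> 0"
      by (rule sob_approx[OF assms(1)]) (rule that)
  have "W1p_norm \<Omega> p (\<lambda>x. u x - \<phi> k x) = pint M p (\<lambda>x. u x - \<phi> k x) powr (1/p) + pint M p (\<lambda>x. g x - grad (\<phi> k) x) powr (1/p)" for k
    unfolding W1p_norm_def Lp_norm_eq
    using weak_grad_LP(2)[OF has_weak_gradient_diff[OF open_\<Omega> w test_has_weak_gradient[OF open_\<Omega> \<phi>(1)[of k]]]]
      LP_diff[OF sob_LP(2)[OF assms] test_LP(2)[OF open_\<Omega> \<phi>(1)[of k] p_pos(1)] p_pos(2)] by simp
  moreover have "(\<lambda>k. pint M p (\<lambda>x. u x - \<phi> k x) powr (1/p) + pint M p (\<lambda>x. g x - grad (\<phi> k) x) powr (1/p)) \<longlonglongrightarrow> 0 powr (1/p) + 0 powr (1/p)"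
    using p_pos by (intro tendsto_add tendsto_powr' \<phi>(2,3) tendsto_const) (auto simp: pint_nonneg)
  ultimately have lim: "(\<lambda>k. W1p_norm \<Omega> p (\<lambda>x. u x - \<phi> k x)) \<longlonglongrightarrow> 0" using p_pos by simp
  have "\<exists>\<psi>\<in>test_functions \<Omega>. W1p_norm \<Omega> p (\<lambda>x. u x - \<psi> x) < \<epsilon>" if "\<epsilon> > 0" for \<epsilon>
    using order_tendstoD(2)[OF lim that] \<phi>(1) by (auto simp: eventually_sequentially)
  then show ?thesis unfolding W01p_def W1p_def Lp_eq_LP using w sob_LP[OF assms] by auto
qed

lemma W01p_sob:
  assumes "u \<in> W01p \<Omega> p"
  shows "sob \<Omega> p u (weak_grad \<Omega> u)"
proof -
  obtain g where g: "u \<in> LP M p" "g \<in> LP M p" "has_weak_gradient \<Omega> u g"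
    using assms unfolding W01p_def W1p_def Lp_eq_LP by auto
  note G = weak_grad_LP[OF g(3,2)]
  have w: "has_weak_gradient \<Omega> u (weak_grad \<Omega> u)"
    using someI[of "has_weak_gradient \<Omega> u" g] g(3) by (simp add: weak_grad_def)
  have "\<forall>k. \<exists>\<phi>. \<phi> \<in> test_functions \<Omega> \<and> W1p_norm \<Omega> p (\<lambda>x. u x - \<phi> x) < inverse (real (Suc k))"
  proof
    fix k
    have "0 < inverse (real (Suc k))" by simp
    then show "\<exists>\<phi>. \<phi> \<in> test_functions \<Omega> \<and> W1p_norm \<Omega> p (\<lambda>x. u x - \<phi> x) < inverse (real (Suc k))"
      using assms unfolding W01p_def by blast
  qed
  from choice[OF this] obtain \<phi> where "\<forall>k. \<phi> k \<in> test_functions \<Omega> \<and> W1p_norm \<Omega> p (\<lambda>x. u x - \<phi> k x) < inverse (real (Suc k))"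
    by blast
  then have \<phi>: "\<And>k. \<phi> k \<in> test_functions \<Omega>" "\<And>k. W1p_norm \<Omega> p (\<lambda>x. u x - \<phi> k x) < inverse (real (Suc k))" by blast+
  \<comment> \<open>The chosen gradient of a difference is almost everywhere the difference of the
    gradients, so a small \<open>W1p_norm\<close> controls the approximation of the
    gradient.\<close>
  have eq: "pint M p (weak_grad \<Omega> (\<lambda>x. u x - \<phi> k x)) = pint M p (\<lambda>x. weak_grad \<Omega> u x - grad (\<phi> k) x)" for k
    using weak_grad_LP(2)[OF has_weak_gradient_diff[OF open_\<Omega> w test_has_weak_gradient[OF open_\<Omega> \<phi>(1)[of k]]]]
      LP_diff[OF G(1) test_LP(2)[OF open_\<Omega> \<phi>(1)[of k] p_pos(1)] p_pos(2)] by simp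
  have lim: "(\<lambda>k. a k) \<longlonglongrightarrow> 0"
    if "\<And>k. 0 \<le> a k" "\<And>k. a k powr (1/p) \<le> inverse (real (Suc k))" for a
  proof (rule tendsto_sandwich[OF _ _ tendsto_const])
    show "(\<lambda>k. inverse (real (Suc k)) powr p) \<longlonglongrightarrow> 0"
      using tendsto_powr'[OF LIMSEQ_inverse_real_of_nat tendsto_const[of p]] p_pos by simp
    have "a k \<le> inverse (real (Suc k)) powr p" for k
    proof -
      have "(a k powr (1/p)) powr p \<le> inverse (real (Suc k)) powr p" using that p_pos
        by (intro powr_mono2) auto
      then show ?thesis using that(1)[of k] p_pos by (simp add: powr_powr)
    qed
    then show "\<forall>\<^sub>F k in sequentially. a k \<le> inverse (real (Suc k)) powr p" by simp
  qed (use that in auto)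
  have b: "pint M p (\<lambda>x. u x - \<phi> k x) powr (1/p) \<le> inverse (real (Suc k))" "pint M p (\<lambda>x. weak_grad \<Omega> u x - grad (\<phi> k) x) powr (1/p) \<le> inverse (real (Suc k))" for k
    using \<phi>(2)[of k] unfolding W1p_norm_def Lp_norm_eq eq
    using powr_ge_zero[of "pint M p (\<lambda>x. u x - \<phi> k x)" "1/p"] powr_ge_zero[of "pint M p (\<lambda>x. weak_grad \<Omega> u x - grad (\<phi> k) x)" "1/p"]
    by linarith+
  show ?thesis unfolding sob_def
    using g(1) G(1) \<phi>(1) lim[OF pint_nonneg b(1)] lim[OF pint_nonneg b(2)] by blast
qed

text \<open>Composition with T makes the estimate charge the gradient only where T' is not small: T
  = id gives the usual inequality, a truncation gives the concentration estimate. It holds for test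
  functions composed with T; in the limit the gradients converge in L^p, and Fatou's lemma handles
  the other side.\<close>

lemma sobolev_sob:
  obtains C where "C > 0"
    "\<And>T T' u g. sob \<Omega> p u g \<Longrightarrow> (\<And>s. (T has_real_derivative T' s) (at s)) \<Longrightarrow> continuous_on UNIV T' \<Longrightarrow> (\<And>s. \<bar>T' s\<bar> \<le> 1) \<Longrightarrow> T 0 = 0
      \<Longrightarrow> (\<lambda>x. T (u x)) \<in> LP M q \<and> pint M q (\<lambda>x. T (u x)) powr (p / q) \<le> C * pint M p (\<lambda>x. T' (u x) *\<^sub>R g x)"
proof -
  obtain C0 where C0: "C0 > 0"
    "\<And>f :: real^'n \<Rightarrow> real. \<And>g. C1c f g \<Longrightarrow> (LINT x|lborel. \<bar>f x\<bar> powr q) powr (p / q) \<le> C0 * (LINT x|lborel. norm (g x) powr p)"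
    using sobolev_C1c[OF p_gt p_lt] unfolding q_def by metis
  \<comment> \<open>The factor \<open>2 powr p\<close> is lost to the triangle inequality for p-th
    powers when the gradients pass to the limit.\<close>
  define C where "C = C0 * 2 powr p"
  have C: "C > 0" using C0 by (simp add: C_def)
  have "(\<lambda>x. T (u x)) \<in> LP M q \<and> pint M q (\<lambda>x. T (u x)) powr (p / q) \<le> C * pint M p (\<lambda>x. T' (u x) *\<^sub>R g x)"
    if s: "sob \<Omega> p u g" and T: "\<And>s. (T has_real_derivative T' s) (at s)" "continuous_on UNIV T'" "\<And>s. \<bar>T' s\<bar> \<le> 1" "T 0 = 0" for T T' u g
  proof -
    note L = sob_LP[OF s]
    obtain \<phi> where \<phi>: "\<And>k. \<phi> k \<in> test_functions \<Omega>" "(\<lambda>k. pint M p (\<lambda>x. u x - \<phi> k x)) \<longlonglongrightarrow> 0"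
      "(\<lambda>k. pint M p (\<lambda>x. g x - grad (\<phi> k) x)) \<longlonglongrightarrow> 0"
        by (rule sob_approx[OF s]) (rule that)
    have d: "(\<lambda>x. \<phi> k x - u x) \<in> LP M p" for k
      by (rule LP_diff[OF test_LP(1)[OF open_\<Omega> \<phi>(1) p_pos(1)] L(1) p_pos(2)])
    obtain r where r: "strict_mono (r::nat\<Rightarrow>nat)" "AE x in M. (\<lambda>k. \<phi> (r k) x) \<longlonglongrightarrow> u x"
      by (rule pint_AE_subseq[OF d p_pos(1) pint_tendsto_minus[OF \<phi>(2)]]) (rule that)
    define \<psi> where "\<psi> k = \<phi> (r k)" for k
    have \<psi>: "\<psi> k \<in> test_functions \<Omega>" for k by (simp add: \<psi>_def \<phi>(1))
    have \<psi>u: "AE x in M. (\<lambda>k. \<psi> k x) \<longlonglongrightarrow> u x" using r(2)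
      by (simp add: \<psi>_def)
    have \<psi>g: "(\<lambda>k. pint M p (\<lambda>x. grad (\<psi> k) x - g x)) \<longlonglongrightarrow> 0"
      using LIMSEQ_subseq_LIMSEQ[OF pint_tendsto_minus[OF \<phi>(3)] r(1)] by (simp add: \<psi>_def o_def)
    note TL = test_LP(1,2)[OF open_\<Omega> \<psi> p_pos(1)]
    have [measurable]: "u \<in> borel_measurable M" "g \<in> borel_measurable M" "\<psi> k \<in> borel_measurable M" "grad (\<psi> k) \<in> borel_measurable M" for k
      using L TL by (auto simp: LP_def)
    have [measurable]: "T' \<in> borel_measurable borel" using T(2) by (rule borel_measurable_continuous_onI)
    have cT: "isCont T s" for s using T(1) DERIV_isCont by blast
    have [measurable]: "T \<in> borel_measurable borel"
      using cT by (intro borel_measurable_continuous_onI continuous_at_imp_continuous_on) auto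
    let ?A = "\<lambda>x. T' (u x) *\<^sub>R g x"
    let ?Ak = "\<lambda>k x. T' (\<psi> k x) *\<^sub>R grad (\<psi> k) x"
    have c: "C1c (\<lambda>x. T (\<psi> k x)) (?Ak k)" for k
      by (rule C1c_compose[OF test_C1c[OF \<psi>] T(1,2,4)])
    have z: "T (\<psi> k x) = 0" "?Ak k x = 0" if "x \<notin> \<Omega>" for k x
      using test_zero_outside[OF \<psi>[of k] that] T(4) by auto
    have TLP: "(\<lambda>x. T (\<psi> k x)) \<in> LP M q" for k
      by (rule C1c_LP(1)[OF open_\<Omega> c z pq(2)])
    have S: "pint M q (\<lambda>x. T (\<psi> k x)) powr (p / q) \<le> C0 * pint M p (?Ak k)" for k
      using C0(2)[OF c[of k]] C1c_LP(3)[OF open_\<Omega> c[of k] z pq(2)] C1c_LP(4)[OF open_\<Omega> c[of k] z p_pos(1)] by simp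
    have b: "norm (T' s *\<^sub>R y) \<le> norm y" for s and y :: "real^'n" using T(3)[of s]
      by (simp add: mult_left_le_one_le)
    have ALP: "?A \<in> LP M p" by (rule LP_dominated(1)[OF L(2)]) (use b p_pos in auto)
    have AkLP: "?Ak k \<in> LP M p" for k by (rule LP_dominated(1)[OF TL(2)]) (use b p_pos in auto)
    \<comment> \<open>The difference of the composed gradients is split: the first part is small
      because T' is bounded by 1, the second by dominated convergence along the almost everywhere
      convergent sequence.\<close>
    have "(\<lambda>k. pint M p (\<lambda>x. T' (\<psi> k x) *\<^sub>R (grad (\<psi> k) x - g x) + (T' (\<psi> k x) - T' (u x)) *\<^sub>R g x)) \<longlonglongrightarrow> 0"
    proof (rule pint_tendsto_triangle[OF _ _ p_pos(2)])
      have gl: "(\<lambda>x. grad (\<psi> k) x - g x) \<in> LP M p" for k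
        by (rule LP_diff[OF TL(2) L(2) p_pos(2)])
      show 1: "(\<lambda>x. T' (\<psi> k x) *\<^sub>R (grad (\<psi> k) x - g x)) \<in> LP M p" for k
        by (rule LP_dominated(1)[OF gl]) (use b p_pos in auto)
      have le: "pint M p (\<lambda>x. T' (\<psi> k x) *\<^sub>R (grad (\<psi> k) x - g x)) \<le> pint M p (\<lambda>x. grad (\<psi> k) x - g x)" for k
        by (rule LP_dominated(2)[OF gl]) (use b p_pos in auto)
      show "(\<lambda>k. pint M p (\<lambda>x. T' (\<psi> k x) *\<^sub>R (grad (\<psi> k) x - g x))) \<longlonglongrightarrow> 0"
        by (rule tendsto_sandwich[OF _ _ tendsto_const \<psi>g]) (use le pint_nonneg in \<open>auto intro!: always_eventually simp: pint_nonneg\<close>)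
      have b2: "norm ((T' s - T' t) *\<^sub>R y) \<le> norm (2 *\<^sub>R y)" for s t and y :: "real^'n"
        using T(3)[of s] T(3)[of t] by (auto intro!: mult_right_mono)
      show "(\<lambda>x. (T' (\<psi> k x) - T' (u x)) *\<^sub>R g x) \<in> LP M p" for k
        by (rule LP_dominated(1)[OF LP_scaleR[OF L(2), of 2]]) (use b2 p_pos in auto)
      have "(\<lambda>k. LINT x|M. norm ((T' (\<psi> k x) - T' (u x)) *\<^sub>R g x) powr p) \<longlonglongrightarrow> (LINT x|M. 0)"
      proof (rule integral_dominated_convergence[where w="\<lambda>x. norm (2 *\<^sub>R g x) powr p"])
        show "integrable M (\<lambda>x. norm (2 *\<^sub>R g x) powr p)"
          by (rule LP_D(2)[OF LP_scaleR[OF L(2)]])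
        show "AE x in M. (\<lambda>k. norm ((T' (\<psi> k x) - T' (u x)) *\<^sub>R g x) powr p) \<longlonglongrightarrow> 0"
          using \<psi>u
        proof eventually_elim
          case (elim x)
          have "(\<lambda>k. T' (\<psi> k x)) \<longlonglongrightarrow> T' (u x)"
            by (rule continuous_on_tendsto_compose[OF T(2) elim]) auto
          then have "(\<lambda>k. norm ((T' (\<psi> k x) - T' (u x)) *\<^sub>R g x) powr p) \<longlonglongrightarrow> norm ((T' (u x) - T' (u x)) *\<^sub>R g x) powr p"
            using p_pos by (intro tendsto_powr' tendsto_intros) auto
          then show ?case by simp
        qed
        show "AE x in M. norm (norm ((T' (\<psi> k x) - T' (u x)) *\<^sub>R g x) powr p) \<le> norm (2 *\<^sub>R g x) powr p" for k
          using b2 p_pos by (intro AE_I2) (auto intro!: powr_mono2)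
      qed auto
      then show "(\<lambda>k. pint M p (\<lambda>x. (T' (\<psi> k x) - T' (u x)) *\<^sub>R g x)) \<longlonglongrightarrow> 0" by (simp add: pint_def)
    qed
    moreover have "T' (\<psi> k x) *\<^sub>R (grad (\<psi> k) x - g x) + (T' (\<psi> k x) - T' (u x)) *\<^sub>R g x = ?Ak k x - ?A x" for k x
      by (simp add: algebra_simps)
    ultimately have lim: "(\<lambda>k. pint M p (\<lambda>x. ?Ak k x - ?A x)) \<longlonglongrightarrow> 0"
      by simp
    have TuAE: "AE x in M. (\<lambda>k. T (\<psi> k x)) \<longlonglongrightarrow> T (u x)"
      using \<psi>u by eventually_elim (rule isCont_tendsto_compose[OF cT])
    have key: "(\<lambda>x. T (u x)) \<in> LP M q" "pint M q (\<lambda>x. T (u x)) powr (p / q) \<le> C * (pint M p ?A + \<delta>)" if \<delta>: "\<delta> > 0" for \<delta>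
    proof -
      let ?B = "(C * (pint M p ?A + \<delta>)) powr (q / p)"
      have "\<forall>\<^sub>F k in sequentially. pint M p (\<lambda>x. ?Ak k x - ?A x) < \<delta>"
        using order_tendstoD(2)[OF lim \<delta>] .
      then have ev: "\<forall>\<^sub>F k in sequentially. pint M q (\<lambda>x. T (\<psi> k x)) \<le> ?B"
      proof eventually_elim
        case (elim k)
        have "pint M p (?Ak k) = pint M p (\<lambda>x. (?Ak k x - ?A x) + ?A x)" by simp
        also have "\<dots> \<le> 2 powr p * (pint M p (\<lambda>x. ?Ak k x - ?A x) + pint M p ?A)"
          by (rule pint_add_le[OF LP_diff[OF AkLP ALP p_pos(2)] ALP p_pos(2)])
        also have "\<dots> \<le> 2 powr p * (pint M p ?A + \<delta>)" using elim
          by (intro mult_left_mono) auto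
        finally have "C0 * pint M p (?Ak k) \<le> C * (pint M p ?A + \<delta>)"
          using C0(1) by (simp add: C_def mult.assoc)
        then have "pint M q (\<lambda>x. T (\<psi> k x)) powr (p / q) \<le> C * (pint M p ?A + \<delta>)"
          using S[of k] by linarith
        then have "(pint M q (\<lambda>x. T (\<psi> k x)) powr (p / q)) powr (q / p) \<le> ?B"
          using p_pos pq by (intro powr_mono2) auto
        then show ?case using p_pos pq pint_nonneg[of M q "\<lambda>x. T (\<psi> k x)"]
          by (simp add: powr_powr)
      qed
      have m: "(\<lambda>x. T (u x)) \<in> borel_measurable M" by measurable
      show "(\<lambda>x. T (u x)) \<in> LP M q" by (rule LP_Fatou(1)[OF TLP m pq(2) TuAE ev])
      have "pint M q (\<lambda>x. T (u x)) \<le> ?B" by (rule LP_Fatou(2)[OF TLP m pq(2) TuAE ev])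
      then have "pint M q (\<lambda>x. T (u x)) powr (p / q) \<le> ?B powr (p / q)" using p_pos pq pint_nonneg
        by (intro powr_mono2) auto
      also have "?B powr (p / q) = C * (pint M p ?A + \<delta>)"
        using p_pos pq C \<delta> pint_nonneg[of M p ?A] by (simp add: powr_powr)
      finally show "pint M q (\<lambda>x. T (u x)) powr (p / q) \<le> C * (pint M p ?A + \<delta>)" .
    qed
    have "pint M q (\<lambda>x. T (u x)) powr (p / q) \<le> C * pint M p ?A"
    proof (rule field_le_epsilon)
      fix e :: real assume "e > 0"
      then show "pint M q (\<lambda>x. T (u x)) powr (p / q) \<le> C * pint M p ?A + e"
        using key(2)[of "e / C"] C by (simp add: distrib_left)
    qed
    with key(1)[of 1] show ?thesis by simp
  qed
  with C show ?thesis by (rule that)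
qed

text \<open>Each function is replaced by a test function with error below 1/(k+1), which preserves
  the gradient bound up to a constant.\<close>

lemma rellich_sob:
  fixes u :: "nat \<Rightarrow> 'd::finite \<Rightarrow> real^'n \<Rightarrow> real"
  assumes s: "\<And>k j. sob \<Omega> p (u k j) (g k j)" and B: "\<And>k j. pint M p (g k j) \<le> B"
  obtains r v where "strict_mono (r::nat\<Rightarrow>nat)" "\<And>j. v j \<in> LP M p" "\<And>j. (\<lambda>k. pint M p (\<lambda>x. u (r k) j x - v j x)) \<longlonglongrightarrow> 0"
proof -
  have "\<forall>kj. \<exists>\<phi>. \<phi> \<in> test_functions \<Omega> \<and> pint M p (\<lambda>x. u (fst kj) (snd kj) x - \<phi> x) < inverse (real (Suc (fst kj))) \<and> pint M p (\<lambda>x. g (fst kj) (snd kj) x - grad \<phi> x) < inverse (real (Suc (fst kj)))"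
    using sob_close[OF s] by (intro allI) simp
  from choice[OF this] obtain \<Phi> where \<Phi>: "\<forall>kj. \<Phi> kj \<in> test_functions \<Omega> \<and> pint M p (\<lambda>x. u (fst kj) (snd kj) x - \<Phi> kj x) < inverse (real (Suc (fst kj))) \<and> pint M p (\<lambda>x. g (fst kj) (snd kj) x - grad (\<Phi> kj) x) < inverse (real (Suc (fst kj)))"
    by blast
  define \<phi> where "\<phi> k j = \<Phi> (k, j)" for k j
  have \<phi>: "\<phi> k j \<in> test_functions \<Omega>" "pint M p (\<lambda>x. u k j x - \<phi> k j x) < inverse (real (Suc k))" "pint M p (\<lambda>x. g k j x - grad (\<phi> k j) x) < inverse (real (Suc k))" for k j
    using spec[OF \<Phi>, of "(k, j)"] by (simp_all add: \<phi>_def)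
  note T = test_LP(1,2)[OF open_\<Omega> \<phi>(1) p_pos(1)]
  have bd: "pint M p (grad (\<phi> k j)) \<le> 2 powr p * (B + 1)" for k j
  proof -
    have "pint M p (\<lambda>x. g k j x - (g k j x - grad (\<phi> k j) x)) \<le> 2 powr p * (pint M p (g k j) + pint M p (\<lambda>x. g k j x - grad (\<phi> k j) x))"
      by (rule pint_diff_le[OF sob_LP(2)[OF s] LP_diff[OF sob_LP(2)[OF s] T(2) p_pos(2)] p_pos(2)])
    also have "\<dots> \<le> 2 powr p * (B + 1)"
    proof -
      have "inverse (real (Suc k)) \<le> 1" by (simp add: inverse_eq_divide)
      then show ?thesis using B[of k j] \<phi>(3)[of k j] by (intro mult_left_mono add_mono) auto
    qed
    finally show ?thesis by simp
  qed
  obtain r where r: "strict_mono (r::nat\<Rightarrow>nat)"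
    "\<And>j \<epsilon>. \<epsilon> > 0 \<Longrightarrow> \<exists>N. \<forall>k\<ge>N. \<forall>l\<ge>N. pint M p (\<lambda>x. \<phi> (r k) j x - \<phi> (r l) j x) < \<epsilon>"
    by (rule rellich_test[OF open_\<Omega> bounded_\<Omega> p_gt p_lt \<phi>(1) bd]) (rule that)
  have "\<forall>j. \<exists>v. v \<in> LP M p \<and> (\<lambda>k. pint M p (\<lambda>x. \<phi> (r k) j x - v x)) \<longlonglongrightarrow> 0"
  proof
    fix j
    obtain v where "v \<in> LP M p" "(\<lambda>k. pint M p (\<lambda>x. \<phi> (r k) j x - v x)) \<longlonglongrightarrow> 0"
      by (rule LP_complete[OF T(1) p_pos(1) r(2)[of _ j]]) (assumption, rule that)
    then show "\<exists>v. v \<in> LP M p \<and> (\<lambda>k. pint M p (\<lambda>x. \<phi> (r k) j x - v x)) \<longlonglongrightarrow> 0" by blast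
  qed
  from choice[OF this] obtain v where v: "\<And>j. v j \<in> LP M p" "\<And>j. (\<lambda>k. pint M p (\<lambda>x. \<phi> (r k) j x - v j x)) \<longlonglongrightarrow> 0" by blast
  have "(\<lambda>k. pint M p (\<lambda>x. u (r k) j x - v j x)) \<longlonglongrightarrow> 0" for j
  proof -
    have "(\<lambda>k. pint M p (\<lambda>x. u k j x - \<phi> k j x)) \<longlonglongrightarrow> 0"
      by (rule LIMSEQ_null_inverse_Suc[OF pint_nonneg less_imp_le[OF \<phi>(2)]])
    from LIMSEQ_subseq_LIMSEQ[OF this r(1)] have l: "(\<lambda>k. pint M p (\<lambda>x. u (r k) j x - \<phi> (r k) j x)) \<longlonglongrightarrow> 0" by (simp add: o_def)
    have "(\<lambda>k. pint M p (\<lambda>x. (u (r k) j x - \<phi> (r k) j x) + (\<phi> (r k) j x - v j x))) \<longlonglongrightarrow> 0"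
      by (rule pint_tendsto_triangle[OF LP_diff[OF sob_LP(1)[OF s] T(1) p_pos(2)] LP_diff[OF T(1) v(1) p_pos(2)] p_pos(2) l v(2)])
    then show ?thesis by simp
  qed
  with r(1) v(1) show ?thesis by (rule that)
qed

end

section \<open>The anisotropic energy\<close>

lemma norm_Pair_powr_le:
  fixes a b :: "'a::real_normed_vector"
  assumes "0 \<le> r"
  shows "norm (a, b) powr r \<le> 2 powr r * (norm a powr r + norm b powr r)"
proof -
  have "norm (a, b) powr r \<le> (norm a + norm b) powr r"
    using assms norm_Pair_le[of a b] by (intro powr_mono2) auto
  also have "\<dots> \<le> 2 powr r * (norm a powr r + norm b powr r)" using assms by (intro powr_add_le) auto
  finally show ?thesis .
qed

lemma homogeneous_bound:
  fixes \<Phi> :: "'a::metric_space \<Rightarrow> 'b::euclidean_space \<Rightarrow> real"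
  assumes K: "compact K" and c: "continuous_on (K \<times> UNIV) (\<lambda>(x, v). \<Phi> x v)" and r: "r > 0"
    and h: "\<And>x v \<rho>. x \<in> K \<Longrightarrow> \<rho> > 0 \<Longrightarrow> \<Phi> x (\<rho> *\<^sub>R v) = \<rho> powr r * \<Phi> x v"
  obtains C where "C > 0" "\<And>x v. x \<in> K \<Longrightarrow> \<bar>\<Phi> x v\<bar> \<le> C * norm v powr r"
proof -
  have c1: "continuous_on (K \<times> UNIV) (\<lambda>(x, v). \<bar>\<Phi> x v\<bar>)"
    using continuous_on_rabs[OF c] by (simp add: case_prod_beta)
  have c2: "continuous_on (K \<times> UNIV) (\<lambda>(x, v::'b). norm v powr r)"
    unfolding case_prod_beta using r by (intro continuous_on_powr' continuous_intros) auto
  obtain C where C: "C \<ge> 0" "\<And>x v. x \<in> K \<Longrightarrow> \<bar>\<Phi> x v\<bar> \<le> 1 * norm v powr r + C * norm v powr r"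
  proof (rule homogeneous_compact_bound[OF K c1 c2, of r 1])
    show "\<And>x v \<rho>. x \<in> K \<Longrightarrow> \<rho> > 0 \<Longrightarrow> \<bar>\<Phi> x (\<rho> *\<^sub>R v)\<bar> = \<rho> powr r * \<bar>\<Phi> x v\<bar>" by (simp add: h abs_mult)
  qed (use r in \<open>auto simp: powr_mult\<close>)
  then show ?thesis by (intro that[of "1 + C"]) (auto simp: distrib_right)
qed

text \<open>Compactness applied to the pair (a - b, b): the increment vanishes wherever the first
  entry does, so a small part of the whole pair and a multiple of the first entry control
  it.\<close>

lemma homogeneous_diff_bound:
  fixes \<Phi> :: "'a::metric_space \<Rightarrow> 'b::euclidean_space \<Rightarrow> real"
  assumes K: "compact K" and c: "continuous_on (K \<times> UNIV) (\<lambda>(x, v). \<Phi> x v)" and r: "r > 0" and \<epsilon>: "\<epsilon> > 0"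
    and h: "\<And>x v \<rho>. x \<in> K \<Longrightarrow> \<rho> > 0 \<Longrightarrow> \<Phi> x (\<rho> *\<^sub>R v) = \<rho> powr r * \<Phi> x v"
  obtains C where "C > 0" "\<And>x a b. x \<in> K \<Longrightarrow> \<bar>\<Phi> x a - \<Phi> x b\<bar> \<le> \<epsilon> * norm b powr r + C * norm (a - b) powr r"
proof -
  have c1: "continuous_on (K \<times> UNIV) (\<lambda>(x, v). \<bar>\<Phi> x (fst v + snd v) - \<Phi> x (snd v)\<bar>)"
    unfolding case_prod_beta
  proof (intro continuous_intros)
    show "continuous_on (K \<times> UNIV) (\<lambda>z. \<Phi> (fst z) (fst (snd z) + snd (snd z)))"
      using continuous_on_compose2[OF c, of "K \<times> UNIV" "\<lambda>z. (fst z, fst (snd z) + snd (snd z))"] by (force intro!: continuous_intros)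
    show "continuous_on (K \<times> UNIV) (\<lambda>z. \<Phi> (fst z) (snd (snd z)))"
      using continuous_on_compose2[OF c, of "K \<times> UNIV" "\<lambda>z. (fst z, snd (snd z))"]
        by (force intro!: continuous_intros)
  qed
  have c2: "continuous_on (K \<times> UNIV) (\<lambda>(x, v::'b \<times> 'b). norm (fst v) powr r)"
    unfolding case_prod_beta using r by (intro continuous_on_powr' continuous_intros) auto
  \<comment> \<open>Compensates the factor \<open>2 powr r\<close> that arises when the norm of the
    pair is split.\<close>
  define \<delta> where "\<delta> = \<epsilon> / 2 powr r"
  have \<delta>: "\<delta> > 0" "\<delta> * 2 powr r = \<epsilon>" using \<epsilon>
    by (auto simp: \<delta>_def)
  obtain C where C: "C \<ge> 0" "\<And>x v. x \<in> K \<Longrightarrow> \<bar>\<Phi> x (fst v + snd v) - \<Phi> x (snd v)\<bar> \<le> \<delta> * norm v powr r + C * norm (fst v) powr r"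
  proof (rule homogeneous_compact_bound[OF K c1 c2, of r \<delta>])
    fix x v and \<rho> :: real assume x: "x \<in> K" and \<rho>: "\<rho> > 0"
    have "\<bar>\<Phi> x (\<rho> *\<^sub>R (fst v + snd v)) - \<Phi> x (\<rho> *\<^sub>R snd v)\<bar> = \<rho> powr r * \<bar>\<Phi> x (fst v + snd v) - \<Phi> x (snd v)\<bar>"
      unfolding h[OF x \<rho>] by (simp add: right_diff_distrib[symmetric] abs_mult)
    then show "\<bar>\<Phi> x (fst (\<rho> *\<^sub>R v) + snd (\<rho> *\<^sub>R v)) - \<Phi> x (snd (\<rho> *\<^sub>R v))\<bar> = \<rho> powr r * \<bar>\<Phi> x (fst v + snd v) - \<Phi> x (snd v)\<bar>"
      by (simp add: scaleR_add_right)
  qed (use r \<delta> in \<open>auto simp: powr_mult\<close>)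
  show ?thesis
  proof (rule that[of "\<epsilon> + C"])
    fix x a b assume x: "x \<in> K"
    have "\<bar>\<Phi> x a - \<Phi> x b\<bar> \<le> \<delta> * norm (a - b, b) powr r + C * norm (a - b) powr r" using C(2)[OF x, of "(a - b, b)"] by simp
    also have "\<delta> * norm (a - b, b) powr r \<le> \<delta> * (2 powr r * (norm (a - b) powr r + norm b powr r))"
      using \<delta> r by (intro mult_left_mono norm_Pair_powr_le) auto
    also have "\<delta> * (2 powr r * (norm (a - b) powr r + norm b powr r)) = \<epsilon> * (norm (a - b) powr r + norm b powr r)"
      using \<delta>(2) by (simp add: mult.assoc[symmetric])
    finally show "\<bar>\<Phi> x a - \<Phi> x b\<bar> \<le> \<epsilon> * norm b powr r + (\<epsilon> + C) * norm (a - b) powr r" by (simp add: algebra_simps)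
  qed (use \<epsilon> C in auto)
qed

lemma homogeneous_integrable:
  fixes \<Phi> :: "'a::metric_space \<Rightarrow> 'b::euclidean_space \<Rightarrow> real"
  assumes K: "compact K" and c: "continuous_on (K \<times> UNIV) (\<lambda>(x, v). \<Phi> x v)" and r: "r > 0"
    and h: "\<And>x v \<rho>. x \<in> K \<Longrightarrow> \<rho> > 0 \<Longrightarrow> \<Phi> x (\<rho> *\<^sub>R v) = \<rho> powr r * \<Phi> x v"
    and sp: "space M \<subseteq> K" and m: "(\<lambda>x. \<Phi> x (a x)) \<in> borel_measurable M" and a: "a \<in> LP M r"
  shows "integrable M (\<lambda>x. \<Phi> x (a x))"
proof -
  obtain C where C: "C > 0" "\<And>x v. x \<in> K \<Longrightarrow> \<bar>\<Phi> x v\<bar> \<le> C * norm v powr r"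
    by (rule homogeneous_bound[OF K c r h]) (assumption+, rule that)
  show ?thesis
    by (rule Bochner_Integration.integrable_bound[OF integrable_mult_right[OF LP_D(2)[OF a], of C] m])
      (use C sp in \<open>auto intro!: AE_I2\<close>)
qed

text \<open>Continuity in L^r, read off from the increment bound by taking first \<epsilon> small
  and then k large.\<close>

lemma homogeneous_integral_tendsto:
  fixes \<Phi> :: "'a::metric_space \<Rightarrow> 'b::euclidean_space \<Rightarrow> real"
  assumes K: "compact K" and c: "continuous_on (K \<times> UNIV) (\<lambda>(x, v). \<Phi> x v)" and r: "r > 0"
    and h: "\<And>x v \<rho>. x \<in> K \<Longrightarrow> \<rho> > 0 \<Longrightarrow> \<Phi> x (\<rho> *\<^sub>R v) = \<rho> powr r * \<Phi> x v"
    and sp: "space M \<subseteq> K" and m: "\<And>a. a \<in> borel_measurable M \<Longrightarrow> (\<lambda>x. \<Phi> x (a x)) \<in> borel_measurable M"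
    and a: "\<And>k. a k \<in> LP M r" "b \<in> LP M r" and lim: "(\<lambda>k. pint M r (\<lambda>x. a k x - b x)) \<longlonglongrightarrow> 0"
  shows "(\<lambda>k. LINT x|M. \<Phi> x (a k x)) \<longlonglongrightarrow> (LINT x|M. \<Phi> x (b x))"
proof (rule LIMSEQ_I)
  fix e :: real assume e: "e > 0"
  define \<epsilon> where "\<epsilon> = e / (2 * (pint M r b + 1))"
  have P: "pint M r b + 1 > 0" using pint_nonneg[of M r b] by simp
  have \<epsilon>: "\<epsilon> > 0" using e P by (simp add: \<epsilon>_def)
  have \<epsilon>': "\<epsilon> * pint M r b < e / 2"
  proof -
    have "\<epsilon> * pint M r b < \<epsilon> * (pint M r b + 1)" using \<epsilon> by simp
    also have "\<dots> = e / 2"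
    proof -
      have "e / (2 * D) * D = e / 2" if "D > 0" for D :: real using that by simp
      from this[OF P] show ?thesis unfolding \<epsilon>_def .
    qed
    finally show ?thesis .
  qed
  obtain C where C: "C > 0" "\<And>x a b. x \<in> K \<Longrightarrow> \<bar>\<Phi> x a - \<Phi> x b\<bar> \<le> \<epsilon> * norm b powr r + C * norm (a - b) powr r"
    by (rule homogeneous_diff_bound[OF K c r \<epsilon> h]) (assumption+, rule that)
  have i: "integrable M (\<lambda>x. \<Phi> x (w x))" if "w \<in> LP M r" for w
    by (rule homogeneous_integrable[OF K c r h sp m[OF LP_D(1)[OF that]] that])
  have d: "(\<lambda>x. a k x - b x) \<in> LP M r" for k using LP_diff[OF a(1) a(2)] r by simp
  have est: "\<bar>(LINT x|M. \<Phi> x (a k x)) - (LINT x|M. \<Phi> x (b x))\<bar> \<le> \<epsilon> * pint M r b + C * pint M r (\<lambda>x. a k x - b x)" for k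
  proof -
    have "\<bar>(LINT x|M. \<Phi> x (a k x)) - (LINT x|M. \<Phi> x (b x))\<bar> = norm (LINT x|M. \<Phi> x (a k x) - \<Phi> x (b x))"
      using i[OF a(1)[of k]] i[OF a(2)] by simp
    also have "\<dots> \<le> (LINT x|M. norm (\<Phi> x (a k x) - \<Phi> x (b x)))"
      by (rule integral_norm_bound)
    also have "\<dots> \<le> (LINT x|M. \<epsilon> * norm (b x) powr r + C * norm (a k x - b x) powr r)"
      using i[OF a(1)[of k]] i[OF a(2)] LP_D(2)[OF a(2)] LP_D(2)[OF d[of k]] C sp
        by (intro integral_mono) auto
    also have "\<dots> = \<epsilon> * pint M r b + C * pint M r (\<lambda>x. a k x - b x)"
      using LP_D(2)[OF a(2)] LP_D(2)[OF d[of k]] by (simp add: pint_def)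
    finally show ?thesis .
  qed
  have "(\<lambda>k. C * pint M r (\<lambda>x. a k x - b x)) \<longlonglongrightarrow> 0"
    using tendsto_mult[OF tendsto_const lim, of C] by simp
  then have "\<forall>\<^sub>F k in sequentially. C * pint M r (\<lambda>x. a k x - b x) < e / 2" using e
    by (intro order_tendstoD(2)) auto
  then obtain N where N: "\<And>k. k \<ge> N \<Longrightarrow> C * pint M r (\<lambda>x. a k x - b x) < e / 2"
    by (auto simp: eventually_sequentially)
  have "norm ((LINT x|M. \<Phi> x (a k x)) - (LINT x|M. \<Phi> x (b x))) < e" if "k \<ge> N" for k
    using est[of k] N[OF that] \<epsilon>' unfolding real_norm_def by linarith
  then show "\<exists>N. \<forall>k\<ge>N. norm ((LINT x|M. \<Phi> x (a k x)) - (LINT x|M. \<Phi> x (b x))) < e" by blast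
qed

text \<open>Differentiation under the integral sign along t = 1/(k+1): the mean value theorem bounds
  the quotients by \<open>w\<close>. A one-sided sequence is enough for first variations, because a
  direction and its negative can both be tested.\<close>

lemma integral_quotient_limit:
  fixes f :: "'a \<Rightarrow> real \<Rightarrow> real"
  assumes d: "\<And>x t. x \<in> space M \<Longrightarrow> (f x has_real_derivative D x t) (at t)"
    and b: "\<And>x t. x \<in> space M \<Longrightarrow> 0 \<le> t \<Longrightarrow> t \<le> 1 \<Longrightarrow> \<bar>D x t\<bar> \<le> w x" and w: "integrable M w"
    and i: "\<And>t. integrable M (\<lambda>x. f x t)"
  shows "integrable M (\<lambda>x. D x 0)"
    "(\<lambda>k. ((LINT x|M. f x (inverse (real (Suc k)))) - (LINT x|M. f x 0)) / inverse (real (Suc k))) \<longlonglongrightarrow> (LINT x|M. D x 0)"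
proof -
  define t where "t k = inverse (real (Suc k))" for k
  have t: "0 < t k" "t k \<le> 1" for k by (auto simp: t_def inverse_eq_divide)
  have t0: "t \<longlonglongrightarrow> 0" unfolding t_def by (rule LIMSEQ_inverse_real_of_nat)
  have tat: "filterlim t (at 0) sequentially" using t0 t(1)
    by (auto simp: filterlim_at less_imp_neq[THEN not_sym])
  define Q where "Q k x = (f x (t k) - f x 0) / t k" for k x
  have Qlim: "(\<lambda>k. Q k x) \<longlonglongrightarrow> D x 0" if "x \<in> space M" for x
  proof -
    have "((\<lambda>h. (f x (0 + h) - f x 0) / h) \<longlongrightarrow> D x 0) (at 0)" using d[OF that, of 0]
      by (simp add: DERIV_def)
    from filterlim_compose[OF this tat] show ?thesis by (simp add: Q_def)
  qed
  have Qb: "norm (Q k x) \<le> w x" if x: "x \<in> space M" for k x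
  proof -
    obtain z where z: "0 < z" "z < t k" "f x (t k) - f x 0 = (t k - 0) * D x z"
      using MVT2[of 0 "t k" "f x" "D x"] d[OF x] t by blast
    then have "Q k x = D x z" using t[of k] by (simp add: Q_def)
    then show ?thesis using b[OF x, of z] z t[of k] by simp
  qed
  have Qm: "Q k \<in> borel_measurable M" for k unfolding Q_def[abs_def] using i[of "t k"] i[of 0]
    by measurable
  have Dm: "(\<lambda>x. D x 0) \<in> borel_measurable M" using Qlim
    by (intro borel_measurable_LIMSEQ_metric[of Q M "\<lambda>x. D x 0"] Qm) auto
  show "integrable M (\<lambda>x. D x 0)"
    by (rule Bochner_Integration.integrable_bound[OF w Dm]) (use b in \<open>force intro!: AE_I2\<close>)
  have "(\<lambda>k. LINT x|M. Q k x) \<longlonglongrightarrow> (LINT x|M. D x 0)"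
    by (rule integral_dominated_convergence[OF Dm Qm w]) (use Qlim Qb in \<open>auto intro!: AE_I2\<close>)
  moreover have "(LINT x|M. Q k x) = ((LINT x|M. f x (t k)) - (LINT x|M. f x 0)) / t k" for k
    unfolding Q_def using i by simp
  ultimately show "(\<lambda>k. ((LINT x|M. f x (inverse (real (Suc k)))) - (LINT x|M. f x 0)) / inverse (real (Suc k))) \<longlonglongrightarrow> (LINT x|M. D x 0)"
    by (simp add: t_def)
qed

lemma powr_midpoint_strict:
  fixes a b r :: real
  assumes "0 \<le> a" "a < b" "1 < r"
  shows "((a + b) / 2) powr r < (a powr r + b powr r) / 2"
proof -
  let ?m = "(a + b) / 2"
  have d: "((\<lambda>s. \<bar>s\<bar> powr r) has_real_derivative r * (\<bar>s\<bar> powr (r - 1) * sgn s)) (at s)" for s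
    by (rule abs_powr_has_derivative[OF assms(3)])
  have am: "a < ?m" "?m < b" using assms by auto
  obtain y where y: "a < y" "y < ?m" "\<bar>?m\<bar> powr r - \<bar>a\<bar> powr r = (?m - a) * (r * (\<bar>y\<bar> powr (r - 1) * sgn y))"
    using MVT2[OF am(1) d] by blast
  obtain z where z: "?m < z" "z < b" "\<bar>b\<bar> powr r - \<bar>?m\<bar> powr r = (b - ?m) * (r * (\<bar>z\<bar> powr (r - 1) * sgn z))"
    using MVT2[OF am(2) d] by blast
  have "y powr (r - 1) < z powr (r - 1)" using y z assms by (intro powr_less_mono2) auto
  moreover have "\<bar>y\<bar> = y" "\<bar>z\<bar> = z" "sgn y = 1" "sgn z = 1" "\<bar>a\<bar> = a" "\<bar>b\<bar> = b" "\<bar>?m\<bar> = ?m" using y z assms by auto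
  moreover have "b - ?m = ?m - a" by (simp add: field_simps)
  moreover have "(?m - a) * (r * y powr (r - 1)) < (?m - a) * (r * z powr (r - 1))"
    if "y powr (r - 1) < z powr (r - 1)"
    using am assms that by (intro mult_strict_left_mono) auto
  ultimately have "(?m - a) * (r * y powr (r - 1)) < (b - ?m) * (r * z powr (r - 1))" by metis
  with y(3) z(3) show ?thesis
    using \<open>\<bar>y\<bar> = y\<close> \<open>\<bar>z\<bar> = z\<close> \<open>sgn y = 1\<close> \<open>sgn z = 1\<close> \<open>\<bar>a\<bar> = a\<close> \<open>\<bar>b\<bar> = b\<close> \<open>\<bar>?m\<bar> = ?m\<close>
    by simp
qed

section \<open>The bilinear form of \<open>A\<close>, its norm and the energy density\<close>

locale elliptic = dirichlet_domain \<Omega> p q for \<Omega> :: "(real^'n) set" and p q :: real +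
  fixes A :: "real^'n \<Rightarrow> real^'n^'n" and \<tau> :: real
  assumes cA: "continuous_on (closure \<Omega>) A" and sA: "\<And>x. x \<in> closure \<Omega> \<Longrightarrow> transpose (A x) = A x"
    and \<tau>: "\<tau> > 0" and ell: "\<And>x \<xi>. x \<in> closure \<Omega> \<Longrightarrow> \<tau> * (norm \<xi>)\<^sup>2 \<le> (A x *v \<xi>) \<bullet> \<xi>"
begin

abbreviation "K \<equiv> closure \<Omega>"

definition B :: "real^'n \<Rightarrow> real^'n \<Rightarrow> real^'n \<Rightarrow> real" where
  "B x \<xi> \<eta> = (A x *v \<xi>) \<bullet> \<eta>"

definition N :: "real^'n \<Rightarrow> real^'n \<Rightarrow> real" where
  "N x \<xi> = sqrt (B x \<xi> \<xi>)"

definition E :: "real^'n \<Rightarrow> real^'n \<Rightarrow> real" where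
  "E x \<xi> = B x \<xi> \<xi> powr (p / 2)"

lemma K_compact: "compact K"
  using bounded_\<Omega> by simp

lemma \<Omega>_K: "x \<in> \<Omega> \<Longrightarrow> x \<in> K"
  using closure_subset by blast

lemma B_linear:
  "B x (\<xi> + \<eta>) \<zeta> = B x \<xi> \<zeta> + B x \<eta> \<zeta>" "B x \<zeta> (\<xi> + \<eta>) = B x \<zeta> \<xi> + B x \<zeta> \<eta>"
  "B x (c *\<^sub>R \<xi>) \<zeta> = c * B x \<xi> \<zeta>" "B x \<zeta> (c *\<^sub>R \<xi>) = c * B x \<zeta> \<xi>"
  by (simp_all add: B_def matrix_vector_right_distrib inner_add_left inner_add_right matrix_vector_mult_scaleR)

lemma B_sym: "x \<in> K \<Longrightarrow> B x \<xi> \<eta> = B x \<eta> \<xi>"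
proof -
  assume x: "x \<in> K"
  have "B x \<xi> \<eta> = (transpose (A x) *v \<xi>) \<bullet> \<eta>" using sA[OF x] by (simp add: B_def)
  also have "\<dots> = \<xi> \<bullet> (A x *v \<eta>)" by (simp add: transpose_matrix_vector dot_lmul_matrix)
  finally show ?thesis by (simp add: B_def inner_commute)
qed

lemma B_ell: "x \<in> K \<Longrightarrow> \<tau> * (norm \<xi>)\<^sup>2 \<le> B x \<xi> \<xi>"
  using ell by (simp add: B_def)

lemma B_nonneg: "x \<in> K \<Longrightarrow> 0 \<le> B x \<xi> \<xi>"
proof -
  assume "x \<in> K"
  have "0 \<le> \<tau> * (norm \<xi>)\<^sup>2" using \<tau> by simp
  also have "\<dots> \<le> B x \<xi> \<xi>" by (rule B_ell) fact
  finally show ?thesis .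
qed

lemma B_pos: "x \<in> K \<Longrightarrow> \<xi> \<noteq> 0 \<Longrightarrow> 0 < B x \<xi> \<xi>"
proof -
  assume "x \<in> K" "\<xi> \<noteq> 0"
  then have "0 < \<tau> * (norm \<xi>)\<^sup>2" using \<tau> by simp
  also have "\<dots> \<le> B x \<xi> \<xi>" by (rule B_ell) fact
  finally show ?thesis .
qed

lemma B_zero: "B x 0 \<xi> = 0" "B x \<xi> 0 = 0"
  by (simp_all add: B_def)

lemma N_nonneg: "x \<in> K \<Longrightarrow> 0 \<le> N x \<xi>"
  by (simp add: N_def B_nonneg)

lemma N_sq: "x \<in> K \<Longrightarrow> N x \<xi> * N x \<xi> = B x \<xi> \<xi>"
  by (simp add: N_def B_nonneg)

lemma E_N: "x \<in> K \<Longrightarrow> E x \<xi> = N x \<xi> powr p"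
  using B_nonneg[of x \<xi>] by (simp add: E_def N_def powr_half_sqrt[symmetric] powr_powr)

lemma B_Cauchy: assumes x: "x \<in> K" shows "\<bar>B x \<xi> \<eta>\<bar> \<le> N x \<xi> * N x \<eta>"
proof (cases "\<eta> = 0")
  case False
  then have b: "B x \<eta> \<eta> > 0" by (rule B_pos[OF x])
  define t where "t = B x \<xi> \<eta> / B x \<eta> \<eta>"
  have "0 \<le> B x (\<xi> + (- t) *\<^sub>R \<eta>) (\<xi> + (- t) *\<^sub>R \<eta>)"
    by (rule B_nonneg[OF x])
  also have "\<dots> = B x \<xi> \<xi> - 2 * t * B x \<xi> \<eta> + t * t * B x \<eta> \<eta>"
    unfolding B_linear using B_sym[OF x, of \<eta> \<xi>] by (simp add: algebra_simps)
  also have "t * t * B x \<eta> \<eta> = t * B x \<xi> \<eta>" using b by (simp add: t_def)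
  finally have "t * B x \<xi> \<eta> \<le> B x \<xi> \<xi>" by simp
  then have "B x \<xi> \<eta> * B x \<xi> \<eta> \<le> B x \<xi> \<xi> * B x \<eta> \<eta>" using b
    by (simp add: t_def field_simps)
  also have "\<dots> = (N x \<xi> * N x \<eta>) * (N x \<xi> * N x \<eta>)"
    using N_sq[OF x, of \<xi>] N_sq[OF x, of \<eta>] by (simp add: ac_simps)
  finally have "(\<bar>B x \<xi> \<eta>\<bar>)\<^sup>2 \<le> (N x \<xi> * N x \<eta>)\<^sup>2"
    by (simp add: power2_eq_square)
  then show ?thesis by (rule power2_le_imp_le) (simp add: N_nonneg[OF x])
qed (simp add: B_zero N_def)

lemma N_triangle: assumes x: "x \<in> K" shows "N x (\<xi> + \<eta>) \<le> N x \<xi> + N x \<eta>"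
proof -
  have "B x (\<xi> + \<eta>) (\<xi> + \<eta>) = B x \<xi> \<xi> + 2 * B x \<xi> \<eta> + B x \<eta> \<eta>"
    unfolding B_linear using B_sym[OF x, of \<eta> \<xi>] by simp
  also have "\<dots> \<le> N x \<xi> * N x \<xi> + 2 * (N x \<xi> * N x \<eta>) + N x \<eta> * N x \<eta>"
    unfolding N_sq[OF x] using B_Cauchy[OF x, of \<xi> \<eta>] by simp
  also have "\<dots> = (N x \<xi> + N x \<eta>)\<^sup>2" by (simp add: power2_eq_square algebra_simps)
  finally have "(N x (\<xi> + \<eta>))\<^sup>2 \<le> (N x \<xi> + N x \<eta>)\<^sup>2"
    using N_sq[OF x, of "\<xi> + \<eta>"] by (simp add: power2_eq_square)
  then show ?thesis by (rule power2_le_imp_le) (simp add: N_nonneg[OF x])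
qed

lemma N_scale: "x \<in> K \<Longrightarrow> N x (c *\<^sub>R \<xi>) = \<bar>c\<bar> * N x \<xi>"
  by (simp add: N_def B_linear mult.assoc[symmetric] real_sqrt_mult)

lemma E_nonneg: "0 \<le> E x \<xi>"
  by (simp add: E_def)

lemma E_zero: "E x 0 = 0"
  by (simp add: E_def B_zero)

lemma E_scale: "x \<in> K \<Longrightarrow> E x (c *\<^sub>R \<xi>) = \<bar>c\<bar> powr p * E x \<xi>"
  by (simp add: E_N N_scale powr_mult N_nonneg)

lemma E_lower: assumes x: "x \<in> K" shows "\<tau> powr (p / 2) * norm \<xi> powr p \<le> E x \<xi>"
proof -
  have "(\<tau> * (norm \<xi>)\<^sup>2) powr (p / 2) \<le> E x \<xi>"
    unfolding E_def using \<tau> p_pos B_ell[OF x, of \<xi>] by (intro powr_mono2) auto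
  moreover have "((norm \<xi>)\<^sup>2) powr (p / 2) = norm \<xi> powr p"
    by (simp add: power2_eq_square powr_mult powr_add[symmetric])
  ultimately show ?thesis using \<tau> by (simp add: powr_mult)
qed

lemma B_continuous: "continuous_on (K \<times> UNIV) (\<lambda>z. B (fst z) (snd z) (snd z))"
proof -
  have "continuous_on (K \<times> UNIV) (\<lambda>z::(real^'n) \<times> (real^'n). A (fst z))"
    by (rule continuous_on_compose2[OF cA continuous_on_fst[OF continuous_on_id]]) auto
  then show ?thesis unfolding B_def matrix_vector_mult_def
    by (intro continuous_intros continuous_on_vec_lambda continuous_on_component)
qed

lemma E_continuous: "continuous_on (K \<times> UNIV) (\<lambda>(x, \<xi>). E x \<xi>)"
  unfolding case_prod_beta E_def
  using p_pos B_nonneg by (intro continuous_on_powr' B_continuous continuous_on_const) auto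

lemma A_measurable: "(\<lambda>x. A x $ i $ j) \<in> borel_measurable M"
proof -
  have "continuous_on \<Omega> (\<lambda>x. A x $ i $ j)"
    by (intro continuous_on_component continuous_on_subset[OF cA closure_subset])
  then show ?thesis by (rule continuous_imp_measurable_on_sets_lebesgue) (rule \<Omega>_sets)
qed

lemma vec_nth_measurable:
  fixes g :: "'a \<Rightarrow> ('b::euclidean_space)^'m"
  assumes "g \<in> borel_measurable L"
  shows "(\<lambda>x. g x $ j) \<in> borel_measurable L"
  by (rule measurable_compose[OF assms]) (intro borel_measurable_continuous_onI continuous_on_component continuous_on_id)

lemma B_measurable:
  assumes "g \<in> borel_measurable M" "h \<in> borel_measurable M"
  shows "(\<lambda>x. B x (g x) (h x)) \<in> borel_measurable M"
  unfolding B_def inner_vec_def matrix_vector_mult_def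
  using A_measurable vec_nth_measurable[OF assms(1)] vec_nth_measurable[OF assms(2)] by simp

lemma E_measurable:
  assumes "g \<in> borel_measurable M"
  shows "(\<lambda>x. E x (g x)) \<in> borel_measurable M"
  unfolding E_def using B_measurable[OF assms assms] by measurable

text \<open>If the norms of \<xi> and \<eta> agree, strictness comes from the parallelogram
  identity; if they differ, from the triangle inequality and the strict convexity of the p-th
  power.\<close>

lemma E_midpoint:
  assumes x: "x \<in> K"
  shows "E x ((1/2) *\<^sub>R (\<xi> + \<eta>)) \<le> (E x \<xi> + E x \<eta>) / 2"
    and "\<xi> \<noteq> \<eta> \<Longrightarrow> E x ((1/2) *\<^sub>R (\<xi> + \<eta>)) < (E x \<xi> + E x \<eta>) / 2"
proof -
  have strict: "E x ((1/2) *\<^sub>R (\<xi> + \<eta>)) < (E x \<xi> + E x \<eta>) / 2"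
    if ne: "\<xi> \<noteq> \<eta>"
  proof (cases "N x \<xi> = N x \<eta>")
    case True
    have "B x ((1/2) *\<^sub>R (\<xi> + \<eta>)) ((1/2) *\<^sub>R (\<xi> + \<eta>)) + B x ((1/2) *\<^sub>R (\<xi> + (-1) *\<^sub>R \<eta>)) ((1/2) *\<^sub>R (\<xi> + (-1) *\<^sub>R \<eta>)) = (B x \<xi> \<xi> + B x \<eta> \<eta>) / 2"
      unfolding B_linear using B_sym[OF x, of \<eta> \<xi>] by (simp add: field_simps)
    moreover have "B x \<eta> \<eta> = B x \<xi> \<xi>" using True N_sq[OF x, of \<xi>] N_sq[OF x, of \<eta>]
      by simp
    moreover have "0 < B x ((1/2) *\<^sub>R (\<xi> + (-1) *\<^sub>R \<eta>)) ((1/2) *\<^sub>R (\<xi> + (-1) *\<^sub>R \<eta>))" by (rule B_pos[OF x]) (use ne in simp)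
    ultimately have "B x ((1/2) *\<^sub>R (\<xi> + \<eta>)) ((1/2) *\<^sub>R (\<xi> + \<eta>)) < B x \<xi> \<xi>" by simp
    then have "E x ((1/2) *\<^sub>R (\<xi> + \<eta>)) < E x \<xi>"
      unfolding E_def using B_nonneg[OF x] p_pos by (intro powr_less_mono2) auto
    moreover have "E x \<eta> = E x \<xi>" using True E_N[OF x] by simp
    ultimately show ?thesis by simp
  next
    case False
    have "N x ((1/2) *\<^sub>R (\<xi> + \<eta>)) \<le> (N x \<xi> + N x \<eta>) / 2"
      using N_triangle[OF x, of \<xi> \<eta>] by (simp add: N_scale[OF x])
    then have "E x ((1/2) *\<^sub>R (\<xi> + \<eta>)) \<le> ((N x \<xi> + N x \<eta>) / 2) powr p"
      unfolding E_N[OF x] using N_nonneg[OF x] p_pos by (intro powr_mono2) auto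
    also have "\<dots> < (N x \<xi> powr p + N x \<eta> powr p) / 2"
    proof (cases "N x \<xi> < N x \<eta>")
      case True
      then show ?thesis using powr_midpoint_strict[OF N_nonneg[OF x] True p_gt] by simp
    next
      case F: False
      then have "N x \<eta> < N x \<xi>" using False by simp
      then show ?thesis using powr_midpoint_strict[OF N_nonneg[OF x] _ p_gt, of \<eta> "N x \<xi>"]
        by (simp add: add.commute)
    qed
    finally show ?thesis unfolding E_N[OF x] .
  qed
  show "\<xi> \<noteq> \<eta> \<Longrightarrow> E x ((1/2) *\<^sub>R (\<xi> + \<eta>)) < (E x \<xi> + E x \<eta>) / 2" by (rule strict)
  show "E x ((1/2) *\<^sub>R (\<xi> + \<eta>)) \<le> (E x \<xi> + E x \<eta>) / 2"
  proof (cases "\<xi> = \<eta>")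
    case True
    then have "(1/2) *\<^sub>R (\<xi> + \<eta>) = \<xi>" by (simp add: scaleR_2[symmetric])
    then show ?thesis using True by simp
  qed (use strict in auto)
qed

text \<open>Away from the origin this is the chain rule. If the line meets the origin at t, then E
  along it is |s - t|^p E(w), whose derivative at t is 0 because p > 1; the formula also evaluates
  to 0 there.\<close>

lemma E_deriv:
  assumes x: "x \<in> K"
  shows "((\<lambda>t. E x (v + t *\<^sub>R w)) has_real_derivative p * (B x (v + t *\<^sub>R w) (v + t *\<^sub>R w) powr ((p - 2) / 2) * B x (v + t *\<^sub>R w) w)) (at t)"
proof (cases "v + t *\<^sub>R w = 0")
  case False
  have b: "B x (v + t *\<^sub>R w) (v + t *\<^sub>R w) > 0" by (rule B_pos[OF x False])
  have e: "B x (v + s *\<^sub>R w) (v + s *\<^sub>R w) = B x v v + s * (2 * B x v w) + s * s * B x w w" for s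
    unfolding B_linear using B_sym[OF x, of w v] by (simp add: algebra_simps)
  have "((\<lambda>s. B x (v + s *\<^sub>R w) (v + s *\<^sub>R w)) has_real_derivative 2 * B x (v + t *\<^sub>R w) w) (at t)"
    unfolding e by (auto intro!: derivative_eq_intros simp: B_linear)
  from DERIV_fun_powr[OF this b, of "p / 2"] show ?thesis
    unfolding E_def by (rule DERIV_cong) (simp add: diff_divide_distrib)
next
  case True
  have e: "E x (v + s *\<^sub>R w) = \<bar>s - t\<bar> powr p * E x w" for s
  proof -
    have "v + s *\<^sub>R w = (v + t *\<^sub>R w) + (s - t) *\<^sub>R w" by (simp add: algebra_simps)
    then have "v + s *\<^sub>R w = (s - t) *\<^sub>R w" using True by simp
    then show ?thesis by (simp add: E_scale[OF x])
  qed
  have "((\<lambda>s. \<bar>s - t\<bar> powr p) has_real_derivative 0) (at t)"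
  proof -
    have s: "((\<lambda>s. s - t) has_real_derivative 1) (at t)" by (auto intro!: derivative_eq_intros)
    show ?thesis
      using DERIV_chain2[where f="\<lambda>s. \<bar>s\<bar> powr p" and g="\<lambda>s. s - t" and x=t, OF abs_powr_has_derivative[OF p_gt] s] by simp
  qed
  from DERIV_cmult_right[OF this, of "E x w"]
  have "((\<lambda>s. \<bar>s - t\<bar> powr p * E x w) has_real_derivative 0) (at t)" by simp
  then show ?thesis unfolding e using True by (simp add: B_zero)
qed

lemma E_deriv_bound:
  assumes x: "x \<in> K" and t: "0 \<le> t" "t \<le> 1"
  shows "\<bar>p * (B x (v + t *\<^sub>R w) (v + t *\<^sub>R w) powr ((p - 2) / 2) * B x (v + t *\<^sub>R w) w)\<bar> \<le> p * 2 powr p * (E x v + E x w)"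
proof -
  let ?z = "v + t *\<^sub>R w"
  define n where "n = N x v + N x w"
  have n0: "0 \<le> n" "0 \<le> N x w" "N x w \<le> n" using N_nonneg[OF x] by (auto simp: n_def)
  have "N x ?z \<le> N x v + \<bar>t\<bar> * N x w" using N_triangle[OF x, of v "t *\<^sub>R w"]
    by (simp add: N_scale[OF x])
  also have "\<dots> \<le> n" using t n0 by (simp add: n_def mult_left_le_one_le)
  finally have zn: "N x ?z \<le> n" .
  have "B x ?z ?z powr ((p - 2) / 2) * \<bar>B x ?z w\<bar> \<le> n powr p"
  proof (cases "?z = 0")
    case False
    have Nz: "N x ?z > 0" using B_pos[OF x False] by (simp add: N_def)
    \<comment> \<open>For p < 2 this factor blows up for small \<open>?z\<close>; the factor
      \<open>N x ?z\<close> from Cauchy-Schwarz raises the exponent to p - 1 > 0 before monotonicity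
      is used.\<close>
    have "B x ?z ?z powr ((p - 2) / 2) = N x ?z powr (p - 2)"
      using B_nonneg[OF x, of ?z] by (simp add: N_def powr_half_sqrt[symmetric] powr_powr)
    then have "B x ?z ?z powr ((p - 2) / 2) * \<bar>B x ?z w\<bar> \<le> N x ?z powr (p - 2) * (N x ?z * N x w)"
      using B_Cauchy[OF x, of ?z w] by (intro mult_mono) auto
    also have "\<dots> = N x ?z powr (p - 1) * N x w" using Nz by (simp add: powr_diff power2_eq_square)
    also have "\<dots> \<le> n powr (p - 1) * n" using zn n0 p_gt Nz by (intro mult_mono powr_mono2) auto
    also have "\<dots> = n powr p" using n0 zn Nz by (simp add: powr_diff)
    finally show ?thesis .
  qed (simp add: B_zero)
  also have "n powr p \<le> 2 powr p * (E x v + E x w)"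
    unfolding n_def E_N[OF x] using N_nonneg[OF x] p_pos by (intro powr_add_le) auto
  finally show ?thesis using p_pos by (simp add: abs_mult mult.assoc mult_left_mono)
qed

end

section \<open>Lower semicontinuity of the energy\<close>

context elliptic
begin

definition EV :: "real^'n \<Rightarrow> (real^'n)^'d \<Rightarrow> real" where
  "EV x \<Xi> = (\<Sum>j\<in>UNIV. E x (\<Xi> $ j))"

definition en :: "(real^'n \<Rightarrow> (real^'n)^'d) \<Rightarrow> real" where
  "en g = (LINT x|M. EV x (g x))"

definition sobv :: "(real^'n \<Rightarrow> real^'d) \<Rightarrow> (real^'n \<Rightarrow> (real^'n)^'d) \<Rightarrow> bool" where
  "sobv u g \<longleftrightarrow> (\<forall>j. sob \<Omega> p (\<lambda>x. u x $ j) (\<lambda>x. g x $ j))"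

text \<open>The midpoint defect of convexity. Its integral is a combination of three energies, so
  its smallness can be read off from energy levels alone.\<close>

definition gap :: "real^'n \<Rightarrow> (real^'n)^'d \<Rightarrow> (real^'n)^'d \<Rightarrow> real" where
  "gap x \<Xi> H = (EV x \<Xi> + EV x H) / 2 - EV x ((1/2) *\<^sub>R (\<Xi> + H))"

lemma EV_nonneg: "0 \<le> EV x \<Xi>"
  by (simp add: EV_def sum_nonneg E_nonneg)

lemma EV_scale: "x \<in> K \<Longrightarrow> EV x (c *\<^sub>R \<Xi>) = \<bar>c\<bar> powr p * EV x \<Xi>"
  by (simp add: EV_def E_scale sum_distrib_left)

lemma EV_continuous: "continuous_on (K \<times> UNIV) (\<lambda>(x, \<Xi>::(real^'n)^'d). EV x \<Xi>)"
  unfolding case_prod_beta EV_def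
proof (intro continuous_on_sum)
  fix j :: 'd
  show "continuous_on (K \<times> UNIV) (\<lambda>z. E (fst z) (snd z $ j))"
    using continuous_on_compose2[OF E_continuous, of "K \<times> UNIV" "\<lambda>z. (fst z, snd z $ j)"]
    by (force intro!: continuous_intros continuous_on_component)
qed

lemma EV_measurable:
  fixes g :: "real^'n \<Rightarrow> (real^'n)^'d"
  assumes "g \<in> borel_measurable M"
  shows "(\<lambda>x. EV x (g x)) \<in> borel_measurable M"
  unfolding EV_def by (intro borel_measurable_sum E_measurable vec_nth_measurable assms)

lemma EV_lower:
  fixes \<Xi> :: "(real^'n)^'d"
  assumes x: "x \<in> K"
  shows "norm \<Xi> powr p \<le> real CARD('d) powr p / \<tau> powr (p / 2) * EV x \<Xi>"
proof -
  have t: "\<tau> powr (p / 2) > 0" using \<tau> by simp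
  have "norm \<Xi> powr p \<le> real CARD('d) powr p * (\<Sum>j\<in>UNIV. norm (\<Xi> $ j) powr p)"
    by (rule norm_vec_powr_le[OF p_pos(2)])
  also have "\<dots> \<le> real CARD('d) powr p * (\<Sum>j\<in>UNIV. E x (\<Xi> $ j) / \<tau> powr (p / 2))"
    using E_lower[OF x] t by (intro mult_left_mono sum_mono) (auto simp: pos_le_divide_eq mult.commute)
  finally show ?thesis by (simp add: EV_def sum_divide_distrib[symmetric])
qed

lemma gap_nonneg: "x \<in> K \<Longrightarrow> 0 \<le> gap x \<Xi> H"
proof -
  assume x: "x \<in> K"
  have "EV x ((1/2) *\<^sub>R (\<Xi> + H)) \<le> (\<Sum>j\<in>UNIV. (E x (\<Xi> $ j) + E x (H $ j)) / 2)"
    unfolding EV_def using E_midpoint(1)[OF x] by (intro sum_mono) simp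
  then show ?thesis by (simp add: gap_def EV_def sum_divide_distrib[symmetric] sum.distrib)
qed

text \<open>Strict convexity in one single component is enough to make the sum strict.\<close>

lemma gap_zero:
  assumes x: "x \<in> K" and g: "gap x \<Xi> H = 0"
  shows "\<Xi> = H"
proof (rule ccontr)
  assume "\<Xi> \<noteq> H"
  then obtain i where i: "\<Xi> $ i \<noteq> H $ i" by (auto simp: vec_eq_iff)
  have "EV x ((1/2) *\<^sub>R (\<Xi> + H)) < (\<Sum>j\<in>UNIV. (E x (\<Xi> $ j) + E x (H $ j)) / 2)"
    unfolding EV_def
  proof (rule sum_strict_mono_ex1)
    show "\<forall>j\<in>UNIV. E x (((1/2) *\<^sub>R (\<Xi> + H)) $ j) \<le> (E x (\<Xi> $ j) + E x (H $ j)) / 2"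
      using E_midpoint(1)[OF x] by simp
    show "\<exists>j\<in>UNIV. E x (((1/2) *\<^sub>R (\<Xi> + H)) $ j) < (E x (\<Xi> $ j) + E x (H $ j)) / 2"
      using E_midpoint(2)[OF x i] by (intro bexI[of _ i]) auto
  qed simp
  then show False using g by (simp add: gap_def EV_def sum_divide_distrib[symmetric] sum.distrib)
qed

text \<open>Uniform convexity in quantitative form: \<open>gap\<close> is nonnegative, homogeneous
  and vanishes only on the diagonal, so compactness bounds |\<Xi> - H|^p by it, up to a small
  multiple of the whole.\<close>

lemma gap_bound:
  assumes \<epsilon>: "\<epsilon> > 0"
  obtains C where "C > 0" "\<And>x \<Xi> H :: (real^'n)^'d. x \<in> K \<Longrightarrow>
      norm (\<Xi> - H) powr p \<le> \<epsilon> * (norm \<Xi> powr p + norm H powr p) + C * gap x \<Xi> H"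
proof -
  let ?\<Psi> = "\<lambda>(x::real^'n) (z::((real^'n)^'d) \<times> ((real^'n)^'d)). norm (fst z - snd z) powr p"
  let ?G = "\<lambda>x (z::((real^'n)^'d) \<times> ((real^'n)^'d)). gap x (fst z) (snd z)"
  define \<delta> where "\<delta> = \<epsilon> / 2 powr p"
  have \<delta>: "\<delta> > 0" "\<delta> * 2 powr p = \<epsilon>" using \<epsilon>
    by (auto simp: \<delta>_def)
  have c1: "continuous_on (K \<times> UNIV) (\<lambda>(x, z). ?\<Psi> x z)"
    unfolding case_prod_beta using p_pos by (intro continuous_on_powr' continuous_intros) auto
  have c2: "continuous_on (K \<times> UNIV) (\<lambda>(x, z). ?G x z)"
    unfolding case_prod_beta gap_def
  proof (intro continuous_intros)
    show "continuous_on (K \<times> UNIV) (\<lambda>z. EV (fst z) (fst (snd z) :: (real^'n)^'d))"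
      using continuous_on_compose2[OF EV_continuous, of "K \<times> UNIV" "\<lambda>z. (fst z, fst (snd z))"]
        by (force intro!: continuous_intros)
    show "continuous_on (K \<times> UNIV) (\<lambda>z. EV (fst z) (snd (snd z) :: (real^'n)^'d))"
      using continuous_on_compose2[OF EV_continuous, of "K \<times> UNIV" "\<lambda>z. (fst z, snd (snd z))"]
        by (force intro!: continuous_intros)
    show "continuous_on (K \<times> UNIV) (\<lambda>z. EV (fst z) ((1/2) *\<^sub>R (fst (snd z) + snd (snd z)) :: (real^'n)^'d))"
      using continuous_on_compose2[OF EV_continuous, of "K \<times> UNIV" "\<lambda>z. (fst z, (1/2) *\<^sub>R (fst (snd z) + snd (snd z)))"] by (force intro!: continuous_intros)
  qed simp
  obtain C where C: "C \<ge> 0" "\<And>x z. x \<in> K \<Longrightarrow> ?\<Psi> x z \<le> \<delta> * norm z powr p + C * ?G x z"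
  proof (rule homogeneous_compact_bound[OF K_compact c1 c2, of p \<delta>])
    fix x z and \<rho> :: real assume x: "x \<in> K" and \<rho>: "\<rho> > 0"
    show "?\<Psi> x (\<rho> *\<^sub>R z) = \<rho> powr p * ?\<Psi> x z"
      using \<rho> by (simp add: scaleR_diff_right[symmetric] powr_mult)
    have e: "(1/2) *\<^sub>R (\<rho> *\<^sub>R fst z + \<rho> *\<^sub>R snd z) = \<rho> *\<^sub>R ((1/2) *\<^sub>R (fst z + snd z))" by (simp add: scaleR_add_right)
    show "?G x (\<rho> *\<^sub>R z) = \<rho> powr p * ?G x z"
      unfolding gap_def fst_scaleR snd_scaleR e EV_scale[OF x] using \<rho> by (simp add: algebra_simps)
  next
    fix x and z :: "((real^'n)^'d) \<times> ((real^'n)^'d)" assume x: "x \<in> K"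
    show "0 \<le> ?G x z" by (rule gap_nonneg[OF x])
    show "?\<Psi> x z \<le> 0" if "?G x z = 0" using gap_zero[OF x that] by simp
  qed (use \<delta> p_pos in auto)
  show ?thesis
  proof (rule that[of "C + 1"])
    fix x and \<Xi> H :: "(real^'n)^'d" assume x: "x \<in> K"
    have "norm (\<Xi> - H) powr p \<le> \<delta> * norm (\<Xi>, H) powr p + C * gap x \<Xi> H"
      using C(2)[OF x, of "(\<Xi>, H)"] by simp
    also have "\<delta> * norm (\<Xi>, H) powr p \<le> \<delta> * (2 powr p * (norm \<Xi> powr p + norm H powr p))"
      using \<delta> p_pos by (intro mult_left_mono norm_Pair_powr_le) auto
    also have "\<dots> = \<epsilon> * (norm \<Xi> powr p + norm H powr p)" using \<delta>(2)
      by (simp add: mult.assoc[symmetric])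
    finally show "norm (\<Xi> - H) powr p \<le> \<epsilon> * (norm \<Xi> powr p + norm H powr p) + (C + 1) * gap x \<Xi> H"
      using gap_nonneg[OF x, of \<Xi> H] by (simp add: distrib_right)
  qed (use C in simp)
qed

lemma EV_integrable:
  fixes g :: "real^'n \<Rightarrow> (real^'n)^'d"
  assumes "g \<in> LP M p"
  shows "integrable M (\<lambda>x. EV x (g x))"
  by (rule homogeneous_integrable[OF K_compact EV_continuous p_pos(1) _ _ EV_measurable[OF LP_D(1)[OF assms]] assms])
    (use \<Omega>_K in \<open>auto simp: EV_scale\<close>)

lemma en_tendsto:
  fixes g :: "nat \<Rightarrow> real^'n \<Rightarrow> (real^'n)^'d"
  assumes "\<And>k. g k \<in> LP M p" "h \<in> LP M p" "(\<lambda>k. pint M p (\<lambda>x. g k x - h x)) \<longlonglongrightarrow> 0"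
  shows "(\<lambda>k. en (g k)) \<longlonglongrightarrow> en h"
  unfolding en_def
  by (rule homogeneous_integral_tendsto[OF K_compact EV_continuous p_pos(1) _ _ EV_measurable assms])
    (use \<Omega>_K in \<open>auto simp: EV_scale\<close>)

lemma en_nonneg: "0 \<le> en g"
  unfolding en_def by (rule integral_nonneg_AE) (simp add: EV_nonneg)

lemma en_cong_AE:
  fixes g :: "real^'n \<Rightarrow> (real^'n)^'d"
  assumes "AE x in M. g x = h x" "g \<in> borel_measurable M" "h \<in> borel_measurable M"
  shows "en g = en h"
  unfolding en_def using assms by (intro integral_cong_AE EV_measurable) auto

lemma pint_le_en:
  fixes g :: "real^'n \<Rightarrow> (real^'n)^'d"
  assumes g: "g \<in> LP M p"
  shows "pint M p g \<le> real CARD('d) powr p / \<tau> powr (p / 2) * en g"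
proof -
  have "pint M p g \<le> (LINT x|M. real CARD('d) powr p / \<tau> powr (p / 2) * EV x (g x))"
    unfolding pint_def using LP_D(2)[OF g] EV_integrable[OF g] EV_lower[OF \<Omega>_K]
    by (intro integral_mono) auto
  then show ?thesis by (simp add: en_def)
qed

lemma sobv_LP: "sobv u g \<Longrightarrow> u \<in> LP M p" "sobv u g \<Longrightarrow> g \<in> LP M p"
proof -
  assume "sobv u g"
  then have s: "sob \<Omega> p (\<lambda>x. u x $ j) (\<lambda>x. g x $ j)" for j by (simp add: sobv_def)
  show "u \<in> LP M p" "g \<in> LP M p"
    by (rule LP_vecI(1)[OF sob_LP(1)[OF s] p_pos(2)], rule LP_vecI(1)[OF sob_LP(2)[OF s] p_pos(2)])
qed

lemma sobv_add: "sobv u g \<Longrightarrow> sobv v h \<Longrightarrow> sobv (\<lambda>x. u x + v x) (\<lambda>x. g x + h x)"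
  using sob_add by (auto simp: sobv_def)

lemma sobv_scale: "sobv u g \<Longrightarrow> sobv (\<lambda>x. c *\<^sub>R u x) (\<lambda>x. c *\<^sub>R g x)"
  using sob_scale by (auto simp: sobv_def)

lemma sobv_diff: "sobv u g \<Longrightarrow> sobv v h \<Longrightarrow> sobv (\<lambda>x. u x - v x) (\<lambda>x. g x - h x)"
  using sob_diff by (auto simp: sobv_def)

lemma pint_component_tendsto:
  fixes w :: "nat \<Rightarrow> real^'n \<Rightarrow> ('b::euclidean_space)^'d"
  assumes "\<And>k. w k \<in> LP M p" "(\<lambda>k. pint M p (w k)) \<longlonglongrightarrow> 0"
  shows "(\<lambda>k. pint M p (\<lambda>x. w k x $ j)) \<longlonglongrightarrow> 0"
  by (rule tendsto_sandwich[OF _ _ tendsto_const assms(2)])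
    (use LP_component(2)[OF assms(1) p_pos(2)] in \<open>auto intro!: always_eventually simp: pint_nonneg\<close>)

lemma sobv_limit:
  fixes u :: "nat \<Rightarrow> real^'n \<Rightarrow> real^'d"
  assumes s: "\<And>k. sobv (u k) (g k)" and L: "v \<in> LP M p" "h \<in> LP M p"
    and l: "(\<lambda>k. pint M p (\<lambda>x. u k x - v x)) \<longlonglongrightarrow> 0" "(\<lambda>k. pint M p (\<lambda>x. g k x - h x)) \<longlonglongrightarrow> 0"
  shows "sobv v h"
  unfolding sobv_def
proof
  fix j
  have 1: "(\<lambda>k. pint M p (\<lambda>x. (u k x - v x) $ j)) \<longlonglongrightarrow> 0"
    by (rule pint_component_tendsto[OF LP_diff[OF sobv_LP(1)[OF s] L(1) p_pos(2)] l(1)])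
  have 2: "(\<lambda>k. pint M p (\<lambda>x. (g k x - h x) $ j)) \<longlonglongrightarrow> 0"
    by (rule pint_component_tendsto[OF LP_diff[OF sobv_LP(2)[OF s] L(2) p_pos(2)] l(2)])
  show "sob \<Omega> p (\<lambda>x. v x $ j) (\<lambda>x. h x $ j)"
    by (rule sob_limit[of "\<lambda>k x. u k x $ j" "\<lambda>k x. g k x $ j"])
      (use s 1 2 LP_component(1)[OF L(1) p_pos(2)] LP_component(1)[OF L(2) p_pos(2)] in \<open>auto simp: sobv_def\<close>)
qed

lemma sobv_unique:
  assumes "sobv v h" "sobv v h'"
  shows "AE x in M. h x = h' x"
proof -
  have "AE x in M. \<forall>j\<in>UNIV. h x $ j = h' x $ j"
    using assms
      by (intro AE_finite_allI) (auto simp: sobv_def intro: weak_gradient_unique[OF open_\<Omega> sob_has_weak_gradient sob_has_weak_gradient])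
  then show ?thesis by eventually_elim (simp add: vec_eq_iff)
qed

lemma gap_integral:
  fixes g h :: "real^'n \<Rightarrow> (real^'n)^'d"
  assumes "g \<in> LP M p" "h \<in> LP M p"
  shows "integrable M (\<lambda>x. gap x (g x) (h x))"
    "(LINT x|M. gap x (g x) (h x)) = (en g + en h) / 2 - en (\<lambda>x. (1/2) *\<^sub>R (g x + h x))"
proof -
  have i: "integrable M (\<lambda>x. EV x (g x))" "integrable M (\<lambda>x. EV x (h x))" "integrable M (\<lambda>x. EV x ((1/2) *\<^sub>R (g x + h x)))"
    using EV_integrable[OF assms(1)] EV_integrable[OF assms(2)] EV_integrable[OF LP_scaleR[OF LP_add[OF assms p_pos(2)], of "1/2"]] by auto
  then show "integrable M (\<lambda>x. gap x (g x) (h x))" unfolding gap_def by auto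
  show "(LINT x|M. gap x (g x) (h x)) = (en g + en h) / 2 - en (\<lambda>x. (1/2) *\<^sub>R (g x + h x))"
    unfolding gap_def en_def using i by simp
qed

lemma gap_pint_bound:
  assumes \<epsilon>: "\<epsilon> > 0"
  obtains C where "C > 0" "\<And>g h :: real^'n \<Rightarrow> (real^'n)^'d. g \<in> LP M p \<Longrightarrow> h \<in> LP M p \<Longrightarrow>
    pint M p (\<lambda>x. g x - h x) \<le> \<epsilon> * (pint M p g + pint M p h) + C * ((en g + en h) / 2 - en (\<lambda>x. (1/2) *\<^sub>R (g x + h x)))"
proof -
  obtain C where C: "C > 0" "\<And>x \<Xi> H :: (real^'n)^'d. x \<in> K \<Longrightarrow>
      norm (\<Xi> - H) powr p \<le> \<epsilon> * (norm \<Xi> powr p + norm H powr p) + C * gap x \<Xi> H"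
    by (rule gap_bound[OF \<epsilon>]) (rule that)
  show ?thesis
  proof (rule that[OF C(1)])
    fix g h :: "real^'n \<Rightarrow> (real^'n)^'d" assume L: "g \<in> LP M p" "h \<in> LP M p"
    have "pint M p (\<lambda>x. g x - h x) \<le> (LINT x|M. \<epsilon> * (norm (g x) powr p + norm (h x) powr p) + C * gap x (g x) (h x))"
      unfolding pint_def
        using LP_D(2)[OF LP_diff[OF L p_pos(2)]] LP_D(2)[OF L(1)] LP_D(2)[OF L(2)] gap_integral(1)[OF L] C(2)[OF \<Omega>_K]
      by (intro integral_mono) auto
    also have "\<dots> = \<epsilon> * (pint M p g + pint M p h) + C * (LINT x|M. gap x (g x) (h x))"
      using LP_D(2)[OF L(1)] LP_D(2)[OF L(2)] gap_integral(1)[OF L] by (simp add: pint_def)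
    finally show "pint M p (\<lambda>x. g x - h x) \<le> \<epsilon> * (pint M p g + pint M p h) + C * ((en g + en h) / 2 - en (\<lambda>x. (1/2) *\<^sub>R (g x + h x)))"
      unfolding gap_integral(2)[OF L] .
  qed
qed

text \<open>Lower semicontinuity without weak compactness: near-minimisers of the energy over small
  \<open>L\<^sup>p\<close>-balls around \<open>v\<close> form a Cauchy sequence because the energy
    is uniformly convex.\<close>

lemma energy_lsc:
  fixes u :: "nat \<Rightarrow> real^'n \<Rightarrow> real^'d"
  assumes s: "\<And>k. sobv (u k) (g k)" and v: "v \<in> LP M p" and lim: "(\<lambda>k. pint M p (\<lambda>x. u k x - v x)) \<longlonglongrightarrow> 0"
    and c: "\<And>k. en (g k) \<le> c k" "c \<longlonglongrightarrow> c0"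
  obtains h where "sobv v h" "en h \<le> c0"
proof -
  \<comment> \<open>Gradients of Sobolev functions within \<epsilon> of v in the sense of
    \<open>pint\<close>; the infimum \<open>d\<close> of their energies can only grow as \<epsilon>
    shrinks.\<close>
  define X where "X \<epsilon> = {h. \<exists>w. sobv w h \<and> pint M p (\<lambda>x. w x - v x) \<le> \<epsilon>}" for \<epsilon>
  define d where "d \<epsilon> = Inf (en ` X \<epsilon>)" for \<epsilon>
  have bdd: "bdd_below (en ` X \<epsilon>)" for \<epsilon> using en_nonneg by (intro bdd_belowI[of _ 0]) auto
  have ev: "\<forall>\<^sub>F k in sequentially. g k \<in> X \<epsilon>" if "\<epsilon> > 0" for \<epsilon>
    using order_tendstoD(2)[OF lim that] by eventually_elim (use s in \<open>force simp: X_def\<close>)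
  have ne: "X \<epsilon> \<noteq> {}" if "\<epsilon> > 0" for \<epsilon>
    using eventually_happens[OF ev[OF that]] by auto
  have dc: "d \<epsilon> \<le> c0" if "\<epsilon> > 0" for \<epsilon>
  proof (rule tendsto_lowerbound[OF c(2)])
    show "\<forall>\<^sub>F k in sequentially. d \<epsilon> \<le> c k"
      using ev[OF that]
    proof eventually_elim
      case (elim k)
      have "d \<epsilon> \<le> en (g k)" unfolding d_def by (rule cInf_lower[OF _ bdd]) (use elim in auto)
      then show ?case using c(1)[of k] by simp
    qed
  qed simp
  define D where "D m = d ((1/2) ^ m)" for m :: nat
  have mono: "mono D"
  proof (rule incseq_SucI)
    fix m
    have "X ((1/2) ^ Suc m) \<subseteq> X ((1/2) ^ m)"
    proof
      fix h assume "h \<in> X ((1/2) ^ Suc m)"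
      then obtain w where w: "sobv w h" "pint M p (\<lambda>x. w x - v x) \<le> (1/2) ^ Suc m" unfolding X_def
        by blast
      have "(1/2::real) ^ Suc m \<le> (1/2) ^ m" by simp
      then have "pint M p (\<lambda>x. w x - v x) \<le> (1/2) ^ m" using w(2) by linarith
      then show "h \<in> X ((1/2) ^ m)" unfolding X_def using w(1) by blast
    qed
    then show "D m \<le> D (Suc m)" unfolding D_def d_def using ne[of "(1/2) ^ Suc m"]
      by (intro cInf_superset_mono bdd image_mono) auto
  qed
  have Dc: "D m \<le> c0" for m unfolding D_def by (rule dc) simp
  obtain L where L: "D \<longlonglongrightarrow> L" "\<And>m. D m \<le> L" using incseq_convergent[OF mono] Dc
    by blast
  have L0: "L \<le> c0" by (rule LIMSEQ_le_const2[OF L(1)]) (use Dc in auto)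
  \<comment> \<open>Near-minimisers are taken at radius 2^-(m+1), whereas midpoints are compared at
    radius 2^-m; this leaves room for the triangle inequality.\<close>
  have "\<forall>m. \<exists>wh. sobv (fst wh) (snd wh) \<and> pint M p (\<lambda>x. fst wh x - v x) \<le> (1/2) ^ Suc m \<and> en (snd wh) < D (Suc m) + (1/2) ^ m"
  proof
    fix m
    have "Inf (en ` X ((1/2) ^ Suc m)) < D (Suc m) + (1/2) ^ m" by (simp add: D_def d_def)
    then obtain e where "e \<in> en ` X ((1/2) ^ Suc m)" "e < D (Suc m) + (1/2) ^ m"
      using cInf_lessD[of "en ` X ((1/2) ^ Suc m)"] ne[of "(1/2) ^ Suc m"] by (auto simp del: power_Suc)
    then show "\<exists>wh. sobv (fst wh) (snd wh) \<and> pint M p (\<lambda>x. fst wh x - v x) \<le> (1/2) ^ Suc m \<and> en (snd wh) < D (Suc m) + (1/2) ^ m"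
      unfolding X_def by (auto simp del: power_Suc)
  qed
  from choice[OF this] obtain wh where wh: "\<forall>m. sobv (fst (wh m)) (snd (wh m)) \<and> pint M p (\<lambda>x. fst (wh m) x - v x) \<le> (1/2) ^ Suc m \<and> en (snd (wh m)) < D (Suc m) + (1/2) ^ m"
    by blast
  define w where "w m = fst (wh m)" for m
  define h where "h m = snd (wh m)" for m
  have w: "sobv (w m) (h m)" "pint M p (\<lambda>x. w m x - v x) \<le> (1/2) ^ Suc m" "en (h m) < D (Suc m) + (1/2) ^ m" for m
    using spec[OF wh, of m] by (simp_all add: w_def h_def)
  note WL = sobv_LP[OF w(1)]
  have mid: "D m \<le> en (\<lambda>x. (1/2) *\<^sub>R (h m x + h l x))" if "m \<le> l" for m l
  proof -
    have "pint M p (\<lambda>x. (1/2) *\<^sub>R (w m x + w l x) - v x) = pint M p (\<lambda>x. (1/2) *\<^sub>R ((w m x - v x) + (w l x - v x)))"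
    proof -
      have "(1/2) *\<^sub>R (w m x + w l x) - v x = (1/2) *\<^sub>R ((w m x - v x) + (w l x - v x))" for x
      proof -
        have "v x = (1/2) *\<^sub>R (v x + v x)" by (simp add: scaleR_2[symmetric])
        then show ?thesis by (metis (no_types, opaque_lifting) add_diff_add scaleR_diff_right)
      qed
      then show ?thesis by simp
    qed
    also have "\<dots> = (1/2) powr p * pint M p (\<lambda>x. (w m x - v x) + (w l x - v x))"
      unfolding pint_scaleR by simp
    \<comment> \<open>The factor (1/2)^p of the midpoint cancels the loss 2^p of the triangle
      inequality, so the two radii simply add.\<close>
    also have "\<dots> \<le> (1/2) powr p * (2 powr p * (pint M p (\<lambda>x. w m x - v x) + pint M p (\<lambda>x. w l x - v x)))"
      by (intro mult_left_mono pint_add_le LP_diff WL v p_pos) auto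
    also have "\<dots> = pint M p (\<lambda>x. w m x - v x) + pint M p (\<lambda>x. w l x - v x)"
      by (simp add: powr_divide)
    also have "\<dots> \<le> (1/2) ^ Suc m + (1/2) ^ Suc l" by (intro add_mono w)
    also have "\<dots> \<le> (1/2) ^ Suc m + (1/2) ^ Suc m" using that
      by (intro add_mono power_decreasing) auto
    also have "\<dots> = (1/2) ^ m" by simp
    finally have "(\<lambda>x. (1/2) *\<^sub>R (h m x + h l x)) \<in> X ((1/2) ^ m)"
      unfolding X_def using sobv_scale[OF sobv_add[OF w(1)[of m] w(1)[of l]], of "1/2"] by auto
    then show ?thesis unfolding D_def d_def by (intro cInf_lower bdd) auto
  qed
  define H where "H = real CARD('d) powr p / \<tau> powr (p / 2) * (L + 1)"
  have enb: "en (h m) \<le> L + (1/2) ^ m" for m using w(3)[of m] L(2)[of "Suc m"] by simp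
  have Hb: "pint M p (h m) \<le> H" for m
  proof -
    have "pint M p (h m) \<le> real CARD('d) powr p / \<tau> powr (p / 2) * en (h m)"
      by (rule pint_le_en[OF WL(2)])
    also have "\<dots> \<le> H" unfolding H_def using enb[of m] power_le_one[of "1/2::real" m]
      by (intro mult_left_mono) auto
    finally show ?thesis .
  qed
  have H0: "H \<ge> 0" using Hb[of 0] pint_nonneg[of M p "h 0"] by simp
  have cau: "\<exists>N. \<forall>m\<ge>N. \<forall>n\<ge>N. pint M p (\<lambda>x. h m x - h n x) < e"
    if e: "e > 0" for e
  proof -
    define \<epsilon> where "\<epsilon> = e / (2 * (2 * H + 1))"
    have \<epsilon>: "\<epsilon> > 0" using e H0 by (simp add: \<epsilon>_def)
    have \<epsilon>H: "\<epsilon> * (H + H) < e / 2"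
    proof -
      have "\<epsilon> * (H + H) < \<epsilon> * (2 * H + 1)" using \<epsilon>
        by (intro mult_strict_left_mono) auto
      also have "\<dots> = e / 2"
      proof -
        have "e / (2 * D) * D = e / 2" if "D > 0" for D :: real using that by simp
        from this[of "2 * H + 1"] show ?thesis unfolding \<epsilon>_def using H0 by simp
      qed
      finally show ?thesis .
    qed
    obtain C where C: "C > 0" "\<And>g h :: real^'n \<Rightarrow> (real^'n)^'d. g \<in> LP M p \<Longrightarrow> h \<in> LP M p \<Longrightarrow>
      pint M p (\<lambda>x. g x - h x) \<le> \<epsilon> * (pint M p g + pint M p h) + C * ((en g + en h) / 2 - en (\<lambda>x. (1/2) *\<^sub>R (g x + h x)))"
      by (rule gap_pint_bound[OF \<epsilon>]) (rule that)
    \<comment> \<open>For indices from m on, the energies exceed L by at most 2^-m and midpoints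
      have energy at least \<open>D m\<close>; hence the gap is at most L - D m + 2^-m, which tends
      to 0.\<close>
    have "(\<lambda>m. C * (L - D m + (1/2) ^ m)) \<longlonglongrightarrow> C * (L - L + 0)"
      by (intro tendsto_intros L(1) LIMSEQ_power_zero) auto
    then have "\<forall>\<^sub>F m in sequentially. C * (L - D m + (1/2) ^ m) < e / 2" using e
      by (intro order_tendstoD(2)) auto
    then obtain N where N: "\<And>m. m \<ge> N \<Longrightarrow> C * (L - D m + (1/2) ^ m) < e / 2"
      by (auto simp: eventually_sequentially)
    have main: "pint M p (\<lambda>x. h m x - h n x) < e" if mn: "N \<le> m" "m \<le> n" for m n
    proof -
      have "(en (h m) + en (h n)) / 2 - en (\<lambda>x. (1/2) *\<^sub>R (h m x + h n x)) \<le> L - D m + (1/2) ^ m"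
      proof -
        have "(1/2::real) ^ n \<le> (1/2) ^ m" using mn(2) by (intro power_decreasing) auto
        moreover have "(a + b) / 2 - c \<le> L - d' + s"
          if "a \<le> L + s" "b \<le> L + t" "d' \<le> c" "t \<le> s" for a b c d' s t :: real
          using that by (simp add: field_simps)
        ultimately show ?thesis using enb[of m] enb[of n] mid[OF mn(2)] by blast
      qed
      then have "C * ((en (h m) + en (h n)) / 2 - en (\<lambda>x. (1/2) *\<^sub>R (h m x + h n x))) \<le> C * (L - D m + (1/2) ^ m)"
        using C(1) by (intro mult_left_mono) auto
      moreover have "\<epsilon> * (pint M p (h m) + pint M p (h n)) \<le> \<epsilon> * (H + H)"
        using \<epsilon> Hb by (intro mult_left_mono add_mono) auto
      ultimately show ?thesis using C(2)[OF WL(2) WL(2), of m n] N[OF mn(1)] \<epsilon>H by linarith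
    qed
    have "pint M p (\<lambda>x. h m x - h n x) < e" if "m \<ge> N" "n \<ge> N" for m n
      using main[of m n] main[of n m] that pint_minus[of M p "h m" "h n"] by (cases "m \<le> n") auto
    then show ?thesis by blast
  qed
  obtain h0 where h0: "h0 \<in> LP M p" "(\<lambda>m. pint M p (\<lambda>x. h m x - h0 x)) \<longlonglongrightarrow> 0"
    by (rule LP_complete[OF WL(2) p_pos(1) cau]) (assumption, rule that)
  have "(\<lambda>m. pint M p (\<lambda>x. w m x - v x)) \<longlonglongrightarrow> 0"
  proof (rule tendsto_sandwich[OF _ _ tendsto_const])
    show "(\<lambda>m. (1/2::real) ^ Suc m) \<longlonglongrightarrow> 0"
      by (intro LIMSEQ_Suc LIMSEQ_power_zero) auto
  qed (use w(2) in \<open>auto intro!: always_eventually simp: pint_nonneg simp del: power_Suc\<close>)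
  then have 1: "sobv v h0" by (rule sobv_limit[OF w(1) v h0(1) _ h0(2)])
  have "en h0 \<le> L"
  proof (rule LIMSEQ_le[OF en_tendsto[OF WL(2) h0]])
    show "(\<lambda>m. L + (1/2) ^ m) \<longlonglongrightarrow> L"
      using tendsto_add[OF tendsto_const LIMSEQ_power_zero[of "1/2::real"], of L] by simp
    show "\<exists>N. \<forall>n\<ge>N. en (h n) \<le> L + (1/2) ^ n" using enb by blast
  qed
  with L0 have "en h0 \<le> c0" by simp
  with 1 show ?thesis by (rule that)
qed

end

section \<open>The first eigenvalue\<close>

text \<open>Differentiating H(\<rho> s) = \<rho>^r H(s) in s makes the partial derivatives
  homogeneous of degree r - 1; their growth bound is then the compactness bound for homogeneous
  functions.\<close>

lemma C1_homogeneous: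
  fixes H :: "real^'d \<Rightarrow> real"
  assumes C1: "Ck 1 H" and hom: "homogeneous r H" and r: "1 < r"
  shows C1_homogeneous_continuous: "continuous_on UNIV H"
    and C1_homogeneous_partial_continuous: "continuous_on UNIV (partial_deriv j H)"
    and C1_homogeneous_partial_scale: "\<rho> > 0 \<Longrightarrow> partial_deriv j H (\<rho> *\<^sub>R s) = \<rho> powr (r - 1) * partial_deriv j H s"
    and C1_homogeneous_line_deriv: "((\<lambda>t. H (v + t *\<^sub>R axis j \<phi>)) has_real_derivative partial_deriv j H (v + t *\<^sub>R axis j \<phi>) * \<phi>) (at t)"
    and C1_homogeneous_partial_bound: "\<exists>C>0. \<forall>s. \<bar>partial_deriv j H s\<bar> \<le> C * norm s powr (r - 1)"
proof -
  have dH: "(H has_derivative (\<lambda>h. grad H s \<bullet> h)) (at s)" for s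
    using C1 by (intro has_derivative_grad) (auto simp: differentiable_on_def)
  show "continuous_on UNIV H" using C1 by (auto intro: differentiable_imp_continuous_on)
  show cp: "continuous_on UNIV (partial_deriv j H)" using C1 by auto
  show sc: "partial_deriv j H (\<rho> *\<^sub>R s) = \<rho> powr (r - 1) * partial_deriv j H s"
    if \<rho>: "\<rho> > 0" for \<rho> s
  proof -
    have "((\<lambda>s. \<rho> *\<^sub>R s) has_derivative (\<lambda>h. \<rho> *\<^sub>R h)) (at s)"
      by (rule bounded_linear_imp_has_derivative[OF bounded_linear_scaleR_right])
    from has_derivative_compose[OF this dH] have "((\<lambda>s. H (\<rho> *\<^sub>R s)) has_derivative (\<lambda>h. grad H (\<rho> *\<^sub>R s) \<bullet> (\<rho> *\<^sub>R h))) (at s)" .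
    from partial_deriv_eqI[OF this, of j]
    have 1: "partial_deriv j (\<lambda>s. H (\<rho> *\<^sub>R s)) s = \<rho> * partial_deriv j H (\<rho> *\<^sub>R s)"
      by (simp add: inner_axis grad_def)
    have e: "(\<lambda>s. H (\<rho> *\<^sub>R s)) = (\<lambda>s. \<rho> powr r * H s)" using hom \<rho>
      by (auto simp: homogeneous_def)
    have "((\<lambda>s. \<rho> powr r * H s) has_derivative (\<lambda>h. \<rho> powr r * (grad H s \<bullet> h))) (at s)"
      by (rule has_derivative_mult_right[OF dH])
    from partial_deriv_eqI[OF this, of j]
    have 2: "partial_deriv j (\<lambda>s. \<rho> powr r * H s) s = \<rho> powr r * partial_deriv j H s"
      by (simp add: inner_axis grad_def)
    have "\<rho> * partial_deriv j H (\<rho> *\<^sub>R s) = \<rho> powr r * partial_deriv j H s" using 1 2 e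
      by simp
    moreover have "\<rho> powr r = \<rho> * \<rho> powr (r - 1)" using \<rho> by (simp add: powr_diff)
    ultimately show ?thesis using \<rho> by simp
  qed
  show "((\<lambda>t. H (v + t *\<^sub>R axis j \<phi>)) has_real_derivative partial_deriv j H (v + t *\<^sub>R axis j \<phi>) * \<phi>) (at t)"
  proof -
    have "((\<lambda>t. v + t *\<^sub>R axis j \<phi>) has_derivative (\<lambda>h. h *\<^sub>R axis j \<phi>)) (at t)"
      by (rule has_derivative_eq_rhs) (rule derivative_intros | simp)+
    from has_derivative_compose[OF this dH] show ?thesis
      unfolding has_field_derivative_def by (rule has_derivative_eq_rhs) (auto simp: inner_axis grad_def)
  qed
  \<comment> \<open>The general growth bound has a compact parameter space; here it is a single
    point.\<close>
  have "continuous_on ({0::real} \<times> UNIV) (\<lambda>(x, v). partial_deriv j H v)"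
    unfolding case_prod_beta by (rule continuous_on_compose2[OF cp]) (auto intro: continuous_intros)
  then obtain C where "C > 0" "\<And>x v. x \<in> {0::real} \<Longrightarrow> \<bar>partial_deriv j H v\<bar> \<le> C * norm v powr (r - 1)"
    by (rule homogeneous_bound[rotated, of _ _ "r - 1"]) (use r sc in auto)
  then show "\<exists>C>0. \<forall>s. \<bar>partial_deriv j H s\<bar> \<le> C * norm s powr (r - 1)" by auto
qed

lemma norm_axis_real: "norm (axis j (c::real) :: real^'d) = \<bar>c\<bar>"
proof -
  have "axis j c = c *\<^sub>R (axis j 1 :: real^'d)" by (simp add: vec_eq_iff axis_def)
  then show ?thesis by simp
qed

text \<open>The bound is uniform in t and integrable for v and \<phi> in L^r, so it dominates the
  difference quotients of the integral of H.\<close>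

lemma C1_homogeneous_line_bound:
  fixes H :: "real^'d \<Rightarrow> real"
  assumes "Ck 1 H" "homogeneous r H" "1 < r"
  obtains C where "C > 0" "\<And>v t \<phi>. 0 \<le> t \<Longrightarrow> t \<le> 1 \<Longrightarrow>
    \<bar>partial_deriv j H (v + t *\<^sub>R axis j \<phi>) * \<phi>\<bar> \<le> C * (norm v powr r + \<bar>\<phi>\<bar> powr r)"
proof -
  obtain C where C: "C > 0" "\<And>s. \<bar>partial_deriv j H s\<bar> \<le> C * norm s powr (r - 1)"
    using C1_homogeneous_partial_bound[OF assms] by blast
  show ?thesis
  proof (rule that[of "C * 2 powr r"])
    fix v :: "real^'d" and t \<phi> :: real assume t: "0 \<le> t" "t \<le> 1"
    define n where "n = norm v + \<bar>\<phi>\<bar>"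
    have "norm (v + t *\<^sub>R axis j \<phi>) \<le> norm v + t * \<bar>\<phi>\<bar>"
      using norm_triangle_ineq[of v "t *\<^sub>R axis j \<phi>"] t by (simp add: norm_axis_real)
    also have "\<dots> \<le> n" using t by (simp add: n_def mult_left_le_one_le)
    finally have le: "norm (v + t *\<^sub>R axis j \<phi>) \<le> n" .
    have "\<bar>partial_deriv j H (v + t *\<^sub>R axis j \<phi>) * \<phi>\<bar> \<le> (C * n powr (r - 1)) * n"
      unfolding abs_mult
    proof (rule mult_mono)
      have "norm (v + t *\<^sub>R axis j \<phi>) powr (r - 1) \<le> n powr (r - 1)" using le assms(3)
        by (intro powr_mono2) auto
      then show "\<bar>partial_deriv j H (v + t *\<^sub>R axis j \<phi>)\<bar> \<le> C * n powr (r - 1)"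
        using C(2)[of "v + t *\<^sub>R axis j \<phi>"] C(1) by (meson mult_left_mono order_trans less_imp_le)
    qed (use C in \<open>auto simp: n_def\<close>)
    also have "\<dots> = C * n powr r"
      by (cases "n = 0") (auto simp: powr_diff n_def)
    also have "n powr r \<le> 2 powr r * (norm v powr r + \<bar>\<phi>\<bar> powr r)" unfolding n_def
      using assms(3) by (intro powr_add_le) auto
    finally show "\<bar>partial_deriv j H (v + t *\<^sub>R axis j \<phi>) * \<phi>\<bar> \<le> C * 2 powr r * (norm v powr r + \<bar>\<phi>\<bar> powr r)"
      using C(1) by (simp add: mult_left_mono mult.assoc)
  qed (use C in simp)
qed

lemma continuous_const_fst: "continuous_on UNIV H \<Longrightarrow> continuous_on (S \<times> UNIV) (\<lambda>(x, v). H v)"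
  unfolding case_prod_beta by (rule continuous_on_compose2) (auto intro: continuous_intros)

context elliptic
begin

section \<open>Homogeneous integrands over \<Omega>\<close>

lemma homogeneous_LP_integrable:
  fixes H :: "real^'d \<Rightarrow> real"
  assumes "continuous_on UNIV H" "homogeneous r H" "0 < r" "u \<in> LP M r"
  shows "integrable M (\<lambda>x. H (u x))"
proof -
  have "(\<lambda>x. H (u x)) \<in> borel_measurable M"
    using measurable_compose[OF LP_D(1)[OF assms(4)] borel_measurable_continuous_onI[OF assms(1)]] .
  then show ?thesis
    using homogeneous_integrable[OF K_compact continuous_const_fst[OF assms(1)] assms(3) _ _ _ assms(4)] assms(2) \<Omega>_K
    by (auto simp: homogeneous_def)
qed

lemma homogeneous_LP_tendsto:
  fixes H :: "real^'d \<Rightarrow> real"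
  assumes "continuous_on UNIV H" "homogeneous r H" "0 < r" "\<And>k. u k \<in> LP M r" "v \<in> LP M r"
    "(\<lambda>k. pint M r (\<lambda>x. u k x - v x)) \<longlonglongrightarrow> 0"
  shows "(\<lambda>k. LINT x|M. H (u k x)) \<longlonglongrightarrow> (LINT x|M. H (v x))"
  by (rule homogeneous_integral_tendsto[OF K_compact continuous_const_fst[OF assms(1)] assms(3) _ _ _ assms(4,5,6)])
    (use assms(2) \<Omega>_K measurable_compose[OF _ borel_measurable_continuous_onI[OF assms(1)]] in \<open>auto simp: homogeneous_def\<close>)

lemma E_integrable:
  assumes "g \<in> LP M p"
  shows "integrable M (\<lambda>x. E x (g x))"
  by (rule homogeneous_integrable[OF K_compact E_continuous p_pos(1) _ _ E_measurable[OF LP_D(1)[OF assms]] assms])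
    (use \<Omega>_K in \<open>auto simp: E_scale\<close>)

lemma en_components:
  fixes g :: "real^'n \<Rightarrow> (real^'n)^'d"
  assumes "g \<in> LP M p"
  shows "en g = (\<Sum>j\<in>UNIV. LINT x|M. E x (g x $ j))"
  unfolding en_def EV_def using E_integrable[OF LP_component(1)[OF assms p_pos(2)]]
    by (intro Bochner_Integration.integral_sum) auto

lemma weak_grad_energy:
  assumes "sob \<Omega> p u g"
  shows "(LINT x|M. ((A x *v weak_grad \<Omega> u x) \<bullet> weak_grad \<Omega> u x) powr (p / 2)) = (LINT x|M. E x (g x))"
proof -
  note w = sob_has_weak_gradient[OF assms]
  have "(LINT x|M. E x (weak_grad \<Omega> u x)) = (LINT x|M. E x (g x))"
    using weak_grad_AE[OF w] E_measurable[OF LP_D(1)[OF weak_grad_LP(1)[OF w sob_LP(2)[OF assms]]]] E_measurable[OF LP_D(1)[OF sob_LP(2)[OF assms]]]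
    by (intro integral_cong_AE) (auto elim: eventually_mono)
  then show ?thesis by (simp add: E_def B_def)
qed

abbreviation "lam1 \<equiv> lambda1 \<Omega> A p"

abbreviation "energies \<equiv> {LINT x|M. ((A x *v weak_grad \<Omega> u x) \<bullet> weak_grad \<Omega> u x) powr (p / 2) | u. u \<in> W01p \<Omega> p \<and> Lp_norm \<Omega> p u = 1}"

text \<open>The gradient becomes part of the data, because \<open>weak_grad\<close> agrees with it
  almost everywhere. The facts on \<open>lambda1\<close> below rest on this form.\<close>

lemma energies_eq: "energies = {LINT x|M. E x (g x) | u g. sob \<Omega> p u g \<and> pint M p u = 1}"
proof -
  have n: "Lp_norm \<Omega> p u = 1 \<longleftrightarrow> pint M p u = 1"
    for u :: "real^'n \<Rightarrow> real"
  proof -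
    have "(pint M p u powr (1 / p)) powr p = pint M p u" using p_pos pint_nonneg[of M p u]
      by (simp add: powr_powr)
    then show ?thesis unfolding Lp_norm_eq by (metis powr_one_eq_one)
  qed
  show ?thesis
  proof (intro equalityI subsetI)
    fix y assume "y \<in> energies"
    then obtain u where u: "u \<in> W01p \<Omega> p" "Lp_norm \<Omega> p u = 1" "y = (LINT x|M. ((A x *v weak_grad \<Omega> u x) \<bullet> weak_grad \<Omega> u x) powr (p / 2))" by blast
    show "y \<in> {LINT x|M. E x (g x) | u g. sob \<Omega> p u g \<and> pint M p u = 1}"
      using W01p_sob[OF u(1)] weak_grad_energy[OF W01p_sob[OF u(1)]] u n by blast
  next
    fix y assume "y \<in> {LINT x|M. E x (g x) | u g. sob \<Omega> p u g \<and> pint M p u = 1}"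
    then obtain u g where u: "sob \<Omega> p u g" "pint M p u = 1" "y = (LINT x|M. E x (g x))" by blast
    then show "y \<in> energies" using sob_W01p[OF u(1)] weak_grad_energy[OF u(1)] n by force
  qed
qed

lemma normalising_factor:
  assumes "0 < y"
  shows "\<bar>y powr (- 1 / p)\<bar> powr p = 1 / y"
proof -
  have "\<bar>y powr (- 1 / p)\<bar> powr p = y powr (- 1 / p * p)"
    by (simp only: powr_powr abs_of_nonneg powr_ge_zero)
  also have "- 1 / p * p = - 1" using p_pos by simp
  also have "y powr - 1 = 1 / y" using assms by (simp add: powr_minus inverse_eq_divide)
  finally show ?thesis .
qed

lemma energies_bdd: "bdd_below energies"
  by (intro bdd_belowI[of _ 0]) (auto intro!: integral_nonneg_AE)

lemma lambda1_le:
  assumes s: "sob \<Omega> p u g"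
  shows "lam1 * pint M p u \<le> (LINT x|M. E x (g x))"
proof (cases "pint M p u = 0")
  case True
  then show ?thesis by (auto intro!: integral_nonneg_AE simp: E_nonneg)
next
  case False
  define y where "y = pint M p u"
  have y: "y > 0" using False pint_nonneg[of M p u] by (simp add: y_def)
  define c where "c = y powr (- 1 / p)"
  have c: "\<bar>c\<bar> powr p = 1 / y" unfolding c_def by (rule normalising_factor[OF y])
  have "pint M p (\<lambda>x. c * u x) = 1" using pint_scaleR[of M p c u] c y by (simp add: y_def)
  with sob_scale[OF s, of c] have "\<exists>w h. (LINT x|M. E x (c *\<^sub>R g x)) = (LINT x|M. E x (h x)) \<and> sob \<Omega> p w h \<and> pint M p w = 1"
    by (intro exI[of _ "\<lambda>x. c * u x"] exI[of _ "\<lambda>x. c *\<^sub>R g x"]) simp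
  then have "(LINT x|M. E x (c *\<^sub>R g x)) \<in> energies" unfolding energies_eq by simp
  then have "lam1 \<le> (LINT x|M. E x (c *\<^sub>R g x))" unfolding lambda1_def
    by (rule cInf_lower[OF _ energies_bdd])
  also have "\<dots> = (LINT x|M. (1 / y) * E x (g x))"
    by (intro Bochner_Integration.integral_cong) (auto simp: E_scale[OF \<Omega>_K] c)
  also have "\<dots> = (1 / y) * (LINT x|M. E x (g x))" by simp
  finally show ?thesis using y by (simp add: y_def field_simps)
qed

lemma E_pint_lower:
  assumes "g \<in> LP M p"
  shows "\<tau> powr (p / 2) * pint M p g \<le> (LINT x|M. E x (g x))"
proof -
  have "(LINT x|M. \<tau> powr (p / 2) * norm (g x) powr p) \<le> (LINT x|M. E x (g x))"
    using LP_D(2)[OF assms] E_integrable[OF assms] E_lower[OF \<Omega>_K] by (intro integral_mono) auto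
  then show ?thesis by (simp add: pint_def)
qed

text \<open>Guarantees that the set of energies is not empty, so that its \<open>Inf\<close> is a
  true infimum; a bump is positive on an open box, which is not a null set.\<close>

lemma exists_normalised:
  assumes "\<Omega> \<noteq> {}"
  shows "\<exists>u g. sob \<Omega> p u g \<and> pint M p u = 1"
proof -
  obtain x0 where "x0 \<in> \<Omega>" using assms by blast
  then obtain a b where ab: "cbox a b \<subseteq> \<Omega>" "x0 \<in> box a b"
    using open_contains_cbox[OF open_\<Omega>] by metis
  let ?\<phi> = "bump a b 1"
  have t: "?\<phi> \<in> test_functions \<Omega>" by (rule bump_test[OF _ ab(1)]) simp
  have "pint M p ?\<phi> \<noteq> 0"
  proof
    assume "pint M p ?\<phi> = 0"
    then have "AE x in M. norm (?\<phi> x) powr p = 0"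
      unfolding pint_def using LP_D(2)[OF test_LP(1)[OF open_\<Omega> t p_pos(1)]]
      by (subst (asm) integral_nonneg_eq_0_iff_AE) auto
    then have "AE x in M. x \<notin> box a b"
    proof eventually_elim
      case (elim x)
      show ?case
      proof
        assume x: "x \<in> box a b"
        have "?\<phi> x > 0" unfolding bump_def
          using x by (intro prod_pos mult_pos_pos) (auto simp: flat_exp_1 mem_box_cart)
        then show False using elim by simp
      qed
    qed
    then have "AE x in lebesgue. x \<in> \<Omega> \<longrightarrow> x \<notin> box a b" using \<Omega>_sets
      by (subst (asm) AE_restrict_space_iff) auto
    then have "AE x in lebesgue. x \<notin> box a b"
      by eventually_elim (use ab box_subset_cbox[of a b] in auto)
    then have "box a b \<in> null_sets lebesgue" by (subst (asm) AE_iff_null_sets[symmetric]) auto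
    then have "negligible (box a b)" by (simp add: negligible_iff_null_sets)
    then show False using ab(2) by (simp add: negligible_interval(2))
  qed
  then have y: "pint M p ?\<phi> > 0" using pint_nonneg[of M p ?\<phi>] by simp
  define c where "c = pint M p ?\<phi> powr (- 1 / p)"
  have c: "\<bar>c\<bar> powr p = 1 / pint M p ?\<phi>" unfolding c_def by (rule normalising_factor[OF y])
  have "pint M p (\<lambda>x. c * ?\<phi> x) = 1" using pint_scaleR[of M p c ?\<phi>] c y by simp
  then show ?thesis using sob_scale[OF sob_test[OF t], of c] by blast
qed

lemma sobolev_exponent:
  obtains C where "C > 0" "\<And>u g. sob \<Omega> p u g \<Longrightarrow> u \<in> LP M q \<and> pint M q u powr (p / q) \<le> C * pint M p g"
proof (rule sobolev_sob)
  fix C assume C: "C > 0" and S: "\<And>T T' u g. sob \<Omega> p u g \<Longrightarrow> (\<And>s. (T has_real_derivative T' s) (at s)) \<Longrightarrow> continuous_on UNIV T' \<Longrightarrow> (\<And>s. \<bar>T' s\<bar> \<le> 1) \<Longrightarrow> T 0 = 0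
      \<Longrightarrow> (\<lambda>x. T (u x)) \<in> LP M q \<and> pint M q (\<lambda>x. T (u x)) powr (p / q) \<le> C * pint M p (\<lambda>x. T' (u x) *\<^sub>R g x)"
  show thesis
  proof (rule that[OF C])
    fix u g assume s: "sob \<Omega> p u g"
    show "u \<in> LP M q \<and> pint M q u powr (p / q) \<le> C * pint M p g"
      using S[OF s, of "\<lambda>s. s" "\<lambda>_. 1"] by simp
  qed
qed

text \<open>Poincare's inequality from the Sobolev inequality and the finite measure of \<Omega>,
  combined with ellipticity.\<close>

lemma lambda1_pos:
  assumes "\<Omega> \<noteq> {}"
  shows "lam1 > 0"
proof -
  obtain C where C: "C > 0" "\<And>u g. sob \<Omega> p u g \<Longrightarrow> u \<in> LP M q \<and> pint M q u powr (p / q) \<le> C * pint M p g"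
    by (rule sobolev_exponent) (rule that)
  define V where "V = (measure M (space M)) powr (1 - p / q)"
  \<comment> \<open>\<open>V + 1\<close> makes the denominator positive whatever the measure of
    \<Omega>.\<close>
  define c0 where "c0 = \<tau> powr (p / 2) / (C * (V + 1))"
  have V0: "V \<ge> 0" by (simp add: V_def)
  have c0: "c0 > 0" using C V0 \<tau> by (simp add: c0_def)
  have "c0 \<le> y" if y: "y \<in> energies" for y
  proof -
    obtain u g where u: "sob \<Omega> p u g" "pint M p u = 1" "y = (LINT x|M. E x (g x))"
      using y[unfolded energies_eq] by blast
    have "1 \<le> V * (pint M q u) powr (p / q)"
      using LP_exponent(2)[OF p_pos(1) pq(1)] C(2)[OF u(1)] u(2) unfolding V_def by fastforce
    also have "\<dots> \<le> V * (C * pint M p g)" using C(2)[OF u(1)] V0 by (intro mult_left_mono) auto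
    also have "\<dots> \<le> (V + 1) * (C * pint M p g)" using C(1) pint_nonneg[of M p g]
      by (intro mult_right_mono) auto
    finally have "1 \<le> pint M p g * (C * (V + 1))" by (simp only: ac_simps)
    moreover have "0 < C * (V + 1)" using C(1) V0 by simp
    ultimately have "1 / (C * (V + 1)) \<le> pint M p g" by (simp only: pos_divide_le_eq)
    then have "\<tau> powr (p / 2) * (1 / (C * (V + 1))) \<le> \<tau> powr (p / 2) * pint M p g"
      by (intro mult_left_mono) auto
    also have "\<dots> \<le> y" unfolding u(3) by (rule E_pint_lower[OF sob_LP(2)[OF u(1)]])
    finally show ?thesis by (simp add: c0_def)
  qed
  moreover have "energies \<noteq> {}" unfolding energies_eq using exists_normalised[OF assms] by auto
  ultimately have "c0 \<le> lam1" unfolding lambda1_def by (intro cInf_greatest) auto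
  then show ?thesis using c0 by simp
qed

lemma lambda1_approx:
  assumes "\<Omega> \<noteq> {}" "\<epsilon> > 0"
  obtains u g where "sob \<Omega> p u g" "pint M p u = 1" "(LINT x|M. E x (g x)) < lam1 + \<epsilon>"
proof -
  have ne: "energies \<noteq> {}" unfolding energies_eq using exists_normalised[OF assms(1)] by auto
  have "Inf energies < lam1 + \<epsilon>" using assms(2) by (simp add: lambda1_def)
  then obtain y where "y \<in> energies" "y < lam1 + \<epsilon>" using cInf_lessD[OF ne] by blast
  then show ?thesis using that unfolding energies_eq by blast
qed

lemma sobv_LPq: "sobv u g \<Longrightarrow> u \<in> LP M q"
proof -
  assume s: "sobv u g"
  obtain C where C: "C > 0" "\<And>u g. sob \<Omega> p u g \<Longrightarrow> u \<in> LP M q \<and> pint M q u powr (p / q) \<le> C * pint M p g"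
    by (rule sobolev_exponent) (rule that)
  show ?thesis by (rule LP_vecI(1)[OF _ pq(4)]) (use C(2) s in \<open>auto simp: sobv_def\<close>)
qed

text \<open>With \<epsilon> = 2^-p / 2 the contribution of \<Xi> is at most half of the left side
  plus terms in H, and can be absorbed. Only |H|^p remains, and H will be the gradient of the fixed
  limit.\<close>

lemma gap_bound_one_sided:
  obtains C where "C > 0" "\<And>x \<Xi> H :: (real^'n)^'d. x \<in> K \<Longrightarrow> norm (\<Xi> - H) powr p \<le> 2 * norm H powr p + C * gap x \<Xi> H"
proof -
  define P where "P = (2::real) powr p"
  have P: "P \<ge> 1" unfolding P_def using p_pos by (intro ge_one_powr_ge_zero) auto
  have e: "1 / (2 * P) > 0" using P by simp
  obtain C where C: "C > 0" "\<And>x \<Xi> H :: (real^'n)^'d. x \<in> K \<Longrightarrow>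
      norm (\<Xi> - H) powr p \<le> 1 / (2 * P) * (norm \<Xi> powr p + norm H powr p) + C * gap x \<Xi> H"
    by (rule gap_bound[OF e]) (rule that)
  show ?thesis
  proof (rule that[of "2 * C"])
    fix x and \<Xi> H :: "(real^'n)^'d" assume x: "x \<in> K"
    define b where "b = norm (\<Xi> - H) powr p"
    define h where "h = norm H powr p"
    have h0: "h \<ge> 0" by (simp add: h_def)
    have "norm \<Xi> powr p \<le> P * (b + h)"
      using norm_add_powr_le[OF p_pos(2), of "\<Xi> - H" H] by (simp add: b_def h_def P_def)
    then have "1 / (2 * P) * (norm \<Xi> powr p + h) \<le> 1 / (2 * P) * (P * (b + h) + h)" using P
      by (intro mult_left_mono) auto
    also have "\<dots> = b / 2 + h / 2 + h / (2 * P)" using P by (simp add: field_simps)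
    also have "h / (2 * P) \<le> h / 2" using P h0 by (intro divide_left_mono) auto
    finally have "b \<le> b / 2 + h / 2 + h / 2 + C * gap x \<Xi> H" using C(2)[OF x, of \<Xi> H]
      by (simp add: b_def h_def)
    then show "norm (\<Xi> - H) powr p \<le> 2 * norm H powr p + 2 * C * gap x \<Xi> H"
      by (simp add: b_def h_def)
  qed (use C in simp)
qed

end

section \<open>Constrained minimisation at the critical exponent\<close>

locale critical = elliptic \<Omega> p q A \<tau>
  for \<Omega> :: "(real^'n) set" and p q :: real and A \<tau> +
  fixes G :: "real^'d \<Rightarrow> real"
  assumes \<Omega>_nonempty: "\<Omega> \<noteq> {}" and G_C1: "Ck 1 G" and G_hom: "homogeneous q G" and G_pos: "\<And>s. s \<noteq> 0 \<Longrightarrow> G s > 0"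
begin

definition IG :: "(real^'n \<Rightarrow> real^'d) \<Rightarrow> real" where
  "IG u = (LINT x|M. G (u x))"

lemma G_continuous: "continuous_on UNIV G"
  by (rule C1_homogeneous_continuous[OF G_C1 G_hom pq(3)])

lemma G_upper: obtains C where "C > 0" "\<And>s. G s \<le> C * norm s powr q"
proof -
  obtain C where C: "C > 0" "\<And>x s. x \<in> K \<Longrightarrow> \<bar>G s\<bar> \<le> C * norm s powr q"
    by (rule homogeneous_bound[OF K_compact continuous_const_fst[OF G_continuous] pq(2)])
      (use G_hom in \<open>auto simp: homogeneous_def\<close>)
  obtain x0 where "x0 \<in> K" using \<Omega>_nonempty \<Omega>_K by blast
  then show ?thesis using C abs_le_D1 by (intro that[of C]) blast+
qed

lemma G_nonneg: "0 \<le> G s"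
proof (cases "s = 0")
  case True
  have "G (2 *\<^sub>R 0) = 2 powr q * G 0" using G_hom unfolding homogeneous_def by (metis zero_less_numeral)
  moreover have "2 powr q > (1::real)" using pq by (simp add: gr_one_powr)
  ultimately show ?thesis using True pq by simp
qed (use G_pos[of s] in simp)

text \<open>G is positive off the origin, so compactness applies with N = G; the remaining half of
  the power is absorbed on the left.\<close>

lemma G_lower: obtains C where "C > 0" "\<And>s. norm s powr q \<le> C * G s"
proof -
  have c1: "continuous_on (K \<times> UNIV) (\<lambda>(x, v::real^'d). norm v powr q)"
    unfolding case_prod_beta using pq by (intro continuous_on_powr' continuous_intros) auto
  obtain C where C: "C \<ge> 0" "\<And>x s. x \<in> K \<Longrightarrow> norm s powr q \<le> 1/2 * norm s powr q + C * G s"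
  proof (rule homogeneous_compact_bound[OF K_compact c1 continuous_const_fst[OF G_continuous], of q "1/2"])
    show "\<And>x v. x \<in> K \<Longrightarrow> v \<noteq> 0 \<Longrightarrow> G v = 0 \<Longrightarrow> norm v powr q \<le> 0" using G_pos by force
  qed (use G_hom G_nonneg pq in \<open>auto simp: homogeneous_def powr_mult\<close>)
  obtain x0 where x0: "x0 \<in> K" using \<Omega>_nonempty \<Omega>_K by blast
  show ?thesis
  proof (rule that[of "2 * C + 1"])
    fix s show "norm s powr q \<le> (2 * C + 1) * G s"
      using C(2)[OF x0, of s] G_nonneg[of s] by (simp add: distrib_right)
  qed (use C in simp)
qed

lemma IG_integrable: "u \<in> LP M q \<Longrightarrow> integrable M (\<lambda>x. G (u x))"
  by (rule homogeneous_LP_integrable[OF G_continuous G_hom pq(2)])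

lemma IG_nonneg: "0 \<le> IG u"
  unfolding IG_def by (rule integral_nonneg_AE) (simp add: G_nonneg)

lemma IG_scale: "c > 0 \<Longrightarrow> IG (\<lambda>x. c *\<^sub>R u x) = c powr q * IG u"
  using G_hom by (simp add: IG_def homogeneous_def)

text \<open>A C^1 substitute for cutting off small values: the derivative s^2/(1+s^2) lies between 0
  and 1 and vanishes at 0, while large s lose less than pi/2.\<close>

definition trunc :: "real \<Rightarrow> real" where
  "trunc s = s - arctan s"

definition trunc' :: "real \<Rightarrow> real" where
  "trunc' s = 1 - inverse (1 + s\<^sup>2)"

lemma trunc_deriv: "(trunc has_real_derivative trunc' s) (at s)"
  unfolding trunc_def[abs_def] trunc'_def by (auto intro!: derivative_eq_intros)

lemma trunc'_bound: "\<bar>trunc' s\<bar> \<le> 1"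
proof -
  have "0 < 1 + s\<^sup>2" by (simp add: add_pos_nonneg)
  then have "0 \<le> inverse (1 + s\<^sup>2)" "inverse (1 + s\<^sup>2) \<le> 1"
    by (auto simp: inverse_le_1_iff)
  then show ?thesis by (simp add: trunc'_def)
qed

lemma trunc'_continuous: "continuous_on UNIV trunc'"
proof -
  have "1 + s\<^sup>2 \<noteq> 0" for s :: real
    by (metis add_pos_nonneg less_irrefl zero_le_power2 zero_less_one)
  then show ?thesis unfolding trunc'_def[abs_def] by (intro continuous_intros) auto
qed

lemma trunc_0: "trunc 0 = 0" "trunc' 0 = 0"
  by (simp_all add: trunc_def trunc'_def)

text \<open>For |s| >= 4 the loss \<open>arctan s\<close> is below 2, hence at most half of |s|; for
  |s| < 4 the difference of the exponents costs at most \<open>4 powr q\<close>.\<close>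

lemma abs_powr_le_trunc: "\<bar>s\<bar> powr q \<le> 2 powr q * \<bar>trunc s\<bar> powr q + 4 powr q * \<bar>s\<bar> powr p"
proof (cases "\<bar>s\<bar> \<ge> 4")
  case True
  have "\<bar>arctan s\<bar> < pi / 2" using arctan_bounded[of s] by auto
  also have "pi / 2 < 2" using pi_less_4 by simp
  finally have "\<bar>s\<bar> \<le> 2 * \<bar>trunc s\<bar>" using True
    by (simp add: trunc_def abs_if split: if_splits)
  then have "\<bar>s\<bar> powr q \<le> (2 * \<bar>trunc s\<bar>) powr q" using pq by (intro powr_mono2) auto
  then show ?thesis by (simp add: powr_mult add_increasing2)
next
  case False
  show ?thesis
  proof (cases "s = 0")
    case sn: False
    have "\<bar>s\<bar> powr q = \<bar>s\<bar> powr (q - p) * \<bar>s\<bar> powr p" using sn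
      by (simp add: powr_diff)
    also have "\<bar>s\<bar> powr (q - p) \<le> 4 powr (q - p)" using False pq by (intro powr_mono2) auto
    also have "4 powr (q - p) \<le> (4::real) powr q" using p_pos by (intro powr_mono) auto
    finally have "\<bar>s\<bar> powr q \<le> 4 powr q * \<bar>s\<bar> powr p" by (simp add: mult_right_mono)
    then show ?thesis by (simp add: add_increasing)
  qed (use pq in simp)
qed

text \<open>Collects what a minimising sequence supplies without mentioning F, so that the constants
  derived from it are the same for all F. The last clause says that \<Gamma> asymptotically bounds
  the integrated \<open>gap\<close> between \<open>g k\<close> and h.\<close>

definition near_min :: "(nat \<Rightarrow> real^'n \<Rightarrow> real^'d) \<Rightarrow> (nat \<Rightarrow> real^'n \<Rightarrow> (real^'n)^'d) \<Rightarrow> (real^'n \<Rightarrow> real^'d) \<Rightarrow> (real^'n \<Rightarrow> (real^'n)^'d) \<Rightarrow> real \<Rightarrow> bool" where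
  "near_min u g v h \<Gamma> \<longleftrightarrow> (\<forall>k. sobv (u k) (g k)) \<and> sobv v h \<and> (\<lambda>k. pint M p (\<lambda>x. u k x - v x)) \<longlonglongrightarrow> 0
    \<and> (AE x in M. (\<lambda>k. u k x) \<longlonglongrightarrow> v x) \<and> (\<forall>k. IG (u k) = 1) \<and> 0 \<le> \<Gamma>
    \<and> (\<forall>\<epsilon>>0. \<forall>\<^sub>F k in sequentially. (en (g k) + en h) / 2 - en (\<lambda>x. (1/2) *\<^sub>R (g k x + h x)) \<le> \<Gamma> + \<epsilon>)"

text \<open>The mass lost in the limit is superlinearly small in the energy defect \<open>\<Gamma>\<close>: it is carried by
  the region where \<open>u k - v\<close> is large, and applying the Sobolev inequality to
  \<open>trunc (u k - v)\<close> only costs the gradient on that region, where \<open>\<nabla>v\<close>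
    is negligible.\<close>

lemma concentration:
  "\<exists>C>0. \<forall>u g v h \<Gamma>. near_min u g v h \<Gamma> \<longrightarrow> 1 - IG v \<le> C * \<Gamma> powr (q / p)"
proof (rule sobolev_sob)
  fix Cs assume Cs: "Cs > 0" and S: "\<And>T T' u g. sob \<Omega> p u g \<Longrightarrow> (\<And>s. (T has_real_derivative T' s) (at s)) \<Longrightarrow> continuous_on UNIV T' \<Longrightarrow> (\<And>s. \<bar>T' s\<bar> \<le> 1) \<Longrightarrow> T 0 = 0
      \<Longrightarrow> (\<lambda>x. T (u x)) \<in> LP M q \<and> pint M q (\<lambda>x. T (u x)) powr (p / q) \<le> Cs * pint M p (\<lambda>x. T' (u x) *\<^sub>R g x)"
  obtain Cg where Cg: "Cg > 0" "\<And>x \<Xi> H :: (real^'n)^'d. x \<in> K \<Longrightarrow> norm (\<Xi> - H) powr p \<le> 2 * norm H powr p + Cg * gap x \<Xi> H"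
    by (rule gap_bound_one_sided) (rule that)
  obtain CG where CG: "CG > 0" "\<And>s. G s \<le> CG * norm s powr q" by (rule G_upper) (rule that)
  define C1 where "C1 = CG * 2 powr q"
  have C1: "C1 > 0" using CG by (simp add: C1_def)
  define n where "n = real CARD('d)"
  have n: "n > 0" by (simp add: n_def)
  define C3 where "C3 = C1 * (n powr q * (n * (2 powr q * (Cs * Cg) powr (q / p))))"
  have C3: "C3 > 0" using C1 n Cs Cg by (simp add: C3_def)
  have "1 - IG v \<le> C3 * \<Gamma> powr (q / p)" if nm: "near_min u g v h \<Gamma>" for u g v h \<Gamma>
  proof -
    have s: "sobv (u k) (g k)" "sobv v h" "IG (u k) = 1" for k using nm by (auto simp: near_min_def)
    have lim: "(\<lambda>k. pint M p (\<lambda>x. u k x - v x)) \<longlonglongrightarrow> 0" "AE x in M. (\<lambda>k. u k x) \<longlonglongrightarrow> v x" and \<Gamma>: "0 \<le> \<Gamma>"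
      using nm by (auto simp: near_min_def)
    let ?gi = "\<lambda>k. (en (g k) + en h) / 2 - en (\<lambda>x. (1/2) *\<^sub>R (g k x + h x))"
    have ge: "\<forall>\<^sub>F k in sequentially. ?gi k \<le> \<Gamma> + \<epsilon>" if "\<epsilon> > 0"
      for \<epsilon> using nm that by (auto simp: near_min_def)
    note L = sobv_LP[OF s(1)] and Lv = sobv_LP[OF s(2)]
    have Lq: "u k \<in> LP M q" "v \<in> LP M q" for k using sobv_LPq s by auto
    define w where "w k x = u k x - v x" for k x
    have ws: "sobv (w k) (\<lambda>x. g k x - h x)" for k unfolding w_def using sobv_diff[OF s(1) s(2)] .
    have wj: "sob \<Omega> p (\<lambda>x. w k x $ j) (\<lambda>x. (g k x - h x) $ j)" for k j using ws
      by (simp add: sobv_def)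
    have wL: "w k \<in> LP M p" "w k \<in> LP M q" for k using sobv_LP(1)[OF ws] sobv_LPq[OF ws] by auto
    have w0: "(\<lambda>k. pint M p (w k)) \<longlonglongrightarrow> 0" using lim(1)
      by (simp add: w_def[abs_def])
    have wAE: "AE x in M. (\<lambda>k. w k x) \<longlonglongrightarrow> 0"
      using lim(2)
    proof eventually_elim
      case (elim x)
      from tendsto_diff[OF elim tendsto_const[of "v x"]] show ?case by (simp add: w_def)
    qed
    have [measurable]: "u k \<in> borel_measurable M" "v \<in> borel_measurable M" "w k \<in> borel_measurable M" "h \<in> borel_measurable M" "g k \<in> borel_measurable M" for k
      using L Lv wL by (auto simp: LP_def)
    have wjm[measurable]: "(\<lambda>x. w k x $ j) \<in> borel_measurable M" for k j
      by (rule vec_nth_measurable) measurable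
    have [measurable]: "trunc' \<in> borel_measurable borel"
      by (rule borel_measurable_continuous_onI[OF trunc'_continuous])
    have [measurable]: "G \<in> borel_measurable borel"
      by (rule borel_measurable_continuous_onI[OF G_continuous])
    \<comment> \<open>The part of the limit gradient charged to the truncated function; it tends to
      0 because \<open>trunc' 0 = 0\<close> and \<open>w k\<close> tends to 0 almost
      everywhere.\<close>
    define \<alpha> where "\<alpha> k j = (LINT x|M. \<bar>trunc' (w k x $ j)\<bar> powr p * norm (h x) powr p)" for k j
    have tb: "\<bar>trunc' t\<bar> powr p \<le> 1" for t
      using powr_mono2[of p "\<bar>trunc' t\<bar>" 1] trunc'_bound[of t] p_pos by simp
    have \<alpha>i: "integrable M (\<lambda>x. \<bar>trunc' (w k x $ j)\<bar> powr p * norm (h x) powr p)"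
      for k j
      by (rule Bochner_Integration.integrable_bound[OF LP_D(2)[OF Lv(2)]])
        (use tb in \<open>auto intro!: AE_I2 simp: abs_mult mult_left_le_one_le\<close>)
    have \<alpha>0: "(\<lambda>k. \<alpha> k j) \<longlonglongrightarrow> 0" for j
    proof -
      have "(\<lambda>k. \<alpha> k j) \<longlonglongrightarrow> (LINT x|M. 0)"
        unfolding \<alpha>_def
      proof (rule integral_dominated_convergence[where w="\<lambda>x. norm (h x) powr p"])
        show "integrable M (\<lambda>x. norm (h x) powr p)" by (rule LP_D(2)[OF Lv(2)])
        show "AE x in M. (\<lambda>k. \<bar>trunc' (w k x $ j)\<bar> powr p * norm (h x) powr p) \<longlonglongrightarrow> 0"
          using wAE
        proof eventually_elim
          case (elim x)
          have "(\<lambda>k. w k x $ j) \<longlonglongrightarrow> 0 $ j" by (rule tendsto_vec_nth[OF elim])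
          then have "(\<lambda>k. trunc' (w k x $ j)) \<longlonglongrightarrow> trunc' 0"
            by (intro continuous_on_tendsto_compose[OF trunc'_continuous]) auto
          then have "(\<lambda>k. \<bar>trunc' (w k x $ j)\<bar> powr p * norm (h x) powr p) \<longlonglongrightarrow> \<bar>trunc' 0\<bar> powr p * norm (h x) powr p"
            using p_pos by (intro tendsto_mult tendsto_powr' tendsto_rabs tendsto_const) auto
          then show ?case using p_pos by (simp add: trunc_0)
        qed
        show "AE x in M. norm (\<bar>trunc' (w k x $ j)\<bar> powr p * norm (h x) powr p) \<le> norm (h x) powr p" for k
          using tb by (intro AE_I2) (auto simp: abs_mult mult_left_le_one_le)
      qed measurable
      then show ?thesis by simp
    qed
    have wq: "pint M q (\<lambda>x. w k x $ j) \<le> 2 powr q * (Cs * (2 * \<alpha> k j + Cg * ?gi k)) powr (q / p) + 4 powr q * pint M p (\<lambda>x. w k x $ j)" for k j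
    proof -
      let ?t = "\<lambda>x. trunc (w k x $ j)"
      have T: "?t \<in> LP M q" "pint M q ?t powr (p / q) \<le> Cs * pint M p (\<lambda>x. trunc' (w k x $ j) *\<^sub>R (g k x - h x) $ j)"
        using S[OF wj[of k j] trunc_deriv trunc'_continuous trunc'_bound trunc_0(1)] by auto
      have gd: "(\<lambda>x. (g k x - h x) $ j) \<in> LP M p" by (rule sob_LP(2)[OF wj])
      have [measurable]: "(\<lambda>x. (g k x - h x) $ j) \<in> borel_measurable M" by (rule LP_D(1)[OF gd])
      have dL: "(\<lambda>x. trunc' (w k x $ j) *\<^sub>R (g k x - h x) $ j) \<in> LP M p"
      proof (rule LP_dominated(1)[OF gd])
        show "norm (trunc' (w k x $ j) *\<^sub>R (g k x - h x) $ j) \<le> norm ((g k x - h x) $ j)" for x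
          using trunc'_bound[of "w k x $ j"] by (simp add: mult_left_le_one_le)
      qed (measurable, rule p_pos)
      have "pint M p (\<lambda>x. trunc' (w k x $ j) *\<^sub>R (g k x - h x) $ j)
          \<le> (LINT x|M. 2 * (\<bar>trunc' (w k x $ j)\<bar> powr p * norm (h x) powr p) + Cg * gap x (g k x) (h x))"
        unfolding pint_def
      proof (rule integral_mono[OF LP_D(2)[OF dL]])
        show "integrable M (\<lambda>x. 2 * (\<bar>trunc' (w k x $ j)\<bar> powr p * norm (h x) powr p) + Cg * gap x (g k x) (h x))"
          using \<alpha>i gap_integral(1)[OF L(2) Lv(2)] by auto
        fix x assume "x \<in> space M"
        then have x: "x \<in> K" using \<Omega>_K by simp
        \<comment> \<open>Multiplying the one-sided gap bound by a <= 1 keeps this factor on the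
          term with h, where it is needed, and drops it from the gap.\<close>
        define a where "a = \<bar>trunc' (w k x $ j)\<bar> powr p"
        have a: "0 \<le> a" "a \<le> 1" using tb by (auto simp: a_def)
        have "norm ((g k x - h x) $ j) powr p \<le> norm (g k x - h x) powr p"
          using p_pos by (intro powr_mono2 Finite_Cartesian_Product.norm_nth_le) auto
        also have "\<dots> \<le> 2 * norm (h x) powr p + Cg * gap x (g k x) (h x)" by (rule Cg(2)[OF x])
        finally have "a * norm ((g k x - h x) $ j) powr p \<le> a * (2 * norm (h x) powr p + Cg * gap x (g k x) (h x))"
          using a by (intro mult_left_mono) auto
        also have "\<dots> = 2 * (a * norm (h x) powr p) + a * (Cg * gap x (g k x) (h x))"
          by (simp add: algebra_simps)
        also have "a * (Cg * gap x (g k x) (h x)) \<le> Cg * gap x (g k x) (h x)"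
          using a mult_nonneg_nonneg[OF less_imp_le[OF Cg(1)] gap_nonneg[OF x, of "g k x" "h x"]]
            by (intro mult_left_le_one_le) auto
        finally show "norm (trunc' (w k x $ j) *\<^sub>R (g k x - h x) $ j) powr p \<le> 2 * (\<bar>trunc' (w k x $ j)\<bar> powr p * norm (h x) powr p) + Cg * gap x (g k x) (h x)"
          by (simp add: a_def powr_mult)
      qed
      also have "\<dots> = 2 * \<alpha> k j + Cg * ?gi k"
        using \<alpha>i gap_integral[OF L(2) Lv(2)] by (simp add: \<alpha>_def)
      finally have "Cs * pint M p (\<lambda>x. trunc' (w k x $ j) *\<^sub>R (g k x - h x) $ j) \<le> Cs * (2 * \<alpha> k j + Cg * ?gi k)"
        using Cs by (intro mult_left_mono) auto
      then have "pint M q ?t powr (p / q) \<le> Cs * (2 * \<alpha> k j + Cg * ?gi k)" using T(2) by linarith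
      then have "(pint M q ?t powr (p / q)) powr (q / p) \<le> (Cs * (2 * \<alpha> k j + Cg * ?gi k)) powr (q / p)"
        using p_pos pq by (intro powr_mono2) auto
      then have tq: "pint M q ?t \<le> (Cs * (2 * \<alpha> k j + Cg * ?gi k)) powr (q / p)"
        using p_pos pq pint_nonneg[of M q ?t] by (simp add: powr_powr)
      have wjL: "(\<lambda>x. w k x $ j) \<in> LP M q" "(\<lambda>x. w k x $ j) \<in> LP M p"
        using LP_component(1)[OF wL(2) pq(4)] LP_component(1)[OF wL(1) p_pos(2)] by auto
      have "pint M q (\<lambda>x. w k x $ j) \<le> (LINT x|M. 2 powr q * norm (?t x) powr q + 4 powr q * norm (w k x $ j) powr p)"
        unfolding pint_def using LP_D(2)[OF wjL(1)] LP_D(2)[OF wjL(2)] LP_D(2)[OF T(1)] abs_powr_le_trunc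
        by (intro integral_mono) auto
      also have "\<dots> = 2 powr q * pint M q ?t + 4 powr q * pint M p (\<lambda>x. w k x $ j)"
        using LP_D(2)[OF wjL(2)] LP_D(2)[OF T(1)] by (simp add: pint_def)
      also have "\<dots> \<le> 2 powr q * (Cs * (2 * \<alpha> k j + Cg * ?gi k)) powr (q / p) + 4 powr q * pint M p (\<lambda>x. w k x $ j)"
        using tq by (intro add_right_mono mult_left_mono) auto
      finally show ?thesis .
    qed
    \<comment> \<open>What remains of the mass difference after a multiple of |w|^q is subtracted.
      This positive part is dominated by a multiple of |v|^q and vanishes in the limit, as in the
      Brezis-Lieb lemma.\<close>
    let ?b = "\<lambda>k x. max 0 (G (u k x) - G (v x) - C1 * norm (w k x) powr q)"
    have bb: "?b k x \<le> C1 * norm (v x) powr q" for k x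
    proof -
      have "G (u k x) \<le> CG * norm (v x + w k x) powr q" using CG(2)[of "u k x"] by (simp add: w_def)
      also have "\<dots> \<le> CG * (2 powr q * (norm (v x) powr q + norm (w k x) powr q))"
        using CG(1) pq by (intro mult_left_mono norm_add_powr_le) auto
      finally have "G (u k x) \<le> C1 * norm (v x) powr q + C1 * norm (w k x) powr q"
        by (simp add: C1_def algebra_simps)
      then show ?thesis using G_nonneg[of "v x"] C1 by simp
    qed
    have vi: "integrable M (\<lambda>x. C1 * norm (v x) powr q)" using LP_D(2)[OF Lq(2)] by simp
    have bi: "integrable M (?b k)" for k
      by (rule Bochner_Integration.integrable_bound[OF vi]) (use bb C1 in \<open>auto intro!: AE_I2\<close>)
    have "(\<lambda>k. LINT x|M. ?b k x) \<longlonglongrightarrow> (LINT x|M. 0)"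
    proof (rule integral_dominated_convergence[OF _ _ vi])
      show "AE x in M. (\<lambda>k. ?b k x) \<longlonglongrightarrow> 0"
        using lim(2) wAE
      proof eventually_elim
        case (elim x)
        have a: "(\<lambda>k. G (u k x)) \<longlonglongrightarrow> G (v x)"
          by (rule continuous_on_tendsto_compose[OF G_continuous elim(1)]) auto
        have b: "(\<lambda>k. norm (w k x) powr q) \<longlonglongrightarrow> norm (0::real^'d) powr q"
          using pq by (intro tendsto_powr' tendsto_norm elim(2) tendsto_const) auto
        have "(\<lambda>k. ?b k x) \<longlonglongrightarrow> max 0 (G (v x) - G (v x) - C1 * (norm (0::real^'d) powr q))"
          by (intro tendsto_max tendsto_diff tendsto_mult tendsto_const a b)
        then show ?case using pq by simp
      qed
      show "AE x in M. norm (?b k x) \<le> C1 * norm (v x) powr q" for k using bb by (intro AE_I2) auto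
    qed measurable
    then have b0: "(\<lambda>k. LINT x|M. ?b k x) \<longlonglongrightarrow> 0" by simp
    have mass: "1 - IG v \<le> C1 * pint M q (w k) + (LINT x|M. ?b k x)" for k
    proof -
      have "1 - IG v = (LINT x|M. G (u k x) - G (v x))"
        using s(3)[of k] IG_integrable[OF Lq(1)[of k]] IG_integrable[OF Lq(2)] by (simp add: IG_def)
      also have "\<dots> \<le> (LINT x|M. C1 * norm (w k x) powr q + ?b k x)"
        using IG_integrable[OF Lq(1)[of k]] IG_integrable[OF Lq(2)] bi LP_D(2)[OF wL(2)[of k]]
          by (intro integral_mono) auto
      also have "\<dots> = C1 * pint M q (w k) + (LINT x|M. ?b k x)" using bi LP_D(2)[OF wL(2)[of k]]
        by (simp add: pint_def)
      finally show ?thesis .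
    qed
    \<comment> \<open>The bound on the lost mass, with slack \<epsilon> in every term that vanishes
      only in the limit.\<close>
    define R where "R \<epsilon> = C1 * (n powr q * (n * (2 powr q * (Cs * (2 * \<epsilon> + Cg * (\<Gamma> + \<epsilon>))) powr (q / p) + \<epsilon>))) + \<epsilon>" for \<epsilon>
    have R: "1 - IG v \<le> R \<epsilon>" if \<epsilon>: "\<epsilon> > 0" for \<epsilon>
    proof -
      have "\<forall>\<^sub>F k in sequentially. \<alpha> k j < \<epsilon>" for j
        by (rule order_tendstoD(2)[OF \<alpha>0 \<epsilon>])
      then have e1: "\<forall>\<^sub>F k in sequentially. \<forall>j. \<alpha> k j < \<epsilon>"
        by (rule eventually_all_finite)
      have "(\<lambda>k. 4 powr q * pint M p (\<lambda>x. w k x $ j)) \<longlonglongrightarrow> 0" for j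
        using tendsto_mult[OF tendsto_const pint_component_tendsto[OF wL(1) w0], of "4 powr q" j] by simp
      then have "\<forall>\<^sub>F k in sequentially. 4 powr q * pint M p (\<lambda>x. w k x $ j) < \<epsilon>" for j by (rule order_tendstoD(2)) (rule \<epsilon>)
      then have e2: "\<forall>\<^sub>F k in sequentially. \<forall>j. 4 powr q * pint M p (\<lambda>x. w k x $ j) < \<epsilon>" by (rule eventually_all_finite)
      have e3: "\<forall>\<^sub>F k in sequentially. (LINT x|M. ?b k x) < \<epsilon>"
        by (rule order_tendstoD(2)[OF b0 \<epsilon>])
      have "\<forall>\<^sub>F k in sequentially. 1 - IG v \<le> R \<epsilon>"
        using e1 e2 e3 ge[OF \<epsilon>]
      proof eventually_elim
        case (elim k)
        have gi0: "0 \<le> ?gi k"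
        proof -
          have "0 \<le> (LINT x|M. gap x (g k x) (h x))" using gap_nonneg[OF \<Omega>_K]
            by (intro integral_nonneg_AE AE_I2) auto
          then show ?thesis using gap_integral(2)[OF L(2) Lv(2)] by simp
        qed
        have \<alpha>n: "0 \<le> \<alpha> k j" for j unfolding \<alpha>_def by (rule integral_nonneg_AE) auto
        have "pint M q (\<lambda>x. w k x $ j) \<le> 2 powr q * (Cs * (2 * \<epsilon> + Cg * (\<Gamma> + \<epsilon>))) powr (q / p) + \<epsilon>" for j
        proof -
          have "2 * \<alpha> k j + Cg * ?gi k \<le> 2 * \<epsilon> + Cg * (\<Gamma> + \<epsilon>)"
            using elim(1,4) Cg(1) by (intro add_mono mult_left_mono) (auto intro: less_imp_le)
          then have "(Cs * (2 * \<alpha> k j + Cg * ?gi k)) powr (q / p) \<le> (Cs * (2 * \<epsilon> + Cg * (\<Gamma> + \<epsilon>))) powr (q / p)"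
            using Cs Cg(1) gi0 \<alpha>n[of j] p_pos pq by (intro powr_mono2 mult_left_mono) auto
          then have "2 powr q * (Cs * (2 * \<alpha> k j + Cg * ?gi k)) powr (q / p) \<le> 2 powr q * (Cs * (2 * \<epsilon> + Cg * (\<Gamma> + \<epsilon>))) powr (q / p)"
            by (intro mult_left_mono) auto
          from order_trans[OF wq[of k j] add_mono[OF this less_imp_le[OF spec[OF elim(2), of j]]]] show ?thesis .
        qed
        then have "(\<Sum>j\<in>UNIV. pint M q (\<lambda>x. w k x $ j)) \<le> (\<Sum>j\<in>(UNIV::'d set). 2 powr q * (Cs * (2 * \<epsilon> + Cg * (\<Gamma> + \<epsilon>))) powr (q / p) + \<epsilon>)"
          by (intro sum_mono)
        also have "\<dots> = n * (2 powr q * (Cs * (2 * \<epsilon> + Cg * (\<Gamma> + \<epsilon>))) powr (q / p) + \<epsilon>)" by (simp add: n_def)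
        finally have "n powr q * (\<Sum>j\<in>UNIV. pint M q (\<lambda>x. w k x $ j)) \<le> n powr q * (n * (2 powr q * (Cs * (2 * \<epsilon> + Cg * (\<Gamma> + \<epsilon>))) powr (q / p) + \<epsilon>))"
          by (intro mult_left_mono) auto
        moreover have "pint M q (w k) \<le> n powr q * (\<Sum>j\<in>UNIV. pint M q (\<lambda>x. w k x $ j))"
          unfolding n_def by (rule LP_vecI(2)[OF LP_component(1)[OF wL(2) pq(4)] pq(4)])
        ultimately have "C1 * pint M q (w k) \<le> C1 * (n powr q * (n * (2 powr q * (Cs * (2 * \<epsilon> + Cg * (\<Gamma> + \<epsilon>))) powr (q / p) + \<epsilon>)))"
          using C1 by (intro mult_left_mono) auto
        then show ?case using mass[of k] elim(3) unfolding R_def by linarith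
      qed
      then show ?thesis by (simp add: eventually_const)
    qed
    have "(\<lambda>k. R (inverse (real (Suc k)))) \<longlonglongrightarrow> C1 * (n powr q * (n * (2 powr q * (Cs * (2 * 0 + Cg * (\<Gamma> + 0))) powr (q / p) + 0))) + 0"
      unfolding R_def
    proof (intro tendsto_add tendsto_mult tendsto_const LIMSEQ_inverse_real_of_nat tendsto_powr')
      show "Cs * (2 * 0 + Cg * (\<Gamma> + 0)) \<noteq> 0 \<or> 0 < q / p \<and> (\<forall>\<^sub>F k in sequentially. 0 \<le> Cs * (2 * inverse (real (Suc k)) + Cg * (\<Gamma> + inverse (real (Suc k)))))"
        using Cs Cg \<Gamma> p_pos pq
          by (intro disjI2 conjI always_eventually allI mult_nonneg_nonneg add_nonneg_nonneg) auto
    qed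
    then have "1 - IG v \<le> C1 * (n powr q * (n * (2 powr q * (Cs * (2 * 0 + Cg * (\<Gamma> + 0))) powr (q / p) + 0))) + 0"
      by (rule LIMSEQ_le_const) (use R in \<open>auto simp del: of_nat_Suc\<close>)
    also have "\<dots> = C3 * \<Gamma> powr (q / p)"
      using Cs Cg \<Gamma> by (simp add: C3_def powr_mult)
    finally show ?thesis .
  qed
  with C3 show ?thesis by blast
qed

section \<open>The functional, its coercivity and its infimum\<close>

definition subcrit :: "(real^'d \<Rightarrow> real) \<Rightarrow> real \<Rightarrow> bool" where
  "subcrit F m \<longleftrightarrow> continuous_on UNIV F \<and> homogeneous p F \<and> 0 < m \<and> m < lam1 \<and> (\<forall>s. F s \<le> m * (\<Sum>j\<in>UNIV. \<bar>s $ j\<bar> powr p))"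

definition Q :: "(real^'d \<Rightarrow> real) \<Rightarrow> (real^'n \<Rightarrow> real^'d) \<Rightarrow> (real^'n \<Rightarrow> (real^'n)^'d) \<Rightarrow> real" where
  "Q F u g = en g - (LINT x|M. F (u x))"

abbreviation "levels F \<equiv> {Q F u g | u g. sobv u g \<and> IG u = 1}"

definition level :: "(real^'d \<Rightarrow> real) \<Rightarrow> real" where
  "level F = Inf (levels F)"

text \<open>The eigenvalue inequality is used in each component and summed; \<open>m < lam1\<close>
  then leaves a positive fraction of the energy.\<close>

lemma subcrit_integral_le:
  assumes F: "subcrit F m" and s: "sobv u g"
  shows "(LINT x|M. F (u x)) \<le> (m / lam1) * en g"
proof -
  have l: "lam1 > 0" by (rule lambda1_pos[OF \<Omega>_nonempty])
  have c: "continuous_on UNIV F" "homogeneous p F" "0 < m" "\<And>s. F s \<le> m * (\<Sum>j\<in>UNIV. \<bar>s $ j\<bar> powr p)" using F by (auto simp: subcrit_def)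
  note L = sobv_LP[OF s]
  have Lj: "(\<lambda>x. u x $ j) \<in> LP M p" for j by (rule LP_component(1)[OF L(1) p_pos(2)])
  have sj: "sob \<Omega> p (\<lambda>x. u x $ j) (\<lambda>x. g x $ j)" for j using s by (simp add: sobv_def)
  have "(LINT x|M. F (u x)) \<le> (LINT x|M. m * (\<Sum>j\<in>UNIV. norm (u x $ j) powr p))"
    using homogeneous_LP_integrable[OF c(1,2) p_pos(1) L(1)] LP_D(2)[OF Lj] c(4) by (intro integral_mono) auto
  also have "\<dots> = m * (\<Sum>j\<in>UNIV. pint M p (\<lambda>x. u x $ j))" using LP_D(2)[OF Lj]
    by (simp add: pint_def)
  also have "\<dots> \<le> m * (\<Sum>j\<in>UNIV. (LINT x|M. E x (g x $ j)) / lam1)"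
    using lambda1_le[OF sj] l c(3)
      by (intro mult_left_mono sum_mono) (auto simp: pos_le_divide_eq mult.commute)
  also have "\<dots> = (m / lam1) * en g" by (simp add: en_components[OF L(2)] sum_divide_distrib[symmetric])
  finally show ?thesis .
qed

lemma Q_coercive:
  assumes F: "subcrit F m" and s: "sobv u g"
  shows "(1 - m / lam1) * en g \<le> Q F u g" "0 \<le> Q F u g" "0 < 1 - m / lam1"
proof -
  have l: "lam1 > 0" by (rule lambda1_pos[OF \<Omega>_nonempty])
  show a: "(1 - m / lam1) * en g \<le> Q F u g" using subcrit_integral_le[OF F s]
    by (simp add: Q_def algebra_simps)
  show b: "0 < 1 - m / lam1" using F l by (simp add: subcrit_def)
  have "0 \<le> (1 - m / lam1) * en g" using b en_nonneg[of g] by (intro mult_nonneg_nonneg) auto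
  then show "0 \<le> Q F u g" using a by linarith
qed

lemma Q_scale:
  assumes F: "homogeneous p F" and c: "c > 0"
  shows "Q F (\<lambda>x. c *\<^sub>R u x) (\<lambda>x. c *\<^sub>R g x) = c powr p * Q F u g"
proof -
  have "en (\<lambda>x. c *\<^sub>R g x) = (LINT x|M. c powr p * EV x (g x))"
    unfolding en_def using c by (intro Bochner_Integration.integral_cong) (auto simp: EV_scale[OF \<Omega>_K])
  moreover have "(LINT x|M. F (c *\<^sub>R u x)) = c powr p * (LINT x|M. F (u x))" using F c
    by (simp add: homogeneous_def)
  ultimately show ?thesis by (simp add: Q_def en_def right_diff_distrib)
qed

lemma levels_bdd: "subcrit F m \<Longrightarrow> bdd_below (levels F)"
  using Q_coercive(2) by (intro bdd_belowI[of _ 0]) auto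

text \<open>\<open>Q\<close> scales with exponent p and the constraint with exponent q, so functions
  with positive \<open>IG\<close> can be rescaled to the constraint. The unnormalised form is what
  limits that have lost mass and free variations require.\<close>

lemma level_le:
  assumes F: "subcrit F m" and s: "sobv u g"
  shows "level F * IG u powr (p / q) \<le> Q F u g"
proof (cases "IG u = 0")
  case True
  then show ?thesis using Q_coercive(2)[OF F s] p_pos pq by simp
next
  case False
  then have \<theta>: "IG u > 0" using IG_nonneg[of u] by simp
  define c where "c = IG u powr (- 1 / q)"
  have c: "c > 0" using \<theta> by (simp add: c_def)
  have cq: "c powr q = 1 / IG u"
  proof -
    have "c powr q = IG u powr (- 1 / q * q)" unfolding c_def by (simp only: powr_powr)
    also have "- 1 / q * q = - 1" using pq by simp
    also have "IG u powr - 1 = 1 / IG u" using \<theta> by (simp add: powr_minus inverse_eq_divide)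
    finally show ?thesis .
  qed
  have cp: "c powr p = 1 / IG u powr (p / q)"
  proof -
    have "c powr p = IG u powr (- (p / q))" unfolding c_def by (simp add: powr_powr)
    then show ?thesis using \<theta> by (simp add: powr_minus inverse_eq_divide)
  qed
  have "IG (\<lambda>x. c *\<^sub>R u x) = 1" using IG_scale[OF c, of u] cq \<theta> by simp
  then have "Q F (\<lambda>x. c *\<^sub>R u x) (\<lambda>x. c *\<^sub>R g x) \<in> levels F"
    using sobv_scale[OF s, of c] by blast
  then have "level F \<le> Q F (\<lambda>x. c *\<^sub>R u x) (\<lambda>x. c *\<^sub>R g x)"
    unfolding level_def by (rule cInf_lower[OF _ levels_bdd[OF F]])
  also have "\<dots> = Q F u g / IG u powr (p / q)" using Q_scale[OF _ c, of F u g] F cp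
    by (simp add: subcrit_def)
  finally show ?thesis using \<theta> by (simp add: pos_le_divide_eq)
qed

lemma sobv_axis:
  assumes "sob \<Omega> p u g"
  shows "sobv (\<lambda>x. axis j (u x)) (\<lambda>x. axis j (g x))"
  unfolding sobv_def
proof
  fix i
  have "sob \<Omega> p (\<lambda>x. 0) (\<lambda>x. 0)" using sob_scale[OF assms, of 0] by simp
  then show "sob \<Omega> p (\<lambda>x. axis j (u x) $ i) (\<lambda>x. axis j (g x) $ i)"
    using assms by (cases "i = j") (auto simp: axis_def)
qed

lemma en_axis: "en (\<lambda>x. axis j (g x) :: (real^'n)^'d) = (LINT x|M. E x (g x))"
proof -
  have "EV x (axis j (g x) :: (real^'n)^'d) = E x (g x)" for x
    unfolding EV_def using sum.delta[of "UNIV::'d set" j "\<lambda>i. E x (g x)"]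
    by (simp add: axis_def if_distrib[of "E x"] E_zero cong: if_cong)
  then show ?thesis by (simp add: en_def)
qed

lemma IG_pos:
  assumes u: "u \<in> LP M q" and ne: "pint M p u > 0"
  shows "IG u > 0"
proof -
  obtain C where C: "C > 0" "\<And>s. norm s powr q \<le> C * G s" by (rule G_lower) (rule that)
  have "pint M q u \<le> (LINT x|M. C * G (u x))"
    unfolding pint_def using LP_D(2)[OF u] IG_integrable[OF u] C by (intro integral_mono) auto
  then have le: "pint M q u \<le> C * IG u" by (simp add: IG_def)
  have "pint M q u \<noteq> 0" using LP_exponent(2)[OF p_pos(1) pq(1) u] ne p_pos pq by auto
  then have "pint M q u > 0" using pint_nonneg[of M q u] by simp
  then show ?thesis using le C by (metis less_le_trans zero_less_mult_pos)
qed

lemma levels_nonempty: "levels F \<noteq> {}"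
proof -
  obtain u g where u: "sob \<Omega> p u g" "pint M p u = 1" using exists_normalised[OF \<Omega>_nonempty]
    by blast
  fix j :: 'd
  let ?u = "\<lambda>x. axis j (u x) :: real^'d"
  have s: "sobv ?u (\<lambda>x. axis j (g x))" by (rule sobv_axis[OF u(1)])
  have "pint M p ?u = 1" using u(2) by (simp add: pint_def norm_axis_real)
  then have I: "IG ?u > 0" using IG_pos[OF sobv_LPq[OF s]] by simp
  define c where "c = IG ?u powr (- 1 / q)"
  have c: "c > 0" using I by (simp add: c_def)
  have "c powr q = IG ?u powr (- 1 / q * q)" unfolding c_def by (simp only: powr_powr)
  also have "- 1 / q * q = - 1" using pq by simp
  also have "IG ?u powr - 1 = 1 / IG ?u" using I by (simp add: powr_minus inverse_eq_divide)
  finally have "IG (\<lambda>x. c *\<^sub>R ?u x) = 1" using IG_scale[OF c, of ?u] I by simp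
  then show ?thesis using sobv_scale[OF s, of c] by blast
qed

text \<open>A minimising sequence has a limit in L^p. Lower semicontinuity bounds the energy of the
  limit and defines the defect \<Gamma>; the two competing bounds on the lost mass leave only
  \<Gamma> = 0 when the level is below \<kappa>.\<close>

lemma minimiser_exists:
  "\<exists>\<kappa>>0. \<forall>F m. subcrit F m \<longrightarrow> level F < \<kappa> \<longrightarrow> (\<exists>v h. sobv v h \<and> IG v = 1 \<and> Q F v h = level F)"
proof -
  obtain C3 where C3: "C3 > 0" "\<And>u g v h \<Gamma>. near_min u g v h \<Gamma> \<Longrightarrow> 1 - IG v \<le> C3 * \<Gamma> powr (q / p)"
    using concentration by blast
  \<comment> \<open>Solves C3 \<kappa>^(q/p) = 1, whereas a positive defect would require C3 S^(q/p)
    >= 2.\<close>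
  define \<kappa> where "\<kappa> = (1 / C3) powr (p / q)"
  have \<kappa>: "\<kappa> > 0" using C3 by (simp add: \<kappa>_def)
  have "\<exists>v h. sobv v h \<and> IG v = 1 \<and> Q F v h = level F"
    if F: "subcrit F m" and lv: "level F < \<kappa>" for F m
  proof -
    have cF: "continuous_on UNIV F" "homogeneous p F" using F by (auto simp: subcrit_def)
    let ?S = "level F"
    have S0: "0 \<le> ?S" unfolding level_def using Q_coercive(2)[OF F] levels_nonempty[of F]
      by (intro cInf_greatest) auto
    have "\<forall>k. \<exists>ug. sobv (fst ug) (snd ug) \<and> IG (fst ug) = 1 \<and> Q F (fst ug) (snd ug) < ?S + inverse (real (Suc k))"
    proof
      fix k
      have "Inf (levels F) < ?S + inverse (real (Suc k))" by (simp add: level_def)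
      then obtain y where "y \<in> levels F" "y < ?S + inverse (real (Suc k))"
        using cInf_lessD[OF levels_nonempty] by blast
      then show "\<exists>ug. sobv (fst ug) (snd ug) \<and> IG (fst ug) = 1 \<and> Q F (fst ug) (snd ug) < ?S + inverse (real (Suc k))" by auto
    qed
    from choice[OF this] obtain ug where ug: "\<forall>k. sobv (fst (ug k)) (snd (ug k)) \<and> IG (fst (ug k)) = 1 \<and> Q F (fst (ug k)) (snd (ug k)) < ?S + inverse (real (Suc k))"
      by blast
    define u0 where "u0 k = fst (ug k)" for k
    define g0 where "g0 k = snd (ug k)" for k
    have s0: "sobv (u0 k) (g0 k)" "IG (u0 k) = 1" "Q F (u0 k) (g0 k) < ?S + inverse (real (Suc k))" for k
      using spec[OF ug, of k] by (simp_all add: u0_def g0_def)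
    define cst where "cst = real CARD('d) powr p / \<tau> powr (p / 2)"
    define b where "b = cst * ((?S + 1) / (1 - m / lam1))"
    have gb: "pint M p (\<lambda>x. g0 k x $ j) \<le> b" for k j
    proof -
      have "inverse (real (Suc k)) \<le> 1" by (simp add: inverse_eq_divide)
      then have "(1 - m / lam1) * en (g0 k) \<le> ?S + 1" using Q_coercive(1)[OF F s0(1)[of k]] s0(3)[of k]
        by linarith
      then have "en (g0 k) \<le> (?S + 1) / (1 - m / lam1)" using Q_coercive(3)[OF F s0(1)[of k]]
        by (simp add: pos_le_divide_eq mult.commute)
      then have "cst * en (g0 k) \<le> b" unfolding b_def by (intro mult_left_mono) (auto simp: cst_def)
      moreover have "pint M p (g0 k) \<le> cst * en (g0 k)" unfolding cst_def
        by (rule pint_le_en[OF sobv_LP(2)[OF s0(1)]])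
      ultimately show ?thesis using LP_component(2)[OF sobv_LP(2)[OF s0(1)[of k]] p_pos(2), of j] by linarith
    qed
    have sj: "sob \<Omega> p (\<lambda>x. u0 k x $ j) (\<lambda>x. g0 k x $ j)" for k j using s0(1)
      by (simp add: sobv_def)
    obtain r1 v1 where r1: "strict_mono (r1::nat\<Rightarrow>nat)" "\<And>j. v1 j \<in> LP M p" "\<And>j. (\<lambda>k. pint M p (\<lambda>x. u0 (r1 k) x $ j - v1 j x)) \<longlonglongrightarrow> 0"
      by (rule rellich_sob[of "\<lambda>k j x. u0 k x $ j" "\<lambda>k j x. g0 k x $ j", OF sj gb]) (rule that)
    define v where "v x = (\<chi> j. v1 j x)" for x
    have vL: "v \<in> LP M p" by (rule LP_vecI(1)[OF _ p_pos(2)]) (simp add: v_def r1(2))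
    have dL: "(\<lambda>x. u0 (r1 k) x - v x) \<in> LP M p" for k
      by (rule LP_diff[OF sobv_LP(1)[OF s0(1)] vL p_pos(2)])
    have l1: "(\<lambda>k. pint M p (\<lambda>x. u0 (r1 k) x - v x)) \<longlonglongrightarrow> 0"
    proof (rule tendsto_sandwich[OF _ _ tendsto_const])
      have "(\<lambda>k. real CARD('d) powr p * (\<Sum>j\<in>UNIV. pint M p (\<lambda>x. u0 (r1 k) x $ j - v1 j x))) \<longlonglongrightarrow> real CARD('d) powr p * (\<Sum>j\<in>(UNIV::'d set). 0)"
        by (intro tendsto_intros r1(3))
      then show "(\<lambda>k. real CARD('d) powr p * (\<Sum>j\<in>UNIV. pint M p (\<lambda>x. u0 (r1 k) x $ j - v1 j x))) \<longlonglongrightarrow> 0" by simp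
      have "pint M p (\<lambda>x. u0 (r1 k) x - v x) \<le> real CARD('d) powr p * (\<Sum>j\<in>UNIV. pint M p (\<lambda>x. u0 (r1 k) x $ j - v1 j x))" for k
        using LP_vecI(2)[OF LP_component(1)[OF dL p_pos(2)] p_pos(2), of k] by (simp add: v_def)
      then show "\<forall>\<^sub>F k in sequentially. pint M p (\<lambda>x. u0 (r1 k) x - v x) \<le> real CARD('d) powr p * (\<Sum>j\<in>UNIV. pint M p (\<lambda>x. u0 (r1 k) x $ j - v1 j x))" by simp
    qed (simp add: pint_nonneg)
    obtain r2 where r2: "strict_mono (r2::nat\<Rightarrow>nat)" "AE x in M. (\<lambda>k. u0 (r1 (r2 k)) x) \<longlonglongrightarrow> v x"
      by (rule pint_AE_subseq[of "\<lambda>k. u0 (r1 k)", OF dL p_pos(1) l1]) (rule that)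
    define u where "u k = u0 (r1 (r2 k))" for k
    define g where "g k = g0 (r1 (r2 k))" for k
    have s: "sobv (u k) (g k)" "IG (u k) = 1" for k by (simp_all add: u_def g_def s0)
    have sQ: "Q F (u k) (g k) \<le> ?S + inverse (real (Suc k))" for k
    proof -
      have "k \<le> r1 (r2 k)" using seq_suble[OF r1(1), of "r2 k"] seq_suble[OF r2(1), of k] by linarith
      then have "inverse (real (Suc (r1 (r2 k)))) \<le> inverse (real (Suc k))"
        by (intro le_imp_inverse_le) auto
      then show ?thesis using s0(3)[of "r1 (r2 k)"] unfolding u_def g_def by linarith
    qed
    have lim: "(\<lambda>k. pint M p (\<lambda>x. u k x - v x)) \<longlonglongrightarrow> 0"
      using LIMSEQ_subseq_LIMSEQ[OF l1 r2(1)] by (simp add: u_def o_def)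
    have ae: "AE x in M. (\<lambda>k. u k x) \<longlonglongrightarrow> v x" using r2(2) by (simp add: u_def)
    note L = sobv_LP[OF s(1)]
    \<comment> \<open>Upper bounds for the energies along the sequence; they converge because the
      F-term is continuous in L^p.\<close>
    define c where "c k = ?S + inverse (real (Suc k)) + (LINT x|M. F (u k x))" for k
    define c0 where "c0 = ?S + 0 + (LINT x|M. F (v x))"
    have cl: "c \<longlonglongrightarrow> c0" unfolding c_def c0_def
      by (intro tendsto_add tendsto_const LIMSEQ_inverse_real_of_nat homogeneous_LP_tendsto[OF cF p_pos(1) L(1) vL lim])
    have enc: "en (g k) \<le> c k" for k using sQ[of k] by (simp add: c_def Q_def)
    obtain h where h: "sobv v h" "en h \<le> c0" by (rule energy_lsc[OF s(1) vL lim enc cl]) (rule that)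
    note Lh = sobv_LP[OF h(1)]
    \<comment> \<open>Half of the possible energy drop, because the midpoint gap is asymptotically
      at most (c0 + en h)/2 - en h.\<close>
    define \<Gamma> where "\<Gamma> = (c0 - en h) / 2"
    have \<Gamma>: "0 \<le> \<Gamma>" using h(2) by (simp add: \<Gamma>_def)
    let ?mid = "\<lambda>k x. (1/2) *\<^sub>R (g k x + h x)"
    have mids: "sobv (\<lambda>x. (1/2) *\<^sub>R (u k x + v x)) (?mid k)" for k
      by (rule sobv_scale[OF sobv_add[OF s(1) h(1)]])
    have midlim: "(\<lambda>k. pint M p (\<lambda>x. (1/2) *\<^sub>R (u k x + v x) - v x)) \<longlonglongrightarrow> 0"
    proof -
      have e: "(1/2) *\<^sub>R (u k x + v x) - v x = (1/2) *\<^sub>R (u k x - v x)" for k x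
      proof -
        have "v x = (1/2) *\<^sub>R (v x + v x)" by (simp add: scaleR_2[symmetric])
        then show ?thesis by (metis (no_types, opaque_lifting) add_diff_cancel_right scaleR_diff_right)
      qed
      have "(\<lambda>k. \<bar>1/2\<bar> powr p * pint M p (\<lambda>x. u k x - v x)) \<longlonglongrightarrow> \<bar>1/2\<bar> powr p * 0" by (intro tendsto_intros lim)
      then show ?thesis unfolding e pint_scaleR by simp
    qed
    \<comment> \<open>Midpoints also converge to v in L^p, so lower semicontinuity applies to them;
      a persistent drop by \<epsilon> along a subsequence would give v a gradient of smaller energy,
      against uniqueness.\<close>
    have mid: "\<forall>\<^sub>F k in sequentially. en h - \<epsilon> \<le> en (?mid k)"
      if \<epsilon>: "\<epsilon> > 0" for \<epsilon>
    proof (rule ccontr)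
      assume "\<not> (\<forall>\<^sub>F k in sequentially. en h - \<epsilon> \<le> en (?mid k))"
      then obtain t where t: "strict_mono (t::nat\<Rightarrow>nat)" "\<And>k. \<not> en h - \<epsilon> \<le> en (?mid (t k))"
        using not_eventually_sequentiallyD by blast
      have le: "en (?mid (t k)) \<le> en h - \<epsilon>" for k using t(2)[of k] by simp
      have "(\<lambda>k. pint M p (\<lambda>x. (1/2) *\<^sub>R (u (t k) x + v x) - v x)) \<longlonglongrightarrow> 0"
        using LIMSEQ_subseq_LIMSEQ[OF midlim t(1)] by (simp add: o_def)
      then obtain h' where h': "sobv v h'" "en h' \<le> en h - \<epsilon>"
        by (rule energy_lsc[OF mids vL _ le tendsto_const]) (rule that)
      have "en h' = en h"
        using en_cong_AE[OF sobv_unique[OF h'(1) h(1)]] LP_D(1)[OF sobv_LP(2)[OF h'(1)]] LP_D(1)[OF Lh(2)]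
          by simp
      then show False using h'(2) \<epsilon> by simp
    qed
    have "near_min u g v h \<Gamma>"
      unfolding near_min_def
    proof (intro conjI allI impI s h(1) lim ae \<Gamma>)
      fix \<epsilon> :: real assume \<epsilon>: "\<epsilon> > 0"
      have "\<forall>\<^sub>F k in sequentially. c k < c0 + \<epsilon>" using \<epsilon>
        by (intro order_tendstoD(2)[OF cl]) auto
      moreover have "\<forall>\<^sub>F k in sequentially. en h - \<epsilon> / 2 \<le> en (?mid k)"
        using \<epsilon> by (intro mid) auto
      ultimately show "\<forall>\<^sub>F k in sequentially. (en (g k) + en h) / 2 - en (?mid k) \<le> \<Gamma> + \<epsilon>"
      proof eventually_elim
        case (elim k)
        then show ?case using enc[of k] unfolding \<Gamma>_def by (simp add: field_simps)
      qed
    qed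
    from C3(2)[OF this] have mass: "1 - IG v \<le> C3 * \<Gamma> powr (q / p)" .
    have "2 * \<Gamma> = c0 - en h" by (simp add: \<Gamma>_def)
    then have Qv: "Q F v h = ?S - 2 * \<Gamma>" by (simp add: Q_def c0_def)
    have \<theta>1: "IG v \<le> 1"
    proof -
      have G1: "(\<lambda>x. G (u k x)) \<in> LP M 1" "pint M 1 (\<lambda>x. G (u k x)) = 1" for k
        using IG_integrable[OF sobv_LPq[OF s(1)]] s(2)[of k] G_nonneg by (auto simp: LP_def pint_def IG_def)
      have "AE x in M. (\<lambda>k. G (u k x)) \<longlonglongrightarrow> G (v x)"
        using ae by eventually_elim (rule continuous_on_tendsto_compose[OF G_continuous], auto)
      moreover have "(\<lambda>x. G (v x)) \<in> borel_measurable M" using IG_integrable[OF sobv_LPq[OF h(1)]]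
        by auto
      ultimately have "pint M 1 (\<lambda>x. G (v x)) \<le> 1"
        using G1 by (intro LP_Fatou(2)[of "\<lambda>k x. G (u k x)"]) auto
      then show ?thesis using G_nonneg by (simp add: pint_def IG_def)
    qed
    \<comment> \<open>\<open>IG v\<close> lies in [0,1] and p/q < 1; this replaces the power by the
      linear term wanted below.\<close>
    have \<theta>: "IG v \<le> IG v powr (p / q)"
    proof (cases "IG v = 0")
      case False
      then have "IG v > 0" using IG_nonneg[of v] by simp
      then have "IG v powr 1 \<le> IG v powr (p / q)" using \<theta>1 p_pos pq by (intro powr_mono') auto
      then show ?thesis using \<open>IG v > 0\<close> by simp
    qed simp
    have "?S * IG v \<le> ?S * IG v powr (p / q)" using \<theta> S0 by (rule mult_left_mono)
    also have "\<dots> \<le> ?S - 2 * \<Gamma>" using level_le[OF F h(1)] Qv by simp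
    finally have "2 * \<Gamma> \<le> ?S * (1 - IG v)" by (simp add: algebra_simps)
    also have "\<dots> \<le> ?S * (C3 * \<Gamma> powr (q / p))" by (rule mult_left_mono[OF mass S0])
    finally have main: "2 * \<Gamma> \<le> ?S * (C3 * \<Gamma> powr (q / p))" .
    have "\<Gamma> = 0"
    proof (rule ccontr)
      assume "\<Gamma> \<noteq> 0"
      then have \<Gamma>p: "\<Gamma> > 0" using \<Gamma> by simp
      have \<Gamma>S: "\<Gamma> \<le> ?S" using Q_coercive(2)[OF F h(1)] Qv \<Gamma> by simp
      then have Sp: "?S > 0" using \<Gamma>p by simp
      have "\<Gamma> powr (q / p) = \<Gamma> powr (q / p - 1) * \<Gamma>" using \<Gamma>p
        by (simp add: powr_diff)
      \<comment> \<open>The superlinear power yields one factor \<Gamma> and a remaining power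
        bounded by that of S, because \<Gamma> <= S.\<close>
      also have "\<dots> \<le> ?S powr (q / p - 1) * \<Gamma>" using \<Gamma>p \<Gamma>S p_pos pq
        by (intro mult_right_mono powr_mono2) auto
      finally have "?S * (C3 * \<Gamma> powr (q / p)) \<le> ?S * (C3 * (?S powr (q / p - 1) * \<Gamma>))"
        using S0 C3(1) by (intro mult_left_mono) auto
      also have "\<dots> = (C3 * ?S powr (q / p)) * \<Gamma>" using Sp by (simp add: powr_diff)
      finally have "2 * \<Gamma> \<le> (C3 * ?S powr (q / p)) * \<Gamma>" using main by linarith
      then have "2 \<le> C3 * ?S powr (q / p)" using \<Gamma>p by simp
      moreover have "?S powr (q / p) < \<kappa> powr (q / p)" using lv S0 p_pos pq
        by (intro powr_less_mono2) auto
      moreover have "\<kappa> powr (q / p) = 1 / C3" using C3(1) p_pos pq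
        by (simp add: \<kappa>_def powr_powr)
      ultimately have "2 \<le> C3 * (1 / C3)" using C3(1) by (metis less_imp_le mult_left_mono order_trans)
      then show False using C3(1) by simp
    qed
    then have "IG v = 1" "Q F v h = ?S" using mass \<theta>1 Qv p_pos pq by auto
    with h(1) show ?thesis by blast
  qed
  with \<kappa> show ?thesis by blast
qed

end

section \<open>The Euler--Lagrange equation\<close>

context critical
begin

section \<open>Directional derivatives of the functionals\<close>

lemma LP_axis:
  assumes "f \<in> LP M r" "0 \<le> r"
  shows "(\<lambda>x. axis j (f x) :: real^'d) \<in> LP M r"
proof (rule LP_dominated(1)[OF assms(1) _ _ assms(2)])
  have "continuous_on UNIV (axis j :: real \<Rightarrow> real^'d)"
    using continuous_on_scaleR[OF continuous_on_id continuous_on_const[of UNIV "axis j 1 :: real^'d"]]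
    by (rule continuous_on_eq) (simp add: vec_eq_iff axis_def)
  then show "(\<lambda>x. axis j (f x) :: real^'d) \<in> borel_measurable M"
    using measurable_compose[OF LP_D(1)[OF assms(1)] borel_measurable_continuous_onI] by blast
qed (simp add: norm_axis_real)

lemma homogeneous_line_limit:
  fixes H :: "real^'d \<Rightarrow> real"
  assumes H: "Ck 1 H" "homogeneous r H" "1 < r" and v: "v \<in> LP M r" and \<phi>: "\<phi> \<in> LP M r"
  shows "integrable M (\<lambda>x. partial_deriv j H (v x) * \<phi> x)"
    "(\<lambda>k. ((LINT x|M. H (v x + inverse (real (Suc k)) *\<^sub>R axis j (\<phi> x))) - (LINT x|M. H (v x))) / inverse (real (Suc k)))
      \<longlonglongrightarrow> (LINT x|M. partial_deriv j H (v x) * \<phi> x)"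
proof -
  obtain C where C: "C > 0" "\<And>v t \<phi>. 0 \<le> t \<Longrightarrow> t \<le> 1 \<Longrightarrow>
    \<bar>partial_deriv j H (v + t *\<^sub>R axis j \<phi>) * \<phi>\<bar> \<le> C * (norm v powr r + \<bar>\<phi>\<bar> powr r)"
    by (rule C1_homogeneous_line_bound[OF H]) (rule that)
  have r: "0 \<le> r" "0 < r" using H by auto
  have w: "integrable M (\<lambda>x. C * (norm (v x) powr r + \<bar>\<phi> x\<bar> powr r))"
    using LP_D(2)[OF v] LP_D(2)[OF \<phi>] by simp
  have i: "integrable M (\<lambda>x. H (v x + t *\<^sub>R axis j (\<phi> x)))" for t
    by (rule homogeneous_LP_integrable[OF C1_homogeneous_continuous[OF H] H(2) r(2)])
      (rule LP_add[OF v LP_scaleR[OF LP_axis[OF \<phi> r(1)]] r(1)])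
  note lim = integral_quotient_limit[of M "\<lambda>x t. H (v x + t *\<^sub>R axis j (\<phi> x))" "\<lambda>x t. partial_deriv j H (v x + t *\<^sub>R axis j (\<phi> x)) * \<phi> x",
      OF C1_homogeneous_line_deriv[OF H] C(2) w i]
  show "integrable M (\<lambda>x. partial_deriv j H (v x) * \<phi> x)" using lim(1) by simp
  show "(\<lambda>k. ((LINT x|M. H (v x + inverse (real (Suc k)) *\<^sub>R axis j (\<phi> x))) - (LINT x|M. H (v x))) / inverse (real (Suc k)))
      \<longlonglongrightarrow> (LINT x|M. partial_deriv j H (v x) * \<phi> x)" using lim(2) by simp
qed

abbreviation "flux x \<xi> \<zeta> \<equiv> B x \<xi> \<xi> powr ((p - 2) / 2) * B x \<xi> \<zeta>"

lemma energy_line_limit: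
  assumes g: "g \<in> LP M p" and \<psi>: "\<psi> \<in> LP M p"
  shows "integrable M (\<lambda>x. flux x (g x) (\<psi> x))"
    "(\<lambda>k. ((LINT x|M. E x (g x + inverse (real (Suc k)) *\<^sub>R \<psi> x)) - (LINT x|M. E x (g x))) / inverse (real (Suc k)))
      \<longlonglongrightarrow> p * (LINT x|M. flux x (g x) (\<psi> x))"
proof -
  have w: "integrable M (\<lambda>x. p * 2 powr p * (E x (g x) + E x (\<psi> x)))"
    using E_integrable[OF g] E_integrable[OF \<psi>] by simp
  have i: "integrable M (\<lambda>x. E x (g x + t *\<^sub>R \<psi> x))" for t
    by (rule E_integrable[OF LP_add[OF g LP_scaleR[OF \<psi>] p_pos(2)]])
  have d: "((\<lambda>t. E x (g x + t *\<^sub>R \<psi> x)) has_real_derivative p * flux x (g x + t *\<^sub>R \<psi> x) (\<psi> x)) (at t)" if "x \<in> space M" for x t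
    using E_deriv[OF \<Omega>_K] that by simp
  have b: "\<bar>p * flux x (g x + t *\<^sub>R \<psi> x) (\<psi> x)\<bar> \<le> p * 2 powr p * (E x (g x) + E x (\<psi> x))" if "x \<in> space M" "0 \<le> t" "t \<le> 1" for x t
    using E_deriv_bound[OF \<Omega>_K that(2,3)] that(1) by simp
  note lim = integral_quotient_limit[of M "\<lambda>x t. E x (g x + t *\<^sub>R \<psi> x)" "\<lambda>x t. p * flux x (g x + t *\<^sub>R \<psi> x) (\<psi> x)", OF d b w i]
  show "integrable M (\<lambda>x. flux x (g x) (\<psi> x))"
    using integrable_mult_right[OF lim(1), of "1 / p"] p_pos by simp
  show "(\<lambda>k. ((LINT x|M. E x (g x + inverse (real (Suc k)) *\<^sub>R \<psi> x)) - (LINT x|M. E x (g x))) / inverse (real (Suc k)))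
      \<longlonglongrightarrow> p * (LINT x|M. flux x (g x) (\<psi> x))" using lim(2) by simp
qed

lemma en_line:
  fixes h :: "real^'n \<Rightarrow> (real^'n)^'d"
  assumes h: "h \<in> LP M p" and \<psi>: "\<psi> \<in> LP M p" and H: "(\<lambda>x. h x + t *\<^sub>R axis j (\<psi> x)) \<in> LP M p"
  shows "en (\<lambda>x. h x + t *\<^sub>R axis j (\<psi> x)) - en h = (LINT x|M. E x (h x $ j + t *\<^sub>R \<psi> x)) - (LINT x|M. E x (h x $ j))"
proof -
  have "(\<Sum>i\<in>UNIV - {j}. LINT x|M. E x ((h x + t *\<^sub>R axis j (\<psi> x)) $ i)) = (\<Sum>i\<in>UNIV - {j}. LINT x|M. E x (h x $ i))"
    by (intro sum.cong) (auto simp: axis_def)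
  then show ?thesis
    unfolding en_components[OF H] en_components[OF h]
    by (subst (1 2) sum.remove[of UNIV j]) auto
qed

text \<open>Minimality is tested through \<open>level_le\<close>, which holds off the constraint as
  well. A free variation in the j-th component therefore suffices, and the multiplier
  \<open>level F\<close> appears by itself.\<close>

lemma euler_lagrange_ge:
  assumes F: "subcrit F m" and F1: "Ck 1 F" and v: "sobv v h" "IG v = 1" "Q F v h = level F" and \<phi>: "sob \<Omega> p \<phi> \<psi>"
  shows "level F * ((p / q) * (LINT x|M. partial_deriv j G (v x) * \<phi> x))
    \<le> p * (LINT x|M. flux x (h x $ j) (\<psi> x)) - (LINT x|M. partial_deriv j F (v x) * \<phi> x)"
proof -
  have F2: "homogeneous p F" using F by (simp add: subcrit_def)
  define t where "t k = inverse (real (Suc k))" for k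
  have t: "t k > 0" for k by (simp add: t_def)
  have ax: "sobv (\<lambda>x. axis j (\<phi> x)) (\<lambda>x. axis j (\<psi> x))"
    by (rule sobv_axis[OF \<phi>])
  define V where "V k x = v x + t k *\<^sub>R axis j (\<phi> x)" for k x
  define H where "H k x = h x + t k *\<^sub>R axis j (\<psi> x)" for k x
  have VH: "sobv (V k) (H k)" for k unfolding V_def H_def by (rule sobv_add[OF v(1) sobv_scale[OF ax]])
  note Lv = sobv_LP[OF v(1)] and L\<phi> = sob_LP[OF \<phi>]
  have hj: "(\<lambda>x. h x $ j) \<in> LP M p" by (rule LP_component(1)[OF Lv(2) p_pos(2)])
  have \<phi>q: "\<phi> \<in> LP M q"
    using LP_component(1)[OF sobv_LPq[OF ax] pq(4), of j] by simp
  define I where "I = (LINT x|M. partial_deriv j G (v x) * \<phi> x)"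
  have limG: "(\<lambda>k. (IG (V k) - 1) / t k) \<longlonglongrightarrow> I"
    using homogeneous_line_limit(2)[OF G_C1 G_hom pq(3) sobv_LPq[OF v(1)] \<phi>q, of j] v(2)
    unfolding IG_def V_def t_def I_def by simp
  have limF: "(\<lambda>k. ((LINT x|M. F (V k x)) - (LINT x|M. F (v x))) / t k) \<longlonglongrightarrow> (LINT x|M. partial_deriv j F (v x) * \<phi> x)"
    using homogeneous_line_limit(2)[OF F1 F2 p_gt Lv(1) L\<phi>(1), of j] unfolding V_def t_def by simp
  have limE: "(\<lambda>k. (en (H k) - en h) / t k) \<longlonglongrightarrow> p * (LINT x|M. flux x (h x $ j) (\<psi> x))"
  proof -
    have "en (H k) - en h = (LINT x|M. E x (h x $ j + t k *\<^sub>R \<psi> x)) - (LINT x|M. E x (h x $ j))"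
      for k
      using en_line[OF Lv(2) L\<phi>(2), of "t k" j] sobv_LP(2)[OF VH[of k]] unfolding H_def by blast
    then show ?thesis using energy_line_limit(2)[OF hj L\<phi>(2)] unfolding t_def by simp
  qed
  have limQ: "(\<lambda>k. (Q F (V k) (H k) - Q F v h) / t k) \<longlonglongrightarrow> p * (LINT x|M. flux x (h x $ j) (\<psi> x)) - (LINT x|M. partial_deriv j F (v x) * \<phi> x)"
  proof -
    have "(Q F (V k) (H k) - Q F v h) / t k = (en (H k) - en h) / t k - ((LINT x|M. F (V k x)) - (LINT x|M. F (v x))) / t k" for k
      unfolding Q_def diff_divide_distrib[symmetric] by simp
    then show ?thesis using tendsto_diff[OF limE limF] by simp
  qed
  have t0: "t \<longlonglongrightarrow> 0" unfolding t_def by (rule LIMSEQ_inverse_real_of_nat)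
  have IG1: "(\<lambda>k. IG (V k)) \<longlonglongrightarrow> 1"
  proof -
    have "(\<lambda>k. (IG (V k) - 1) / t k * t k + 1) \<longlonglongrightarrow> I * 0 + 1"
      by (intro tendsto_intros limG t0)
    then show ?thesis using t by (simp add: less_imp_neq[THEN not_sym])
  qed
  have "((\<lambda>z. z powr (p / q)) has_real_derivative p / q) (at 1)"
    by (rule DERIV_cong[OF has_real_derivative_powr]) auto
  \<comment> \<open>Caratheodory's form of the derivative of z^(p/q) at 1: the factorisation also
    covers those k with \<open>IG (V k) = 1\<close>, where a difference quotient would divide by
    0.\<close>
  then obtain \<kappa> where \<kappa>: "\<And>z. z powr (p / q) - 1 powr (p / q) = \<kappa> z * (z - 1)" "isCont \<kappa> 1" "\<kappa> 1 = p / q"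
    unfolding CARAT_DERIV by blast
  have "(\<lambda>k. level F * (\<kappa> (IG (V k)) * ((IG (V k) - 1) / t k))) \<longlonglongrightarrow> level F * (\<kappa> 1 * I)"
    by (intro tendsto_intros limG isCont_tendsto_compose[OF \<kappa>(2) IG1])
  then have lim1: "(\<lambda>k. level F * (\<kappa> (IG (V k)) * ((IG (V k) - 1) / t k))) \<longlonglongrightarrow> level F * ((p / q) * I)" by (simp add: \<kappa>(3))
  have le: "level F * (\<kappa> (IG (V k)) * ((IG (V k) - 1) / t k)) \<le> (Q F (V k) (H k) - Q F v h) / t k"
    for k
  proof -
    have "level F * (IG (V k) powr (p / q) - 1) \<le> Q F (V k) (H k) - Q F v h"
      using level_le[OF F VH[of k]] v(3) by (simp add: right_diff_distrib)
    then have "level F * (\<kappa> (IG (V k)) * (IG (V k) - 1)) / t k \<le> (Q F (V k) (H k) - Q F v h) / t k"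
      using \<kappa>(1)[of "IG (V k)"] t[of k] by (intro divide_right_mono) auto
    then show ?thesis by simp
  qed
  show ?thesis
    using LIMSEQ_le[OF lim1 limQ] le unfolding I_def by blast
qed

text \<open>The inequality applied to \<phi> and to its negative.\<close>

lemma euler_lagrange:
  assumes F: "subcrit F m" and F1: "Ck 1 F" and v: "sobv v h" "IG v = 1" "Q F v h = level F" and \<phi>: "sob \<Omega> p \<phi> \<psi>"
  shows "p * (LINT x|M. flux x (h x $ j) (\<psi> x)) =
    (LINT x|M. partial_deriv j F (v x) * \<phi> x) + level F * ((p / q) * (LINT x|M. partial_deriv j G (v x) * \<phi> x))"
proof -
  have n: "sob \<Omega> p (\<lambda>x. - \<phi> x) (\<lambda>x. - \<psi> x)"
    using sob_scale[OF \<phi>, of "-1"] by simp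
  have "B x \<xi> (- \<zeta>) = - B x \<xi> \<zeta>" for x \<xi> \<zeta> by (simp add: B_def)
  then show ?thesis
    using euler_lagrange_ge[OF F F1 v \<phi>, of j] euler_lagrange_ge[OF F F1 v n, of j] by simp
qed

lemma IG_one_nonzero:
  assumes "v \<in> LP M q" "IG v = 1"
  shows "\<not> (AE x in M. v x = 0)"
proof
  assume ae: "AE x in M. v x = 0"
  obtain C where "C > 0" "\<And>s. G s \<le> C * norm s powr q" by (rule G_upper) (rule that)
  then have G0: "G 0 = 0" using G_nonneg[of 0] pq by (metis mult_zero_right norm_zero order_antisym powr_0)
  have "IG v = (LINT x|M. 0)"
    unfolding IG_def using ae IG_integrable[OF assms(1)] G0
      by (intro integral_cong_AE) (auto elim: eventually_mono)
  then show False using assms(2) by simp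
qed

text \<open>The level is the Lagrange multiplier and must be positive for the final rescaling. Mass
  1 makes v nonzero, and coercivity then makes \<open>Q\<close> positive.\<close>

lemma level_pos:
  assumes F: "subcrit F m" and v: "sobv v h" "IG v = 1" "Q F v h = level F"
  shows "level F > 0"
proof -
  note L = sobv_LP[OF v(1)]
  have "\<not> (AE x in M. v x = 0)" by (rule IG_one_nonzero[OF sobv_LPq[OF v(1)] v(2)])
  then have "pint M p v \<noteq> 0"
    unfolding pint_def using LP_D(2)[OF L(1)] by (subst integral_nonneg_eq_0_iff_AE) auto
  then have "(\<Sum>j\<in>UNIV. pint M p (\<lambda>x. v x $ j)) \<noteq> 0"
    using LP_vecI(2)[OF LP_component(1)[OF L(1) p_pos(2)] p_pos(2)] pint_nonneg[of M p v] by auto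
  moreover have "(\<Sum>j\<in>UNIV. pint M p (\<lambda>x. v x $ j)) \<ge> 0"
    by (simp add: sum_nonneg pint_nonneg)
  ultimately have "0 < lam1 * (\<Sum>j\<in>UNIV. pint M p (\<lambda>x. v x $ j))"
    using lambda1_pos[OF \<Omega>_nonempty] by simp
  also have "\<dots> \<le> (\<Sum>j\<in>UNIV. LINT x|M. E x (h x $ j))"
    unfolding sum_distrib_left using v(1) lambda1_le by (intro sum_mono) (auto simp: sobv_def)
  also have "\<dots> = en h" by (rule en_components[OF L(2), symmetric])
  finally have "0 < (1 - m / lam1) * en h" using Q_coercive(3)[OF F v(1)] by simp
  then show ?thesis using Q_coercive(1)[OF F v(1)] v(3) by simp
qed

text \<open>The left side and the F-term scale with c^(p-1), the G-term with c^(q-1), so a suitable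
  multiple of the minimiser removes the multiplier.\<close>

lemma minimiser_weak_solution:
  assumes F: "subcrit F m" and F1: "Ck 1 F" and v: "sobv v h" "IG v = 1" "Q F v h = level F"
  shows "\<exists>u. weak_solution \<Omega> A p F G u \<and> \<not> (AE x in M. u x = 0)"
proof -
  have F2: "homogeneous p F" using F by (simp add: subcrit_def)
  let ?S = "level F"
  have S: "?S > 0" by (rule level_pos[OF F v])
  \<comment> \<open>Solves c^(q-p) = S, which matches the two scalings.\<close>
  define c where "c = ?S powr (1 / (q - p))"
  have c: "c > 0" using S by (simp add: c_def)
  have cS: "c powr (q - 1) = c powr (p - 1) * ?S"
  proof -
    have "c powr (q - p) = ?S" using S pq by (simp add: c_def powr_powr)
    moreover have "c powr (q - 1) = c powr (p - 1) * c powr (q - p)" by (simp add: powr_add[symmetric])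
    ultimately show ?thesis by simp
  qed
  define u where "u x = c *\<^sub>R v x" for x
  have su: "sobv u (\<lambda>x. c *\<^sub>R h x)" unfolding u_def by (rule sobv_scale[OF v(1)])
  note Lv = sobv_LP[OF v(1)]
  have "weak_solution \<Omega> A p F G u"
    unfolding weak_solution_def
  proof (intro conjI allI ballI)
    show "u \<in> W01p_vec \<Omega> p" unfolding W01p_vec_def using su sob_W01p by (auto simp: sobv_def)
    fix j \<phi> assume "\<phi> \<in> W01p \<Omega> p"
    then have \<phi>: "sob \<Omega> p \<phi> (weak_grad \<Omega> \<phi>)" by (rule W01p_sob)
    let ?Du = "weak_grad \<Omega> (\<lambda>x. u x $ j)"
    have uj: "sob \<Omega> p (\<lambda>x. u x $ j) (\<lambda>x. c *\<^sub>R h x $ j)" using su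
      by (simp add: sobv_def)
    have ax: "sobv (\<lambda>x. axis j (\<phi> x)) (\<lambda>x. axis j (weak_grad \<Omega> \<phi> x))"
      by (rule sobv_axis[OF \<phi>])
    have \<phi>q: "\<phi> \<in> LP M q" using LP_component(1)[OF sobv_LPq[OF ax] pq(4), of j] by simp
    have hj: "(\<lambda>x. h x $ j) \<in> LP M p" by (rule LP_component(1)[OF Lv(2) p_pos(2)])
    have Dae: "AE x in M. ?Du x = c *\<^sub>R h x $ j" by (rule weak_grad_AE[OF sob_has_weak_gradient[OF uj]])
    have Dm: "?Du \<in> borel_measurable M"
      using LP_D(1)[OF weak_grad_LP(1)[OF sob_has_weak_gradient[OF uj] sob_LP(2)[OF uj]]] .
    have \<phi>m: "weak_grad \<Omega> \<phi> \<in> borel_measurable M"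
      by (rule LP_D(1)[OF sob_LP(2)[OF \<phi>]])
    have fs: "flux x (c *\<^sub>R \<xi>) \<zeta> = c powr (p - 1) * flux x \<xi> \<zeta>" if x: "x \<in> K"
      for x \<xi> \<zeta>
    proof -
      have "(c * (c * B x \<xi> \<xi>)) powr ((p - 2) / 2) = (c * c) powr ((p - 2) / 2) * B x \<xi> \<xi> powr ((p - 2) / 2)"
        using c B_nonneg[OF x] by (simp add: powr_mult[symmetric] mult.assoc)
      also have "(c * c) powr ((p - 2) / 2) = c powr (p - 2)" using c
        by (simp add: powr_mult powr_add[symmetric])
      finally have "flux x (c *\<^sub>R \<xi>) \<zeta> = (c powr (p - 2) * c) * flux x \<xi> \<zeta>"
        unfolding B_linear by simp
      also have "c powr (p - 2) * c = c powr (p - 1)" using c by (simp add: powr_diff power2_eq_square)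
      finally show ?thesis .
    qed
    let ?lhs = "\<lambda>x. ((A x *v ?Du x) \<bullet> ?Du x) powr ((p - 2) / 2) * ((A x *v ?Du x) \<bullet> weak_grad \<Omega> \<phi> x)"
    let ?rhs = "\<lambda>x. (1 / p * partial_deriv j F (u x) + 1 / crit_exp (real CARD('n)) p * partial_deriv j G (u x)) * \<phi> x"
    have lae: "AE x in M. ?lhs x = c powr (p - 1) * flux x (h x $ j) (weak_grad \<Omega> \<phi> x)"
    proof -
      have "AE x in M. x \<in> \<Omega>" by (rule AE_I2) simp
      with Dae show ?thesis
      proof eventually_elim
        case (elim x)
        then have "?lhs x = flux x (c *\<^sub>R h x $ j) (weak_grad \<Omega> \<phi> x)" by (simp add: B_def)
        then show ?case using fs[OF \<Omega>_K[OF elim(2)]] by simp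
      qed
    qed
    have lm: "?lhs \<in> borel_measurable M"
    proof -
      have "(\<lambda>x. B x (?Du x) (?Du x)) \<in> borel_measurable M" "(\<lambda>x. B x (?Du x) (weak_grad \<Omega> \<phi> x)) \<in> borel_measurable M"
        by (rule B_measurable[OF Dm Dm], rule B_measurable[OF Dm \<phi>m])
      then show ?thesis unfolding B_def by measurable
    qed
    note el = energy_line_limit(1)[OF hj sob_LP(2)[OF \<phi>]]
    have li: "integrable M (\<lambda>x. c powr (p - 1) * flux x (h x $ j) (weak_grad \<Omega> \<phi> x))"
      using el by simp
    have li': "integrable M ?lhs"
      using lae by (intro integrable_cong_AE_imp[OF li lm]) (auto elim: eventually_mono)
    have Fi: "integrable M (\<lambda>x. partial_deriv j F (v x) * \<phi> x)"
      by (rule homogeneous_line_limit(1)[OF F1 F2 p_gt Lv(1) sob_LP(1)[OF \<phi>]])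
    have Gi: "integrable M (\<lambda>x. partial_deriv j G (v x) * \<phi> x)"
      by (rule homogeneous_line_limit(1)[OF G_C1 G_hom pq(3) sobv_LPq[OF v(1)] \<phi>q])
    \<comment> \<open>Dividing the Euler-Lagrange identity by p gives the coefficients 1/p and S/q;
      the factor S is what c^(q-1) contributes beyond c^(p-1).\<close>
    have re: "?rhs x = c powr (p - 1) * (1 / p * (partial_deriv j F (v x) * \<phi> x) + ?S / q * (partial_deriv j G (v x) * \<phi> x))" for x
      unfolding u_def C1_homogeneous_partial_scale[OF F1 F2 p_gt c] C1_homogeneous_partial_scale[OF G_C1 G_hom pq(3) c] cS q_def[symmetric]
      by (simp add: algebra_simps)
    have ri: "integrable M ?rhs" unfolding re using Fi Gi by simp
    have "(LINT x|M. ?lhs x) = c powr (p - 1) * (LINT x|M. flux x (h x $ j) (weak_grad \<Omega> \<phi> x))"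
      using integral_cong_AE[OF lm borel_measurable_integrable[OF li] lae] by simp
    also have "(LINT x|M. flux x (h x $ j) (weak_grad \<Omega> \<phi> x)) = 1 / p * (LINT x|M. partial_deriv j F (v x) * \<phi> x) + ?S / q * (LINT x|M. partial_deriv j G (v x) * \<phi> x)"
      using euler_lagrange[OF F F1 v \<phi>, of j] p_pos pq by (simp add: field_simps)
    also have "c powr (p - 1) * \<dots> = (LINT x|M. ?rhs x)" unfolding re using Fi Gi by simp
    finally have eq: "(LINT x|M. ?lhs x) = (LINT x|M. ?rhs x)" .
    show "let Du = ?Du; lhs = (\<lambda>x. ((A x *v Du x) \<bullet> Du x) powr ((p - 2) / 2) * ((A x *v Du x) \<bullet> weak_grad \<Omega> \<phi> x)); rhs = ?rhs
        in integrable M lhs \<and> integrable M rhs \<and> (LINT x|M. lhs x) = (LINT x|M. rhs x)"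
      unfolding Let_def using li' ri eq by blast
  qed
  moreover have "\<not> (AE x in M. u x = 0)"
  proof
    assume "AE x in M. u x = 0"
    then have "AE x in M. v x = 0" by eventually_elim (use c in \<open>simp add: u_def\<close>)
    then show False using IG_one_nonzero[OF sobv_LPq[OF v(1)] v(2)] by blast
  qed
  ultimately show ?thesis by blast
qed

end

section \<open>Levels below the concentration threshold\<close>

text \<open>The test function exceeds \<open>lam1\<close> by less than lam1 - \<mu>, and the F-term
  contributes at least \<mu>; the two differences give the factor 2. The constant c converts norm 1
  in L^p into a lower bound for the constraint.\<close>

lemma (in critical) level_small:
  "\<exists>c>0. \<forall>F m \<mu>. subcrit F m \<longrightarrow> (\<forall>s. \<mu> * (\<Sum>j\<in>UNIV. \<bar>s $ j\<bar> powr p) \<le> F s) \<longrightarrow> \<mu> < lam1 \<longrightarrow>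
    level F \<le> c * (2 * (lam1 - \<mu>))"
proof -
  obtain C where C: "C > 0" "\<And>s. norm s powr q \<le> C * G s" by (rule G_lower) (rule that)
  define V where "V = measure M (space M) powr (1 - p / q)"
  have V0: "0 \<le> V" by (simp add: V_def)
  define c where "c = (V + 1) * C powr (p / q)"
  have c: "c > 0" using C(1) V0 by (simp add: c_def)
  have "level F \<le> c * (2 * (lam1 - \<mu>))"
    if F: "subcrit F m" and \<mu>: "\<And>s. \<mu> * (\<Sum>j\<in>UNIV. \<bar>s $ j\<bar> powr p) \<le> F s" "\<mu> < lam1" for F m \<mu>
  proof (cases "level F \<le> 0")
    case True
    moreover have "0 \<le> c * (2 * (lam1 - \<mu>))" using c \<mu>(2) by simp
    ultimately show ?thesis by linarith
  next
    case False
    obtain u g where u: "sob \<Omega> p u g" "pint M p u = 1" "(LINT x|M. E x (g x)) < lam1 + (lam1 - \<mu>)"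
      by (rule lambda1_approx[OF \<Omega>_nonempty, of "lam1 - \<mu>"]) (use \<mu>(2) in simp, rule that)
    fix j :: 'd
    let ?u = "\<lambda>x. axis j (u x) :: real^'d" and ?g = "\<lambda>x. axis j (g x) :: (real^'n)^'d"
    have s: "sobv ?u ?g" by (rule sobv_axis[OF u(1)])
    note Lq = sobv_LPq[OF s]
    have one: "pint M p ?u = 1" using u(2) by (simp add: pint_def norm_axis_real)
    have "pint M q ?u \<le> (LINT x|M. C * G (?u x))"
      unfolding pint_def using LP_D(2)[OF Lq] IG_integrable[OF Lq] C by (intro integral_mono) auto
    then have qle: "pint M q ?u \<le> C * IG ?u" by (simp add: IG_def)
    have "1 \<le> V * pint M q ?u powr (p / q)" using LP_exponent(2)[OF p_pos(1) pq(1) Lq] one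
      by (simp add: V_def)
    also have "\<dots> \<le> (V + 1) * (C * IG ?u) powr (p / q)"
      using qle pint_nonneg[of M q ?u] V0 p_pos pq by (intro mult_mono powr_mono2) auto
    also have "\<dots> = c * IG ?u powr (p / q)" using C(1) IG_nonneg[of ?u] by (simp add: c_def powr_mult)
    finally have "level F * 1 \<le> level F * (c * IG ?u powr (p / q))" using False
      by (intro mult_left_mono) auto
    also have "\<dots> \<le> c * Q F ?u ?g" using mult_left_mono[OF level_le[OF F s], of c] c
      by (simp add: ac_simps)
    also have "Q F ?u ?g \<le> 2 * (lam1 - \<mu>)"
    proof -
      have Fh: "continuous_on UNIV F" "homogeneous p F" using F by (auto simp: subcrit_def)
      have "(\<Sum>i\<in>UNIV. \<bar>(axis j t :: real^'d) $ i\<bar> powr p) = \<bar>t\<bar> powr p" for t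
        using sum.delta[of "UNIV::'d set" j "\<lambda>i. \<bar>t\<bar> powr p"] p_pos
        by (simp add: axis_def if_distrib[of "\<lambda>z. \<bar>z\<bar> powr p"] cong: if_cong)
      then have "\<mu> * norm (u x) powr p \<le> F (?u x)" for x using \<mu>(1)[of "?u x"] by simp
      then have "(LINT x|M. \<mu> * norm (u x) powr p) \<le> (LINT x|M. F (?u x))"
        using LP_D(2)[OF sob_LP(1)[OF u(1)]] homogeneous_LP_integrable[OF Fh p_pos(1) sobv_LP(1)[OF s]]
        by (intro integral_mono) auto
      then have "\<mu> \<le> (LINT x|M. F (?u x))" using u(2) by (simp add: pint_def)
      moreover have "Q F ?u ?g = (LINT x|M. E x (g x)) - (LINT x|M. F (?u x))" by (simp only: Q_def en_axis)
      moreover have "e - f \<le> 2 * (l - \<mu>)" if "\<mu> \<le> f" "e < l + (l - \<mu>)" for e f l :: real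
        using that by (simp add: algebra_simps)
      ultimately show ?thesis using u(3) by presburger
    qed
    finally show ?thesis using c by simp
  qed
  then show ?thesis using c by blast
qed

section \<open>Extrema on the p-sphere\<close>

lemma p_sphere_compact:
  assumes "0 < p"
  shows "compact (p_sphere p :: (real^'d) set)"
proof (rule compact_eq_bounded_closed[THEN iffD2], rule conjI)
  have "norm s \<le> real CARD('d)" if "s \<in> p_sphere p" for s :: "real^'d"
  proof -
    have "\<bar>s $ i\<bar> \<le> 1" for i
    proof (rule ccontr)
      assume "\<not> \<bar>s $ i\<bar> \<le> 1"
      then have "1 powr p < \<bar>s $ i\<bar> powr p" using assms by (intro powr_less_mono2) auto
      then have "1 < \<bar>s $ i\<bar> powr p" by simp
      also have "\<dots> \<le> (\<Sum>i\<in>UNIV. \<bar>s $ i\<bar> powr p)" by (intro member_le_sum) auto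
      finally show False using that by (simp add: p_sphere_def)
    qed
    then have "(\<Sum>i\<in>UNIV. \<bar>s $ i\<bar>) \<le> (\<Sum>i\<in>(UNIV::'d set). 1)"
      by (intro sum_mono) auto
    then show ?thesis using norm_le_l1_cart[of s] by simp
  qed
  then show "bounded (p_sphere p :: (real^'d) set)" unfolding bounded_iff by blast
  have "continuous_on UNIV (\<lambda>s::real^'d. \<Sum>i\<in>UNIV. \<bar>s $ i\<bar> powr p)"
    using assms by (intro continuous_on_sum continuous_on_powr' continuous_intros) auto
  then show "closed (p_sphere p :: (real^'d) set)"
    unfolding p_sphere_def by (intro closed_Collect_eq continuous_on_const)
qed

lemma p_sphere_nonempty:
  assumes "0 < p"
  shows "p_sphere p \<noteq> ({} :: (real^'d) set)"
proof -
  fix j :: 'd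
  have "(\<Sum>i\<in>UNIV. \<bar>(axis j 1 :: real^'d) $ i\<bar> powr p) = (\<Sum>i\<in>UNIV. if i = j then 1 else 0)"
    using assms by (intro sum.cong) (auto simp: axis_def)
  then have "axis j 1 \<in> (p_sphere p :: (real^'d) set)" by (simp add: p_sphere_def)
  then show ?thesis by blast
qed

text \<open>\<open>GREATEST\<close> and \<open>LEAST\<close> denote the extrema once these are
  attained, which continuity on the compact nonempty sphere provides.\<close>

lemma sphere_extrema:
  fixes F :: "real^'d \<Rightarrow> real"
  assumes "0 < p" "continuous_on UNIV F" "s \<in> p_sphere p"
  shows "min_sphere p F \<le> F s" "F s \<le> max_sphere p F"
proof -
  have c: "continuous_on (p_sphere p) F" by (rule continuous_on_subset[OF assms(2)]) simp
  obtain a where "a \<in> p_sphere p" "\<forall>s\<in>p_sphere p. F s \<le> F a"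
    using continuous_attains_sup[OF p_sphere_compact[OF assms(1)] p_sphere_nonempty[OF assms(1)] c] by blast
  then have "max_sphere p F = F a" "F s \<le> F a" unfolding max_sphere_def using assms(3)
    by (auto intro: Greatest_equality)
  then show "F s \<le> max_sphere p F" by simp
  obtain b where "b \<in> p_sphere p" "\<forall>s\<in>p_sphere p. F b \<le> F s"
    using continuous_attains_inf[OF p_sphere_compact[OF assms(1)] p_sphere_nonempty[OF assms(1)] c] by blast
  then have "min_sphere p F = F b" "F b \<le> F s" unfolding min_sphere_def using assms(3)
    by (auto intro: Least_equality)
  then show "min_sphere p F \<le> F s" by simp
qed

text \<open>A nonzero vector is scaled to the sphere by r with r^p equal to the sum of the |s_j|^p;
  at the origin homogeneity forces the value 0.\<close>

lemma homogeneous_sphere_bounds: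
  fixes F :: "real^'d \<Rightarrow> real"
  assumes "0 < p" "continuous_on UNIV F" "homogeneous p F"
  shows "min_sphere p F * (\<Sum>j\<in>UNIV. \<bar>s $ j\<bar> powr p) \<le> F s \<and> F s \<le> max_sphere p F * (\<Sum>j\<in>UNIV. \<bar>s $ j\<bar> powr p)"
proof (cases "s = 0")
  case True
  have "F (2 *\<^sub>R 0) = 2 powr p * F 0" using assms(3) unfolding homogeneous_def
    by (metis zero_less_numeral)
  moreover have "2 powr p \<noteq> (1::real)" using assms(1) by simp
  ultimately have "F 0 = 0" by simp
  then show ?thesis using True assms by simp
next
  case False
  then obtain i where i: "s $ i \<noteq> 0" by (auto simp: vec_eq_iff)
  define S where "S = (\<Sum>j\<in>UNIV. \<bar>s $ j\<bar> powr p)"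
  have "0 < \<bar>s $ i\<bar> powr p" using i by simp
  also have "\<dots> \<le> S" unfolding S_def by (intro member_le_sum) auto
  finally have S: "S > 0" .
  define r where "r = S powr (1 / p)"
  have r: "r > 0" "r powr p = S" using S assms(1) by (simp_all add: r_def powr_powr)
  let ?e = "(1 / r) *\<^sub>R s"
  have "(\<Sum>j\<in>UNIV. \<bar>?e $ j\<bar> powr p) = (\<Sum>j\<in>UNIV. \<bar>s $ j\<bar> powr p / S)"
    using r by (intro sum.cong) (auto simp: abs_mult powr_divide)
  also have "\<dots> = 1" unfolding sum_divide_distrib[symmetric] using S by (simp add: S_def[symmetric])
  finally have e: "?e \<in> p_sphere p" by (simp add: p_sphere_def)
  have "F (r *\<^sub>R ?e) = r powr p * F ?e" using assms(3) r(1) unfolding homogeneous_def by blast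
  then have "F s = S * F ?e" using r by simp
  moreover have "S * min_sphere p F \<le> S * F ?e" "S * F ?e \<le> S * max_sphere p F"
    using sphere_extrema[OF assms(1,2) e] S by (auto intro: mult_left_mono)
  ultimately show ?thesis unfolding S_def[symmetric] by (simp add: mult.commute)
qed

theorem theorem1p2:
  fixes \<Omega> :: "(real^'n) set"
    and A :: "real^'n \<Rightarrow> real^'n^'n"
    and G :: "real^'d \<Rightarrow> real"
    and x0 :: "real^'n"
    and p \<tau> C0 \<gamma> :: real
  assumes "1 < p" and "p < real CARD('n)"
    and "open \<Omega>" and "bounded \<Omega>"
    and "continuous_on (closure \<Omega>) A"
    and "\<And>x. x \<in> closure \<Omega> \<Longrightarrow> transpose (A x) = A x"
    and "\<tau> > 0"
    and "\<And>x \<xi>. x \<in> closure \<Omega> \<Longrightarrow> \<tau> * (norm \<xi>)\<^sup>2 \<le> (A x *v \<xi>) \<bullet> \<xi>"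
    and "Ck 1 G"
    and "homogeneous (crit_exp (real CARD('n)) p) G"
    and "\<And>s. s \<noteq> 0 \<Longrightarrow> G s > 0"
    and "x0 \<in> \<Omega>"
    and "\<And>x. x \<in> closure \<Omega> \<Longrightarrow> det (A x0) \<le> det (A x)"
    and "C0 > 0" and "0 < \<gamma>" and "\<gamma> \<le> p"
    and "\<And>x \<xi>. x \<in> \<Omega> \<Longrightarrow>
           ((A x *v \<xi>) \<bullet> \<xi>) powr (p / 2) \<ge>
           ((A x0 *v \<xi>) \<bullet> \<xi>) powr (p / 2) + C0 * norm (x - x0) powr \<gamma> * norm \<xi> powr p"
  shows "\<exists>lam. 0 < lam \<and> lam < lambda1 \<Omega> A p \<and>
           (\<forall>F :: real^'d \<Rightarrow> real.
              Ck 1 F \<and> homogeneous p F \<and>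
              0 < max_sphere p F \<and> max_sphere p F < lambda1 \<Omega> A p \<and>
              lam < min_sphere p F \<longrightarrow>
              (\<exists>u. weak_solution \<Omega> A p F G u \<and> \<not> (AE x in lebesgue_on \<Omega>. u x = 0)))"
proof -
  let ?q = "crit_exp (real CARD('n)) p"
  interpret critical \<Omega> p ?q A \<tau> G
    using assms by unfold_locales auto
  obtain \<kappa> where \<kappa>: "\<kappa> > 0"
    "\<And>F m. subcrit F m \<Longrightarrow> level F < \<kappa> \<Longrightarrow> \<exists>v h. sobv v h \<and> IG v = 1 \<and> Q F v h = level F"
    using minimiser_exists by blast
  obtain c where c: "c > 0" "\<And>F m \<mu>. subcrit F m \<Longrightarrow> (\<And>s. \<mu> * (\<Sum>j\<in>UNIV. \<bar>s $ j\<bar> powr p) \<le> F s) \<Longrightarrow> \<mu> < lam1 \<Longrightarrow>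
    level F \<le> c * (2 * (lam1 - \<mu>))"
    using level_small by blast
  have l: "lam1 > 0" by (rule lambda1_pos[OF \<Omega>_nonempty])
  \<comment> \<open>The first bound keeps the threshold \<open>lam1 - \<delta>\<close> positive, the
    second makes the estimate of the level at most \<kappa>; strictness comes from
    \<open>lam1 - \<delta> < min_sphere p F\<close>.\<close>
  define \<delta> where "\<delta> = min (lam1 / 2) (\<kappa> / (2 * c))"
  have \<delta>: "0 < \<delta>" "\<delta> < lam1" using l \<kappa>(1) c(1) by (auto simp: \<delta>_def)
  have "\<delta> \<le> \<kappa> / (2 * c)" by (simp add: \<delta>_def)
  then have \<delta>\<kappa>: "c * (2 * \<delta>) \<le> \<kappa>" using c(1) by (simp add: field_simps)
  have "\<exists>u. weak_solution \<Omega> A p F G u \<and> \<not> (AE x in lebesgue_on \<Omega>. u x = 0)"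
    if F: "Ck 1 F" "homogeneous p F" "0 < max_sphere p F" "max_sphere p F < lam1" "lam1 - \<delta> < min_sphere p F"
    for F :: "real^'d \<Rightarrow> real"
  proof -
    have cF: "continuous_on UNIV F" by (rule C1_homogeneous_continuous[OF F(1,2) p_gt])
    note b = homogeneous_sphere_bounds[OF p_pos(1) cF F(2)]
    have sub: "subcrit F (max_sphere p F)" unfolding subcrit_def using cF F b by blast
    obtain s where s: "s \<in> (p_sphere p :: (real^'d) set)" using p_sphere_nonempty[OF p_pos(1)] by blast
    have \<mu>: "min_sphere p F < lam1" using sphere_extrema[OF p_pos(1) cF s] F(4) by linarith
    have "level F \<le> c * (2 * (lam1 - min_sphere p F))" by (rule c(2)[OF sub _ \<mu>]) (use b in blast)
    also have "\<dots> < c * (2 * \<delta>)" using c(1) F(5) by (intro mult_strict_left_mono) auto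
    finally have "level F < \<kappa>" using \<delta>\<kappa> by linarith
    then obtain v h where "sobv v h" "IG v = 1" "Q F v h = level F" using \<kappa>(2)[OF sub] by blast
    then show ?thesis by (rule minimiser_weak_solution[OF sub F(1)])
  qed
  then show ?thesis using \<delta> by (intro exI[of _ "lam1 - \<delta>"]) auto
qed

end
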